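(* Let $\mathcal D=D^b(H)$ for a finite-dimensional hereditary $k$-algebra $H$ over a field $k$, and let $G:\mathcal D\to\mathcal D$ be a triangle autoequivalence satisfying (g1) and (g2). Then the triangulated category $\mathcal D/G$ is a Krull–Schmidt category.
   Context: $\mathcal D$ is the bounded derived category of finitely generated $H$-modules, with shift $[1]$. $\operatorname{ind}$ denotes isomorphism classes of indecomposable objects. Conditions: (g1) for each $U\in\operatorname{ind}H$, $G^nU$ lies in $\operatorname{ind}H$ for only finitely many $n\in\mathbb Z$; (g2) there is $N\in\mathbb N$ such that $\{U[n]\mid U\in\operatorname{ind}H,\ n\in[-N,N]\}$ contains a system of representatives of the orbits of $G$ on $\operatorname{ind}\mathcal D$. The factor category $\mathcal D/G$ has as objects the $G$-orbits $\widetilde X$ of objects $X$ of $\mathcal D$, and $\operatorname{Hom}_{\mathcal D/G}(\widetilde X,\widetilde Y)=\coprod_{i\in\mathbb Z}\operatorname{Hom}_{\mathcal D}(G^iX,Y)$; by Keller it is triangulated and the natural functor $\mathcal D\to\mathcal D/G$ is a triangle functor. Krull–Schmidt means that every object is a finite direct sum of objects with local endomorphism rings. *)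

theory Defs
  imports Complex_Main "HOL-Library.Function_Algebras" "HOL-Algebra.Ideal"
begin

section \<open>Preadditive, additive and Krull-Schmidt categories\<close>

text \<open>
  Arrows carry no domain or codomain: \<open>Arr C X Y\<close> is a hom-set, \<open>Cmp C X Y Z g f\<close> is the
  composite of \<open>f \<in> Arr C X Y\<close> with \<open>g \<in> Arr C Y Z\<close>, and \<open>Add C X Y\<close>, \<open>Zer C X Y\<close> give the
  group structure of \<open>Arr C X Y\<close>.
\<close>

record ('o, 'm) precat =
  Ob  :: "'o set"
  Arr :: "'o \<Rightarrow> 'o \<Rightarrow> 'm set"
  Idn :: "'o \<Rightarrow> 'm"
  Cmp :: "'o \<Rightarrow> 'o \<Rightarrow> 'o \<Rightarrow> 'm \<Rightarrow> 'm \<Rightarrow> 'm"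
  Add :: "'o \<Rightarrow> 'o \<Rightarrow> 'm \<Rightarrow> 'm \<Rightarrow> 'm"
  Zer :: "'o \<Rightarrow> 'o \<Rightarrow> 'm"

definition category :: "('o, 'm) precat \<Rightarrow> bool" where
  "category C \<longleftrightarrow>
     (\<forall>X\<in>Ob C. Idn C X \<in> Arr C X X) \<and>
     (\<forall>X\<in>Ob C. \<forall>Y\<in>Ob C. \<forall>f\<in>Arr C X Y.
        Cmp C X X Y f (Idn C X) = f \<and> Cmp C X Y Y (Idn C Y) f = f) \<and>
     (\<forall>X\<in>Ob C. \<forall>Y\<in>Ob C. \<forall>Z\<in>Ob C. \<forall>f\<in>Arr C X Y. \<forall>g\<in>Arr C Y Z. Cmp C X Y Z g f \<in> Arr C X Z) \<and>
     (\<forall>W\<in>Ob C. \<forall>X\<in>Ob C. \<forall>Y\<in>Ob C. \<forall>Z\<in>Ob C. \<forall>f\<in>Arr C W X. \<forall>g\<in>Arr C X Y. \<forall>h\<in>Arr C Y Z.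
        Cmp C W Y Z h (Cmp C W X Y g f) = Cmp C W X Z (Cmp C X Y Z h g) f)"

text \<open>The additive group of a hom-set, written as a multiplicative record.\<close>

definition hom_group :: "('o, 'm) precat \<Rightarrow> 'o \<Rightarrow> 'o \<Rightarrow> 'm monoid" where
  "hom_group C X Y = \<lparr>carrier = Arr C X Y, mult = Add C X Y, one = Zer C X Y\<rparr>"

definition preadditive_category :: "('o, 'm) precat \<Rightarrow> bool" where
  "preadditive_category C \<longleftrightarrow> category C \<and>
     (\<forall>X\<in>Ob C. \<forall>Y\<in>Ob C. comm_group (hom_group C X Y)) \<and>
     (\<forall>X\<in>Ob C. \<forall>Y\<in>Ob C. \<forall>Z\<in>Ob C. \<forall>f\<in>Arr C X Y. \<forall>f'\<in>Arr C X Y. \<forall>g\<in>Arr C Y Z. \<forall>g'\<in>Arr C Y Z.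
        Cmp C X Y Z g (Add C X Y f f') = Add C X Z (Cmp C X Y Z g f) (Cmp C X Y Z g f') \<and>
        Cmp C X Y Z (Add C Y Z g g') f = Add C X Z (Cmp C X Y Z g f) (Cmp C X Y Z g' f))"

text \<open>\<open>X\<close> is a (bi)product of the objects in the list \<open>Ys\<close>; the empty list gives a zero object.\<close>

definition direct_sum :: "('o, 'm) precat \<Rightarrow> 'o list \<Rightarrow> 'o \<Rightarrow> bool" where
  "direct_sum C Ys X \<longleftrightarrow> X \<in> Ob C \<and> set Ys \<subseteq> Ob C \<and>
     (\<exists>\<iota> \<pi>. (\<forall>i<length Ys. \<iota> i \<in> Arr C (Ys ! i) X \<and> \<pi> i \<in> Arr C X (Ys ! i)) \<and>
        (\<forall>i<length Ys. \<forall>j<length Ys. Cmp C (Ys ! i) X (Ys ! j) (\<pi> j) (\<iota> i) =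
           (if i = j then Idn C (Ys ! i) else Zer C (Ys ! i) (Ys ! j))) \<and>
        finprod (hom_group C X X) (\<lambda>i. Cmp C X (Ys ! i) X (\<iota> i) (\<pi> i)) {..<length Ys} = Idn C X)"

abbreviation zero_object :: "('o, 'm) precat \<Rightarrow> 'o \<Rightarrow> bool" where
  "zero_object C X \<equiv> direct_sum C [] X"

definition additive_category :: "('o, 'm) precat \<Rightarrow> bool" where
  "additive_category C \<longleftrightarrow> preadditive_category C \<and> (\<exists>X. zero_object C X) \<and>
     (\<forall>X\<in>Ob C. \<forall>Y\<in>Ob C. \<exists>Z. direct_sum C [X, Y] Z)"

definition isomorphism :: "('o, 'm) precat \<Rightarrow> 'o \<Rightarrow> 'o \<Rightarrow> 'm \<Rightarrow> bool" where
  "isomorphism C X Y f \<longleftrightarrow> f \<in> Arr C X Y \<and>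
     (\<exists>g\<in>Arr C Y X. Cmp C X Y X g f = Idn C X \<and> Cmp C Y X Y f g = Idn C Y)"

definition isomorphic :: "('o, 'm) precat \<Rightarrow> 'o \<Rightarrow> 'o \<Rightarrow> bool" where
  "isomorphic C X Y \<longleftrightarrow> (\<exists>f. isomorphism C X Y f)"

definition indecomposable :: "('o, 'm) precat \<Rightarrow> 'o \<Rightarrow> bool" where
  "indecomposable C X \<longleftrightarrow> X \<in> Ob C \<and> \<not> zero_object C X \<and>
     (\<forall>A B. direct_sum C [A, B] X \<longrightarrow> zero_object C A \<or> zero_object C B)"

definition End_ring :: "('o, 'm) precat \<Rightarrow> 'o \<Rightarrow> 'm ring" where
  "End_ring C X = \<lparr>carrier = Arr C X X, mult = Cmp C X X X, one = Idn C X,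
     zero = Zer C X X, add = Add C X X\<rparr>"

text \<open>A ring is local if its non-units form a two-sided ideal; this forces \<open>1 \<noteq> 0\<close>.\<close>

definition local_ring :: "'m ring \<Rightarrow> bool" where
  "local_ring R \<longleftrightarrow> ideal (carrier R - Units R) R"

definition krull_schmidt :: "('o, 'm) precat \<Rightarrow> bool" where
  "krull_schmidt C \<longleftrightarrow> additive_category C \<and>
     (\<forall>X\<in>Ob C. \<exists>Ys. direct_sum C Ys X \<and> (\<forall>Y\<in>set Ys. local_ring (End_ring C Y)))"


section \<open>Endofunctors\<close>

record ('o, 'm) endofun =
  fob :: "'o \<Rightarrow> 'o"
  far :: "'o \<Rightarrow> 'o \<Rightarrow> 'm \<Rightarrow> 'm"

definition endofunctor :: "('o, 'm) precat \<Rightarrow> ('o, 'm) endofun \<Rightarrow> bool" where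
  "endofunctor C F \<longleftrightarrow>
     (\<forall>X\<in>Ob C. fob F X \<in> Ob C) \<and>
     (\<forall>X\<in>Ob C. \<forall>Y\<in>Ob C. \<forall>f\<in>Arr C X Y. far F X Y f \<in> Arr C (fob F X) (fob F Y)) \<and>
     (\<forall>X\<in>Ob C. far F X X (Idn C X) = Idn C (fob F X)) \<and>
     (\<forall>X\<in>Ob C. \<forall>Y\<in>Ob C. \<forall>Z\<in>Ob C. \<forall>f\<in>Arr C X Y. \<forall>g\<in>Arr C Y Z.
        far F X Z (Cmp C X Y Z g f) =
        Cmp C (fob F X) (fob F Y) (fob F Z) (far F Y Z g) (far F X Y f))"

definition additive_endofunctor :: "('o, 'm) precat \<Rightarrow> ('o, 'm) endofun \<Rightarrow> bool" where
  "additive_endofunctor C F \<longleftrightarrow> endofunctor C F \<and>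
     (\<forall>X\<in>Ob C. \<forall>Y\<in>Ob C. \<forall>f\<in>Arr C X Y. \<forall>g\<in>Arr C X Y.
        far F X Y (Add C X Y f g) = Add C (fob F X) (fob F Y) (far F X Y f) (far F X Y g))"

definition id_fun :: "('o, 'm) endofun" where
  "id_fun = \<lparr>fob = (\<lambda>X. X), far = (\<lambda>X Y f. f)\<rparr>"

definition comp_fun :: "('o, 'm) endofun \<Rightarrow> ('o, 'm) endofun \<Rightarrow> ('o, 'm) endofun" where
  "comp_fun F G = \<lparr>fob = (\<lambda>X. fob F (fob G X)),
     far = (\<lambda>X Y f. far F (fob G X) (fob G Y) (far G X Y f))\<rparr>"

definition natural_iso ::
  "('o, 'm) precat \<Rightarrow> ('o, 'm) endofun \<Rightarrow> ('o, 'm) endofun \<Rightarrow> ('o \<Rightarrow> 'm) \<Rightarrow> bool" where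
  "natural_iso C F G \<tau> \<longleftrightarrow>
     (\<forall>X\<in>Ob C. isomorphism C (fob F X) (fob G X) (\<tau> X)) \<and>
     (\<forall>X\<in>Ob C. \<forall>Y\<in>Ob C. \<forall>f\<in>Arr C X Y.
        Cmp C (fob F X) (fob F Y) (fob G Y) (\<tau> Y) (far F X Y f) =
        Cmp C (fob F X) (fob G X) (fob G Y) (far G X Y f) (\<tau> X))"

text \<open>
  \<open>S\<close> is the shift functor and \<open>T\<close> the class of distinguished triangles
  \<open>X \<rightarrow> Y \<rightarrow> Z \<rightarrow> S X\<close>, given as tuples \<open>(X, Y, Z, u, v, w)\<close>.
\<close>

definition triangle_endofunctor ::
  "('o, 'm) precat \<Rightarrow> ('o, 'm) endofun \<Rightarrow> ('o \<times> 'o \<times> 'o \<times> 'm \<times> 'm \<times> 'm) set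
     \<Rightarrow> ('o, 'm) endofun \<Rightarrow> bool" where
  "triangle_endofunctor C S T F \<longleftrightarrow> additive_endofunctor C F \<and>
     (\<exists>\<xi>. natural_iso C (comp_fun F S) (comp_fun S F) \<xi> \<and>
        (\<forall>X Y Z u v w. (X, Y, Z, u, v, w) \<in> T \<longrightarrow>
           (fob F X, fob F Y, fob F Z, far F X Y u, far F Y Z v,
            Cmp C (fob F Z) (fob F (fob S X)) (fob S (fob F X)) (\<xi> X) (far F Z (fob S X) w)) \<in> T))"

text \<open>
  \<open>H\<close> is quasi-inverse to \<open>G\<close>, with \<open>\<eta> : 1 \<rightarrow> H G\<close> and \<open>\<theta> : 1 \<rightarrow> G H\<close> the unit and the inverse of the
  counit of an adjoint equivalence; the last clause is the triangle identity. Every functor that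
  is an equivalence has such data.
\<close>

definition adjoint_quasi_inverse ::
  "('o, 'm) precat \<Rightarrow> ('o, 'm) endofun \<Rightarrow> ('o, 'm) endofun \<Rightarrow> ('o \<Rightarrow> 'm) \<Rightarrow> ('o \<Rightarrow> 'm) \<Rightarrow> bool" where
  "adjoint_quasi_inverse C G H \<eta> \<theta> \<longleftrightarrow> endofunctor C G \<and> endofunctor C H \<and>
     natural_iso C id_fun (comp_fun H G) \<eta> \<and> natural_iso C id_fun (comp_fun G H) \<theta> \<and>
     (\<forall>X\<in>Ob C. far G X (fob H (fob G X)) (\<eta> X) = \<theta> (fob G X))"


section \<open>The orbit category of an autoequivalence\<close>

primrec npow :: "('o, 'm) endofun \<Rightarrow> nat \<Rightarrow> ('o, 'm) endofun" where
  "npow F 0 = id_fun"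
| "npow F (Suc n) = comp_fun F (npow F n)"

text \<open>\<open>zpow G H i\<close> is \<open>G\<^sup>i\<close>, where the negative powers of \<open>G\<close> are the powers of its quasi-inverse \<open>H\<close>.\<close>

definition zpow :: "('o, 'm) endofun \<Rightarrow> ('o, 'm) endofun \<Rightarrow> int \<Rightarrow> ('o, 'm) endofun" where
  "zpow G H i = (if 0 \<le> i then npow G (nat i) else npow H (nat (- i)))"

text \<open>
  The canonical isomorphisms \<open>G\<^sup>m\<^sup>+\<^sup>1 X \<rightarrow> G G\<^sup>m X\<close> and \<open>G\<^sup>m\<^sup>-\<^sup>1 X \<rightarrow> H G\<^sup>m X\<close>, and those they induce,
  \<open>G\<^sup>i\<^sup>+\<^sup>j X \<rightarrow> G\<^sup>j G\<^sup>i X\<close>. All of them are identities if \<open>G\<close> is an automorphism with inverse \<open>H\<close>.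
\<close>

definition step_up ::
  "('o, 'm) precat \<Rightarrow> ('o, 'm) endofun \<Rightarrow> ('o, 'm) endofun \<Rightarrow> ('o \<Rightarrow> 'm) \<Rightarrow> int \<Rightarrow> 'o \<Rightarrow> 'm" where
  "step_up C G H \<theta> m X = (if 0 \<le> m then Idn C (fob (zpow G H (m + 1)) X)
     else \<theta> (fob (zpow G H (m + 1)) X))"

definition step_down ::
  "('o, 'm) precat \<Rightarrow> ('o, 'm) endofun \<Rightarrow> ('o, 'm) endofun \<Rightarrow> ('o \<Rightarrow> 'm) \<Rightarrow> int \<Rightarrow> 'o \<Rightarrow> 'm" where
  "step_down C G H \<eta> m X = (if m \<le> 0 then Idn C (fob (zpow G H (m - 1)) X)
     else \<eta> (fob (zpow G H (m - 1)) X))"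

primrec split_up ::
  "('o, 'm) precat \<Rightarrow> ('o, 'm) endofun \<Rightarrow> ('o, 'm) endofun \<Rightarrow> ('o \<Rightarrow> 'm) \<Rightarrow> nat \<Rightarrow> int \<Rightarrow> 'o \<Rightarrow> 'm" where
  "split_up C G H \<theta> 0 i X = Idn C (fob (zpow G H i) X)"
| "split_up C G H \<theta> (Suc j) i X =
     (let A = fob (zpow G H (i + int j)) X; B = fob (npow G j) (fob (zpow G H i) X)
      in Cmp C (fob (zpow G H (i + int j + 1)) X) (fob G A) (fob G B)
           (far G A B (split_up C G H \<theta> j i X)) (step_up C G H \<theta> (i + int j) X))"

primrec split_down ::
  "('o, 'm) precat \<Rightarrow> ('o, 'm) endofun \<Rightarrow> ('o, 'm) endofun \<Rightarrow> ('o \<Rightarrow> 'm) \<Rightarrow> nat \<Rightarrow> int \<Rightarrow> 'o \<Rightarrow> 'm" where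
  "split_down C G H \<eta> 0 i X = Idn C (fob (zpow G H i) X)"
| "split_down C G H \<eta> (Suc j) i X =
     (let A = fob (zpow G H (i - int j)) X; B = fob (npow H j) (fob (zpow G H i) X)
      in Cmp C (fob (zpow G H (i - int j - 1)) X) (fob H A) (fob H B)
           (far H A B (split_down C G H \<eta> j i X)) (step_down C G H \<eta> (i - int j) X))"

definition split_pow ::
  "('o, 'm) precat \<Rightarrow> ('o, 'm) endofun \<Rightarrow> ('o, 'm) endofun \<Rightarrow> ('o \<Rightarrow> 'm) \<Rightarrow> ('o \<Rightarrow> 'm)
     \<Rightarrow> int \<Rightarrow> int \<Rightarrow> 'o \<Rightarrow> 'm" where
  "split_pow C G H \<eta> \<theta> j i X =
     (if 0 \<le> j then split_up C G H \<theta> (nat j) i X else split_down C G H \<eta> (nat (- j)) i X)"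

text \<open>
  An object \<open>X\<close> of \<open>C\<close> stands for its \<open>G\<close>-orbit: \<open>X\<close> and \<open>G X\<close> are isomorphic in the orbit category.
  The arrows from \<open>X\<close> to \<open>Y\<close> are the elements of the coproduct of the groups \<open>Arr C (G\<^sup>i X) Y\<close>, and
  \<open>f : G\<^sup>i X \<rightarrow> Y\<close> followed by \<open>g : G\<^sup>j Y \<rightarrow> Z\<close> is \<open>g \<circ> G\<^sup>j f : G\<^sup>i\<^sup>+\<^sup>j X \<cong> G\<^sup>j G\<^sup>i X \<rightarrow> Z\<close>.
\<close>

definition orbit_category ::
  "('o, 'm) precat \<Rightarrow> ('o, 'm) endofun \<Rightarrow> ('o, 'm) endofun \<Rightarrow> ('o \<Rightarrow> 'm) \<Rightarrow> ('o \<Rightarrow> 'm)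
     \<Rightarrow> ('o, int \<Rightarrow> 'm) precat" where
  "orbit_category C G H \<eta> \<theta> =
     (let P = (\<lambda>i. fob (zpow G H i)) in
      \<lparr>Ob = Ob C,
       Arr = (\<lambda>X Y. {f. (\<forall>i. f i \<in> Arr C (P i X) Y) \<and> finite {i. f i \<noteq> Zer C (P i X) Y}}),
       Idn = (\<lambda>X i. if i = 0 then Idn C X else Zer C (P i X) X),
       Cmp = (\<lambda>X Y Z g f n. finprod (hom_group C (P n X) Z)
         (\<lambda>j. Cmp C (P n X) (P j Y) Z (g j)
            (Cmp C (P n X) (P j (P (n - j) X)) (P j Y)
              (far (zpow G H j) (P (n - j) X) Y (f (n - j)))
              (split_pow C G H \<eta> \<theta> j (n - j) X)))
         {j. g j \<noteq> Zer C (P j Y) Z}),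
       Add = (\<lambda>X Y f g i. Add C (P i X) Y (f i) (g i)),
       Zer = (\<lambda>X Y i. Zer C (P i X) Y)\<rparr>)"


section \<open>Localization by right fractions\<close>

text \<open>
  The arrows from \<open>X\<close> to \<open>Y\<close> are the classes of roofs \<open>(Z, s, f)\<close>, that is, \<open>s : Z \<rightarrow> X\<close> in \<open>S\<close> and
  \<open>f : Z \<rightarrow> Y\<close>, standing for \<open>f s\<^sup>-\<^sup>1\<close>. In each operation the union runs over all choices of
  representatives and of completed Ore squares. If \<open>S\<close> admits a calculus of right fractions
  compatible with the additive structure, then all the classes in such a union coincide.
\<close>

definition roofs ::
  "('o, 'm) precat \<Rightarrow> ('o \<Rightarrow> 'o \<Rightarrow> 'm set) \<Rightarrow> 'o \<Rightarrow> 'o \<Rightarrow> ('o \<times> 'm \<times> 'm) set" where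
  "roofs C S X Y = {(Z, s, f). Z \<in> Ob C \<and> s \<in> S Z X \<and> f \<in> Arr C Z Y}"

definition roof_eq ::
  "('o, 'm) precat \<Rightarrow> ('o \<Rightarrow> 'o \<Rightarrow> 'm set) \<Rightarrow> 'o \<Rightarrow> 'o \<Rightarrow> ('o \<times> 'm \<times> 'm) \<Rightarrow> ('o \<times> 'm \<times> 'm) \<Rightarrow> bool" where
  "roof_eq C S X Y = (\<lambda>(Z, s, f) (Z', s', f').
     \<exists>W\<in>Ob C. \<exists>u\<in>Arr C W Z. \<exists>u'\<in>Arr C W Z'.
       Cmp C W Z X s u \<in> S W X \<and>
       Cmp C W Z X s u = Cmp C W Z' X s' u' \<and> Cmp C W Z Y f u = Cmp C W Z' Y f' u')"

definition roof_class ::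
  "('o, 'm) precat \<Rightarrow> ('o \<Rightarrow> 'o \<Rightarrow> 'm set) \<Rightarrow> 'o \<Rightarrow> 'o \<Rightarrow> ('o \<times> 'm \<times> 'm) \<Rightarrow> ('o \<times> 'm \<times> 'm) set" where
  "roof_class C S X Y r = {r' \<in> roofs C S X Y. roof_eq C S X Y r r'}"

definition localization ::
  "('o, 'm) precat \<Rightarrow> ('o \<Rightarrow> 'o \<Rightarrow> 'm set) \<Rightarrow> ('o, ('o \<times> 'm \<times> 'm) set) precat" where
  "localization C S =
     \<lparr>Ob = Ob C,
      Arr = (\<lambda>X Y. roof_class C S X Y ` roofs C S X Y),
      Idn = (\<lambda>X. roof_class C S X X (X, Idn C X, Idn C X)),
      Cmp = (\<lambda>X Y Z b a. \<Union>{roof_class C S X Z (W, Cmp C W A X s u, Cmp C W B Z g h) |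
         A s f B t g W u h. (A, s, f) \<in> a \<and> (B, t, g) \<in> b \<and> W \<in> Ob C \<and> u \<in> S W A \<and> h \<in> Arr C W B \<and>
         Cmp C W A Y f u = Cmp C W B Y t h}),
      Add = (\<lambda>X Y a b. \<Union>{roof_class C S X Y (Z, s, Add C Z Y f g) |
         Z s f g. (Z, s, f) \<in> a \<and> (Z, s, g) \<in> b}),
      Zer = (\<lambda>X Y. roof_class C S X Y (X, Idn C X, Zer C X Y))\<rparr>"

definition localize_arr ::
  "('o, 'm) precat \<Rightarrow> ('o \<Rightarrow> 'o \<Rightarrow> 'm set) \<Rightarrow> 'o \<Rightarrow> 'o \<Rightarrow> 'm \<Rightarrow> ('o \<times> 'm \<times> 'm) set" where
  "localize_arr C S X Y f = roof_class C S X Y (X, Idn C X, f)"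

definition localize_fun ::
  "('o, 'm) precat \<Rightarrow> ('o \<Rightarrow> 'o \<Rightarrow> 'm set) \<Rightarrow> ('o, 'm) endofun
     \<Rightarrow> ('o, ('o \<times> 'm \<times> 'm) set) endofun" where
  "localize_fun C S F =
     \<lparr>fob = fob F,
      far = (\<lambda>X Y a. \<Union>{roof_class C S (fob F X) (fob F Y) (fob F Z, far F Z X s, far F Z Y f) |
         Z s f. (Z, s, f) \<in> a})\<rparr>"


section \<open>Finite-dimensional hereditary algebras and their finitely generated modules\<close>

definition fd_algebra :: "('k::field \<Rightarrow> 'h::ring_1 \<Rightarrow> 'h) \<Rightarrow> bool" where
  "fd_algebra scale \<longleftrightarrow> (\<exists>B. finite_dimensional_vector_space scale B) \<and>
     (\<forall>c x y. scale c (x * y) = scale c x * y \<and> scale c (x * y) = x * scale c y)"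

text \<open>
  The finitely generated left modules over a finite-dimensional algebra are finite-dimensional, so
  up to isomorphism they all live on subspaces of the space of sequences in \<open>'k\<close>. Module
  homomorphisms are functions that vanish outside the carrier of their domain, so that equality of
  homomorphisms is equality of functions.
\<close>

type_synonym 'k vec = "nat \<Rightarrow> 'k"

record ('h, 'k) hmod =
  mcar :: "'k vec set"
  mact :: "'h \<Rightarrow> 'k vec \<Rightarrow> 'k vec"

definition fg_module :: "('k::field \<Rightarrow> 'h::ring_1 \<Rightarrow> 'h) \<Rightarrow> ('h, 'k) hmod \<Rightarrow> bool" where
  "fg_module scale M \<longleftrightarrow>
     0 \<in> mcar M \<and> (\<forall>v\<in>mcar M. \<forall>w\<in>mcar M. v + w \<in> mcar M) \<and>
     (\<forall>a. \<forall>v\<in>mcar M. mact M a v \<in> mcar M) \<and>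
     (\<forall>a. \<forall>v\<in>mcar M. \<forall>w\<in>mcar M. mact M a (v + w) = mact M a v + mact M a w) \<and>
     (\<forall>a b. \<forall>v\<in>mcar M. mact M (a + b) v = mact M a v + mact M b v) \<and>
     (\<forall>a b. \<forall>v\<in>mcar M. mact M (a * b) v = mact M a (mact M b v)) \<and>
     (\<forall>c. \<forall>v\<in>mcar M. mact M (scale c 1) v = (\<lambda>n. c * v n)) \<and>
     (\<exists>S. finite S \<and> S \<subseteq> mcar M \<and> (\<forall>v\<in>mcar M. \<exists>a. v = (\<Sum>s\<in>S. mact M (a s) s)))"

definition module_hom ::
  "('h, 'k::field) hmod \<Rightarrow> ('h, 'k) hmod \<Rightarrow> ('k vec \<Rightarrow> 'k vec) set" where
  "module_hom M N = {f. (\<forall>v\<in>mcar M. f v \<in> mcar N) \<and>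
     (\<forall>v\<in>mcar M. \<forall>w\<in>mcar M. f (v + w) = f v + f w) \<and>
     (\<forall>a. \<forall>v\<in>mcar M. f (mact M a v) = mact N a (f v)) \<and>
     (\<forall>v. v \<notin> mcar M \<longrightarrow> f v = 0)}"

definition restr :: "('h, 'k::field) hmod \<Rightarrow> ('k vec \<Rightarrow> 'k vec) \<Rightarrow> 'k vec \<Rightarrow> 'k vec" where
  "restr M f = (\<lambda>v. if v \<in> mcar M then f v else 0)"

definition FgMod ::
  "('k::field \<Rightarrow> 'h::ring_1 \<Rightarrow> 'h) \<Rightarrow> (('h, 'k) hmod, 'k vec \<Rightarrow> 'k vec) precat" where
  "FgMod scale =
     \<lparr>Ob = {M. fg_module scale M},
      Arr = module_hom,
      Idn = (\<lambda>M. restr M (\<lambda>v. v)),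
      Cmp = (\<lambda>L M N g f v. g (f v)),
      Add = (\<lambda>M N f g v. f v + g v),
      Zer = (\<lambda>M N v. 0)\<rparr>"

definition projective_module :: "('k::field \<Rightarrow> 'h::ring_1 \<Rightarrow> 'h) \<Rightarrow> ('h, 'k) hmod \<Rightarrow> bool" where
  "projective_module scale P \<longleftrightarrow> fg_module scale P \<and>
     (\<forall>M N. \<forall>g\<in>module_hom M N. \<forall>f\<in>module_hom P N.
        fg_module scale M \<and> fg_module scale N \<and> g ` mcar M = mcar N \<longrightarrow>
        (\<exists>h\<in>module_hom P M. \<forall>v\<in>mcar P. g (h v) = f v))"

definition submodule :: "('h, 'k) hmod \<Rightarrow> ('h, 'k) hmod \<Rightarrow> bool" where
  "submodule M P \<longleftrightarrow> mcar M \<subseteq> mcar P \<and> (\<forall>a. \<forall>v\<in>mcar M. mact M a v = mact P a v)"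

definition hereditary :: "('k::field \<Rightarrow> 'h::ring_1 \<Rightarrow> 'h) \<Rightarrow> bool" where
  "hereditary scale \<longleftrightarrow>
     (\<forall>P M. projective_module scale P \<and> fg_module scale M \<and> submodule M P \<longrightarrow>
        projective_module scale M)"

text \<open>The direct sum of two modules interleaves their sequences.\<close>

definition vfst :: "'k vec \<Rightarrow> 'k vec" where "vfst u = (\<lambda>n. u (2 * n))"

definition vsnd :: "'k vec \<Rightarrow> 'k vec" where "vsnd u = (\<lambda>n. u (2 * n + 1))"

definition vpair :: "'k vec \<Rightarrow> 'k vec \<Rightarrow> 'k vec" where
  "vpair v w = (\<lambda>n. if even n then v (n div 2) else w (n div 2))"

definition mod_sum :: "('h, 'k) hmod \<Rightarrow> ('h, 'k) hmod \<Rightarrow> ('h, 'k) hmod" where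
  "mod_sum M N =
     \<lparr>mcar = {u. vfst u \<in> mcar M \<and> vsnd u \<in> mcar N},
      mact = (\<lambda>a u. vpair (mact M a (vfst u)) (mact N a (vsnd u)))\<rparr>"


section \<open>The bounded derived category\<close>

record ('h, 'k) cplx =
  cmod :: "int \<Rightarrow> ('h, 'k) hmod"
  cdif :: "int \<Rightarrow> 'k vec \<Rightarrow> 'k vec"

type_synonym 'k cmap = "int \<Rightarrow> 'k vec \<Rightarrow> 'k vec"

definition bounded_complex :: "('k::field \<Rightarrow> 'h::ring_1 \<Rightarrow> 'h) \<Rightarrow> ('h, 'k) cplx \<Rightarrow> bool" where
  "bounded_complex scale X \<longleftrightarrow>
     (\<forall>n. fg_module scale (cmod X n)) \<and>
     (\<forall>n. cdif X n \<in> module_hom (cmod X n) (cmod X (n + 1))) \<and>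
     (\<forall>n v. cdif X (n + 1) (cdif X n v) = 0) \<and>
     (\<exists>b. \<forall>n. b < \<bar>n\<bar> \<longrightarrow> mcar (cmod X n) = {0})"

definition chain_maps :: "('h, 'k::field) cplx \<Rightarrow> ('h, 'k) cplx \<Rightarrow> 'k cmap set" where
  "chain_maps X Y = {f. (\<forall>n. f n \<in> module_hom (cmod X n) (cmod Y n)) \<and>
     (\<forall>n v. f (n + 1) (cdif X n v) = cdif Y n (f n v))}"

definition homotopic ::
  "('h, 'k::field) cplx \<Rightarrow> ('h, 'k) cplx \<Rightarrow> 'k cmap \<Rightarrow> 'k cmap \<Rightarrow> bool" where
  "homotopic X Y f g \<longleftrightarrow>
     (\<exists>h. (\<forall>n. h n \<in> module_hom (cmod X n) (cmod Y (n - 1))) \<and>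
        (\<forall>n v. f n v - g n v = cdif Y (n - 1) (h n v) + h (n + 1) (cdif X n v)))"

definition hclass ::
  "('h, 'k::field) cplx \<Rightarrow> ('h, 'k) cplx \<Rightarrow> 'k cmap \<Rightarrow> 'k cmap set" where
  "hclass X Y f = {g \<in> chain_maps X Y. homotopic X Y f g}"

text \<open>The homotopy category of bounded complexes of finitely generated modules.\<close>

definition Kb ::
  "('k::field \<Rightarrow> 'h::ring_1 \<Rightarrow> 'h) \<Rightarrow> (('h, 'k) cplx, 'k cmap set) precat" where
  "Kb scale =
     \<lparr>Ob = {X. bounded_complex scale X},
      Arr = (\<lambda>X Y. hclass X Y ` chain_maps X Y),
      Idn = (\<lambda>X. hclass X X (\<lambda>n. restr (cmod X n) (\<lambda>v. v))),
      Cmp = (\<lambda>X Y Z b a. \<Union>{hclass X Z (\<lambda>n v. g n (f n v)) | f g. f \<in> a \<and> g \<in> b}),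
      Add = (\<lambda>X Y a b. \<Union>{hclass X Y (\<lambda>n v. f n v + g n v) | f g. f \<in> a \<and> g \<in> b}),
      Zer = (\<lambda>X Y. hclass X Y (\<lambda>n v. 0))\<rparr>"

definition cocycles :: "('h, 'k::field) cplx \<Rightarrow> int \<Rightarrow> 'k vec set" where
  "cocycles X n = {v \<in> mcar (cmod X n). cdif X n v = 0}"

text \<open>The class of a cocycle modulo coboundaries.\<close>

definition coh_class :: "('h, 'k::field) cplx \<Rightarrow> int \<Rightarrow> 'k vec \<Rightarrow> 'k vec set" where
  "coh_class X n v = {v + cdif X (n - 1) w | w. w \<in> mcar (cmod X (n - 1))}"

definition cohomology :: "('h, 'k::field) cplx \<Rightarrow> int \<Rightarrow> 'k vec set set" where
  "cohomology X n = coh_class X n ` cocycles X n"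

definition cohomology_map :: "('h, 'k::field) cplx \<Rightarrow> 'k cmap \<Rightarrow> int \<Rightarrow> 'k vec set \<Rightarrow> 'k vec set" where
  "cohomology_map Y f n c = (\<Union>v\<in>c. coh_class Y n (f n v))"

definition quasi_iso :: "('h, 'k::field) cplx \<Rightarrow> ('h, 'k) cplx \<Rightarrow> 'k cmap \<Rightarrow> bool" where
  "quasi_iso X Y f \<longleftrightarrow> f \<in> chain_maps X Y \<and>
     (\<forall>n. bij_betw (cohomology_map Y f n) (cohomology X n) (cohomology Y n))"

definition qis :: "('h, 'k::field) cplx \<Rightarrow> ('h, 'k) cplx \<Rightarrow> 'k cmap set set" where
  "qis X Y = hclass X Y ` {f. quasi_iso X Y f}"

definition Db ::
  "('k::field \<Rightarrow> 'h::ring_1 \<Rightarrow> 'h)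
     \<Rightarrow> (('h, 'k) cplx, (('h, 'k) cplx \<times> 'k cmap set \<times> 'k cmap set) set) precat" where
  "Db scale = localization (Kb scale) qis"

definition shift :: "int \<Rightarrow> ('h, 'k::field) cplx \<Rightarrow> ('h, 'k) cplx" where
  "shift m X =
     \<lparr>cmod = (\<lambda>n. cmod X (n + m)),
      cdif = (\<lambda>n v. if even m then cdif X (n + m) v else - cdif X (n + m) v)\<rparr>"

definition Kb_shift :: "(('h, 'k::field) cplx, 'k cmap set) endofun" where
  "Kb_shift = \<lparr>fob = shift 1, far = (\<lambda>X Y a. (\<lambda>f n. f (n + 1)) ` a)\<rparr>"

definition Db_shift ::
  "('k::field \<Rightarrow> 'h::ring_1 \<Rightarrow> 'h)
     \<Rightarrow> (('h, 'k) cplx, (('h, 'k) cplx \<times> 'k cmap set \<times> 'k cmap set) set) endofun" where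
  "Db_shift scale = localize_fun (Kb scale) qis Kb_shift"

definition Db_arr ::
  "('k::field \<Rightarrow> 'h::ring_1 \<Rightarrow> 'h) \<Rightarrow> ('h, 'k) cplx \<Rightarrow> ('h, 'k) cplx \<Rightarrow> 'k cmap
     \<Rightarrow> (('h, 'k) cplx \<times> 'k cmap set \<times> 'k cmap set) set" where
  "Db_arr scale X Y f = localize_arr (Kb scale) qis X Y (hclass X Y f)"

definition cone :: "('h, 'k::field) cplx \<Rightarrow> ('h, 'k) cplx \<Rightarrow> 'k cmap \<Rightarrow> ('h, 'k) cplx" where
  "cone X Y f =
     \<lparr>cmod = (\<lambda>n. mod_sum (cmod X (n + 1)) (cmod Y n)),
      cdif = (\<lambda>n. restr (mod_sum (cmod X (n + 1)) (cmod Y n))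
        (\<lambda>u. vpair (- cdif X (n + 1) (vfst u)) (f (n + 1) (vfst u) + cdif Y n (vsnd u))))\<rparr>"

definition cone_incl :: "('h, 'k::field) cplx \<Rightarrow> 'k cmap" where
  "cone_incl Y = (\<lambda>n. restr (cmod Y n) (\<lambda>v. vpair 0 v))"

definition cone_proj :: "('h, 'k::field) cplx \<Rightarrow> ('h, 'k) cplx \<Rightarrow> 'k cmap" where
  "cone_proj X Y = (\<lambda>n. restr (mod_sum (cmod X (n + 1)) (cmod Y n)) vfst)"

text \<open>
  The distinguished triangles are those isomorphic to some
  \<open>A \<rightarrow> B \<rightarrow> cone f \<rightarrow> shift 1 A\<close> with \<open>f\<close> a chain map from \<open>A\<close> to \<open>B\<close>.
\<close>

definition Db_triangles ::
  "('k::field \<Rightarrow> 'h::ring_1 \<Rightarrow> 'h)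
     \<Rightarrow> (('h, 'k) cplx \<times> ('h, 'k) cplx \<times> ('h, 'k) cplx \<times>
         (('h, 'k) cplx \<times> 'k cmap set \<times> 'k cmap set) set \<times>
         (('h, 'k) cplx \<times> 'k cmap set \<times> 'k cmap set) set \<times>
         (('h, 'k) cplx \<times> 'k cmap set \<times> 'k cmap set) set) set" where
  "Db_triangles scale =
     (let D = Db scale; T = shift 1 in
      {(X, Y, Z, u, v, w). X \<in> Ob D \<and> Y \<in> Ob D \<and> Z \<in> Ob D \<and>
         u \<in> Arr D X Y \<and> v \<in> Arr D Y Z \<and> w \<in> Arr D Z (T X) \<and>
         (\<exists>A\<in>Ob D. \<exists>B\<in>Ob D. \<exists>f\<in>chain_maps A B. \<exists>\<alpha> \<beta> \<gamma>.
            isomorphism D X A \<alpha> \<and> isomorphism D Y B \<beta> \<and> isomorphism D Z (cone A B f) \<gamma> \<and>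
            Cmp D X Y B \<beta> u = Cmp D X A B (Db_arr scale A B f) \<alpha> \<and>
            Cmp D Y Z (cone A B f) \<gamma> v =
              Cmp D Y B (cone A B f) (Db_arr scale B (cone A B f) (cone_incl B)) \<beta> \<and>
            Cmp D Z (T X) (T A) (far (Db_shift scale) X A \<alpha>) w =
              Cmp D Z (cone A B f) (T A) (Db_arr scale (cone A B f) (T A) (cone_proj A B)) \<gamma>)})"

text \<open>The module \<open>U\<close> as a complex concentrated in degree 0.\<close>

definition stalk :: "('h, 'k::field) hmod \<Rightarrow> ('h, 'k) cplx" where
  "stalk U =
     \<lparr>cmod = (\<lambda>n. if n = 0 then U else \<lparr>mcar = {0}, mact = (\<lambda>a v. 0)\<rparr>), cdif = (\<lambda>n v. 0)\<rparr>"


section \<open>The finiteness conditions on the autoequivalence\<close>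

definition cond_g1 ::
  "('k::field \<Rightarrow> 'h::ring_1 \<Rightarrow> 'h)
     \<Rightarrow> (('h, 'k) cplx, (('h, 'k) cplx \<times> 'k cmap set \<times> 'k cmap set) set) endofun
     \<Rightarrow> (('h, 'k) cplx, (('h, 'k) cplx \<times> 'k cmap set \<times> 'k cmap set) set) endofun \<Rightarrow> bool" where
  "cond_g1 scale G H \<longleftrightarrow>
     (\<forall>U. indecomposable (FgMod scale) U \<longrightarrow>
        finite {n. \<exists>V. indecomposable (FgMod scale) V \<and>
          isomorphic (Db scale) (fob (zpow G H n) (stalk U)) (stalk V)})"

definition cond_g2 ::
  "('k::field \<Rightarrow> 'h::ring_1 \<Rightarrow> 'h)
     \<Rightarrow> (('h, 'k) cplx, (('h, 'k) cplx \<times> 'k cmap set \<times> 'k cmap set) set) endofun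
     \<Rightarrow> (('h, 'k) cplx, (('h, 'k) cplx \<times> 'k cmap set \<times> 'k cmap set) set) endofun \<Rightarrow> bool" where
  "cond_g2 scale G H \<longleftrightarrow>
     (\<exists>N::nat. \<forall>X. indecomposable (Db scale) X \<longrightarrow>
        (\<exists>i U n. indecomposable (FgMod scale) U \<and> n \<in> {- int N..int N} \<and>
          isomorphic (Db scale) (fob (zpow G H i) X) (shift n (stalk U))))"

end

theory Submission
  imports Defs
begin

text \<open>
  Over a hereditary algebra every object of the derived category is a finite direct sum of shifts
  \<open>U[m]\<close> of indecomposable modules, and \<open>U[m]\<close> has the local endomorphism ring of \<open>U\<close>. Since \<open>G\<close> permutes
  these objects up to isomorphism and commutes with the shift, (g1) implies that for \<open>X = U[m]\<close> only finitely
  many \<open>G\<^sup>iX\<close> admit a non-zero map to \<open>X\<close>, and that \<open>G\<^sup>iX\<close> is not isomorphic to \<open>X\<close> unless \<open>i = 0\<close>. Hence no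
  composite \<open>X \<rightarrow> G\<^sup>iX \<rightarrow> X\<close> with \<open>i \<noteq> 0\<close> is invertible, so in the \<open>\<int>\<close>-graded ring of endomorphisms
  of the orbit of \<open>X\<close>, which has finitely many non-zero components, Gaussian elimination inverts every element whose
  degree-zero part is a unit. That ring is therefore local, and direct sum decompositions pass to the
  orbit category.
\<close>

section \<open>Preadditive categories\<close>

text \<open>Three obstacles shape the proof. Arrows of \<open>Db scale\<close> are classes of roofs
  and cannot be computed with directly. Each complex is therefore resolved by pairs of projectives
  \<open>K n \<subseteq> Q n\<close>, where heredity makes the submodule projective, and a roof
  becomes a homotopy class of chain maps out of the resolution. The same pairs identify a complex
  with its cohomology, and they confine non-zero maps from V[m'] to U[m] to m' = m and m' = m - 1;
  this is why (g1), which speaks of a single degree, is applied to two shifts. Next, G has only a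
  quasi-inverse, so its powers multiply only up to isomorphism, and associativity in D/G rests on a
  cocycle identity between these isomorphisms. Deriving the second triangle identity makes G and H
  interchangeable, which reduces negative exponents to positive ones. Finally, an endomorphism b of
  an orbit has components in degrees of both signs, so no evident geometric series inverts it. Its
  inverse is found instead as the solution of a finite linear system with entries b (j - i), indexed
  by the degrees that carry non-zero endomorphisms.\<close>

text \<open>Composition and addition in \<open>Kb\<close> and in \<open>localization\<close> are
  unions over all choices of representatives. Once all choices are shown to give the same class and
  one choice exists, the union is that class.\<close>

lemma Union_const: "\<lbrakk>\<And>A. A \<in> F \<Longrightarrow> A = B; B \<in> F\<rbrakk> \<Longrightarrow> \<Union>F = B"
proof -
  assume "\<And>A. A \<in> F \<Longrightarrow> A = B" "B \<in> F"
  then have "F = {B}" by blast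
  then show ?thesis by simp
qed

lemma hom_group_simps [simp]:
  "carrier (hom_group C X Y) = Arr C X Y"
  "mult (hom_group C X Y) = Add C X Y"
  "one (hom_group C X Y) = Zer C X Y"
  by (simp_all add: hom_group_def)

lemma (in comm_monoid) finprod_swap:
  assumes "finite A" "finite B" "\<And>i j. i \<in> A \<Longrightarrow> j \<in> B \<Longrightarrow> f i j \<in> carrier G"
  shows "finprod G (\<lambda>i. finprod G (f i) B) A = finprod G (\<lambda>j. finprod G (\<lambda>i. f i j) A) B"
  using assms(1,3)
proof (induction A rule: finite_induct)
  case empty
  then show ?case by (simp add: finprod_one_eqI)
next
  case (insert a A)
  have "finprod G (\<lambda>i. finprod G (f i) B) (insert a A) =
      finprod G (f a) B \<otimes> finprod G (\<lambda>i. finprod G (f i) B) A"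
    using insert by (intro finprod_insert) (auto intro!: finprod_closed)
  also have "\<dots> = finprod G (\<lambda>j. f a j \<otimes> finprod G (\<lambda>i. f i j) A) B"
    using insert by (subst finprod_multf) (auto intro!: finprod_closed)
  also have "\<dots> = finprod G (\<lambda>j. finprod G (\<lambda>i. f i j) (insert a A)) B"
    using insert by (intro finprod_cong') (auto intro!: finprod_closed)
  finally show ?case .
qed

section \<open>Calculus of hom-groups, finite sums of arrows and isomorphisms\<close>

locale preadditive =
  fixes C :: "('o, 'm) precat"
  assumes preadditive: "preadditive_category C"
begin

lemma cat: "category C"
  using preadditive by (simp add: preadditive_category_def)

lemma idn_in [simp, intro]: "X \<in> Ob C \<Longrightarrow> Idn C X \<in> Arr C X X"
  using cat by (simp add: category_def)

lemma cmp_in [simp, intro]: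
  "\<lbrakk>f \<in> Arr C X Y; g \<in> Arr C Y Z; X \<in> Ob C; Y \<in> Ob C; Z \<in> Ob C\<rbrakk> \<Longrightarrow> Cmp C X Y Z g f \<in> Arr C X Z"
  using cat by (simp add: category_def)

lemma cmp_idr [simp]: "\<lbrakk>f \<in> Arr C X Y; X \<in> Ob C; Y \<in> Ob C\<rbrakk> \<Longrightarrow> Cmp C X X Y f (Idn C X) = f"
  and cmp_idl [simp]: "\<lbrakk>f \<in> Arr C X Y; X \<in> Ob C; Y \<in> Ob C\<rbrakk> \<Longrightarrow> Cmp C X Y Y (Idn C Y) f = f"
  using cat by (simp_all add: category_def)

lemma cmp_assoc:
  "\<lbrakk>f \<in> Arr C W X; g \<in> Arr C X Y; h \<in> Arr C Y Z; W \<in> Ob C; X \<in> Ob C; Y \<in> Ob C; Z \<in> Ob C\<rbrakk> \<Longrightarrow>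
   Cmp C W X Z (Cmp C X Y Z h g) f = Cmp C W Y Z h (Cmp C W X Y g f)"
  using cat by (simp add: category_def)

lemma hom_comm_group: "X \<in> Ob C \<Longrightarrow> Y \<in> Ob C \<Longrightarrow> comm_group (hom_group C X Y)"
  using preadditive by (simp add: preadditive_category_def)

lemma hom_group: "X \<in> Ob C \<Longrightarrow> Y \<in> Ob C \<Longrightarrow> group (hom_group C X Y)"
  using hom_comm_group comm_group.axioms(2) by blast

lemma hom_comm_monoid: "X \<in> Ob C \<Longrightarrow> Y \<in> Ob C \<Longrightarrow> comm_monoid (hom_group C X Y)"
  using hom_comm_group comm_group.axioms(1) by blast

lemma hom_monoid: "X \<in> Ob C \<Longrightarrow> Y \<in> Ob C \<Longrightarrow> Group.monoid (hom_group C X Y)"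
  using hom_comm_monoid comm_monoid.axioms(1) by blast

lemma zer_in [simp, intro]: "X \<in> Ob C \<Longrightarrow> Y \<in> Ob C \<Longrightarrow> Zer C X Y \<in> Arr C X Y"
  using monoid.one_closed[OF hom_monoid] by fastforce

lemma add_in [simp, intro]:
  "\<lbrakk>f \<in> Arr C X Y; g \<in> Arr C X Y; X \<in> Ob C; Y \<in> Ob C\<rbrakk> \<Longrightarrow> Add C X Y f g \<in> Arr C X Y"
  using monoid.m_closed[OF hom_monoid, of X Y f g] by simp

lemma add_zer [simp]: "\<lbrakk>f \<in> Arr C X Y; X \<in> Ob C; Y \<in> Ob C\<rbrakk> \<Longrightarrow> Add C X Y f (Zer C X Y) = f"
  and zer_add [simp]: "\<lbrakk>f \<in> Arr C X Y; X \<in> Ob C; Y \<in> Ob C\<rbrakk> \<Longrightarrow> Add C X Y (Zer C X Y) f = f"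
  using monoid.r_one[OF hom_monoid, of X Y f] monoid.l_one[OF hom_monoid, of X Y f] by simp_all

lemma add_assoc:
  "\<lbrakk>f \<in> Arr C X Y; g \<in> Arr C X Y; h \<in> Arr C X Y; X \<in> Ob C; Y \<in> Ob C\<rbrakk> \<Longrightarrow>
   Add C X Y (Add C X Y f g) h = Add C X Y f (Add C X Y g h)"
  using monoid.m_assoc[OF hom_monoid, of X Y f g h] by simp

lemma add_comm:
  "\<lbrakk>f \<in> Arr C X Y; g \<in> Arr C X Y; X \<in> Ob C; Y \<in> Ob C\<rbrakk> \<Longrightarrow> Add C X Y f g = Add C X Y g f"
  using comm_monoid.m_comm[OF hom_comm_monoid, of X Y f g] by simp

lemma neg_ex:
  "\<lbrakk>f \<in> Arr C X Y; X \<in> Ob C; Y \<in> Ob C\<rbrakk> \<Longrightarrow> \<exists>g\<in>Arr C X Y. Add C X Y g f = Zer C X Y"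
  using group.l_inv_ex[OF hom_group, of X Y f] by simp

lemma add_cancel:
  "\<lbrakk>Add C X Y f g = Add C X Y f h; f \<in> Arr C X Y; g \<in> Arr C X Y; h \<in> Arr C X Y; X \<in> Ob C; Y \<in> Ob C\<rbrakk>
   \<Longrightarrow> g = h"
  using monoid.Units_l_cancel[OF hom_monoid, of X Y f g h] group.Units_eq[OF hom_group, of X Y] by simp

lemma add_self_zer:
  "\<lbrakk>Add C X Y f f = f; f \<in> Arr C X Y; X \<in> Ob C; Y \<in> Ob C\<rbrakk> \<Longrightarrow> f = Zer C X Y"
  by (rule add_cancel[of X Y f]) simp_all

lemma cmp_addr:
  "\<lbrakk>f \<in> Arr C X Y; f' \<in> Arr C X Y; g \<in> Arr C Y Z; X \<in> Ob C; Y \<in> Ob C; Z \<in> Ob C\<rbrakk> \<Longrightarrow>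
   Cmp C X Y Z g (Add C X Y f f') = Add C X Z (Cmp C X Y Z g f) (Cmp C X Y Z g f')"
  and cmp_addl:
  "\<lbrakk>f \<in> Arr C X Y; g \<in> Arr C Y Z; g' \<in> Arr C Y Z; X \<in> Ob C; Y \<in> Ob C; Z \<in> Ob C\<rbrakk> \<Longrightarrow>
   Cmp C X Y Z (Add C Y Z g g') f = Add C X Z (Cmp C X Y Z g f) (Cmp C X Y Z g' f)"
  using preadditive by (simp_all add: preadditive_category_def)

lemma cmp_zer [simp]:
  assumes "g \<in> Arr C Y Z" "X \<in> Ob C" "Y \<in> Ob C" "Z \<in> Ob C"
  shows "Cmp C X Y Z g (Zer C X Y) = Zer C X Z"
  using cmp_addr[of "Zer C X Y" X Y "Zer C X Y" g Z] assms by (intro add_self_zer) auto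

lemma zer_cmp [simp]:
  assumes "f \<in> Arr C X Y" "X \<in> Ob C" "Y \<in> Ob C" "Z \<in> Ob C"
  shows "Cmp C X Y Z (Zer C Y Z) f = Zer C X Z"
  using cmp_addl[of f X Y "Zer C Y Z" Z "Zer C Y Z"] assms by (intro add_self_zer) auto

abbreviation hsum :: "'o \<Rightarrow> 'o \<Rightarrow> ('i \<Rightarrow> 'm) \<Rightarrow> 'i set \<Rightarrow> 'm" where
  "hsum X Y \<equiv> finprod (hom_group C X Y)"

lemma hsum_in [simp, intro]:
  "\<lbrakk>\<And>i. i \<in> A \<Longrightarrow> f i \<in> Arr C X Y; X \<in> Ob C; Y \<in> Ob C\<rbrakk> \<Longrightarrow> hsum X Y f A \<in> Arr C X Y"
  using comm_monoid.finprod_closed[OF hom_comm_monoid, of X Y f A] by auto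

lemma hsum_empty [simp]: "X \<in> Ob C \<Longrightarrow> Y \<in> Ob C \<Longrightarrow> hsum X Y f {} = Zer C X Y"
  using comm_monoid.finprod_empty[OF hom_comm_monoid, of X Y f] by simp

lemma hsum_insert:
  "\<lbrakk>finite A; a \<notin> A; f a \<in> Arr C X Y; \<And>i. i \<in> A \<Longrightarrow> f i \<in> Arr C X Y; X \<in> Ob C; Y \<in> Ob C\<rbrakk> \<Longrightarrow>
   hsum X Y f (insert a A) = Add C X Y (f a) (hsum X Y f A)"
  using comm_monoid.finprod_insert[OF hom_comm_monoid, of X Y A a f] by auto

lemma hsum_cong:
  "\<lbrakk>\<And>i. i \<in> A \<Longrightarrow> g i \<in> Arr C X Y; \<And>i. i \<in> A \<Longrightarrow> f i = g i; X \<in> Ob C; Y \<in> Ob C\<rbrakk> \<Longrightarrow>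
   hsum X Y f A = hsum X Y g A"
  using comm_monoid.finprod_cong'[OF hom_comm_monoid, of X Y A A g f] by auto

lemma hsum_zer:
  "\<lbrakk>\<And>i. i \<in> A \<Longrightarrow> f i = Zer C X Y; X \<in> Ob C; Y \<in> Ob C\<rbrakk> \<Longrightarrow> hsum X Y f A = Zer C X Y"
  using comm_monoid.finprod_one_eqI[OF hom_comm_monoid, of X Y A f] by auto

lemma hsum_mono:
  "\<lbrakk>finite B; A \<subseteq> B; \<And>i. i \<in> B - A \<Longrightarrow> f i = Zer C X Y; \<And>i. i \<in> B \<Longrightarrow> f i \<in> Arr C X Y;
    X \<in> Ob C; Y \<in> Ob C\<rbrakk> \<Longrightarrow> hsum X Y f A = hsum X Y f B"
  using comm_monoid.finprod_mono_neutral_cong_left[OF hom_comm_monoid, of X Y B A f f] by auto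

lemma hsum_single:
  "\<lbrakk>finite A; a \<in> A; \<And>i. i \<in> A \<Longrightarrow> i \<noteq> a \<Longrightarrow> f i = Zer C X Y; f a \<in> Arr C X Y; X \<in> Ob C; Y \<in> Ob C\<rbrakk>
   \<Longrightarrow> hsum X Y f A = f a"
  using hsum_mono[of A "{a}" f X Y] hsum_insert[of "{}" a f X Y] by force

lemma hsum_add:
  "\<lbrakk>\<And>i. i \<in> A \<Longrightarrow> f i \<in> Arr C X Y; \<And>i. i \<in> A \<Longrightarrow> g i \<in> Arr C X Y; X \<in> Ob C; Y \<in> Ob C\<rbrakk> \<Longrightarrow>
   hsum X Y (\<lambda>i. Add C X Y (f i) (g i)) A = Add C X Y (hsum X Y f A) (hsum X Y g A)"
  using comm_monoid.finprod_multf[OF hom_comm_monoid, of X Y f A g] by auto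

lemma hsum_swap:
  "\<lbrakk>finite A; finite B; \<And>i j. i \<in> A \<Longrightarrow> j \<in> B \<Longrightarrow> f i j \<in> Arr C X Y; X \<in> Ob C; Y \<in> Ob C\<rbrakk> \<Longrightarrow>
   hsum X Y (\<lambda>i. hsum X Y (f i) B) A = hsum X Y (\<lambda>j. hsum X Y (\<lambda>i. f i j) A) B"
  using comm_monoid.finprod_swap[OF hom_comm_monoid, of X Y A B f] by auto

lemma hsum_reindex:
  "\<lbrakk>inj_on h A; \<And>i. i \<in> A \<Longrightarrow> f (h i) \<in> Arr C X Y; X \<in> Ob C; Y \<in> Ob C\<rbrakk> \<Longrightarrow>
   hsum X Y f (h ` A) = hsum X Y (\<lambda>i. f (h i)) A"
  using comm_monoid.finprod_reindex[OF hom_comm_monoid, of X Y f h A] by auto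

lemma hsum_Un:
  "\<lbrakk>finite A; finite B; A \<inter> B = {}; \<And>i. i \<in> A \<union> B \<Longrightarrow> f i \<in> Arr C X Y; X \<in> Ob C; Y \<in> Ob C\<rbrakk> \<Longrightarrow>
   hsum X Y f (A \<union> B) = Add C X Y (hsum X Y f A) (hsum X Y f B)"
  using comm_monoid.finprod_Un_disjoint[OF hom_comm_monoid, of X Y A B f] by auto

lemma cmp_hsum:
  assumes "finite A" "\<And>i. i \<in> A \<Longrightarrow> f i \<in> Arr C X Y" "g \<in> Arr C Y Z" "X \<in> Ob C" "Y \<in> Ob C" "Z \<in> Ob C"
  shows "Cmp C X Y Z g (hsum X Y f A) = hsum X Z (\<lambda>i. Cmp C X Y Z g (f i)) A"
  using assms
proof (induction A rule: finite_induct)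
  case (insert a A)
  then show ?case by (simp add: hsum_insert cmp_addr)
qed simp

lemma hsum_cmp:
  assumes "finite A" "\<And>i. i \<in> A \<Longrightarrow> g i \<in> Arr C Y Z" "f \<in> Arr C X Y" "X \<in> Ob C" "Y \<in> Ob C" "Z \<in> Ob C"
  shows "Cmp C X Y Z (hsum Y Z g A) f = hsum X Z (\<lambda>i. Cmp C X Y Z (g i) f) A"
  using assms
proof (induction A rule: finite_induct)
  case (insert a A)
  then show ?case by (simp add: hsum_insert cmp_addl)
qed simp

lemma cmp_hsum_cmp:
  assumes "finite A" "\<And>i. i \<in> A \<Longrightarrow> a i \<in> Arr C X Y" "g \<in> Arr C W X" "f \<in> Arr C Y Z"
    "W \<in> Ob C" "X \<in> Ob C" "Y \<in> Ob C" "Z \<in> Ob C"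
  shows "hsum W Z (\<lambda>i. Cmp C W Y Z f (Cmp C W X Y (a i) g)) A = Cmp C W Y Z f (Cmp C W X Y (hsum X Y a A) g)"
  using assms by (subst hsum_cmp[of A a X Y g W]) (auto simp: cmp_hsum)

lemma hsum_sing [simp]: "\<lbrakk>f a \<in> Arr C X Y; X \<in> Ob C; Y \<in> Ob C\<rbrakk> \<Longrightarrow> hsum X Y f {a} = f a"
  using hsum_insert[of "{}" a f X Y] by simp

lemma hsum_two:
  "\<lbrakk>f 0 \<in> Arr C X Y; f (Suc 0) \<in> Arr C X Y; X \<in> Ob C; Y \<in> Ob C\<rbrakk> \<Longrightarrow>
   hsum X Y f {..<Suc (Suc 0)} = Add C X Y (f 0) (f (Suc 0))"
  using hsum_insert[of "{0}" "Suc 0" f X Y] by (simp add: lessThan_Suc add_comm)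

lemma iso_refl: "X \<in> Ob C \<Longrightarrow> isomorphic C X X"
  unfolding isomorphic_def isomorphism_def by (intro exI[of _ "Idn C X"]) (auto intro!: bexI[of _ "Idn C X"])

lemma isoI:
  "\<lbrakk>f \<in> Arr C X Y; g \<in> Arr C Y X; Cmp C X Y X g f = Idn C X; Cmp C Y X Y f g = Idn C Y\<rbrakk> \<Longrightarrow> isomorphic C X Y"
  unfolding isomorphic_def isomorphism_def by blast

lemma isoE:
  assumes "isomorphic C X Y"
  obtains f g where "f \<in> Arr C X Y" "g \<in> Arr C Y X" "Cmp C X Y X g f = Idn C X" "Cmp C Y X Y f g = Idn C Y"
  using assms unfolding isomorphic_def isomorphism_def by blast

lemma iso_sym: "isomorphic C X Y \<Longrightarrow> isomorphic C Y X"
  by (metis isoE isoI)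

lemma isomorphism_cmp:
  assumes f: "f \<in> Arr C X Y" "f' \<in> Arr C Y X" "Cmp C X Y X f' f = Idn C X" "Cmp C Y X Y f f' = Idn C Y"
    and g: "g \<in> Arr C Y Z" "g' \<in> Arr C Z Y" "Cmp C Y Z Y g' g = Idn C Y" "Cmp C Z Y Z g g' = Idn C Z"
    and [simp]: "X \<in> Ob C" "Y \<in> Ob C" "Z \<in> Ob C"
  shows "Cmp C X Z X (Cmp C Z Y X f' g') (Cmp C X Y Z g f) = Idn C X"
    "Cmp C Z X Z (Cmp C X Y Z g f) (Cmp C Z Y X f' g') = Idn C Z"
proof -
  have "Cmp C X Z X (Cmp C Z Y X f' g') (Cmp C X Y Z g f) = Cmp C X Y X f' (Cmp C X Y Y (Cmp C Y Z Y g' g) f)"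
    using f(1,2) g(1,2) by (simp add: cmp_assoc del: cmp_idl)
  then show "Cmp C X Z X (Cmp C Z Y X f' g') (Cmp C X Y Z g f) = Idn C X"
    using f g by simp
  have "Cmp C Z X Z (Cmp C X Y Z g f) (Cmp C Z Y X f' g') = Cmp C Z Y Z g (Cmp C Z Y Y (Cmp C Y X Y f f') g')"
    using f(1,2) g(1,2) by (simp add: cmp_assoc del: cmp_idl)
  then show "Cmp C Z X Z (Cmp C X Y Z g f) (Cmp C Z Y X f' g') = Idn C Z"
    using f g by simp
qed

lemma iso_trans:
  assumes "isomorphic C X Y" "isomorphic C Y Z" "X \<in> Ob C" "Y \<in> Ob C" "Z \<in> Ob C"
  shows "isomorphic C X Z"
proof -
  obtain f f' where f: "f \<in> Arr C X Y" "f' \<in> Arr C Y X" "Cmp C X Y X f' f = Idn C X" "Cmp C Y X Y f f' = Idn C Y"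
    using assms(1) by (rule isoE)
  obtain g g' where g: "g \<in> Arr C Y Z" "g' \<in> Arr C Z Y" "Cmp C Y Z Y g' g = Idn C Y" "Cmp C Z Y Z g g' = Idn C Z"
    using assms(2) by (rule isoE)
  show ?thesis
    using isomorphism_cmp[OF f g assms(3-5)] f(1,2) g(1,2) assms(3-5)
    by (intro isoI[of "Cmp C X Y Z g f" _ _ "Cmp C Z Y X f' g'"]) auto
qed

end

subsection \<open>Direct sums\<close>

lemma direct_sumE:
  assumes "direct_sum C Ys X"
  obtains \<iota> \<pi> where "\<And>i. i < length Ys \<Longrightarrow> \<iota> i \<in> Arr C (Ys ! i) X"
    "\<And>i. i < length Ys \<Longrightarrow> \<pi> i \<in> Arr C X (Ys ! i)"
    "\<And>i. i < length Ys \<Longrightarrow> Cmp C (Ys ! i) X (Ys ! i) (\<pi> i) (\<iota> i) = Idn C (Ys ! i)"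
    "\<And>i j. i < length Ys \<Longrightarrow> j < length Ys \<Longrightarrow> i \<noteq> j \<Longrightarrow> Cmp C (Ys ! i) X (Ys ! j) (\<pi> j) (\<iota> i) = Zer C (Ys ! i) (Ys ! j)"
    "finprod (hom_group C X X) (\<lambda>i. Cmp C X (Ys ! i) X (\<iota> i) (\<pi> i)) {..<length Ys} = Idn C X"
    "X \<in> Ob C" "set Ys \<subseteq> Ob C"
proof -
  obtain \<iota> \<pi> where "\<forall>i<length Ys. \<iota> i \<in> Arr C (Ys ! i) X \<and> \<pi> i \<in> Arr C X (Ys ! i)"
    "\<forall>i<length Ys. \<forall>j<length Ys. Cmp C (Ys ! i) X (Ys ! j) (\<pi> j) (\<iota> i) =
           (if i = j then Idn C (Ys ! i) else Zer C (Ys ! i) (Ys ! j))"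
    "finprod (hom_group C X X) (\<lambda>i. Cmp C X (Ys ! i) X (\<iota> i) (\<pi> i)) {..<length Ys} = Idn C X"
    "X \<in> Ob C" "set Ys \<subseteq> Ob C"
    using assms unfolding direct_sum_def by blast
  then show thesis by (intro that[of \<iota> \<pi>]) auto
qed

lemma direct_sumI:
  assumes "\<And>i. i < length Ys \<Longrightarrow> \<iota> i \<in> Arr C (Ys ! i) X"
    "\<And>i. i < length Ys \<Longrightarrow> \<pi> i \<in> Arr C X (Ys ! i)"
    "\<And>i. i < length Ys \<Longrightarrow> Cmp C (Ys ! i) X (Ys ! i) (\<pi> i) (\<iota> i) = Idn C (Ys ! i)"
    "\<And>i j. i < length Ys \<Longrightarrow> j < length Ys \<Longrightarrow> i \<noteq> j \<Longrightarrow> Cmp C (Ys ! i) X (Ys ! j) (\<pi> j) (\<iota> i) = Zer C (Ys ! i) (Ys ! j)"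
    "finprod (hom_group C X X) (\<lambda>i. Cmp C X (Ys ! i) X (\<iota> i) (\<pi> i)) {..<length Ys} = Idn C X"
    "X \<in> Ob C" "set Ys \<subseteq> Ob C"
  shows "direct_sum C Ys X"
  unfolding direct_sum_def using assms by (intro conjI exI[of _ \<iota>] exI[of _ \<pi>]) auto

context preadditive
begin

lemma zero_object_iff: "zero_object C X \<longleftrightarrow> X \<in> Ob C \<and> Idn C X = Zer C X X"
  by (auto simp: direct_sum_def)

lemma direct_sum_pairI:
  assumes "i1 \<in> Arr C A X" "i2 \<in> Arr C B X" "p1 \<in> Arr C X A" "p2 \<in> Arr C X B"
    "Cmp C A X A p1 i1 = Idn C A" "Cmp C B X B p2 i2 = Idn C B"
    "Cmp C A X B p2 i1 = Zer C A B" "Cmp C B X A p1 i2 = Zer C B A"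
    "Add C X X (Cmp C X A X i1 p1) (Cmp C X B X i2 p2) = Idn C X"
    and [simp]: "A \<in> Ob C" "B \<in> Ob C" "X \<in> Ob C"
  shows "direct_sum C [A, B] X"
proof (rule direct_sumI[of _ "case_nat i1 (\<lambda>_. i2)" _ _ "case_nat p1 (\<lambda>_. p2)"])
  show "hsum X X (\<lambda>i. Cmp C X ([A, B] ! i) X (case_nat i1 (\<lambda>_. i2) i) (case_nat p1 (\<lambda>_. p2) i)) {..<length [A, B]} = Idn C X"
    using assms by (simp add: hsum_two cmp_in del: lessThan_Suc)
qed (use assms in \<open>auto simp: less_Suc_eq split: nat.splits\<close>)

lemma direct_sum_pairE:
  assumes "direct_sum C [A, B] X"
  obtains i1 i2 p1 p2 where "i1 \<in> Arr C A X" "i2 \<in> Arr C B X" "p1 \<in> Arr C X A" "p2 \<in> Arr C X B"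
    "Cmp C A X A p1 i1 = Idn C A" "Cmp C B X B p2 i2 = Idn C B"
    "Cmp C A X B p2 i1 = Zer C A B" "Cmp C B X A p1 i2 = Zer C B A"
    "Add C X X (Cmp C X A X i1 p1) (Cmp C X B X i2 p2) = Idn C X"
    "A \<in> Ob C" "B \<in> Ob C" "X \<in> Ob C"
proof -
  obtain \<iota> \<pi> where *: "\<And>i. i < length [A, B] \<Longrightarrow> \<iota> i \<in> Arr C ([A, B] ! i) X"
    "\<And>i. i < length [A, B] \<Longrightarrow> \<pi> i \<in> Arr C X ([A, B] ! i)"
    "\<And>i. i < length [A, B] \<Longrightarrow> Cmp C ([A, B] ! i) X ([A, B] ! i) (\<pi> i) (\<iota> i) = Idn C ([A, B] ! i)"
    "\<And>i j. i < length [A, B] \<Longrightarrow> j < length [A, B] \<Longrightarrow> i \<noteq> j \<Longrightarrow> Cmp C ([A, B] ! i) X ([A, B] ! j) (\<pi> j) (\<iota> i) = Zer C ([A, B] ! i) ([A, B] ! j)"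
    "hsum X X (\<lambda>i. Cmp C X ([A, B] ! i) X (\<iota> i) (\<pi> i)) {..<length [A, B]} = Idn C X"
    "X \<in> Ob C" "set [A, B] \<subseteq> Ob C"
    using assms by (rule direct_sumE) blast
  have 1: "\<iota> 0 \<in> Arr C A X" "\<pi> 0 \<in> Arr C X A" "\<iota> 1 \<in> Arr C B X" "\<pi> 1 \<in> Arr C X B"
    using *(1)[of 0] *(2)[of 0] *(1)[of 1] *(2)[of 1] by simp_all
  have "Add C X X (Cmp C X A X (\<iota> 0) (\<pi> 0)) (Cmp C X B X (\<iota> 1) (\<pi> 1)) = Idn C X"
    using *(5) 1 *(6,7) by (simp add: hsum_two cmp_in del: lessThan_Suc)
  then show thesis
    using 1 *(3)[of 0] *(3)[of 1] *(4)[of 0 1] *(4)[of 1 0] *(6,7)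
    by (intro that[of "\<iota> 0" "\<iota> 1" "\<pi> 0" "\<pi> 1"]) simp_all
qed

lemma direct_sum_iso:
  assumes "direct_sum C Ys X" "isomorphic C X X'" "X' \<in> Ob C"
  shows "direct_sum C Ys X'"
  using assms(1)
proof (rule direct_sumE)
  fix \<iota> \<pi>
  assume \<iota>: "\<And>i. i < length Ys \<Longrightarrow> \<iota> i \<in> Arr C (Ys ! i) X"
    and \<pi>: "\<And>i. i < length Ys \<Longrightarrow> \<pi> i \<in> Arr C X (Ys ! i)"
    and diag: "\<And>i. i < length Ys \<Longrightarrow> Cmp C (Ys ! i) X (Ys ! i) (\<pi> i) (\<iota> i) = Idn C (Ys ! i)"
    and off: "\<And>i j. i < length Ys \<Longrightarrow> j < length Ys \<Longrightarrow> i \<noteq> j \<Longrightarrow> Cmp C (Ys ! i) X (Ys ! j) (\<pi> j) (\<iota> i) = Zer C (Ys ! i) (Ys ! j)"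
    and sum: "hsum X X (\<lambda>i. Cmp C X (Ys ! i) X (\<iota> i) (\<pi> i)) {..<length Ys} = Idn C X"
    and X [simp]: "X \<in> Ob C" and Ys: "set Ys \<subseteq> Ob C"
  have Yi [simp]: "i < length Ys \<Longrightarrow> Ys ! i \<in> Ob C" for i using Ys nth_mem by blast
  note [simp] = assms(3)
  obtain f g where fg [simp]: "f \<in> Arr C X X'" "g \<in> Arr C X' X"
      and gf: "Cmp C X X' X g f = Idn C X" "Cmp C X' X X' f g = Idn C X'"
    using assms(2) by (rule isoE)
  \<comment> \<open>The isomorphism and its inverse meet in the middle and cancel, so every
    condition on the transported injections and projections reduces to the original one.\<close>
  have mid: "Cmp C Y X' Z (Cmp C X' X Z b g) (Cmp C Y X X' f a) = Cmp C Y X Z b a"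
    if [simp]: "a \<in> Arr C Y X" "b \<in> Arr C X Z" "Y \<in> Ob C" "Z \<in> Ob C" for a b Y Z
  proof -
    have "Cmp C Y X' Z (Cmp C X' X Z b g) (Cmp C Y X X' f a) = Cmp C Y X Z b (Cmp C Y X X (Cmp C X X' X g f) a)"
      by (simp add: cmp_assoc del: cmp_idl)
    then show ?thesis by (simp add: gf)
  qed
  show ?thesis
  proof (rule direct_sumI[of _ "\<lambda>i. Cmp C (Ys ! i) X X' f (\<iota> i)" _ _ "\<lambda>i. Cmp C X' X (Ys ! i) (\<pi> i) g"])
    have "hsum X' X' (\<lambda>i. Cmp C X' (Ys ! i) X' (Cmp C (Ys ! i) X X' f (\<iota> i)) (Cmp C X' X (Ys ! i) (\<pi> i) g)) {..<length Ys}
       = hsum X' X' (\<lambda>i. Cmp C X' X X' f (Cmp C X' X X (Cmp C X (Ys ! i) X (\<iota> i) (\<pi> i)) g)) {..<length Ys}"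
      by (rule hsum_cong) (simp_all add: cmp_assoc \<iota> \<pi> cmp_in)
    also have "\<dots> = Cmp C X' X X' f (Cmp C X' X X (hsum X X (\<lambda>i. Cmp C X (Ys ! i) X (\<iota> i) (\<pi> i)) {..<length Ys}) g)"
      by (rule cmp_hsum_cmp) (auto simp: \<iota> \<pi>)
    finally show "hsum X' X' (\<lambda>i. Cmp C X' (Ys ! i) X' (Cmp C (Ys ! i) X X' f (\<iota> i)) (Cmp C X' X (Ys ! i) (\<pi> i) g)) {..<length Ys} = Idn C X'"
      by (simp add: sum gf)
  qed (use \<iota> \<pi> Ys in \<open>auto simp: mid diag off\<close>)
qed

text \<open>Refines a decomposition. It serves the induction on the dimension of a module and the
  one that adds a degree at a time to a complex with zero differential.\<close>

lemma direct_sum_append: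
  assumes "direct_sum C [A, B] X" "direct_sum C As A" "direct_sum C Bs B"
  shows "direct_sum C (As @ Bs) X"
proof -
  obtain i1 i2 p1 p2 where ip [simp]: "i1 \<in> Arr C A X" "i2 \<in> Arr C B X" "p1 \<in> Arr C X A" "p2 \<in> Arr C X B"
    and e: "Cmp C A X A p1 i1 = Idn C A" "Cmp C B X B p2 i2 = Idn C B"
    "Cmp C A X B p2 i1 = Zer C A B" "Cmp C B X A p1 i2 = Zer C B A"
    "Add C X X (Cmp C X A X i1 p1) (Cmp C X B X i2 p2) = Idn C X"
    and AB [simp]: "A \<in> Ob C" "B \<in> Ob C" "X \<in> Ob C"
    using assms(1) by (rule direct_sum_pairE)
  obtain \<iota> \<pi> where a: "\<And>i. i < length As \<Longrightarrow> \<iota> i \<in> Arr C (As ! i) A"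
    "\<And>i. i < length As \<Longrightarrow> \<pi> i \<in> Arr C A (As ! i)"
    "\<And>i. i < length As \<Longrightarrow> Cmp C (As ! i) A (As ! i) (\<pi> i) (\<iota> i) = Idn C (As ! i)"
    "\<And>i j. i < length As \<Longrightarrow> j < length As \<Longrightarrow> i \<noteq> j \<Longrightarrow> Cmp C (As ! i) A (As ! j) (\<pi> j) (\<iota> i) = Zer C (As ! i) (As ! j)"
    "hsum A A (\<lambda>i. Cmp C A (As ! i) A (\<iota> i) (\<pi> i)) {..<length As} = Idn C A"
    "set As \<subseteq> Ob C"
    using assms(2) by (rule direct_sumE) blast
  obtain \<iota>' \<pi>' where b: "\<And>i. i < length Bs \<Longrightarrow> \<iota>' i \<in> Arr C (Bs ! i) B"
    "\<And>i. i < length Bs \<Longrightarrow> \<pi>' i \<in> Arr C B (Bs ! i)"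
    "\<And>i. i < length Bs \<Longrightarrow> Cmp C (Bs ! i) B (Bs ! i) (\<pi>' i) (\<iota>' i) = Idn C (Bs ! i)"
    "\<And>i j. i < length Bs \<Longrightarrow> j < length Bs \<Longrightarrow> i \<noteq> j \<Longrightarrow> Cmp C (Bs ! i) B (Bs ! j) (\<pi>' j) (\<iota>' i) = Zer C (Bs ! i) (Bs ! j)"
    "hsum B B (\<lambda>i. Cmp C B (Bs ! i) B (\<iota>' i) (\<pi>' i)) {..<length Bs} = Idn C B"
    "set Bs \<subseteq> Ob C"
    using assms(3) by (rule direct_sumE) blast
  let ?n = "length As"
  have ob [simp]: "i < ?n \<Longrightarrow> As ! i \<in> Ob C" "j < length Bs \<Longrightarrow> Bs ! j \<in> Ob C" for i j
    using a(6) b(6) nth_mem by blast+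
  have mid: "Cmp C Y X Z (Cmp C X W Z v p) (Cmp C Y V X i u) = Cmp C Y W Z v (Cmp C Y V W (Cmp C V X W p i) u)"
    if "u \<in> Arr C Y V" "i \<in> Arr C V X" "p \<in> Arr C X W" "v \<in> Arr C W Z" "Y \<in> Ob C" "V \<in> Ob C" "W \<in> Ob C" "Z \<in> Ob C"
    for u i p v Y V W Z using that by (simp add: cmp_assoc)
  define I where "I i = (if i < ?n then Cmp C (As ! i) A X i1 (\<iota> i) else Cmp C (Bs ! (i - ?n)) B X i2 (\<iota>' (i - ?n)))" for i
  define P where "P i = (if i < ?n then Cmp C X A (As ! i) (\<pi> i) p1 else Cmp C X B (Bs ! (i - ?n)) (\<pi>' (i - ?n)) p2)" for i
  have lt: "i - ?n < length Bs" if "i < length (As @ Bs)" "\<not> i < ?n" for i using that by auto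
  show ?thesis
  proof (rule direct_sumI[of _ I _ _ P])
    fix i assume i: "i < length (As @ Bs)"
    show "I i \<in> Arr C ((As @ Bs) ! i) X" using i lt[OF i] by (auto simp: I_def nth_append a b)
    show "P i \<in> Arr C X ((As @ Bs) ! i)" using i lt[OF i] by (auto simp: P_def nth_append a b)
    show "Cmp C ((As @ Bs) ! i) X ((As @ Bs) ! i) (P i) (I i) = Idn C ((As @ Bs) ! i)"
      using i lt[OF i] by (auto simp: P_def I_def nth_append a b mid e)
    fix j assume j: "j < length (As @ Bs)" and "i \<noteq> j"
    then show "Cmp C ((As @ Bs) ! i) X ((As @ Bs) ! j) (P j) (I i) = Zer C ((As @ Bs) ! i) ((As @ Bs) ! j)"
      using i lt[OF i] lt[OF j] by (auto simp: P_def I_def nth_append a b mid e)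
  next
    let ?f = "\<lambda>i. Cmp C X ((As @ Bs) ! i) X (I i) (P i)"
    have "{..<length (As @ Bs)} = {..<?n} \<union> (\<lambda>i. ?n + i) ` {..<length Bs}"
    proof (intro equalityI subsetI)
      fix i assume "i \<in> {..<length (As @ Bs)}"
      then show "i \<in> {..<?n} \<union> (\<lambda>i. ?n + i) ` {..<length Bs}"
        by (cases "i < ?n") (auto intro!: image_eqI[of _ _ "i - ?n"])
    qed auto
    moreover have fin: "?f i \<in> Arr C X X" if "i < length (As @ Bs)" for i
      using that lt[OF that] by (auto simp: P_def I_def nth_append a b)
    ultimately have "hsum X X ?f {..<length (As @ Bs)} =
        Add C X X (hsum X X ?f {..<?n}) (hsum X X ?f ((\<lambda>i. ?n + i) ` {..<length Bs}))"
      by (simp only:) (rule hsum_Un, auto)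
    also have "hsum X X ?f {..<?n} = hsum X X (\<lambda>i. Cmp C X A X i1 (Cmp C X A A (Cmp C A (As ! i) A (\<iota> i) (\<pi> i)) p1)) {..<?n}"
      by (rule hsum_cong) (auto simp: P_def I_def nth_append a b cmp_assoc cmp_in)
    also have "\<dots> = Cmp C X A X i1 (Cmp C X A A (hsum A A (\<lambda>i. Cmp C A (As ! i) A (\<iota> i) (\<pi> i)) {..<?n}) p1)"
      by (rule cmp_hsum_cmp) (auto simp: a)
    also have "\<dots> = Cmp C X A X i1 p1" by (simp add: a)
    also have "hsum X X ?f ((\<lambda>i. ?n + i) ` {..<length Bs}) = hsum X X (\<lambda>i. ?f (?n + i)) {..<length Bs}"
      by (intro hsum_reindex fin) auto
    also have "\<dots> = hsum X X (\<lambda>i. Cmp C X B X i2 (Cmp C X B B (Cmp C B (Bs ! i) B (\<iota>' i) (\<pi>' i)) p2)) {..<length Bs}"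
      by (rule hsum_cong) (auto simp: P_def I_def nth_append a b cmp_assoc cmp_in)
    also have "\<dots> = Cmp C X B X i2 (Cmp C X B B (hsum B B (\<lambda>i. Cmp C B (Bs ! i) B (\<iota>' i) (\<pi>' i)) {..<length Bs}) p2)"
      by (rule cmp_hsum_cmp) (auto simp: b)
    also have "\<dots> = Cmp C X B X i2 p2" by (simp add: b)
    finally show "hsum X X ?f {..<length (As @ Bs)} = Idn C X" by (simp add: e)
  qed (use a b in auto)
qed

lemma direct_sum_single: "X \<in> Ob C \<Longrightarrow> direct_sum C [X] X"
  by (rule direct_sumI[of _ "\<lambda>_. Idn C X" _ _ "\<lambda>_. Idn C X"]) (auto simp: lessThan_Suc)

end

subsection \<open>Additive functors\<close>

text \<open>The record \<open>endofun\<close> covers functors from a category to itself; here source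
  and target may have different types of objects and arrows, as for modules to complexes to homotopy
  classes to roofs.\<close>

definition additive_functor ::
  "('o, 'm) precat \<Rightarrow> ('p, 'n) precat \<Rightarrow> ('o \<Rightarrow> 'p) \<Rightarrow> ('o \<Rightarrow> 'o \<Rightarrow> 'm \<Rightarrow> 'n) \<Rightarrow> bool" where
  "additive_functor C D \<omega> \<phi> \<longleftrightarrow>
     (\<forall>X\<in>Ob C. \<omega> X \<in> Ob D \<and> \<phi> X X (Idn C X) = Idn D (\<omega> X)) \<and>
     (\<forall>X\<in>Ob C. \<forall>Y\<in>Ob C. \<forall>f\<in>Arr C X Y. \<phi> X Y f \<in> Arr D (\<omega> X) (\<omega> Y)) \<and>
     (\<forall>X\<in>Ob C. \<forall>Y\<in>Ob C. \<forall>Z\<in>Ob C. \<forall>f\<in>Arr C X Y. \<forall>g\<in>Arr C Y Z.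
        \<phi> X Z (Cmp C X Y Z g f) = Cmp D (\<omega> X) (\<omega> Y) (\<omega> Z) (\<phi> Y Z g) (\<phi> X Y f)) \<and>
     (\<forall>X\<in>Ob C. \<forall>Y\<in>Ob C. \<forall>f\<in>Arr C X Y. \<forall>g\<in>Arr C X Y.
        \<phi> X Y (Add C X Y f g) = Add D (\<omega> X) (\<omega> Y) (\<phi> X Y f) (\<phi> X Y g))"

locale addfun = C: preadditive C + D: preadditive D
  for C :: "('o, 'm) precat" and D :: "('p, 'n) precat" +
  fixes \<omega> :: "'o \<Rightarrow> 'p" and \<phi> :: "'o \<Rightarrow> 'o \<Rightarrow> 'm \<Rightarrow> 'n"
  assumes additive_functor: "additive_functor C D \<omega> \<phi>"
begin

lemma ob_in [simp]: "X \<in> Ob C \<Longrightarrow> \<omega> X \<in> Ob D"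
  and fun_idn [simp]: "X \<in> Ob C \<Longrightarrow> \<phi> X X (Idn C X) = Idn D (\<omega> X)"
  and fun_in [simp]: "\<lbrakk>f \<in> Arr C X Y; X \<in> Ob C; Y \<in> Ob C\<rbrakk> \<Longrightarrow> \<phi> X Y f \<in> Arr D (\<omega> X) (\<omega> Y)"
  and fun_cmp: "\<lbrakk>f \<in> Arr C X Y; g \<in> Arr C Y Z; X \<in> Ob C; Y \<in> Ob C; Z \<in> Ob C\<rbrakk> \<Longrightarrow>
        \<phi> X Z (Cmp C X Y Z g f) = Cmp D (\<omega> X) (\<omega> Y) (\<omega> Z) (\<phi> Y Z g) (\<phi> X Y f)"
  and fun_add: "\<lbrakk>f \<in> Arr C X Y; g \<in> Arr C X Y; X \<in> Ob C; Y \<in> Ob C\<rbrakk> \<Longrightarrow>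
        \<phi> X Y (Add C X Y f g) = Add D (\<omega> X) (\<omega> Y) (\<phi> X Y f) (\<phi> X Y g)"
  using additive_functor by (simp_all add: additive_functor_def)

lemma fun_zer [simp]: "\<lbrakk>X \<in> Ob C; Y \<in> Ob C\<rbrakk> \<Longrightarrow> \<phi> X Y (Zer C X Y) = Zer D (\<omega> X) (\<omega> Y)"
  using fun_add[of "Zer C X Y" X Y "Zer C X Y"] by (intro D.add_self_zer) auto

lemma fun_hsum:
  assumes "finite A" "\<And>i. i \<in> A \<Longrightarrow> f i \<in> Arr C X Y" "X \<in> Ob C" "Y \<in> Ob C"
  shows "\<phi> X Y (C.hsum X Y f A) = D.hsum (\<omega> X) (\<omega> Y) (\<lambda>i. \<phi> X Y (f i)) A"
  using assms
proof (induction A rule: finite_induct)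
  case (insert a A)
  then show ?case by (simp add: C.hsum_insert D.hsum_insert fun_add)
qed simp

text \<open>A biproduct is given by equations between composites and one finite sum, all of which an
  additive functor respects. Every decomposition in the derived and the orbit category is obtained
  in this way from modules or complexes.\<close>

lemma fun_direct_sum:
  assumes "direct_sum C Ys X"
  shows "direct_sum D (map \<omega> Ys) (\<omega> X)"
  using assms
proof (rule direct_sumE)
  fix \<iota> \<pi>
  assume \<iota>: "\<And>i. i < length Ys \<Longrightarrow> \<iota> i \<in> Arr C (Ys ! i) X"
    and \<pi>: "\<And>i. i < length Ys \<Longrightarrow> \<pi> i \<in> Arr C X (Ys ! i)"
    and diag: "\<And>i. i < length Ys \<Longrightarrow> Cmp C (Ys ! i) X (Ys ! i) (\<pi> i) (\<iota> i) = Idn C (Ys ! i)"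
    and off: "\<And>i j. i < length Ys \<Longrightarrow> j < length Ys \<Longrightarrow> i \<noteq> j \<Longrightarrow> Cmp C (Ys ! i) X (Ys ! j) (\<pi> j) (\<iota> i) = Zer C (Ys ! i) (Ys ! j)"
    and sum: "C.hsum X X (\<lambda>i. Cmp C X (Ys ! i) X (\<iota> i) (\<pi> i)) {..<length Ys} = Idn C X"
    and X [simp]: "X \<in> Ob C" and Ys: "set Ys \<subseteq> Ob C"
  have Yi [simp]: "i < length Ys \<Longrightarrow> Ys ! i \<in> Ob C" for i using Ys nth_mem by blast
  show ?thesis
  proof (rule direct_sumI[of _ "\<lambda>i. \<phi> (Ys ! i) X (\<iota> i)" _ _ "\<lambda>i. \<phi> X (Ys ! i) (\<pi> i)"])
    have "D.hsum (\<omega> X) (\<omega> X) (\<lambda>i. Cmp D (\<omega> X) (map \<omega> Ys ! i) (\<omega> X) (\<phi> (Ys ! i) X (\<iota> i)) (\<phi> X (Ys ! i) (\<pi> i))) {..<length (map \<omega> Ys)}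
      = D.hsum (\<omega> X) (\<omega> X) (\<lambda>i. \<phi> X X (Cmp C X (Ys ! i) X (\<iota> i) (\<pi> i))) {..<length Ys}"
      unfolding length_map by (rule D.hsum_cong) (auto simp: \<iota> \<pi> fun_cmp)
    also have "\<dots> = Idn D (\<omega> X)" by (subst fun_hsum[symmetric]) (auto simp: \<iota> \<pi> sum)
    finally show "D.hsum (\<omega> X) (\<omega> X) (\<lambda>i. Cmp D (\<omega> X) (map \<omega> Ys ! i) (\<omega> X) (\<phi> (Ys ! i) X (\<iota> i)) (\<phi> X (Ys ! i) (\<pi> i))) {..<length (map \<omega> Ys)} = Idn D (\<omega> X)" .
  qed (use Ys in \<open>auto simp: \<iota> \<pi> diag off simp flip: fun_cmp\<close>)
qed

end

text \<open>Used both for quotients of hom-sets and for pulling the structure back along a fully faithful object map.\<close>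

lemma preadditive_transfer:
  fixes C :: "('o, 'm) precat" and D :: "('p, 'n) precat"
  assumes "preadditive_category C" "\<And>X. X \<in> Ob D \<Longrightarrow> \<omega> X \<in> Ob C"
    and arr: "\<And>X Y. X \<in> Ob D \<Longrightarrow> Y \<in> Ob D \<Longrightarrow> Arr D X Y = \<phi> X Y ` Arr C (\<omega> X) (\<omega> Y)"
    and idn: "\<And>X. X \<in> Ob D \<Longrightarrow> Idn D X = \<phi> X X (Idn C (\<omega> X))"
    and cmp: "\<And>X Y Z f g. \<lbrakk>X \<in> Ob D; Y \<in> Ob D; Z \<in> Ob D; f \<in> Arr C (\<omega> X) (\<omega> Y); g \<in> Arr C (\<omega> Y) (\<omega> Z)\<rbrakk> \<Longrightarrow>
        Cmp D X Y Z (\<phi> Y Z g) (\<phi> X Y f) = \<phi> X Z (Cmp C (\<omega> X) (\<omega> Y) (\<omega> Z) g f)"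
    and add: "\<And>X Y f g. \<lbrakk>X \<in> Ob D; Y \<in> Ob D; f \<in> Arr C (\<omega> X) (\<omega> Y); g \<in> Arr C (\<omega> X) (\<omega> Y)\<rbrakk> \<Longrightarrow>
        Add D X Y (\<phi> X Y f) (\<phi> X Y g) = \<phi> X Y (Add C (\<omega> X) (\<omega> Y) f g)"
    and zer: "\<And>X Y. X \<in> Ob D \<Longrightarrow> Y \<in> Ob D \<Longrightarrow> Zer D X Y = \<phi> X Y (Zer C (\<omega> X) (\<omega> Y))"
  shows "preadditive_category D"
proof -
  interpret C: preadditive C using assms(1) by unfold_locales
  note [simp] = assms(2) C.cmp_assoc C.cmp_addl C.cmp_addr
  have "category D"
    unfolding category_def by (auto simp: arr idn cmp)
  moreover have "comm_group (hom_group D X Y)" if [simp]: "X \<in> Ob D" "Y \<in> Ob D" for X Y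
  proof (rule comm_groupI)
    fix f assume "f \<in> carrier (hom_group D X Y)"
    then obtain f' where f': "f = \<phi> X Y f'" "f' \<in> Arr C (\<omega> X) (\<omega> Y)" by (auto simp: arr)
    then obtain g' where "g' \<in> Arr C (\<omega> X) (\<omega> Y)" "Add C (\<omega> X) (\<omega> Y) g' f' = Zer C (\<omega> X) (\<omega> Y)"
      using C.neg_ex[of f' "\<omega> X" "\<omega> Y"] by auto
    with f' show "\<exists>y\<in>carrier (hom_group D X Y). y \<otimes>\<^bsub>hom_group D X Y\<^esub> f = \<one>\<^bsub>hom_group D X Y\<^esub>"
      by (auto simp: arr zer add intro!: bexI[of _ g'])
  qed (auto simp: arr zer add C.add_assoc, metis C.add_comm that assms(2))
  ultimately show ?thesis
    unfolding preadditive_category_def by (auto simp: arr cmp add)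
qed

section \<open>Local rings\<close>

text \<open>The dichotomy makes one-sided inverses two-sided: if l a = 1, then e = a l is
  idempotent, and either e or 1 - e is a unit, so e is 1 or 0; the value 0 would give 1 = l e a = 0.
  Hence both factors of an invertible product are units, which yields the ideal property.\<close>

lemma local_ringI:
  fixes R (structure)
  assumes "ring R" "\<one> \<noteq> \<zero>" and dich: "\<And>a. a \<in> carrier R \<Longrightarrow> a \<in> Units R \<or> \<one> \<ominus> a \<in> Units R"
  shows "local_ring R"
proof -
  interpret ring R by fact
  have left: "a \<in> Units R" if [simp]: "a \<in> carrier R" "l \<in> carrier R" and la: "l \<otimes> a = \<one>" for a l
  proof -
    let ?e = "a \<otimes> l"
    have e: "?e \<otimes> ?e = ?e"
    proof -
      have "?e \<otimes> ?e = a \<otimes> (l \<otimes> a) \<otimes> l" by (simp add: m_assoc del: la)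
      then show ?thesis by (simp add: la)
    qed
    have "?e \<in> Units R \<or> \<one> \<ominus> ?e \<in> Units R" by (rule dich) simp
    then have "?e = \<one>"
    proof
      assume u: "?e \<in> Units R"
      have "?e \<otimes> ?e = ?e \<otimes> \<one>" using e by simp
      then show ?thesis using u Units_l_cancel[OF u, of ?e \<one>] by simp
    next
      assume u: "\<one> \<ominus> ?e \<in> Units R"
      have "(\<one> \<ominus> ?e) \<otimes> ?e = (\<one> \<ominus> ?e) \<otimes> \<zero>"
        using e by (simp add: minus_eq l_distr l_minus r_neg)
      then have e0: "?e = \<zero>" using Units_l_cancel[OF u, of ?e \<zero>] by simp
      have "\<one> = (l \<otimes> a) \<otimes> (l \<otimes> a)" by (simp add: la)
      also have "\<dots> = l \<otimes> ?e \<otimes> a" by (simp add: m_assoc)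
      finally show ?thesis using e0 assms(2) by simp
    qed
    then show ?thesis using la by (auto simp: Units_def)
  qed
  have right: "b \<in> Units R" if "b \<in> carrier R" "l \<in> carrier R" "b \<otimes> l = \<one>" for b l
  proof -
    have "l \<in> Units R" using left[of l b] that by simp
    then have "b = inv l" using that by (metis Units_inv_closed Units_r_inv inv_unique Units_closed Units_l_inv)
    then show ?thesis using \<open>l \<in> Units R\<close> by simp
  qed
  let ?I = "carrier R - Units R"
  have prod: "a \<in> Units R \<and> b \<in> Units R" if [simp]: "a \<in> carrier R" "b \<in> carrier R" and u: "a \<otimes> b \<in> Units R" for a b
  proof
    have i: "inv (a \<otimes> b) \<in> carrier R" using u by simp
    have "a \<otimes> (b \<otimes> inv (a \<otimes> b)) = \<one>" using u i by (simp flip: m_assoc)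
    then show "a \<in> Units R" using right[OF that(1), of "b \<otimes> inv (a \<otimes> b)"] i by simp
    have "inv (a \<otimes> b) \<otimes> a \<otimes> b = \<one>" using u i by (simp add: m_assoc)
    then show "b \<in> Units R" using left[OF that(2), of "inv (a \<otimes> b) \<otimes> a"] i by simp
  qed
  \<comment> \<open>Multiplying by the inverse of a + b turns the two summands into elements with
    sum 1, to which the dichotomy applies.\<close>
  have plus: "a \<in> Units R \<or> b \<in> Units R" if [simp]: "a \<in> carrier R" "b \<in> carrier R" and u: "a \<oplus> b \<in> Units R" for a b
  proof -
    let ?v = "inv (a \<oplus> b)"
    have v: "?v \<in> carrier R" using u by simp
    have "?v \<otimes> a \<oplus> ?v \<otimes> b = \<one>" using u v by (simp flip: r_distr)
    then have "\<one> \<ominus> ?v \<otimes> a = ?v \<otimes> b"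
    proof -
      assume "?v \<otimes> a \<oplus> ?v \<otimes> b = \<one>"
      moreover have "x \<oplus> y \<ominus> x = y" if "x \<in> carrier R" "y \<in> carrier R" for x y
        using that a_comm[of x y] by (simp add: minus_eq a_assoc r_neg)
      then have "?v \<otimes> a \<oplus> ?v \<otimes> b \<ominus> ?v \<otimes> a = ?v \<otimes> b" using v by simp
      ultimately show ?thesis by simp
    qed
    then have "?v \<otimes> a \<in> Units R \<or> ?v \<otimes> b \<in> Units R" using dich[of "?v \<otimes> a"] v by simp
    then show ?thesis using prod[OF v] that by blast
  qed
  have "\<zero> \<notin> Units R"
    using assms(2) by (auto simp: Units_def)
  moreover have "\<ominus> a \<notin> Units R" if "a \<in> ?I" for a
  proof
    assume u: "\<ominus> a \<in> Units R"
    have "\<ominus> a = (\<ominus> \<one>) \<otimes> a" using that by (simp add: l_minus)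
    then show False using prod[of "\<ominus> \<one>" a] u that by auto
  qed
  ultimately have "subgroup ?I (add_monoid R)"
    using plus by (intro add.subgroupI) (blast, blast, simp, blast)
  then have "ideal ?I R"
  proof (intro idealI[OF assms(1)])
    fix a x assume "a \<in> ?I" "x \<in> carrier R"
    then show "x \<otimes> a \<in> ?I" "a \<otimes> x \<in> ?I" using prod[of x a] prod[of a x] by blast+
  qed
  then show ?thesis by (simp add: local_ring_def)
qed

lemma local_ringD:
  fixes R (structure)
  assumes "local_ring R"
  shows "ring R" "\<one> \<noteq> \<zero>" "\<zero> \<notin> Units R"
    "\<And>a b. \<lbrakk>a \<in> carrier R; b \<in> carrier R; a \<oplus> b \<in> Units R\<rbrakk> \<Longrightarrow> a \<in> Units R \<or> b \<in> Units R"
    "\<And>a b. \<lbrakk>a \<in> carrier R; b \<in> carrier R; a \<otimes> b \<in> Units R\<rbrakk> \<Longrightarrow> a \<in> Units R \<and> b \<in> Units R"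
proof -
  interpret I: ideal "carrier R - Units R" R using assms by (simp add: local_ring_def)
  show "ring R" by (rule I.ring_axioms)
  show z: "\<zero> \<notin> Units R"
    using additive_subgroup.zero_closed[OF I.additive_subgroup_axioms] by blast
  show "\<one> \<noteq> \<zero>"
  proof
    assume "\<one> = \<zero>"
    then have "\<zero> \<in> Units R" using I.Units_one_closed by (simp only:)
    with z show False ..
  qed
  fix a b assume ab: "a \<in> carrier R" "b \<in> carrier R"
  show "a \<oplus> b \<in> Units R \<Longrightarrow> a \<in> Units R \<or> b \<in> Units R"
    using ab additive_subgroup.a_closed[OF I.additive_subgroup_axioms, of a b] by auto
  show "a \<otimes> b \<in> Units R \<Longrightarrow> a \<in> Units R \<and> b \<in> Units R"
    using ab I.I_l_closed[of b a] I.I_r_closed[of a b] by auto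
qed

context preadditive
begin

lemma End_ring_simps [simp]:
  "carrier (End_ring C X) = Arr C X X" "mult (End_ring C X) = Cmp C X X X"
  "one (End_ring C X) = Idn C X" "zero (End_ring C X) = Zer C X X" "add (End_ring C X) = Add C X X"
  by (simp_all add: End_ring_def)

lemma ring_End: 
  assumes [simp]: "X \<in> Ob C"
  shows "ring (End_ring C X)"
proof (rule ringI)
  have "add_monoid (End_ring C X) = hom_group C X X" by (simp add: hom_group_def End_ring_def)
  then show "abelian_group (End_ring C X)"
    by (intro abelian_group.intro abelian_monoid.intro abelian_group_axioms.intro)
      (simp_all only: hom_comm_group hom_comm_monoid assms)
  show "Group.monoid (End_ring C X)" by (rule monoidI) (auto simp: cmp_assoc)
qed (auto simp: cmp_addl cmp_addr)

text \<open>The identity is the sum of the idempotents belonging to the summands. Non-units of a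
  local ring are closed under sums, so one of these idempotents is a unit, and an idempotent unit is
  the identity.\<close>

lemma local_End_direct_sum:
  assumes "local_ring (End_ring C X)" "direct_sum C Ys X"
  shows "\<exists>Y\<in>set Ys. isomorphic C X Y"
  using assms(2)
proof (rule direct_sumE)
  fix \<iota> \<pi>
  assume \<iota>: "\<And>i. i < length Ys \<Longrightarrow> \<iota> i \<in> Arr C (Ys ! i) X"
    and \<pi>: "\<And>i. i < length Ys \<Longrightarrow> \<pi> i \<in> Arr C X (Ys ! i)"
    and diag: "\<And>i. i < length Ys \<Longrightarrow> Cmp C (Ys ! i) X (Ys ! i) (\<pi> i) (\<iota> i) = Idn C (Ys ! i)"
    and sum: "hsum X X (\<lambda>i. Cmp C X (Ys ! i) X (\<iota> i) (\<pi> i)) {..<length Ys} = Idn C X"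
    and X [simp]: "X \<in> Ob C" and Ys: "set Ys \<subseteq> Ob C"
  have Yi [simp]: "i < length Ys \<Longrightarrow> Ys ! i \<in> Ob C" for i using Ys nth_mem by blast
  let ?R = "End_ring C X" and ?f = "\<lambda>i. Cmp C X (Ys ! i) X (\<iota> i) (\<pi> i)"
  note loc = local_ringD[OF assms(1)]
  interpret R: ring ?R by (rule loc(1))
  have none: "hsum X X ?f A \<notin> Units ?R" if "finite A" "\<And>i. i \<in> A \<Longrightarrow> i < length Ys \<and> ?f i \<notin> Units ?R" for A
    using that
  proof (induction A rule: finite_induct)
    case empty
    then show ?case using loc(3) by simp
  next
    case (insert a A)
    then have "hsum X X ?f (insert a A) = Add C X X (?f a) (hsum X X ?f A)"
      by (intro hsum_insert) (auto simp: \<iota> \<pi>)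
    moreover have "?f a \<in> Arr C X X" "hsum X X ?f A \<in> Arr C X X" using insert by (auto simp: \<iota> \<pi>)
    moreover have "?f a \<notin> Units ?R" "hsum X X ?f A \<notin> Units ?R" using insert by simp_all
    ultimately show ?case using loc(4)[of "?f a" "hsum X X ?f A"] by (metis End_ring_simps(1,5))
  qed
  have "\<exists>i<length Ys. ?f i \<in> Units ?R"
  proof (rule ccontr)
    assume "\<not> (\<exists>i<length Ys. ?f i \<in> Units ?R)"
    then have "hsum X X ?f {..<length Ys} \<notin> Units ?R" by (intro none) auto
    then show False using sum R.Units_one_closed by simp
  qed
  then obtain i where i: "i < length Ys" "?f i \<in> Units ?R" by blast
  have "Cmp C X X X (?f i) (?f i) = Cmp C X (Ys ! i) X (\<iota> i) (Cmp C X (Ys ! i) (Ys ! i) (Cmp C (Ys ! i) X (Ys ! i) (\<pi> i) (\<iota> i)) (\<pi> i))"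
    using i(1) by (simp add: cmp_assoc \<iota> \<pi> cmp_in del: cmp_idl)
  then have "?f i \<otimes>\<^bsub>?R\<^esub> ?f i = ?f i \<otimes>\<^bsub>?R\<^esub> \<one>\<^bsub>?R\<^esub>"
    using i(1) by (simp add: diag \<iota> \<pi> cmp_in)
  then have "?f i = Idn C X"
    using R.Units_l_cancel[OF i(2), of "?f i" "\<one>\<^bsub>?R\<^esub>"] R.Units_closed[OF i(2)] by simp
  then have "isomorphic C X (Ys ! i)"
    using isoI[OF \<pi>[OF i(1)] \<iota>[OF i(1)]] diag[OF i(1)] by simp
  then show ?thesis using nth_mem[OF i(1)] by (rule bexI)
qed

end

subsection \<open>Graded rings with local degree-zero part\<close>

text \<open>Gaussian elimination: off-diagonal corrections \<open>x y\<close> with \<open>x \<in> A i\<close>, \<open>y \<in> A (-i)\<close> never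
  destroy the invertibility of a pivot.\<close>

lemma graded_elimination:
  fixes R (structure) and A :: "int \<Rightarrow> 'a set"
  assumes "ring R"
    and A: "\<And>i. A i \<subseteq> carrier R" "\<And>i. \<zero> \<in> A i" "\<And>i x y. x \<in> A i \<Longrightarrow> y \<in> A i \<Longrightarrow> x \<ominus> y \<in> A i"
      "\<And>i j x y. x \<in> A i \<Longrightarrow> y \<in> A j \<Longrightarrow> x \<otimes> y \<in> A (i + j)"
    and U: "\<And>u. u \<in> U \<Longrightarrow> u \<in> A 0 \<and> (\<exists>v\<in>A 0. v \<otimes> u = \<one> \<and> u \<otimes> v = \<one>)"
    and pivot: "\<And>u i x y. \<lbrakk>u \<in> U; i \<noteq> 0; x \<in> A i; y \<in> A (- i)\<rbrakk> \<Longrightarrow> u \<ominus> x \<otimes> y \<in> U"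
    and "finite S" and m: "\<And>i j. i \<in> S \<Longrightarrow> j \<in> S \<Longrightarrow> m i j \<in> A (j - i)" "\<And>i. i \<in> S \<Longrightarrow> m i i \<in> U"
    and r: "\<And>j. j \<in> S \<Longrightarrow> r j \<in> A j"
  shows "\<exists>y. (\<forall>i\<in>S. y i \<in> A i) \<and> (\<forall>j\<in>S. (\<Oplus>i\<in>S. y i \<otimes> m i j) = r j)"
  using assms(8-)
proof (induction S arbitrary: m r rule: finite_induct)
  case empty
  then show ?case by simp
next
  case (insert s S)
  interpret ring R by fact
  note AD = subsetD[OF A(1)]
  have ms: "m s s \<in> U" using insert.prems by simp
  obtain v where v: "v \<in> A 0" "v \<otimes> m s s = \<one>" "m s s \<otimes> v = \<one>" using U[OF ms] by blast
  have A0: "x \<otimes> v \<in> A i" "v \<otimes> x \<in> A i" if "x \<in> A i" for x i using A(4)[OF that v(1)] A(4)[OF v(1) that] by simp_all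
  have mA: "m i j \<in> A (j - i)" if "i \<in> insert s S" "j \<in> insert s S" for i j using insert.prems that by blast
  have rA: "r j \<in> A j" if "j \<in> insert s S" for j using insert.prems that by blast
  have vc [simp]: "v \<in> carrier R" using AD v(1) by blast
  have mc [simp]: "m i j \<in> carrier R" if "i \<in> insert s S" "j \<in> insert s S" for i j using AD mA that by blast
  have rc [simp]: "r j \<in> carrier R" if "j \<in> insert s S" for j using AD rA that by blast
  \<comment> \<open>The Schur complement of the pivot \<open>m s s\<close>. The unknown
    \<open>y\<close> is a row vector, so a multiple of row \<open>s\<close> is subtracted and column
    \<open>s\<close> is cleared.\<close>
  define m' where "m' i j = m i j \<ominus> m i s \<otimes> v \<otimes> m s j" for i j
  define r' where "r' j = r j \<ominus> r s \<otimes> v \<otimes> m s j" for j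
  have m': "m' i j \<in> A (j - i)" if "i \<in> S" "j \<in> S" for i j
    unfolding m'_def
  proof (rule A(3))
    show "m i s \<otimes> v \<otimes> m s j \<in> A (j - i)"
      using A(4)[OF A0(1)[OF mA[of i s]] mA[of s j]] that by simp
  qed (use that mA in auto)
  \<comment> \<open>The correction of a diagonal entry is a product of elements of degrees s - i and
    i - s, which are non-zero because \<open>s\<close> is not in \<open>S\<close>; this is the
    situation of the hypothesis \<open>pivot\<close>.\<close>
  have "m' i i \<in> U" if "i \<in> S" for i
    unfolding m'_def
  proof (rule pivot)
    show "m i s \<otimes> v \<in> A (s - i)" "m s i \<in> A (- (s - i))" using A0(1)[OF mA[of i s]] mA[of s i] that by simp_all
    show "s - i \<noteq> 0" using insert.hyps that by auto
  qed (use insert.prems that in auto)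
  moreover have "r' j \<in> A j" if "j \<in> S" for j
    unfolding r'_def
  proof (rule A(3))
    show "r s \<otimes> v \<otimes> m s j \<in> A j"
      using A(4)[OF A0(1)[OF rA[of s]] mA[of s j]] that by simp
  qed (use that rA in auto)
  ultimately obtain y where y: "\<forall>i\<in>S. y i \<in> A i" "\<forall>j\<in>S. (\<Oplus>i\<in>S. y i \<otimes> m' i j) = r' j"
    using insert.IH[of m' r'] m' by blast
  have yc [simp]: "y i \<in> carrier R" if "i \<in> S" for i using AD y that by blast
  let ?t = "\<lambda>j. \<Oplus>i\<in>S. y i \<otimes> m i j"
  \<comment> \<open>Back substitution: the equation of column \<open>s\<close> determines the
    remaining unknown.\<close>
  define ys where "ys = (r s \<ominus> ?t s) \<otimes> v"
  define z where "z = y(s := ys)"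
  have tA: "(\<Oplus>i\<in>T. y i \<otimes> m i s) \<in> A s" if "finite T" "T \<subseteq> S" for T
    using that
  proof (induction T rule: finite_induct)
    case (insert i T)
    have a: "y i \<otimes> m i s \<in> A s" using A(4)[OF _ mA[of i s], of "y i" i] y insert by auto
    \<comment> \<open>The components \<open>A i\<close> are only assumed closed under differences,
      so the sum is rewritten with two subtractions.\<close>
    have "(\<Oplus>i\<in>insert i T. y i \<otimes> m i s) = y i \<otimes> m i s \<ominus> (\<zero> \<ominus> (\<Oplus>i\<in>T. y i \<otimes> m i s))"
      using insert by (subst finsum_insert) (auto simp: minus_eq subset_iff intro!: finsum_closed)
    then show ?case using A(3)[OF a A(3)[OF A(2)]] insert by simp
  qed (use A(2) in simp)
  have tc: "?t j \<in> carrier R" if "j \<in> insert s S" for j using that by (intro finsum_closed) auto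
  have ysA: "ys \<in> A s" unfolding ys_def by (intro A0 A(3) rA tA) (use insert.hyps in auto)
  then have ysc [simp]: "ys \<in> carrier R" using AD by blast
  have sum: "(\<Oplus>i\<in>insert s S. z i \<otimes> m i j) = ys \<otimes> m s j \<oplus> ?t j" if "j \<in> insert s S" for j
  proof -
    have "(\<Oplus>i\<in>insert s S. z i \<otimes> m i j) = z s \<otimes> m s j \<oplus> (\<Oplus>i\<in>S. z i \<otimes> m i j)"
      using insert.hyps that by (intro finsum_insert) (auto simp: z_def)
    also have "(\<Oplus>i\<in>S. z i \<otimes> m i j) = ?t j"
      using insert.hyps that by (intro finsum_cong') (auto simp: z_def)
    finally show ?thesis by (simp add: z_def)
  qed
  have zeq: "(\<Oplus>i\<in>insert s S. z i \<otimes> m i j) = r j" if j: "j \<in> insert s S" for j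
  proof (cases "j = s")
    case True
    have "ys \<otimes> m s s = r s \<ominus> ?t s"
      unfolding ys_def using tc[of s] by (simp add: m_assoc v)
    then show ?thesis using tc[of s] sum[of s] True by (simp add: minus_eq a_assoc l_neg)
  next
    case False
    then have jS [simp]: "j \<in> S" using j by simp
    have "r' j = (\<Oplus>i\<in>S. y i \<otimes> m i j \<ominus> y i \<otimes> m i s \<otimes> (v \<otimes> m s j))"
      using y(2) jS unfolding m'_def
      by (subst y(2)[rule_format, OF jS, symmetric], unfold m'_def, intro finsum_cong')
        (auto simp: minus_eq r_distr r_minus m_assoc)
    also have "\<dots> = ?t j \<oplus> (\<Oplus>i\<in>S. \<ominus> (y i \<otimes> m i s \<otimes> (v \<otimes> m s j)))"
      unfolding minus_eq by (subst finsum_addf) (auto)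
    also have "(\<Oplus>i\<in>S. \<ominus> (y i \<otimes> m i s \<otimes> (v \<otimes> m s j))) = (\<Oplus>i\<in>S. y i \<otimes> m i s \<otimes> (\<ominus> (v \<otimes> m s j)))"
      by (rule finsum_cong') (auto simp: r_minus)
    also have "\<dots> = ?t s \<otimes> (\<ominus> (v \<otimes> m s j))"
      using insert.hyps by (subst finsum_ldistr) auto
    finally have "r' j = ?t j \<ominus> ?t s \<otimes> v \<otimes> m s j"
      using tc[of s] by (simp add: minus_eq r_minus m_assoc)
    then have rj: "r j \<ominus> r s \<otimes> v \<otimes> m s j = ?t j \<ominus> ?t s \<otimes> v \<otimes> m s j" by (simp add: r'_def)
    have swap: "x \<ominus> y \<oplus> w = x \<oplus> (w \<ominus> y)" if "x \<in> carrier R" "y \<in> carrier R" "w \<in> carrier R" for x y w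
      using that a_comm[of "\<ominus> y" w] by (simp add: minus_eq a_assoc)
    have "ys \<otimes> m s j = r s \<otimes> v \<otimes> m s j \<ominus> ?t s \<otimes> v \<otimes> m s j"
      unfolding ys_def using tc[of s] by (simp add: minus_eq l_distr l_minus)
    then have "ys \<otimes> m s j \<oplus> ?t j = r s \<otimes> v \<otimes> m s j \<oplus> (?t j \<ominus> ?t s \<otimes> v \<otimes> m s j)"
      using tc[of s] tc[of j] swap by simp
    also have "\<dots> = r s \<otimes> v \<otimes> m s j \<oplus> (r j \<ominus> r s \<otimes> v \<otimes> m s j)" by (simp add: rj)
    also have "\<dots> = r j" by (simp add: minus_eq a_lcomm r_neg)
    finally show ?thesis using sum[OF j] by simp
  qed
  have zA: "\<forall>i\<in>insert s S. z i \<in> A i" using y(1) ysA by (auto simp: z_def)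
  show ?case using zA zeq by (intro exI[of _ z] conjI ballI) blast+
qed

section \<open>Powers of an autoequivalence\<close>

lemma comp_fun_simps [simp]:
  "fob (comp_fun F G) X = fob F (fob G X)"
  "far (comp_fun F G) X Y f = far F (fob G X) (fob G Y) (far G X Y f)"
  "fob id_fun X = X" "far id_fun X Y f = f"
  by (simp_all add: comp_fun_def id_fun_def)

lemma endofunctor_id: "endofunctor C id_fun"
  by (simp add: endofunctor_def)

lemma endofunctor_comp: "\<lbrakk>endofunctor C F; endofunctor C G\<rbrakk> \<Longrightarrow> endofunctor C (comp_fun F G)"
  by (simp add: endofunctor_def)

lemma additive_endofunctor_id: "additive_endofunctor C id_fun"
  by (simp add: additive_endofunctor_def endofunctor_id)

lemma additive_endofunctor_comp:
  "\<lbrakk>additive_endofunctor C F; additive_endofunctor C G\<rbrakk> \<Longrightarrow> additive_endofunctor C (comp_fun F G)"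
  by (simp add: additive_endofunctor_def endofunctor_comp) (simp add: endofunctor_def)

lemma endofunctor_npow: "endofunctor C F \<Longrightarrow> endofunctor C (npow F n)"
  by (induction n) (simp_all add: endofunctor_id endofunctor_comp)

lemma additive_endofunctor_npow: "additive_endofunctor C F \<Longrightarrow> additive_endofunctor C (npow F n)"
  by (induction n) (simp_all add: additive_endofunctor_id additive_endofunctor_comp)

lemma zpow_0 [simp]: "zpow G H 0 = id_fun"
  by (simp add: zpow_def)

lemma zpow_up: "0 \<le> i \<Longrightarrow> zpow G H (i + 1) = comp_fun G (zpow G H i)"
  by (simp add: zpow_def nat_add_distrib)

text \<open>Exchanging the two functors reverses the exponent. With the analogous rules for
  \<open>step_up\<close> and \<open>split_pow\<close>, a statement proved for non-negative exponents
  gives the one for negative exponents after exchanging G with H and the unit with the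
  counit.\<close>

lemma zpow_swap: "zpow H G i = zpow G H (- i)"
  by (auto simp: zpow_def)

lemma zpow_down: "i \<le> 0 \<Longrightarrow> zpow G H (i - 1) = comp_fun H (zpow G H i)"
  using zpow_up[of "- i" H G] by (simp add: zpow_swap[of H G])

lemma endofunctor_zpow: "\<lbrakk>endofunctor C G; endofunctor C H\<rbrakk> \<Longrightarrow> endofunctor C (zpow G H i)"
  by (simp add: zpow_def endofunctor_npow)

lemma additive_endofunctor_zpow:
  "\<lbrakk>additive_endofunctor C G; additive_endofunctor C H\<rbrakk> \<Longrightarrow> additive_endofunctor C (zpow G H i)"
  by (simp add: zpow_def additive_endofunctor_npow)

lemma step_down_swap: "step_down C G H \<eta> m X = step_up C H G \<eta> (- m) X"
proof -
  have "zpow G H (m - 1) = zpow H G (- m + 1)" by (simp add: zpow_swap[of H G])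
  then show ?thesis by (simp add: step_up_def step_down_def)
qed

lemma step_up_swap: "step_up C H G \<eta> m X = step_down C G H \<eta> (- m) X"
  by (simp add: step_down_swap)

lemma split_down_swap: "split_down C G H \<eta> n i X = split_up C H G \<eta> n (- i) X"
proof (induction n)
  case 0
  then show ?case by (simp add: zpow_swap[of H G])
next
  case (Suc n)
  have "zpow H G (- i + int n) = zpow G H (i - int n)" "zpow H G (- i + int n + 1) = zpow G H (i - int n - 1)"
    "zpow H G (- i) = zpow G H i"
    by (simp_all add: zpow_swap[of H G] algebra_simps)
  then show ?case using Suc by (simp add: Let_def step_down_swap)
qed

lemma split_pow_swap: "split_pow C H G \<theta> \<eta> j i X = split_pow C G H \<eta> \<theta> (- j) (- i) X"
  using zpow_swap[of H G i] by (cases "j = 0") (auto simp: split_pow_def split_down_swap)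

text \<open>The second triangle identity is added to \<open>adjoint_quasi_inverse\<close> so that
  the locale is invariant under exchanging G with H and \<eta> with \<theta>. It is no restriction:
  \<open>adj_equivI\<close> derives it from the first one.\<close>

locale adj_equiv = preadditive C for C :: "('o, 'm) precat" +
  fixes G H :: "('o, 'm) endofun" and \<eta> \<theta> :: "'o \<Rightarrow> 'm"
  assumes aqi: "adjoint_quasi_inverse C G H \<eta> \<theta>"
    and tri': "\<And>X. X \<in> Ob C \<Longrightarrow> far H X (fob G (fob H X)) (\<theta> X) = \<eta> (fob H X)"
begin

lemma endoG: "endofunctor C G" and endoH: "endofunctor C H"
  using aqi by (simp_all add: adjoint_quasi_inverse_def)

lemma G_ob [simp]: "X \<in> Ob C \<Longrightarrow> fob G X \<in> Ob C"
  and G_in [simp]: "\<lbrakk>f \<in> Arr C X Y; X \<in> Ob C; Y \<in> Ob C\<rbrakk> \<Longrightarrow> far G X Y f \<in> Arr C (fob G X) (fob G Y)"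
  and G_idn [simp]: "X \<in> Ob C \<Longrightarrow> far G X X (Idn C X) = Idn C (fob G X)"
  and G_cmp: "\<lbrakk>f \<in> Arr C X Y; g \<in> Arr C Y Z; X \<in> Ob C; Y \<in> Ob C; Z \<in> Ob C\<rbrakk> \<Longrightarrow>
     far G X Z (Cmp C X Y Z g f) = Cmp C (fob G X) (fob G Y) (fob G Z) (far G Y Z g) (far G X Y f)"
  using endoG by (simp_all add: endofunctor_def)

lemma H_ob [simp]: "X \<in> Ob C \<Longrightarrow> fob H X \<in> Ob C"
  and H_in [simp]: "\<lbrakk>f \<in> Arr C X Y; X \<in> Ob C; Y \<in> Ob C\<rbrakk> \<Longrightarrow> far H X Y f \<in> Arr C (fob H X) (fob H Y)"
  and H_idn [simp]: "X \<in> Ob C \<Longrightarrow> far H X X (Idn C X) = Idn C (fob H X)"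
  using endoH by (simp_all add: endofunctor_def)

lemma theta_iso: "X \<in> Ob C \<Longrightarrow> isomorphism C X (fob G (fob H X)) (\<theta> X)"
  and eta_iso: "X \<in> Ob C \<Longrightarrow> isomorphism C X (fob H (fob G X)) (\<eta> X)"
  and theta_nat: "\<lbrakk>f \<in> Arr C X Y; X \<in> Ob C; Y \<in> Ob C\<rbrakk> \<Longrightarrow>
     Cmp C X Y (fob G (fob H Y)) (\<theta> Y) f =
     Cmp C X (fob G (fob H X)) (fob G (fob H Y)) (far G (fob H X) (fob H Y) (far H X Y f)) (\<theta> X)"
  and tri: "X \<in> Ob C \<Longrightarrow> far G X (fob H (fob G X)) (\<eta> X) = \<theta> (fob G X)"
  using aqi by (simp_all add: adjoint_quasi_inverse_def natural_iso_def)

lemma theta_in [simp]: "X \<in> Ob C \<Longrightarrow> \<theta> X \<in> Arr C X (fob G (fob H X))"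
  and eta_in [simp]: "X \<in> Ob C \<Longrightarrow> \<eta> X \<in> Arr C X (fob H (fob G X))"
  using theta_iso eta_iso by (simp_all add: isomorphism_def)

lemma swap: "adj_equiv C H G \<theta> \<eta>"
proof
  show "adjoint_quasi_inverse C H G \<theta> \<eta>"
    using aqi tri' by (simp add: adjoint_quasi_inverse_def)
qed (rule tri)

abbreviation P :: "int \<Rightarrow> 'o \<Rightarrow> 'o" where "P i \<equiv> fob (zpow G H i)"
abbreviation Pm :: "int \<Rightarrow> 'o \<Rightarrow> 'o \<Rightarrow> 'm \<Rightarrow> 'm" where "Pm i \<equiv> far (zpow G H i)"
abbreviation up :: "int \<Rightarrow> 'o \<Rightarrow> 'm" where "up \<equiv> step_up C G H \<theta>"
abbreviation dn :: "int \<Rightarrow> 'o \<Rightarrow> 'm" where "dn \<equiv> step_down C G H \<eta>"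
abbreviation S :: "int \<Rightarrow> int \<Rightarrow> 'o \<Rightarrow> 'm" where "S \<equiv> split_pow C G H \<eta> \<theta>"

lemma P_ob [simp]: "X \<in> Ob C \<Longrightarrow> P i X \<in> Ob C"
  and P_in [simp]: "\<lbrakk>f \<in> Arr C X Y; X \<in> Ob C; Y \<in> Ob C\<rbrakk> \<Longrightarrow> Pm i X Y f \<in> Arr C (P i X) (P i Y)"
  and P_idn [simp]: "X \<in> Ob C \<Longrightarrow> Pm i X X (Idn C X) = Idn C (P i X)"
  and P_cmp: "\<lbrakk>f \<in> Arr C X Y; g \<in> Arr C Y Z; X \<in> Ob C; Y \<in> Ob C; Z \<in> Ob C\<rbrakk> \<Longrightarrow>
     Pm i X Z (Cmp C X Y Z g f) = Cmp C (P i X) (P i Y) (P i Z) (Pm i Y Z g) (Pm i X Y f)"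
  using endofunctor_zpow[OF endoG endoH, of i] by (simp_all add: endofunctor_def)

lemma P_up: "0 \<le> i \<Longrightarrow> P (i + 1) X = fob G (P i X)"
  and Pm_up: "0 \<le> i \<Longrightarrow> Pm (i + 1) X Y f = far G (P i X) (P i Y) (Pm i X Y f)"
  by (simp_all add: zpow_up)

lemma P_dn: "i < 0 \<Longrightarrow> P i X = fob H (P (i + 1) X)"
  and Pm_dn: "i < 0 \<Longrightarrow> Pm i X Y f = far H (P (i + 1) X) (P (i + 1) Y) (Pm (i + 1) X Y f)"
  using zpow_down[of "i + 1" G H] by simp_all

lemma up_in [simp]: "X \<in> Ob C \<Longrightarrow> up m X \<in> Arr C (P (m + 1) X) (fob G (P m X))"
  by (cases "0 \<le> m") (simp_all add: step_up_def P_up P_dn)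

lemma up_nat:
  assumes "f \<in> Arr C X Y" "X \<in> Ob C" "Y \<in> Ob C"
  shows "Cmp C (P (m + 1) X) (P (m + 1) Y) (fob G (P m Y)) (up m Y) (Pm (m + 1) X Y f) =
     Cmp C (P (m + 1) X) (fob G (P m X)) (fob G (P m Y)) (far G (P m X) (P m Y) (Pm m X Y f)) (up m X)"
proof (cases "0 \<le> m")
  case True
  then show ?thesis using assms by (simp add: step_up_def P_up Pm_up)
next
  case False
  then show ?thesis using assms theta_nat[of "Pm (m + 1) X Y f" "P (m + 1) X" "P (m + 1) Y"]
    by (simp add: step_up_def P_dn[of m] Pm_dn[of m])
qed

text \<open>One of the two steps is always an identity. For m \<le> 0 the step up is \<theta>
  itself; for m > 0 the step down is \<eta>, and the triangle identity turns its image under G into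
  \<theta>.\<close>

lemma up_dn:
  assumes "X \<in> Ob C"
  shows "Cmp C (P m X) (fob G (P (m - 1) X)) (fob G (fob H (P m X))) (far G (P (m - 1) X) (fob H (P m X)) (dn m X)) (up (m - 1) X) = \<theta> (P m X)"
proof (cases "m \<le> 0")
  case True
  then have "P (m - 1) X = fob H (P m X)" by (simp add: zpow_down)
  with True show ?thesis using assms by (simp add: step_up_def step_down_def)
next
  case False
  then have "P m X = fob G (P (m - 1) X)" using P_up[of "m - 1" X] by simp
  with False show ?thesis using assms tri[of "P (m - 1) X"] by (simp add: step_up_def step_down_def)
qed

lemma S_0 [simp]: "S 0 i X = Idn C (P i X)"
  by (simp add: split_pow_def)

lemma S_up:
  assumes "0 \<le> j"
  shows "S (j + 1) i X = Cmp C (P (i + j + 1) X) (fob G (P (i + j) X)) (fob G (P j (P i X)))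
      (far G (P (i + j) X) (P j (P i X)) (S j i X)) (up (i + j) X)"
proof -
  have "npow G (nat j) = zpow G H j" using assms by (simp add: zpow_def)
  moreover have "nat (j + 1) = Suc (nat j)" using assms by simp
  ultimately show ?thesis using assms by (simp add: split_pow_def Let_def)
qed

lemma S_in_nonneg: "0 \<le> j \<Longrightarrow> X \<in> Ob C \<Longrightarrow> S j i X \<in> Arr C (P (i + j) X) (P j (P i X))"
proof (induction j rule: int_ge_induct)
  case (step j)
  then have "S (j + 1) i X \<in> Arr C (P (i + j + 1) X) (fob G (P j (P i X)))"
    using up_in[of X "i + j"] by (simp add: S_up cmp_in)
  then show ?case using step by (simp add: P_up add.assoc)
qed simp

lemmas swap_simps = zpow_swap[of H G] split_pow_swap[of C H G] step_up_swap[of C H G]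

lemma S_in [simp]: "X \<in> Ob C \<Longrightarrow> S j i X \<in> Arr C (P (i + j) X) (P j (P i X))"
  using S_in_nonneg[of j X i] adj_equiv.S_in_nonneg[OF swap, of "- j" X "- i"]
  by (cases "0 \<le> j") (simp_all add: swap_simps algebra_simps)

text \<open>The recursion \<open>S_up\<close> without a condition on the sign of j. For negative j
  the splitting is built from H; unfolding one of its steps, applying \<open>up_dn\<close> and
  moving \<theta> across by naturality gives the claim.\<close>

lemma up_S:
  assumes X [simp]: "X \<in> Ob C"
  shows "Cmp C (P (i + j + 1) X) (P (j + 1) (P i X)) (fob G (P j (P i X))) (up j (P i X)) (S (j + 1) i X) =
      Cmp C (P (i + j + 1) X) (fob G (P (i + j) X)) (fob G (P j (P i X))) (far G (P (i + j) X) (P j (P i X)) (S j i X)) (up (i + j) X)"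
proof (cases "0 \<le> j")
  case True
  then have "up j (P i X) = Idn C (fob G (P j (P i X)))" by (simp add: step_up_def P_up)
  moreover have "Cmp C (P (i + j + 1) X) (fob G (P (i + j) X)) (fob G (P j (P i X))) (far G (P (i + j) X) (P j (P i X)) (S j i X)) (up (i + j) X)
      \<in> Arr C (P (i + j + 1) X) (fob G (P j (P i X)))"
    by (rule cmp_in[OF up_in G_in]) simp_all
  ultimately show ?thesis using True by (simp add: S_up P_up)
next
  case False
  let ?A = "P (i + j + 1) X" and ?B = "P (j + 1) (P i X)" and ?s = "S (j + 1) i X"
  have s [simp]: "?s \<in> Arr C ?A ?B" using S_in[of X "j + 1" i] by (simp add: add.assoc)
  have d [simp]: "dn (i + j + 1) X \<in> Arr C (P (i + j) X) (fob H ?A)"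
    using adj_equiv.up_in[OF swap, of X "- (i + j + 1)"] by (simp add: swap_simps algebra_simps)
  have Pj: "P j Y = fob H (P (j + 1) Y)" for Y using False P_dn by simp
  have "S j i X = Cmp C (P (i + j) X) (fob H ?A) (fob H ?B) (far H ?A ?B ?s) (dn (i + j + 1) X)"
    using False adj_equiv.S_up[OF swap, of "- (j + 1)" "- i" X] by (simp add: swap_simps algebra_simps)
  then have "far G (P (i + j) X) (fob H ?B) (S j i X) = Cmp C (fob G (P (i + j) X)) (fob G (fob H ?A)) (fob G (fob H ?B))
       (far G (fob H ?A) (fob H ?B) (far H ?A ?B ?s)) (far G (P (i + j) X) (fob H ?A) (dn (i + j + 1) X))"
    by (simp add: G_cmp)
  then have "Cmp C ?A (fob G (P (i + j) X)) (fob G (fob H ?B)) (far G (P (i + j) X) (fob H ?B) (S j i X)) (up (i + j) X) =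
      Cmp C ?A (fob G (fob H ?A)) (fob G (fob H ?B)) (far G (fob H ?A) (fob H ?B) (far H ?A ?B ?s))
        (Cmp C ?A (fob G (P (i + j) X)) (fob G (fob H ?A)) (far G (P (i + j) X) (fob H ?A) (dn (i + j + 1) X)) (up (i + j) X))"
    using up_in[of X "i + j"] by (simp add: cmp_assoc)
  also have "\<dots> = Cmp C ?A (fob G (fob H ?A)) (fob G (fob H ?B)) (far G (fob H ?A) (fob H ?B) (far H ?A ?B ?s)) (\<theta> ?A)"
    using up_dn[of X "i + j + 1"] by simp
  also have "\<dots> = Cmp C ?A ?B (fob G (fob H ?B)) (\<theta> ?B) ?s"
    using theta_nat[OF s] by simp
  also have "\<theta> ?B = up j (P i X)" using False by (simp add: step_up_def)
  finally show ?thesis by (simp add: Pj)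
qed

text \<open>The coherence behind associativity in the orbit category: two ways of splitting the
  power i + j + l into three agree. Only l needs a sign, since in the induction step
  \<open>up_S\<close> treats j + l of either sign.\<close>

lemma S_cocycle_nonneg:
  assumes "0 \<le> l" and X [simp]: "X \<in> Ob C"
  shows "Cmp C (P (i + j + l) X) (P l (P (i + j) X)) (P l (P j (P i X))) (Pm l (P (i + j) X) (P j (P i X)) (S j i X)) (S l (i + j) X) =
     Cmp C (P (i + j + l) X) (P (j + l) (P i X)) (P l (P j (P i X))) (S l j (P i X)) (S (j + l) i X)"
  using assms(1)
proof (induction l rule: int_ge_induct)
  case base
  then show ?case by simp
next
  case (step l)
  let ?A = "P (i + j + l + 1) X" and ?A' = "P (i + j + l) X" and ?B = "P l (P (i + j) X)" and ?D = "P l (P j (P i X))"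
    and ?E = "P (j + l) (P i X)" and ?s = "S j i X" and ?E' = "P (j + l + 1) (P i X)"
  have [simp]: "S (j + l) i X \<in> Arr C ?A' ?E" "S (j + l + 1) i X \<in> Arr C ?A ?E'"
    using S_in[of X "j + l" i] S_in[of X "j + l + 1" i] by (simp_all add: add.assoc)
  have [simp]: "up (i + j + l) X \<in> Arr C ?A (fob G ?A')" "up (j + l) (P i X) \<in> Arr C ?E' (fob G ?E)"
    by (simp_all)
  have "Cmp C ?A (P (l + 1) (P (i + j) X)) (P (l + 1) (P j (P i X))) (Pm (l + 1) (P (i + j) X) (P j (P i X)) ?s) (S (l + 1) (i + j) X) =
     Cmp C ?A (fob G ?B) (fob G ?D) (far G ?B ?D (Pm l (P (i + j) X) (P j (P i X)) ?s))
        (Cmp C ?A (fob G ?A') (fob G ?B) (far G ?A' ?B (S l (i + j) X)) (up (i + j + l) X))"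
    using step by (simp add: S_up P_up Pm_up)
  also have "\<dots> = Cmp C ?A (fob G ?A') (fob G ?D) (far G ?A' ?D (Cmp C ?A' ?B ?D (Pm l (P (i + j) X) (P j (P i X)) ?s) (S l (i + j) X))) (up (i + j + l) X)"
    by (simp add: cmp_assoc G_cmp)
  also have "\<dots> = Cmp C ?A (fob G ?A') (fob G ?D) (far G ?A' ?D (Cmp C ?A' ?E ?D (S l j (P i X)) (S (j + l) i X))) (up (i + j + l) X)"
    by (simp only: step.IH)
  also have "\<dots> = Cmp C ?A (fob G ?E) (fob G ?D) (far G ?E ?D (S l j (P i X)))
      (Cmp C ?A (fob G ?A') (fob G ?E) (far G ?A' ?E (S (j + l) i X)) (up (i + j + l) X))"
    by (simp add: cmp_assoc G_cmp)
  also have "Cmp C ?A (fob G ?A') (fob G ?E) (far G ?A' ?E (S (j + l) i X)) (up (i + j + l) X) =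
      Cmp C ?A ?E' (fob G ?E) (up (j + l) (P i X)) (S (j + l + 1) i X)"
    using up_S[of X i "j + l"] by (simp add: add.assoc)
  also have "Cmp C ?A (fob G ?E) (fob G ?D) (far G ?E ?D (S l j (P i X))) (Cmp C ?A ?E' (fob G ?E) (up (j + l) (P i X)) (S (j + l + 1) i X)) =
     Cmp C ?A ?E' (fob G ?D) (Cmp C ?E' (fob G ?E) (fob G ?D) (far G ?E ?D (S l j (P i X))) (up (j + l) (P i X))) (S (j + l + 1) i X)"
    by (simp add: cmp_assoc)
  also have "Cmp C ?E' (fob G ?E) (fob G ?D) (far G ?E ?D (S l j (P i X))) (up (j + l) (P i X)) = S (l + 1) j (P i X)"
    using step by (simp add: S_up)
  finally show ?case using step by (simp add: P_up add.assoc)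
qed

lemma S_cocycle:
  assumes "X \<in> Ob C"
  shows "Cmp C (P (i + j + l) X) (P l (P (i + j) X)) (P l (P j (P i X))) (Pm l (P (i + j) X) (P j (P i X)) (S j i X)) (S l (i + j) X) =
     Cmp C (P (i + j + l) X) (P (j + l) (P i X)) (P l (P j (P i X))) (S l j (P i X)) (S (j + l) i X)"
proof (cases "0 \<le> l")
  case True
  then show ?thesis by (rule S_cocycle_nonneg[OF _ assms])
next
  case False
  then show ?thesis using adj_equiv.S_cocycle_nonneg[OF swap, of "- l" X "- i" "- j"] assms
    by (simp add: swap_simps algebra_simps)
qed

lemma S_nat_nonneg:
  assumes "0 \<le> j" and f [simp]: "f \<in> Arr C X Y" "X \<in> Ob C" "Y \<in> Ob C"
  shows "Cmp C (P (i + j) X) (P j (P i X)) (P j (P i Y)) (Pm j (P i X) (P i Y) (Pm i X Y f)) (S j i X) =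
     Cmp C (P (i + j) X) (P (i + j) Y) (P j (P i Y)) (S j i Y) (Pm (i + j) X Y f)"
  using assms(1)
proof (induction j rule: int_ge_induct)
  case base
  then show ?case by simp
next
  case (step j)
  let ?X = "P (i + j + 1) X" and ?Y = "P (i + j + 1) Y" and ?X' = "P (i + j) X" and ?Y' = "P (i + j) Y"
    and ?XX = "P j (P i X)" and ?YY = "P j (P i Y)" and ?f = "Pm (i + j) X Y f" and ?ff = "Pm j (P i X) (P i Y) (Pm i X Y f)"
  have "Cmp C ?X (P (j + 1) (P i X)) (P (j + 1) (P i Y)) (Pm (j + 1) (P i X) (P i Y) (Pm i X Y f)) (S (j + 1) i X) =
     Cmp C ?X (fob G ?XX) (fob G ?YY) (far G ?XX ?YY ?ff) (Cmp C ?X (fob G ?X') (fob G ?XX) (far G ?X' ?XX (S j i X)) (up (i + j) X))"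
    using step by (simp add: S_up P_up Pm_up)
  also have "\<dots> = Cmp C ?X (fob G ?X') (fob G ?YY) (far G ?X' ?YY (Cmp C ?X' ?XX ?YY ?ff (S j i X))) (up (i + j) X)"
    by (simp add: cmp_assoc G_cmp)
  also have "\<dots> = Cmp C ?X (fob G ?X') (fob G ?YY) (far G ?X' ?YY (Cmp C ?X' ?Y' ?YY (S j i Y) ?f)) (up (i + j) X)"
    by (simp only: step.IH)
  also have "\<dots> = Cmp C ?X (fob G ?Y') (fob G ?YY) (far G ?Y' ?YY (S j i Y)) (Cmp C ?X (fob G ?X') (fob G ?Y') (far G ?X' ?Y' ?f) (up (i + j) X))"
    by (simp add: cmp_assoc G_cmp)
  also have "Cmp C ?X (fob G ?X') (fob G ?Y') (far G ?X' ?Y' ?f) (up (i + j) X) = Cmp C ?X ?Y (fob G ?Y') (up (i + j) Y) (Pm (i + j + 1) X Y f)"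
    using up_nat[of f X Y "i + j"] by simp
  also have "Cmp C ?X (fob G ?Y') (fob G ?YY) (far G ?Y' ?YY (S j i Y)) (Cmp C ?X ?Y (fob G ?Y') (up (i + j) Y) (Pm (i + j + 1) X Y f)) =
      Cmp C ?X ?Y (fob G ?YY) (Cmp C ?Y (fob G ?Y') (fob G ?YY) (far G ?Y' ?YY (S j i Y)) (up (i + j) Y)) (Pm (i + j + 1) X Y f)"
    by (simp add: cmp_assoc)
  also have "Cmp C ?Y (fob G ?Y') (fob G ?YY) (far G ?Y' ?YY (S j i Y)) (up (i + j) Y) = S (j + 1) i Y"
    using step by (simp add: S_up)
  finally show ?case using step by (simp add: P_up add.assoc)
qed

lemma S_nat:
  assumes "f \<in> Arr C X Y" "X \<in> Ob C" "Y \<in> Ob C"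
  shows "Cmp C (P (i + j) X) (P j (P i X)) (P j (P i Y)) (Pm j (P i X) (P i Y) (Pm i X Y f)) (S j i X) =
     Cmp C (P (i + j) X) (P (i + j) Y) (P j (P i Y)) (S j i Y) (Pm (i + j) X Y f)"
proof (cases "0 \<le> j")
  case True
  then show ?thesis by (rule S_nat_nonneg[OF _ assms])
next
  case False
  then show ?thesis using adj_equiv.S_nat_nonneg[OF swap, of "- j" f X Y "- i"] assms
    by (simp add: swap_simps algebra_simps)
qed

lemma S_0_right_nonneg:
  assumes "0 \<le> j" and X [simp]: "X \<in> Ob C"
  shows "S j 0 X = Idn C (P j X)"
  using assms(1)
proof (induction j rule: int_ge_induct)
  case (step j)
  then show ?case using up_in[of X j] by (simp add: S_up P_up step_up_def)
qed simp

lemma S_0_right: "X \<in> Ob C \<Longrightarrow> S j 0 X = Idn C (P j X)"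
  using S_0_right_nonneg[of j X] adj_equiv.S_0_right_nonneg[OF swap, of "- j" X]
  by (cases "0 \<le> j") (simp_all add: swap_simps)

end

section \<open>Action of the powers on isomorphism classes, and the second triangle identity\<close>

context adj_equiv
begin

text \<open>An arrow is recovered from its image: naturality of \<eta> expresses it through H
  applied to that image, conjugated by the unit.\<close>

lemma G_faithful:
  assumes "far G X Y f = far G X Y g" "f \<in> Arr C X Y" "g \<in> Arr C X Y" and [simp]: "X \<in> Ob C" "Y \<in> Ob C"
  shows "f = g"
proof -
  interpret s: adj_equiv C H G \<theta> \<eta> by (rule swap)
  obtain e where e: "e \<in> Arr C (fob H (fob G Y)) Y" "Cmp C Y (fob H (fob G Y)) Y e (\<eta> Y) = Idn C Y"
    using eta_iso[of Y] by (auto simp: isomorphism_def)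
  have "h = Cmp C X (fob H (fob G Y)) Y e (Cmp C X (fob H (fob G X)) (fob H (fob G Y)) (far H (fob G X) (fob G Y) (far G X Y h)) (\<eta> X))"
    if h: "h \<in> Arr C X Y" for h
  proof -
    have "h = Cmp C X Y Y (Cmp C Y (fob H (fob G Y)) Y e (\<eta> Y)) h" using h e by simp
    also have "\<dots> = Cmp C X (fob H (fob G Y)) Y e (Cmp C X Y (fob H (fob G Y)) (\<eta> Y) h)"
      using h e(1) by (simp add: cmp_assoc)
    finally show ?thesis using s.theta_nat[OF h] by simp
  qed
  then show ?thesis using assms by metis
qed

lemma G_isomorphic:
  assumes "isomorphic C X Y" "X \<in> Ob C" "Y \<in> Ob C"
  shows "isomorphic C (fob G X) (fob G Y)"
  using assms(1)
proof (rule isoE)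
  fix f g assume "f \<in> Arr C X Y" "g \<in> Arr C Y X" "Cmp C X Y X g f = Idn C X" "Cmp C Y X Y f g = Idn C Y"
  with assms(2,3) show ?thesis
    by (intro isoI[of "far G X Y f" _ _ "far G Y X g"]) (simp_all flip: G_cmp)
qed

lemma P_isomorphic:
  assumes "isomorphic C X Y" "X \<in> Ob C" "Y \<in> Ob C"
  shows "isomorphic C (P i X) (P i Y)"
  using assms(1)
proof (rule isoE)
  fix f g assume "f \<in> Arr C X Y" "g \<in> Arr C Y X" "Cmp C X Y X g f = Idn C X" "Cmp C Y X Y f g = Idn C Y"
  with assms(2,3) show ?thesis
    by (intro isoI[of "Pm i X Y f" _ _ "Pm i Y X g"]) (simp_all flip: P_cmp)
qed

lemma up_isomorphic: "X \<in> Ob C \<Longrightarrow> isomorphic C (P (m + 1) X) (fob G (P m X))"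
proof (cases "0 \<le> m")
  case False
  assume "X \<in> Ob C"
  with False show ?thesis using theta_iso[of "P (m + 1) X"] by (auto simp: P_dn[of m] isomorphic_def)
qed (auto simp: P_up iso_refl)

lemma P_P_isomorphic_nonneg:
  assumes "0 \<le> j" and X [simp]: "X \<in> Ob C"
  shows "isomorphic C (P j (P i X)) (P (i + j) X)"
  using assms(1)
proof (induction j rule: int_ge_induct)
  case base
  then show ?case by (simp add: iso_refl)
next
  case (step j)
  have "isomorphic C (fob G (P j (P i X))) (fob G (P (i + j) X))"
    using step.IH by (rule G_isomorphic) simp_all
  then have "isomorphic C (fob G (P j (P i X))) (P (i + j + 1) X)"
    by (rule iso_trans[OF _ iso_sym[OF up_isomorphic]]) simp_all
  then show ?case using step.hyps by (simp add: P_up add.assoc)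
qed

lemma P_P_isomorphic: "X \<in> Ob C \<Longrightarrow> isomorphic C (P j (P i X)) (P (i + j) X)"
  using P_P_isomorphic_nonneg[of j X i] adj_equiv.P_P_isomorphic_nonneg[OF swap, of "- j" X "- i"]
  by (cases "0 \<le> j") (simp_all add: swap_simps algebra_simps)

end

text \<open>Naturality of \<theta> at the arrow \<theta> X, followed by cancelling \<theta> X, shows
  that G H (\<theta> X) is \<theta> at G H X, which by the given triangle identity is G (\<eta> (H
  X)). Naturality of \<eta> and cancellation of \<eta> then strip off G.\<close>

lemma (in preadditive) adj_equivI:
  assumes aqi: "adjoint_quasi_inverse C G H \<eta> \<theta>"
  shows "adj_equiv C G H \<eta> \<theta>"
proof
  have G: "endofunctor C G" and H: "endofunctor C H" using aqi by (simp_all add: adjoint_quasi_inverse_def)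
  have ob [simp]: "fob G X \<in> Ob C" "fob H X \<in> Ob C" if "X \<in> Ob C" for X
    using G H that by (simp_all add: endofunctor_def)
  have arr [simp]: "far G X Y f \<in> Arr C (fob G X) (fob G Y)" "far H X Y f \<in> Arr C (fob H X) (fob H Y)"
    if "f \<in> Arr C X Y" "X \<in> Ob C" "Y \<in> Ob C" for X Y f using G H that by (simp_all add: endofunctor_def)
  have th: "isomorphism C X (fob G (fob H X)) (\<theta> X)" "isomorphism C X (fob H (fob G X)) (\<eta> X)"
    "far G X (fob H (fob G X)) (\<eta> X) = \<theta> (fob G X)" if "X \<in> Ob C" for X
    using aqi that by (simp_all add: adjoint_quasi_inverse_def natural_iso_def)
  then have thi [simp]: "\<theta> X \<in> Arr C X (fob G (fob H X))" "\<eta> X \<in> Arr C X (fob H (fob G X))" if "X \<in> Ob C" for X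
    using that by (simp_all add: isomorphism_def)
  have thn: "Cmp C X Y (fob G (fob H Y)) (\<theta> Y) f = Cmp C X (fob G (fob H X)) (fob G (fob H Y)) (far G (fob H X) (fob H Y) (far H X Y f)) (\<theta> X)"
    "Cmp C X Y (fob H (fob G Y)) (\<eta> Y) f = Cmp C X (fob H (fob G X)) (fob H (fob G Y)) (far H (fob G X) (fob G Y) (far G X Y f)) (\<eta> X)"
    if "f \<in> Arr C X Y" "X \<in> Ob C" "Y \<in> Ob C" for X Y f
    using aqi that by (simp_all add: adjoint_quasi_inverse_def natural_iso_def)
  fix X assume X [simp]: "X \<in> Ob C"
  let ?Y = "fob G (fob H X)"
  have epi: "f = g" if eq: "Cmp C A B D f a = Cmp C A B D g a" and iso: "isomorphism C A B a" and fg: "f \<in> Arr C B D" "g \<in> Arr C B D"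
    and [simp]: "A \<in> Ob C" "B \<in> Ob C" "D \<in> Ob C" for A B D a f g
  proof -
    obtain b where b: "b \<in> Arr C B A" "Cmp C B A B a b = Idn C B" and a: "a \<in> Arr C A B"
      using iso by (auto simp: isomorphism_def)
    have "h = Cmp C B A D (Cmp C A B D h a) b" if "h \<in> Arr C B D" for h
      using that b a by (simp add: cmp_assoc)
    from this[OF fg(1)] this[OF fg(2)] show ?thesis using eq by simp
  qed
  have mono: "f = g" if eq: "Cmp C D A B a f = Cmp C D A B a g" and iso: "isomorphism C A B a" and fg: "f \<in> Arr C D A" "g \<in> Arr C D A"
    and [simp]: "A \<in> Ob C" "B \<in> Ob C" "D \<in> Ob C" for A B D a f g
  proof -
    obtain b where b: "b \<in> Arr C B A" "Cmp C A B A b a = Idn C A" and a: "a \<in> Arr C A B"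
      using iso by (auto simp: isomorphism_def)
    have "h = Cmp C D B A b (Cmp C D A B a h)" if "h \<in> Arr C D A" for h
    proof -
      have "h = Cmp C D A A (Cmp C A B A b a) h" using that b by simp
      then show ?thesis using that b(1) a by (simp add: cmp_assoc)
    qed
    from this[OF fg(1)] this[OF fg(2)] show ?thesis using eq by simp
  qed
  have "far G (fob H X) (fob H ?Y) (far H X ?Y (\<theta> X)) = \<theta> ?Y"
    by (rule epi[OF thn(1)[of "\<theta> X" X ?Y, symmetric] th(1)[OF X]]) simp_all
  also have "\<dots> = far G (fob H X) (fob H ?Y) (\<eta> (fob H X))" using th(3)[of "fob H X"] by simp
  finally have eq: "far G (fob H X) (fob H ?Y) (far H X ?Y (\<theta> X)) = far G (fob H X) (fob H ?Y) (\<eta> (fob H X))" .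
  have "Cmp C (fob H X) (fob H ?Y) (fob H (fob G (fob H ?Y))) (\<eta> (fob H ?Y)) (far H X ?Y (\<theta> X)) =
      Cmp C (fob H X) (fob H ?Y) (fob H (fob G (fob H ?Y))) (\<eta> (fob H ?Y)) (\<eta> (fob H X))"
    using thn(2)[of "far H X ?Y (\<theta> X)" "fob H X" "fob H ?Y"] thn(2)[of "\<eta> (fob H X)" "fob H X" "fob H ?Y"]
    unfolding eq by simp
  then show "far H X ?Y (\<theta> X) = \<eta> (fob H X)"
    by (rule mono[OF _ th(2)[of "fob H ?Y"]]) simp_all
qed (rule aqi)

locale adj_equiv_add = adj_equiv +
  assumes addG: "additive_endofunctor C G"
begin

lemma G_add: "\<lbrakk>f \<in> Arr C X Y; g \<in> Arr C X Y; X \<in> Ob C; Y \<in> Ob C\<rbrakk> \<Longrightarrow>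
   far G X Y (Add C X Y f g) = Add C (fob G X) (fob G Y) (far G X Y f) (far G X Y g)"
  using addG by (simp add: additive_endofunctor_def)

text \<open>By naturality \<theta> identifies G H with the identity functor, so G H is additive;
  since G is additive and faithful, H is additive too.\<close>

lemma addH: "additive_endofunctor C H"
  unfolding additive_endofunctor_def
proof (intro conjI ballI endoH)
  fix X Y f g assume [simp]: "X \<in> Ob C" "Y \<in> Ob C" "f \<in> Arr C X Y" "g \<in> Arr C X Y"
  let ?GX = "fob G (fob H X)" and ?GY = "fob G (fob H Y)" and ?Gm = "far G (fob H X) (fob H Y)"
  have "Cmp C X ?GX ?GY (?Gm (far H X Y (Add C X Y f g))) (\<theta> X) =
      Add C X ?GY (Cmp C X Y ?GY (\<theta> Y) f) (Cmp C X Y ?GY (\<theta> Y) g)"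
    by (simp add: cmp_addr flip: theta_nat)
  also have "\<dots> = Cmp C X ?GX ?GY (?Gm (Add C (fob H X) (fob H Y) (far H X Y f) (far H X Y g))) (\<theta> X)"
    by (simp add: theta_nat cmp_addl G_add)
  finally have eq: "Cmp C X ?GX ?GY (?Gm (far H X Y (Add C X Y f g))) (\<theta> X) =
    Cmp C X ?GX ?GY (?Gm (Add C (fob H X) (fob H Y) (far H X Y f) (far H X Y g))) (\<theta> X)" .
  obtain t where t: "t \<in> Arr C ?GX X" "Cmp C ?GX X ?GX (\<theta> X) t = Idn C ?GX"
    using theta_iso[of X] by (auto simp: isomorphism_def)
  have "h = Cmp C ?GX X ?GY (Cmp C X ?GX ?GY h (\<theta> X)) t" if "h \<in> Arr C ?GX ?GY" for h
    using that t by (simp add: cmp_assoc)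
  then have "?Gm (far H X Y (Add C X Y f g)) = ?Gm (Add C (fob H X) (fob H Y) (far H X Y f) (far H X Y g))"
    using eq by (metis G_in H_in H_ob add_in \<open>X \<in> Ob C\<close> \<open>Y \<in> Ob C\<close> \<open>f \<in> Arr C X Y\<close> \<open>g \<in> Arr C X Y\<close>)
  then show "far H X Y (Add C X Y f g) = Add C (fob H X) (fob H Y) (far H X Y f) (far H X Y g)"
    by (rule G_faithful) simp_all
qed

lemma P_add: "\<lbrakk>f \<in> Arr C X Y; g \<in> Arr C X Y; X \<in> Ob C; Y \<in> Ob C\<rbrakk> \<Longrightarrow>
   Pm i X Y (Add C X Y f g) = Add C (P i X) (P i Y) (Pm i X Y f) (Pm i X Y g)"
  using additive_endofunctor_zpow[OF addG addH, of i] by (simp add: additive_endofunctor_def)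

lemma addfun_P: "addfun C C (P i) (Pm i)"
  by unfold_locales (auto simp: additive_functor_def P_cmp P_add)

section \<open>The orbit category\<close>

text \<open>The composite of a homogeneous arrow of degree i with one of degree j, that is, a single
  summand of composition in the orbit category.\<close>

definition gcmp :: "'a \<Rightarrow> 'a \<Rightarrow> 'a \<Rightarrow> int \<Rightarrow> int \<Rightarrow> 'b \<Rightarrow> 'b \<Rightarrow> 'b" where
  "gcmp X Y Z j i g f = Cmp C (P (i + j) X) (P j Y) Z g
     (Cmp C (P (i + j) X) (P j (P i X)) (P j Y) (Pm j (P i X) Y f) (S j i X))"

lemma gcmp_in [simp]:
  "\<lbrakk>f \<in> Arr C (P i X) Y; g \<in> Arr C (P j Y) Z; X \<in> Ob C; Y \<in> Ob C; Z \<in> Ob C\<rbrakk> \<Longrightarrow>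
   gcmp X Y Z j i g f \<in> Arr C (P (i + j) X) Z"
  unfolding gcmp_def by (intro cmp_in[OF cmp_in[OF S_in P_in]]) simp_all

lemma gcmp_addr:
  "\<lbrakk>f \<in> Arr C (P i X) Y; f' \<in> Arr C (P i X) Y; g \<in> Arr C (P j Y) Z; X \<in> Ob C; Y \<in> Ob C; Z \<in> Ob C\<rbrakk> \<Longrightarrow>
   gcmp X Y Z j i g (Add C (P i X) Y f f') = Add C (P (i + j) X) Z (gcmp X Y Z j i g f) (gcmp X Y Z j i g f')"
  unfolding gcmp_def by (simp add: P_add cmp_addl cmp_addr cmp_in)

lemma gcmp_addl:
  "\<lbrakk>f \<in> Arr C (P i X) Y; g \<in> Arr C (P j Y) Z; g' \<in> Arr C (P j Y) Z; X \<in> Ob C; Y \<in> Ob C; Z \<in> Ob C\<rbrakk> \<Longrightarrow>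
   gcmp X Y Z j i (Add C (P j Y) Z g g') f = Add C (P (i + j) X) Z (gcmp X Y Z j i g f) (gcmp X Y Z j i g' f)"
  unfolding gcmp_def by (simp add: cmp_addl cmp_in)

lemma gcmp_zer [simp]:
  assumes "g \<in> Arr C (P j Y) Z" "X \<in> Ob C" "Y \<in> Ob C" "Z \<in> Ob C"
  shows "gcmp X Y Z j i g (Zer C (P i X) Y) = Zer C (P (i + j) X) Z"
  using gcmp_addr[of "Zer C (P i X) Y" i X Y "Zer C (P i X) Y" g j Z] assms
  by (intro add_self_zer) auto

lemma zer_gcmp [simp]:
  assumes "f \<in> Arr C (P i X) Y" "X \<in> Ob C" "Y \<in> Ob C" "Z \<in> Ob C"
  shows "gcmp X Y Z j i (Zer C (P j Y) Z) f = Zer C (P (i + j) X) Z"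
  using gcmp_addl[of f i X Y "Zer C (P j Y) Z" j Z "Zer C (P j Y) Z"] assms
  by (intro add_self_zer) auto

lemma gcmp_idn [simp]:
  assumes "g \<in> Arr C (P j X) Z" "X \<in> Ob C" "Z \<in> Ob C"
  shows "gcmp X X Z j 0 g (Idn C X) = g"
  using assms by (simp add: gcmp_def S_0_right)

lemma idn_gcmp [simp]:
  assumes "f \<in> Arr C (P i X) Y" "X \<in> Ob C" "Y \<in> Ob C"
  shows "gcmp X Y Y 0 i (Idn C Y) f = f"
  using assms by (simp add: gcmp_def)

text \<open>After expansion the two sides differ in how the power i + j + l is split, which
  \<open>S_cocycle\<close> repairs, and in the side of the splitting on which \<open>f\<close>
  stands, which \<open>S_nat\<close> repairs.\<close>

lemma gcmp_assoc:
  assumes f [simp]: "f \<in> Arr C (P i X) Y" and g [simp]: "g \<in> Arr C (P j Y) Z" and h [simp]: "h \<in> Arr C (P l Z) W"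
    and [simp]: "X \<in> Ob C" "Y \<in> Ob C" "Z \<in> Ob C" "W \<in> Ob C"
  shows "gcmp X Z W l (i + j) h (gcmp X Y Z j i g f) = gcmp X Y W (j + l) i (gcmp Y Z W l j h g) f"
proof -
  let ?A = "P (i + j + l) X" and ?B = "P l (P (i + j) X)" and ?D = "P l (P j (P i X))" and ?E = "P l (P j Y)"
    and ?F = "P l Z" and ?M = "P (j + l) (P i X)" and ?N = "P (j + l) Y"
  have [simp]: "S (j + l) i X \<in> Arr C ?A ?M" using S_in[of X "j + l" i] by (simp add: add.assoc)
  have "gcmp X Z W l (i + j) h (gcmp X Y Z j i g f) =
    Cmp C ?A ?F W h (Cmp C ?A ?E ?F (Pm l (P j Y) Z g) (Cmp C ?A ?D ?E (Pm l (P j (P i X)) (P j Y) (Pm j (P i X) Y f))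
      (Cmp C ?A ?B ?D (Pm l (P (i + j) X) (P j (P i X)) (S j i X)) (S l (i + j) X))))"
    unfolding gcmp_def by (simp add: P_cmp cmp_assoc cmp_in)
  also have "\<dots> = Cmp C ?A ?F W h (Cmp C ?A ?E ?F (Pm l (P j Y) Z g) (Cmp C ?A ?D ?E (Pm l (P j (P i X)) (P j Y) (Pm j (P i X) Y f))
      (Cmp C ?A ?M ?D (S l j (P i X)) (S (j + l) i X))))"
    by (simp only: S_cocycle \<open>X \<in> Ob C\<close>)
  also have "Cmp C ?A ?D ?E (Pm l (P j (P i X)) (P j Y) (Pm j (P i X) Y f)) (Cmp C ?A ?M ?D (S l j (P i X)) (S (j + l) i X)) =
     Cmp C ?A ?M ?E (Cmp C ?M ?D ?E (Pm l (P j (P i X)) (P j Y) (Pm j (P i X) Y f)) (S l j (P i X))) (S (j + l) i X)"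
    by (simp add: cmp_assoc)
  also have "\<dots> = Cmp C ?A ?M ?E (Cmp C ?M ?N ?E (S l j Y) (Pm (j + l) (P i X) Y f)) (S (j + l) i X)"
    by (simp add: S_nat)
  finally show ?thesis
    unfolding gcmp_def by (simp add: cmp_assoc cmp_in add.assoc)
qed

abbreviation orb :: "('a, int \<Rightarrow> 'b) precat" where "orb \<equiv> orbit_category C G H \<eta> \<theta>"

lemma orb_simps [simp]:
  "Ob orb = Ob C"
  "Idn orb X = (\<lambda>i. if i = 0 then Idn C X else Zer C (P i X) X)"
  "Add orb X Y f g = (\<lambda>i. Add C (P i X) Y (f i) (g i))"
  "Zer orb X Y = (\<lambda>i. Zer C (P i X) Y)"
  by (simp_all add: orbit_category_def)

lemma orb_arr: "f \<in> Arr orb X Y \<longleftrightarrow> (\<forall>i. f i \<in> Arr C (P i X) Y) \<and> finite {i. f i \<noteq> Zer C (P i X) Y}"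
  by (simp add: orbit_category_def)

lemma orb_arrD: "f \<in> Arr orb X Y \<Longrightarrow> f i \<in> Arr C (P i X) Y"
  by (simp add: orb_arr)

lemma orb_arrI: "\<lbrakk>\<And>i. f i \<in> Arr C (P i X) Y; finite F; \<And>i. i \<notin> F \<Longrightarrow> f i = Zer C (P i X) Y\<rbrakk> \<Longrightarrow> f \<in> Arr orb X Y"
  by (auto simp: orb_arr elim!: finite_subset[rotated])

text \<open>The definition sums over the exact support of \<open>g\<close>. Admitting any finite set
  that contains it lets sums with different supports be compared.\<close>

lemma orb_cmp:
  assumes "g \<in> Arr orb Y Z" "f \<in> Arr orb X Y" "finite F" "\<And>j. j \<notin> F \<Longrightarrow> g j = Zer C (P j Y) Z"
    and [simp]: "X \<in> Ob C" "Y \<in> Ob C" "Z \<in> Ob C"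
  shows "Cmp orb X Y Z g f n = hsum (P n X) Z (\<lambda>j. gcmp X Y Z j (n - j) (g j) (f (n - j))) F"
proof -
  note [simp] = orb_arrD[OF assms(1)] orb_arrD[OF assms(2)]
  have in': "gcmp X Y Z j (n - j) (g j) (f (n - j)) \<in> Arr C (P n X) Z" for j
    using gcmp_in[of "f (n - j)" "n - j" X Y "g j" j Z] by simp
  have "Cmp orb X Y Z g f n = hsum (P n X) Z (\<lambda>j. gcmp X Y Z j (n - j) (g j) (f (n - j))) {j. g j \<noteq> Zer C (P j Y) Z}"
    by (simp add: orbit_category_def gcmp_def Let_def)
  also have "\<dots> = hsum (P n X) Z (\<lambda>j. gcmp X Y Z j (n - j) (g j) (f (n - j))) F"
  proof (rule hsum_mono)
    fix j assume "j \<in> F - {j. g j \<noteq> Zer C (P j Y) Z}"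
    then show "gcmp X Y Z j (n - j) (g j) (f (n - j)) = Zer C (P n X) Z"
      using zer_gcmp[of "f (n - j)" "n - j" X Y Z j] assms(4) by simp
  qed (use assms(3,4) in' in auto)
  finally show ?thesis .
qed

lemma orb_supp:
  assumes "f \<in> Arr orb X Y"
  obtains F where "finite F" "\<And>i. i \<notin> F \<Longrightarrow> f i = Zer C (P i X) Y"
proof (rule that)
  show "finite {i. f i \<noteq> Zer C (P i X) Y}" using assms by (simp add: orb_arr)
qed simp

lemma gcmp_in_shift:
  assumes "f \<in> Arr orb X Y" "g \<in> Arr orb Y Z" "X \<in> Ob C" "Y \<in> Ob C" "Z \<in> Ob C"
  shows "gcmp X Y Z j (n - j) (g j) (f (n - j)) \<in> Arr C (P n X) Z"
  using gcmp_in[of "f (n - j)" "n - j" X Y "g j" j Z] orb_arrD[OF assms(1)] orb_arrD[OF assms(2)] assms(3-) by simp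

lemma orb_cmp_in:
  assumes f: "f \<in> Arr orb X Y" and g: "g \<in> Arr orb Y Z" and [simp]: "X \<in> Ob C" "Y \<in> Ob C" "Z \<in> Ob C"
  shows "Cmp orb X Y Z g f \<in> Arr orb X Z"
proof -
  note [simp] = orb_arrD[OF f] orb_arrD[OF g]
  obtain F where F: "finite F" "\<And>i. i \<notin> F \<Longrightarrow> f i = Zer C (P i X) Y" using f by (rule orb_supp) blast
  obtain E where E: "finite E" "\<And>i. i \<notin> E \<Longrightarrow> g i = Zer C (P i Y) Z" using g by (rule orb_supp) blast
  note eq = orb_cmp[OF g f E, simplified]
  show ?thesis
  proof (rule orb_arrI)
    show "Cmp orb X Y Z g f i \<in> Arr C (P i X) Z" for i
      unfolding eq using gcmp_in_shift[OF f g] by auto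
    show "finite ((\<lambda>(i, j). i + j) ` (F \<times> E))" using E F by blast
    fix n assume n: "n \<notin> (\<lambda>(i, j). i + j) ` (F \<times> E)"
    show "Cmp orb X Y Z g f n = Zer C (P n X) Z"
      unfolding eq
    proof (rule hsum_zer)
      fix j assume j: "j \<in> E"
      have "n - j \<notin> F"
      proof
        assume "n - j \<in> F"
        then have "(\<lambda>(i, j). i + j) (n - j, j) \<in> (\<lambda>(i, j). i + j) ` (F \<times> E)" using j by blast
        then show False using n by simp
      qed
      then show "gcmp X Y Z j (n - j) (g j) (f (n - j)) = Zer C (P n X) Z"
        using gcmp_zer[of "g j" j Y Z X "n - j"] F by simp
    qed simp_all
  qed
qed

lemma orb_assoc:
  assumes f: "f \<in> Arr orb W X" and g: "g \<in> Arr orb X Y" and h: "h \<in> Arr orb Y Z"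
    and [simp]: "W \<in> Ob C" "X \<in> Ob C" "Y \<in> Ob C" "Z \<in> Ob C"
  shows "Cmp orb W Y Z h (Cmp orb W X Y g f) = Cmp orb W X Z (Cmp orb X Y Z h g) f"
proof
  fix n
  note [simp] = orb_arrD[OF f] orb_arrD[OF g] orb_arrD[OF h]
  obtain E where E: "finite E" "\<And>i. i \<notin> E \<Longrightarrow> g i = Zer C (P i X) Y" using g by (rule orb_supp) blast
  obtain D where D: "finite D" "\<And>i. i \<notin> D \<Longrightarrow> h i = Zer C (P i Y) Z" using h by (rule orb_supp) blast
  \<comment> \<open>Contains all degrees in which the composite of \<open>h\<close> with
    \<open>g\<close> can be non-zero. Substituting m = l + j turns the double sum over
    \<open>D\<close> and \<open>E\<close> into one over \<open>D\<close> and \<open>M\<close>, where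
    the order of summation can be exchanged.\<close>
  define M where "M = (\<lambda>(l, j). l + j) ` (D \<times> E)"
  have finM: "finite M" using D E by (simp add: M_def)
  have gf: "Cmp orb W X Y g f \<in> Arr orb W Y" and hg: "Cmp orb X Y Z h g \<in> Arr orb X Z"
    using orb_cmp_in[OF f g] orb_cmp_in[OF g h] by simp_all
  let ?T = "\<lambda>l j. gcmp W Y Z l (n - l) (h l) (gcmp W X Y j (n - l - j) (g j) (f (n - l - j)))"
  let ?T' = "\<lambda>l m. gcmp W X Z m (n - m) (gcmp X Y Z l (m - l) (h l) (g (m - l))) (f (n - m))"
  have fg_in: "gcmp W X Y j (n - l - j) (g j) (f (n - l - j)) \<in> Arr C (P (n - l) W) Y" for l j
    using gcmp_in_shift[OF f g, of j "n - l"] by simp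
  have hg_in: "gcmp X Y Z l (m - l) (h l) (g (m - l)) \<in> Arr C (P m X) Z" for l m
    using gcmp_in_shift[OF g h, of l m] by simp
  have T_in: "?T l j \<in> Arr C (P n W) Z" for l j
    using gcmp_in[OF fg_in[of j l], of "h l" l Z] by simp
  have T'_in: "?T' l m \<in> Arr C (P n W) Z" for l m
    using gcmp_in[OF _ hg_in[of l m], of "f (n - m)" "n - m" W] by simp
  have TT': "?T l j = ?T' l (l + j)" for l j
    using gcmp_assoc[of "f (n - l - j)" "n - l - j" W X "g j" j Y "h l" l Z] by (simp add: algebra_simps)
  have "Cmp orb W Y Z h (Cmp orb W X Y g f) n = hsum (P n W) Z (\<lambda>l. gcmp W Y Z l (n - l) (h l) (Cmp orb W X Y g f (n - l))) D"
    by (rule orb_cmp[OF h gf D]) simp_all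
  also have "\<dots> = hsum (P n W) Z (\<lambda>l. hsum (P n W) Z (?T l) E) D"
  proof (rule hsum_cong)
    fix l
    have lin: "gcmp W Y Z l (n - l) (h l) (hsum (P (n - l) W) Y u A) = hsum (P n W) Z (\<lambda>j. gcmp W Y Z l (n - l) (h l) (u j)) A"
      if "finite A" and u: "\<And>j. u j \<in> Arr C (P (n - l) W) Y" for A and u :: "int \<Rightarrow> 'b"
      using that(1)
    proof (induction A rule: finite_induct)
      case empty
      then show ?case using gcmp_zer[of "h l" l Y Z W "n - l"] by simp
    next
      case (insert a A)
      have "gcmp W Y Z l (n - l) (h l) (u j) \<in> Arr C (P n W) Z" for j
        using gcmp_in[OF u[of j], of "h l" l Z] by simp
      then show ?case using insert u gcmp_addr[of "u a" "n - l" W Y "hsum (P (n - l) W) Y u A" "h l" l Z]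
        by (simp add: hsum_insert)
    qed
    show "gcmp W Y Z l (n - l) (h l) (Cmp orb W X Y g f (n - l)) = hsum (P n W) Z (?T l) E"
      using lin[OF E(1) fg_in[of _ l]] by (simp add: orb_cmp[OF g f E])
  qed (use T_in in auto)
  also have "\<dots> = hsum (P n W) Z (\<lambda>l. hsum (P n W) Z (?T' l) M) D"
  proof (rule hsum_cong)
    fix l assume l: "l \<in> D"
    have "hsum (P n W) Z (?T l) E = hsum (P n W) Z (\<lambda>j. ?T' l (l + j)) E"
      by (simp only: TT')
    also have "\<dots> = hsum (P n W) Z (?T' l) ((\<lambda>j. l + j) ` E)"
      by (rule hsum_reindex[symmetric], simp, rule T'_in, simp_all)
    also have "\<dots> = hsum (P n W) Z (?T' l) M"
    proof (rule hsum_mono[OF finM])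
      show "(\<lambda>j. l + j) ` E \<subseteq> M" using l by (force simp: M_def)
      fix m assume "m \<in> M - (\<lambda>j. l + j) ` E"
      then have "m - l \<notin> E" by (force simp: image_iff)
      then have "gcmp X Y Z l (m - l) (h l) (g (m - l)) = Zer C (P m X) Z"
        using E(2) gcmp_zer[of "h l" l Y Z X "m - l"] by simp
      then show "?T' l m = Zer C (P n W) Z"
        using zer_gcmp[of "f (n - m)" "n - m" W X Z m] by simp
    qed (use T'_in in auto)
    finally show "hsum (P n W) Z (?T l) E = hsum (P n W) Z (?T' l) M" .
  qed (use T'_in in auto)
  also have "\<dots> = hsum (P n W) Z (\<lambda>m. hsum (P n W) Z (\<lambda>l. ?T' l m) D) M"
    by (rule hsum_swap) (use D finM T'_in in auto)
  also have "\<dots> = hsum (P n W) Z (\<lambda>m. gcmp W X Z m (n - m) (Cmp orb X Y Z h g m) (f (n - m))) M"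
  proof (rule hsum_cong)
    fix m
    have lin: "gcmp W X Z m (n - m) (hsum (P m X) Z u A) (f (n - m)) = hsum (P n W) Z (\<lambda>l. gcmp W X Z m (n - m) (u l) (f (n - m))) A"
      if "finite A" and u: "\<And>j. u j \<in> Arr C (P m X) Z" for A and u :: "int \<Rightarrow> 'b"
      using that(1)
    proof (induction A rule: finite_induct)
      case empty
      then show ?case using zer_gcmp[of "f (n - m)" "n - m" W X Z m] by simp
    next
      case (insert a A)
      have "gcmp W X Z m (n - m) (u j) (f (n - m)) \<in> Arr C (P n W) Z" for j
        using gcmp_in[OF _ u[of j], of "f (n - m)" "n - m" W] by simp
      then show ?case using insert u gcmp_addl[of "f (n - m)" "n - m" W X "u a" m Z "hsum (P m X) Z u A"]
        by (simp add: hsum_insert)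
    qed
    show "hsum (P n W) Z (\<lambda>l. ?T' l m) D = gcmp W X Z m (n - m) (Cmp orb X Y Z h g m) (f (n - m))"
      using lin[OF D(1) hg_in[of _ m]] by (simp add: orb_cmp[OF h g D])
    show "gcmp W X Z m (n - m) (Cmp orb X Y Z h g m) (f (n - m)) \<in> Arr C (P n W) Z"
      by (rule gcmp_in_shift[OF f hg]) simp_all
  qed simp_all
  also have "\<dots> = Cmp orb W X Z (Cmp orb X Y Z h g) f n"
  proof (rule orb_cmp[OF hg f finM, symmetric])
    fix m assume "m \<notin> M"
    then have "gcmp X Y Z l (m - l) (h l) (g (m - l)) = Zer C (P m X) Z" if "l \<in> D" for l
    proof -
      have "m - l \<notin> E"
      proof
        assume "m - l \<in> E"
        then have "(\<lambda>(l, j). l + j) (l, m - l) \<in> M" using that unfolding M_def by blast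
        then show False using \<open>m \<notin> M\<close> by simp
      qed
      then show ?thesis using E(2) gcmp_zer[of "h l" l Y Z X "m - l"] by simp
    qed
    then show "Cmp orb X Y Z h g m = Zer C (P m X) Z"
      unfolding orb_cmp[OF h g D, simplified] by (intro hsum_zer) simp_all
  qed simp_all
  finally show "Cmp orb W Y Z h (Cmp orb W X Y g f) n = Cmp orb W X Z (Cmp orb X Y Z h g) f n" .
qed

definition homg :: "int \<Rightarrow> 'a \<Rightarrow> 'a \<Rightarrow> 'b \<Rightarrow> int \<Rightarrow> 'b" where
  "homg d X Y f = (\<lambda>i. if i = d then f else Zer C (P i X) Y)"

lemma homg_in [simp]: "\<lbrakk>f \<in> Arr C (P d X) Y; X \<in> Ob C; Y \<in> Ob C\<rbrakk> \<Longrightarrow> homg d X Y f \<in> Arr orb X Y"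
  by (rule orb_arrI[where F = "{d}"]) (auto simp: homg_def)

lemma homg_same [simp]: "homg d X Y f d = f"
  by (simp add: homg_def)

lemma homg_cmp_apply:
  assumes g: "g \<in> Arr C (P j Y) Z" and f: "f \<in> Arr orb X Y" and [simp]: "X \<in> Ob C" "Y \<in> Ob C" "Z \<in> Ob C"
  shows "Cmp orb X Y Z (homg j Y Z g) f n = gcmp X Y Z j (n - j) g (f (n - j))"
  using gcmp_in[of "f (n - j)" "n - j" X Y g j Z] g orb_arrD[OF f]
  by (subst orb_cmp[OF homg_in[OF g] f, where F = "{j}"]) (simp_all, simp add: homg_def)

lemma homg_cmp:
  assumes g: "g \<in> Arr C (P j Y) Z" and f: "f \<in> Arr C (P i X) Y" and [simp]: "X \<in> Ob C" "Y \<in> Ob C" "Z \<in> Ob C"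
  shows "Cmp orb X Y Z (homg j Y Z g) (homg i X Y f) = homg (i + j) X Z (gcmp X Y Z j i g f)"
proof
  fix n
  show "Cmp orb X Y Z (homg j Y Z g) (homg i X Y f) n = homg (i + j) X Z (gcmp X Y Z j i g f) n"
  proof (cases "n = i + j")
    case True
    then show ?thesis using assms by (subst homg_cmp_apply) simp_all
  next
    case False
    then have "homg i X Y f (n - j) = Zer C (P (n - j) X) Y" by (auto simp: homg_def)
    then show ?thesis using assms False gcmp_zer[of g j Y Z X "n - j"]
      by (subst homg_cmp_apply) (simp_all, simp add: homg_def)
  qed
qed

lemma preadditive_orb: "preadditive_category orb"
proof -
  have "category orb"
    unfolding category_def
  proof (intro conjI ballI)
    fix X assume "X \<in> Ob orb"
    then have [simp]: "X \<in> Ob C" by simp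
    have idn: "Idn orb X = homg 0 X X (Idn C X)" by (simp add: homg_def)
    have idn_in': "homg 0 X X (Idn C X) \<in> Arr orb X X" by simp
    then show "Idn orb X \<in> Arr orb X X" unfolding idn .
    fix Y f assume "Y \<in> Ob orb" and f: "f \<in> Arr orb X Y"
    then have [simp]: "Y \<in> Ob C" by simp
    note [simp] = orb_arrD[OF f]
    have idn_in'': "homg 0 Y Y (Idn C Y) \<in> Arr orb Y Y" by simp
    obtain F where F: "finite F" "\<And>i. i \<notin> F \<Longrightarrow> f i = Zer C (P i X) Y" using f by (rule orb_supp) blast
    show "Cmp orb X X Y f (Idn orb X) = f"
    proof
      fix n
      let ?g = "\<lambda>j. gcmp X X Y j (n - j) (f j) (homg 0 X X (Idn C X) (n - j))"
      \<comment> \<open>The index n is inserted because only the term j = n, where the identity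
        contributes its degree 0, survives.\<close>
      have "Cmp orb X X Y f (Idn orb X) n = hsum (P n X) Y ?g (insert n F)"
        unfolding idn by (rule orb_cmp[OF f idn_in']) (use F in auto)
      also have "\<dots> = ?g n"
      proof (rule hsum_single)
        fix j assume "j \<noteq> n"
        then show "?g j = Zer C (P n X) Y" using gcmp_zer[of "f j" j X Y X "n - j"] by (simp add: homg_def)
      qed (use F in auto)
      also have "\<dots> = f n" by simp
      finally show "Cmp orb X X Y f (Idn orb X) n = f n" .
    qed
    have "Idn orb Y = homg 0 Y Y (Idn C Y)" by (simp add: homg_def)
    then show "Cmp orb X Y Y (Idn orb Y) f = f"
      using f homg_cmp_apply[of "Idn C Y" 0 Y Y f X] by (auto simp: fun_eq_iff)
  next
    fix X Y Z f g assume "X \<in> Ob orb" "Y \<in> Ob orb" "Z \<in> Ob orb" "f \<in> Arr orb X Y" "g \<in> Arr orb Y Z"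
    then show "Cmp orb X Y Z g f \<in> Arr orb X Z" using orb_cmp_in by simp
  next
    fix W X Y Z f g h assume "W \<in> Ob orb" "X \<in> Ob orb" "Y \<in> Ob orb" "Z \<in> Ob orb" "f \<in> Arr orb W X" "g \<in> Arr orb X Y" "h \<in> Arr orb Y Z"
    then show "Cmp orb W Y Z h (Cmp orb W X Y g f) = Cmp orb W X Z (Cmp orb X Y Z h g) f"
      using orb_assoc by simp
  qed
  moreover have "comm_group (hom_group orb X Y)" if [simp]: "X \<in> Ob C" "Y \<in> Ob C" for X Y
  proof (rule comm_groupI)
    show "\<one>\<^bsub>hom_group orb X Y\<^esub> \<in> carrier (hom_group orb X Y)" by (auto intro: orb_arrI[of _ _ _ "{}"])
    {
      fix f g assume fg: "f \<in> carrier (hom_group orb X Y)" "g \<in> carrier (hom_group orb X Y)"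
      then have fg': "f \<in> Arr orb X Y" "g \<in> Arr orb X Y" by simp_all
      note [simp] = orb_arrD[OF fg'(1)] orb_arrD[OF fg'(2)]
      obtain F where F: "finite F" "\<And>i. i \<notin> F \<Longrightarrow> f i = Zer C (P i X) Y" using fg'(1) by (rule orb_supp) blast
      obtain E where E: "finite E" "\<And>i. i \<notin> E \<Longrightarrow> g i = Zer C (P i X) Y" using fg'(2) by (rule orb_supp) blast
      have "Add orb X Y f g \<in> Arr orb X Y"
        using F E by (intro orb_arrI[where F = "F \<union> E"]) auto
      then show "f \<otimes>\<^bsub>hom_group orb X Y\<^esub> g \<in> carrier (hom_group orb X Y)" by simp
      show "f \<otimes>\<^bsub>hom_group orb X Y\<^esub> g = g \<otimes>\<^bsub>hom_group orb X Y\<^esub> f"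
        by (auto simp: fun_eq_iff intro!: add_comm)
      fix h assume "h \<in> carrier (hom_group orb X Y)"
      then have "h i \<in> Arr C (P i X) Y" for i using orb_arrD[of h X Y i] by simp
      then show "f \<otimes>\<^bsub>hom_group orb X Y\<^esub> g \<otimes>\<^bsub>hom_group orb X Y\<^esub> h = f \<otimes>\<^bsub>hom_group orb X Y\<^esub> (g \<otimes>\<^bsub>hom_group orb X Y\<^esub> h)"
        by (auto simp: fun_eq_iff intro!: add_assoc)
    }
    fix f assume f: "f \<in> carrier (hom_group orb X Y)"
    then have f': "f \<in> Arr orb X Y" by simp
    note [simp] = orb_arrD[OF f']
    show "\<one>\<^bsub>hom_group orb X Y\<^esub> \<otimes>\<^bsub>hom_group orb X Y\<^esub> f = f" by (auto simp: fun_eq_iff)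
    obtain F where F: "finite F" "\<And>i. i \<notin> F \<Longrightarrow> f i = Zer C (P i X) Y" using f' by (rule orb_supp) blast
    have "\<exists>g. \<forall>i. g i \<in> Arr C (P i X) Y \<and> Add C (P i X) Y (g i) (f i) = Zer C (P i X) Y"
    proof (intro choice allI)
      fix i
      show "\<exists>g. g \<in> Arr C (P i X) Y \<and> Add C (P i X) Y g (f i) = Zer C (P i X) Y"
        using neg_ex[of "f i" "P i X" Y] by auto
    qed
    then obtain g where g: "\<And>i. g i \<in> Arr C (P i X) Y" "\<And>i. Add C (P i X) Y (g i) (f i) = Zer C (P i X) Y" by blast
    have "g \<in> Arr orb X Y"
    proof (rule orb_arrI[OF g(1) F(1)])
      fix i assume "i \<notin> F"
      then show "g i = Zer C (P i X) Y" using g(1)[of i] g(2)[of i] F(2)[of i] by simp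
    qed
    then show "\<exists>g\<in>carrier (hom_group orb X Y). g \<otimes>\<^bsub>hom_group orb X Y\<^esub> f = \<one>\<^bsub>hom_group orb X Y\<^esub>"
      using g by (auto intro!: bexI[of _ g])
  qed
  moreover have "Cmp orb X Y Z g (Add orb X Y f f') = Add orb X Z (Cmp orb X Y Z g f) (Cmp orb X Y Z g f') \<and>
     Cmp orb X Y Z (Add orb Y Z g g') f = Add orb X Z (Cmp orb X Y Z g f) (Cmp orb X Y Z g' f)"
    if "X \<in> Ob C" "Y \<in> Ob C" "Z \<in> Ob C" and f: "f \<in> Arr orb X Y" "f' \<in> Arr orb X Y" and g: "g \<in> Arr orb Y Z" "g' \<in> Arr orb Y Z"
    for X Y Z f f' g g'
  proof
    note [simp] = that(1-3)
    note [simp] = orb_arrD[OF f(1)] orb_arrD[OF f(2)] orb_arrD[OF g(1)] orb_arrD[OF g(2)]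
    obtain E where E: "finite E" "\<And>i. i \<notin> E \<Longrightarrow> g i = Zer C (P i Y) Z" using g(1) by (rule orb_supp) blast
    obtain E' where E': "finite E'" "\<And>i. i \<notin> E' \<Longrightarrow> g' i = Zer C (P i Y) Z" using g(2) by (rule orb_supp) blast
    obtain F where F: "finite F" "\<And>i. i \<notin> F \<Longrightarrow> f i = Zer C (P i X) Y" using f(1) by (rule orb_supp) blast
    obtain F' where F': "finite F'" "\<And>i. i \<notin> F' \<Longrightarrow> f' i = Zer C (P i X) Y" using f(2) by (rule orb_supp) blast
    have ff: "Add orb X Y f f' \<in> Arr orb X Y"
      using F F' by (intro orb_arrI[where F = "F \<union> F'"]) auto
    have gg: "Add orb Y Z g g' \<in> Arr orb Y Z"
      using E E' by (intro orb_arrI[where F = "E \<union> E'"]) auto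
    let ?E = "E \<union> E'"
    have fin: "finite ?E" using E E' by simp
    have gE: "\<And>i. i \<notin> ?E \<Longrightarrow> g i = Zer C (P i Y) Z" "\<And>i. i \<notin> ?E \<Longrightarrow> g' i = Zer C (P i Y) Z" "\<And>i. i \<notin> ?E \<Longrightarrow> Add orb Y Z g g' i = Zer C (P i Y) Z"
      using E E' by simp_all
    show "Cmp orb X Y Z g (Add orb X Y f f') = Add orb X Z (Cmp orb X Y Z g f) (Cmp orb X Y Z g f')"
    proof
      fix n
      have "gcmp X Y Z j (n - j) (g j) (Add orb X Y f f' (n - j)) =
          Add C (P n X) Z (gcmp X Y Z j (n - j) (g j) (f (n - j))) (gcmp X Y Z j (n - j) (g j) (f' (n - j)))" for j
        using gcmp_addr[of "f (n - j)" "n - j" X Y "f' (n - j)" "g j" j Z] by simp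
      then have "Cmp orb X Y Z g (Add orb X Y f f') n = hsum (P n X) Z (\<lambda>j. Add C (P n X) Z
          (gcmp X Y Z j (n - j) (g j) (f (n - j))) (gcmp X Y Z j (n - j) (g j) (f' (n - j)))) ?E"
        using orb_cmp[OF g(1) ff fin gE(1), of n] by (simp only: that(1-3) orb_simps(1) simp_thms)
      also have "\<dots> = Add C (P n X) Z (hsum (P n X) Z (\<lambda>j. gcmp X Y Z j (n - j) (g j) (f (n - j))) ?E)
          (hsum (P n X) Z (\<lambda>j. gcmp X Y Z j (n - j) (g j) (f' (n - j))) ?E)"
        using gcmp_in_shift[OF f(1) g(1)] gcmp_in_shift[OF f(2) g(1)] by (intro hsum_add) simp_all
      also have "hsum (P n X) Z (\<lambda>j. gcmp X Y Z j (n - j) (g j) (f (n - j))) ?E = Cmp orb X Y Z g f n"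
        by (rule orb_cmp[OF g(1) f(1) fin gE(1), symmetric]) simp_all
      also have "hsum (P n X) Z (\<lambda>j. gcmp X Y Z j (n - j) (g j) (f' (n - j))) ?E = Cmp orb X Y Z g f' n"
        by (rule orb_cmp[OF g(1) f(2) fin gE(1), symmetric]) simp_all
      finally show "Cmp orb X Y Z g (Add orb X Y f f') n = Add orb X Z (Cmp orb X Y Z g f) (Cmp orb X Y Z g f') n"
        by (simp only: orb_simps)
    qed
    show "Cmp orb X Y Z (Add orb Y Z g g') f = Add orb X Z (Cmp orb X Y Z g f) (Cmp orb X Y Z g' f)"
    proof
      fix n
      have "gcmp X Y Z j (n - j) (Add orb Y Z g g' j) (f (n - j)) =
          Add C (P n X) Z (gcmp X Y Z j (n - j) (g j) (f (n - j))) (gcmp X Y Z j (n - j) (g' j) (f (n - j)))" for j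
        using gcmp_addl[of "f (n - j)" "n - j" X Y "g j" j Z "g' j"] by simp
      then have "Cmp orb X Y Z (Add orb Y Z g g') f n = hsum (P n X) Z (\<lambda>j. Add C (P n X) Z
          (gcmp X Y Z j (n - j) (g j) (f (n - j))) (gcmp X Y Z j (n - j) (g' j) (f (n - j)))) ?E"
        using orb_cmp[OF gg f(1) fin gE(3), of n] by (simp only: that(1-3) orb_simps(1) simp_thms)
      also have "\<dots> = Add C (P n X) Z (hsum (P n X) Z (\<lambda>j. gcmp X Y Z j (n - j) (g j) (f (n - j))) ?E)
          (hsum (P n X) Z (\<lambda>j. gcmp X Y Z j (n - j) (g' j) (f (n - j))) ?E)"
        using gcmp_in_shift[OF f(1) g(1)] gcmp_in_shift[OF f(1) g(2)] by (intro hsum_add) simp_all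
      also have "hsum (P n X) Z (\<lambda>j. gcmp X Y Z j (n - j) (g j) (f (n - j))) ?E = Cmp orb X Y Z g f n"
        by (rule orb_cmp[OF g(1) f(1) fin gE(1), symmetric]) simp_all
      also have "hsum (P n X) Z (\<lambda>j. gcmp X Y Z j (n - j) (g' j) (f (n - j))) ?E = Cmp orb X Y Z g' f n"
        by (rule orb_cmp[OF g(2) f(1) fin gE(2), symmetric]) simp_all
      finally show "Cmp orb X Y Z (Add orb Y Z g g') f n = Add orb X Z (Cmp orb X Y Z g f) (Cmp orb X Y Z g' f) n"
        by (simp only: orb_simps)
    qed
  qed
  ultimately show ?thesis unfolding preadditive_category_def orb_simps(1) by blast
qed

sublocale orb: preadditive orb
  by unfold_locales (rule preadditive_orb)

lemma homg_add:
  "X \<in> Ob C \<Longrightarrow> Y \<in> Ob C \<Longrightarrow> Add orb X Y (homg d X Y f) (homg d X Y g) = homg d X Y (Add C (P d X) Y f g)"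
  by (auto simp: homg_def fun_eq_iff)

lemma homg_zer: "homg d X Y (Zer C (P d X) Y) = Zer orb X Y"
  by (auto simp: homg_def fun_eq_iff)

text \<open>The natural functor from D to D/G: the identity on objects, placing an arrow in degree
  0.\<close>

lemma addfun_orb: "addfun C orb (\<lambda>X. X) (homg 0)"
proof unfold_locales
  have "gcmp X Y Z 0 0 g f = Cmp C X Y Z g f" if "X \<in> Ob C" "Y \<in> Ob C" "f \<in> Arr C X Y" for X Y Z f g
    using that by (simp add: gcmp_def)
  then show "additive_functor C orb (\<lambda>X. X) (homg 0)"
    using homg_in[of _ 0] homg_cmp[of _ 0 _ _ _ 0] homg_add[of _ _ 0]
    by (auto simp: additive_functor_def simp del: orb_simps(3)) (auto simp: homg_def fun_eq_iff)
qed

end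

section \<open>Endomorphism rings in the orbit category\<close>

context adj_equiv_add
begin

lemma orb_hsum_apply:
  assumes "finite A" "\<And>i. i \<in> A \<Longrightarrow> f i \<in> Arr orb X Y" and [simp]: "X \<in> Ob C" "Y \<in> Ob C"
  shows "orb.hsum X Y f A n = hsum (P n X) Y (\<lambda>i. f i n) A"
  using assms(1,2)
proof (induction A rule: finite_induct)
  case empty
  have "orb.hsum X Y f {} = Zer orb X Y" by (rule orb.hsum_empty) simp_all
  then show ?case by simp
next
  case (insert a A)
  have "orb.hsum X Y f (insert a A) = Add orb X Y (f a) (orb.hsum X Y f A)"
    using insert by (intro orb.hsum_insert) auto
  moreover have "f i n \<in> Arr C (P n X) Y" if "i \<in> insert a A" for i
    using orb_arrD[OF insert.prems[OF that]] .
  ultimately show ?case using insert by (simp add: hsum_insert)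
qed

text \<open>\<open>fin\<close> makes the linear system for an inverse finite, and
  \<open>noret\<close> keeps its pivots invertible during elimination.\<close>

context
  fixes X
  assumes X [simp]: "X \<in> Ob C" and loc: "local_ring (End_ring C X)"
    and fin: "finite {i. Arr C (P i X) X \<noteq> {Zer C (P i X) X}}"
    and noret: "\<And>i f r. \<lbrakk>i \<noteq> 0; f \<in> Arr C (P i X) X; r \<in> Arr C X (P i X)\<rbrakk> \<Longrightarrow> Cmp C X (P i X) X f r \<notin> Units (End_ring C X)"
begin

text \<open>The unknown components c i must satisfy: the sum over i of c i composed with b (j - i)
  is the component of the identity in degree j. The diagonal of this system is b 0 throughout, so
  \<open>graded_elimination\<close> solves it. Equations outside \<open>T\<close> hold because both
  sides lie in a hom-group with one element.\<close>

lemma orb_left_inverse: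
  assumes b: "b \<in> Arr orb X X" and b0: "b 0 \<in> Units (End_ring C X)"
  shows "\<exists>c\<in>Arr orb X X. c 0 \<in> Units (End_ring C X) \<and> Cmp orb X X X c b = Idn orb X"
proof -
  interpret R: ring "End_ring orb X" by (rule orb.ring_End) simp
  let ?R = "End_ring orb X" and ?E = "End_ring C X"
  note [simp] = orb_arrD[OF b]
  note locD = local_ringD[OF loc]
  interpret E: ring ?E by (rule locD(1))
  have Ecar: "u \<in> Arr C X X" if "u \<in> Units ?E" for u using that E.Units_closed by fastforce
  define A where "A i = homg i X X ` Arr C (P i X) X" for i
  define U where "U = homg 0 X X ` Units ?E"
  \<comment> \<open>The degrees that can carry a non-zero endomorphism; 0 is inserted so that the
    equation for the identity component belongs to the system.\<close>
  define T where "T = insert 0 {i. Arr C (P i X) X \<noteq> {Zer C (P i X) X}}"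
  define r where "r j = (if j = 0 then Idn orb X else Zer orb X X)" for j :: int
  have finT: "finite T" using fin by (simp add: T_def)
  have out: "f = Zer C (P i X) X" if "i \<notin> T" "f \<in> Arr C (P i X) X" for i f using that by (auto simp: T_def)
  have idn: "Idn orb X = homg 0 X X (Idn C X)" by (simp add: homg_def)
  have hin: "homg i X X f \<in> carrier ?R" if "f \<in> Arr C (P i X) X" for i f using that homg_in by simp
  have prod: "homg i X X f \<otimes>\<^bsub>?R\<^esub> homg j X X g = homg (i + j) X X (gcmp X X X i j f g)"
    if "f \<in> Arr C (P i X) X" "g \<in> Arr C (P j X) X" for i j f g
    using homg_cmp[OF that(1,2)] by (simp add: add.commute)
  have neg: "\<exists>g'\<in>Arr C (P i X) X. Add C (P i X) X g' g = Zer C (P i X) X \<and> \<ominus>\<^bsub>?R\<^esub> homg i X X g = homg i X X g'"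
    if g: "g \<in> Arr C (P i X) X" for i g
  proof -
    obtain g' where g': "g' \<in> Arr C (P i X) X" "Add C (P i X) X g' g = Zer C (P i X) X"
      using neg_ex[of g "P i X" X] g by auto
    then have "homg i X X g' \<oplus>\<^bsub>?R\<^esub> homg i X X g = \<zero>\<^bsub>?R\<^esub>"
      using homg_add[of X X i g' g] homg_zer[of i X X] by simp
    then have "\<ominus>\<^bsub>?R\<^esub> homg i X X g = homg i X X g'"
      using R.minus_equality[OF _ hin[OF g] hin[OF g'(1)]] by simp
    with g' show ?thesis by blast
  qed
  \<comment> \<open>For opposite degrees the inner factor of \<open>gcmp\<close> is an arrow from X
    to its i-th power, so \<open>noret\<close> applies.\<close>
  have sec: "gcmp X X X i (- i) f g \<notin> Units ?E"
    if "i \<noteq> 0" and f: "f \<in> Arr C (P i X) X" and g: "g \<in> Arr C (P (- i) X) X" for i f g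
  proof -
    let ?s = "Cmp C X (P i (P (- i) X)) (P i X) (Pm i (P (- i) X) X g) (S i (- i) X)"
    have "?s \<in> Arr C X (P i X)"
      using S_in[of X i "- i"] P_in[OF g, of i] by (intro cmp_in) simp_all
    then have "Cmp C X (P i X) X f ?s \<notin> Units ?E" by (rule noret[OF that(1) f])
    then show ?thesis by (simp add: gcmp_def)
  qed
  have "\<exists>y. (\<forall>i\<in>T. y i \<in> A i) \<and> (\<forall>j\<in>T. (\<Oplus>\<^bsub>?R\<^esub>i\<in>T. y i \<otimes>\<^bsub>?R\<^esub> homg (j - i) X X (b (j - i))) = r j)"
  proof (rule graded_elimination[of ?R A U])
    show "ring ?R" by (rule R.ring_axioms)
    show "A i \<subseteq> carrier ?R" for i using hin by (auto simp: A_def simp del: End_ring_simps)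
    show "\<zero>\<^bsub>?R\<^esub> \<in> A i" for i
      using homg_zer[of i X X] by (auto simp: A_def image_iff intro!: bexI[of _ "Zer C (P i X) X"])
    show "x \<ominus>\<^bsub>?R\<^esub> y \<in> A i" if xy: "x \<in> A i" "y \<in> A i" for i x y
    proof -
      obtain f g where f: "f \<in> Arr C (P i X) X" "x = homg i X X f" and g: "g \<in> Arr C (P i X) X" "y = homg i X X g"
        using xy by (auto simp: A_def)
      obtain g' where g': "g' \<in> Arr C (P i X) X" "\<ominus>\<^bsub>?R\<^esub> homg i X X g = homg i X X g'" using neg[OF g(1)] by blast
      have "x \<ominus>\<^bsub>?R\<^esub> y = homg i X X (Add C (P i X) X f g')"
        using f g g' homg_add[of X X i f g'] by (simp add: R.minus_eq)
      then show ?thesis using f(1) g'(1) by (simp add: A_def)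
    qed
    show "x \<otimes>\<^bsub>?R\<^esub> y \<in> A (i + j)" if xy: "x \<in> A i" "y \<in> A j" for i j x y
    proof -
      obtain f g where f: "f \<in> Arr C (P i X) X" "x = homg i X X f" and g: "g \<in> Arr C (P j X) X" "y = homg j X X g"
        using xy by (auto simp: A_def)
      show ?thesis
        using prod[OF f(1) g(1)] gcmp_in[OF g(1) f(1)] f(2) g(2) by (simp add: A_def add.commute)
    qed
    show "u \<in> A 0 \<and> (\<exists>v\<in>A 0. v \<otimes>\<^bsub>?R\<^esub> u = \<one>\<^bsub>?R\<^esub> \<and> u \<otimes>\<^bsub>?R\<^esub> v = \<one>\<^bsub>?R\<^esub>)" if u: "u \<in> U" for u
    proof -
      obtain f where f: "f \<in> Units ?E" "u = homg 0 X X f" using u by (auto simp: U_def)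
      obtain g where g: "g \<in> Arr C X X" "Cmp C X X X g f = Idn C X" "Cmp C X X X f g = Idn C X"
        using f(1) by (auto simp: Units_def)
      have c: "gcmp X X X 0 0 p q = Cmp C X X X p q" if "q \<in> Arr C X X" for p q
        using that by (simp add: gcmp_def)
      have "homg 0 X X g \<otimes>\<^bsub>?R\<^esub> u = \<one>\<^bsub>?R\<^esub>" "u \<otimes>\<^bsub>?R\<^esub> homg 0 X X g = \<one>\<^bsub>?R\<^esub>"
        using f g Ecar[OF f(1)] prod[of g 0 f 0] prod[of f 0 g 0] idn by (simp_all add: c)
      then show ?thesis using f g Ecar[OF f(1)] by (auto simp: A_def)
    qed
    show "u \<ominus>\<^bsub>?R\<^esub> x \<otimes>\<^bsub>?R\<^esub> y \<in> U" if u: "u \<in> U" and "i \<noteq> 0" and xy: "x \<in> A i" "y \<in> A (- i)" for u i x y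
    proof -
      obtain h where h: "h \<in> Units ?E" "u = homg 0 X X h" using u by (auto simp: U_def)
      obtain f g where f: "f \<in> Arr C (P i X) X" "x = homg i X X f" and g: "g \<in> Arr C (P (- i) X) X" "y = homg (- i) X X g"
        using xy by (auto simp: A_def)
      let ?t = "gcmp X X X i (- i) f g"
      have t: "?t \<in> Arr C X X" using gcmp_in[OF g(1) f(1)] by simp
      have tn: "?t \<notin> Units ?E"
        by (rule sec[OF \<open>i \<noteq> 0\<close> f(1) g(1)])
      obtain t' where t': "t' \<in> Arr C X X" "Add C X X t' ?t = Zer C X X" "\<ominus>\<^bsub>?R\<^esub> homg 0 X X ?t = homg 0 X X t'"
        using neg[of ?t 0] t by auto
      \<comment> \<open>This is \<open>h\<close> minus \<open>?t\<close>. Since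
        \<open>?w + ?t = h\<close> is a unit and \<open>?t\<close> is not, locality of the
        endomorphism ring makes \<open>?w\<close> a unit.\<close>
      let ?w = "Add C X X h t'"
      have "Add C X X ?w ?t = h" using t t' Ecar[OF h(1)] by (simp add: add_assoc)
      then have "?w \<oplus>\<^bsub>?E\<^esub> ?t \<in> Units ?E" using h(1) by simp
      then have "?w \<in> Units ?E" using locD(4)[of ?w ?t] t t' Ecar[OF h(1)] tn by simp
      moreover have "u \<ominus>\<^bsub>?R\<^esub> x \<otimes>\<^bsub>?R\<^esub> y = homg 0 X X ?w"
        using prod[OF f(1) g(1)] f(2) g(2) h(2) t'(3) homg_add[of X X 0 h t'] by (simp add: R.minus_eq)
      ultimately show ?thesis by (simp add: U_def)
    qed
    show "finite T" by (rule finT)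
    show "homg (j - i) X X (b (j - i)) \<in> A (j - i)" for i j by (simp add: A_def)
    show "homg (i - i) X X (b (i - i)) \<in> U" for i using b0 by (simp add: U_def)
    show "r j \<in> A j" for j
      using homg_zer[of j X X] idn
      by (auto simp: r_def A_def image_iff simp del: orb_simps intro: bexI[of _ "Zer C (P j X) X"] bexI[of _ "Idn C X"])
  qed
  then obtain y where y: "\<forall>i\<in>T. y i \<in> A i"
    and sum: "\<And>j. j \<in> T \<Longrightarrow> (\<Oplus>\<^bsub>?R\<^esub>i\<in>T. y i \<otimes>\<^bsub>?R\<^esub> homg (j - i) X X (b (j - i))) = r j" by blast
  have "\<forall>i\<in>T. \<exists>c. c \<in> Arr C (P i X) X \<and> y i = homg i X X c" using y by (auto simp: A_def)
  then obtain c' where c': "\<And>i. i \<in> T \<Longrightarrow> c' i \<in> Arr C (P i X) X" "\<And>i. i \<in> T \<Longrightarrow> y i = homg i X X (c' i)"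
    by metis
  define c where "c i = (if i \<in> T then c' i else Zer C (P i X) X)" for i
  have c_in [simp]: "c i \<in> Arr C (P i X) X" for i using c'(1) by (simp add: c_def)
  have cR: "c \<in> Arr orb X X" by (rule orb_arrI[OF c_in finT]) (simp add: c_def)
  have term_in: "gcmp X X X i (n - i) (c i) (b (n - i)) \<in> Arr C (P n X) X" for i n
    by (rule gcmp_in_shift[OF b cR]) simp_all
  have am: "add_monoid ?R = hom_group orb X X" by (simp add: hom_group_def End_ring_def)
  have cb: "Cmp orb X X X c b n = r n n" if n: "n \<in> T" for n
  proof -
    have fin': "y i \<otimes>\<^bsub>?R\<^esub> homg (n - i) X X (b (n - i)) = homg n X X (gcmp X X X i (n - i) (c i) (b (n - i)))" if "i \<in> T" for i
      using prod[of "c i" i "b (n - i)" "n - i"] c'[OF that] that by (simp add: c_def)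
    have "(\<Oplus>\<^bsub>?R\<^esub>i\<in>T. y i \<otimes>\<^bsub>?R\<^esub> homg (n - i) X X (b (n - i))) = orb.hsum X X (\<lambda>i. y i \<otimes>\<^bsub>?R\<^esub> homg (n - i) X X (b (n - i))) T"
      by (simp only: finsum_def am)
    also have "\<dots> = orb.hsum X X (\<lambda>i. homg n X X (gcmp X X X i (n - i) (c i) (b (n - i)))) T"
      using term_in fin' by (intro orb.hsum_cong) auto
    finally have "r n n = orb.hsum X X (\<lambda>i. homg n X X (gcmp X X X i (n - i) (c i) (b (n - i)))) T n"
      using sum[OF n] by simp
    also have "\<dots> = hsum (P n X) X (\<lambda>i. gcmp X X X i (n - i) (c i) (b (n - i))) T"
      using term_in finT by (subst orb_hsum_apply) auto
    also have "\<dots> = Cmp orb X X X c b n"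
      by (rule orb_cmp[OF cR b finT, symmetric]) (simp_all add: c_def)
    finally show ?thesis by simp
  qed
  have "Cmp orb X X X c b = Idn orb X"
  proof
    fix n
    show "Cmp orb X X X c b n = Idn orb X n"
    proof (cases "n \<in> T")
      case True
      then show ?thesis using cb[of n] by (auto simp: r_def)
    next
      case False
      have "Cmp orb X X X c b n \<in> Arr C (P n X) X" "Idn orb X n \<in> Arr C (P n X) X"
        using orb_arrD[OF orb_cmp_in[OF b cR]] by auto
      then show ?thesis using out[OF False] by metis
    qed
  qed
  \<comment> \<open>Needed so that the lemma can be applied to c in turn. In degree 0 the equation
    reads: c 0 b 0 plus a sum of non-units is 1, so c 0 b 0 is a unit, and then so is c 0.\<close>
  moreover have "c 0 \<in> Units ?E"
  proof -
    have "0 \<in> T" by (simp add: T_def)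
    let ?f = "\<lambda>i. gcmp X X X i (0 - i) (c i) (b (0 - i))"
    have fX: "?f i \<in> Arr C X X" for i using term_in[of i 0] by simp
    have non: "?f i \<notin> Units ?E" if "i \<noteq> 0" for i
      using sec[OF that c_in[of i], of "b (- i)"] by simp
    have nonsum: "hsum X X ?f B \<notin> Units ?E" if "finite B" "0 \<notin> B" for B
      using that
    proof (induction B rule: finite_induct)
      case empty
      then show ?case using locD(3) by simp
    next
      case (insert i B)
      have "hsum X X ?f (insert i B) = Add C X X (?f i) (hsum X X ?f B)"
        by (rule hsum_insert[OF insert.hyps(1,2) fX fX X X])
      moreover have "hsum X X ?f B \<in> Arr C X X" by (rule hsum_in[OF fX X X])
      moreover have "?f i \<notin> Units ?E" using insert.prems by (intro non) simp
      moreover have "hsum X X ?f B \<notin> Units ?E" using insert by simp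
      ultimately show ?case using locD(4)[of "?f i" "hsum X X ?f B"] fX[of i] unfolding End_ring_simps by argo
    qed
    have "Cmp orb X X X c b 0 = hsum X X ?f T"
      using orb_cmp[OF cR b finT, of 0] by (simp add: c_def)
    also have "\<dots> = hsum X X ?f (insert 0 (T - {0}))" using \<open>0 \<in> T\<close> by (simp add: insert_absorb)
    also have "\<dots> = Add C X X (?f 0) (hsum X X ?f (T - {0}))"
      by (rule hsum_insert[OF _ _ fX fX X X]) (simp_all add: finT)
    finally have "?f 0 \<oplus>\<^bsub>?E\<^esub> hsum X X ?f (T - {0}) = \<one>\<^bsub>?E\<^esub>"
      using cb[OF \<open>0 \<in> T\<close>] by (simp add: r_def)
    then have "?f 0 \<oplus>\<^bsub>?E\<^esub> hsum X X ?f (T - {0}) \<in> Units ?E" using E.Units_one_closed by simp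
    moreover have "hsum X X ?f (T - {0}) \<in> Arr C X X" by (rule hsum_in[OF fX X X])
    moreover have "hsum X X ?f (T - {0}) \<notin> Units ?E" using finT by (intro nonsum) auto
    ultimately have "?f 0 \<in> Units ?E" using locD(4)[of "?f 0" "hsum X X ?f (T - {0})"] fX[of 0]
      unfolding End_ring_simps by argo
    moreover have "?f 0 = c 0 \<otimes>\<^bsub>?E\<^esub> b 0" using orb_arrD[OF b, of 0] by (simp add: gcmp_def)
    ultimately show ?thesis using locD(5)[of "c 0" "b 0"] orb_arrD[OF b, of 0] c_in[of 0] by simp
  qed
  ultimately show ?thesis using cR by blast
qed

text \<open>The left inverse c of b satisfies the same hypotheses, so it has a left inverse d; then
  d = d c b = b, and c is inverse to b on both sides.\<close>

lemma orb_unit: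
  assumes b: "b \<in> Arr orb X X" and b0: "b 0 \<in> Units (End_ring C X)"
  shows "b \<in> Units (End_ring orb X)"
proof -
  obtain c where c: "c \<in> Arr orb X X" "c 0 \<in> Units (End_ring C X)" "Cmp orb X X X c b = Idn orb X"
    using orb_left_inverse[OF assms] by blast
  obtain d where d: "d \<in> Arr orb X X" "Cmp orb X X X d c = Idn orb X"
    using orb_left_inverse[OF c(1,2)] by blast
  have "d = Cmp orb X X X d (Cmp orb X X X c b)"
    using c(3) d(1) orb.cmp_idr[of d X X] by simp
  also have "\<dots> = b"
    using orb.cmp_assoc[OF b c(1) d(1)] d(2) b orb.cmp_idl[of b X X] by simp
  finally have "Cmp orb X X X b c = Idn orb X" using d by simp
  with b c show ?thesis by (auto simp: Units_def simp del: orb_simps)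
qed

text \<open>The degree-zero parts of a and 1 - a add up to the identity of X, so one of them is a
  unit, and \<open>orb_unit\<close> lifts this to the whole element.\<close>

lemma local_orb: "local_ring (End_ring orb X)"
proof (rule local_ringI)
  note locD = local_ringD[OF loc]
  interpret E: ring "End_ring C X" by (rule locD(1))
  interpret R: ring "End_ring orb X" by (rule orb.ring_End) simp
  show "ring (End_ring orb X)" by (rule R.ring_axioms)
  have "Idn orb X 0 \<noteq> Zer orb X X 0" using locD(2) by simp
  then show "\<one>\<^bsub>End_ring orb X\<^esub> \<noteq> \<zero>\<^bsub>End_ring orb X\<^esub>" by (metis orb.End_ring_simps(3,4))
  fix a assume a: "a \<in> carrier (End_ring orb X)"
  then have aR: "a \<in> Arr orb X X" by simp
  let ?d = "\<one>\<^bsub>End_ring orb X\<^esub> \<ominus>\<^bsub>End_ring orb X\<^esub> a"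
  have d: "?d \<in> carrier (End_ring orb X)" using a by (simp del: orb.End_ring_simps)
  then have dR: "?d \<in> Arr orb X X" by simp
  have "a \<oplus>\<^bsub>End_ring orb X\<^esub> ?d = \<one>\<^bsub>End_ring orb X\<^esub>"
    using a R.a_comm[of a ?d] by (simp add: R.minus_eq R.a_assoc R.l_neg del: orb.End_ring_simps)
  then have "Add orb X X a ?d 0 = Idn orb X 0" by (metis orb.End_ring_simps(3,5))
  then have eq: "a 0 \<oplus>\<^bsub>End_ring C X\<^esub> ?d 0 = \<one>\<^bsub>End_ring C X\<^esub>" by simp
  have "a 0 \<in> Units (End_ring C X) \<or> ?d 0 \<in> Units (End_ring C X)"
  proof (rule locD(4))
    show "a 0 \<in> carrier (End_ring C X)" "?d 0 \<in> carrier (End_ring C X)"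
      using orb_arrD[OF aR, of 0] orb_arrD[OF dR, of 0] by simp_all
    show "a 0 \<oplus>\<^bsub>End_ring C X\<^esub> ?d 0 \<in> Units (End_ring C X)" unfolding eq by (rule E.Units_one_closed)
  qed
  then show "a \<in> Units (End_ring orb X) \<or> ?d \<in> Units (End_ring orb X)"
    using orb_unit[OF aR] orb_unit[OF dR] by blast
qed

end

end

section \<open>Localization along resolutions\<close>

text \<open>\<open>R X\<close> is left orthogonal to all arrows of \<open>S\<close>, so a roof from \<open>X\<close> to \<open>Y\<close> amounts to an arrow
  from \<open>R X\<close> to \<open>Y\<close>, its value below.\<close>

locale resolved = preadditive C for C :: "('o, 'm) precat" +
  fixes S :: "'o \<Rightarrow> 'o \<Rightarrow> 'm set" and R :: "'o \<Rightarrow> 'o" and q :: "'o \<Rightarrow> 'm"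
  assumes S_arr: "\<And>X Y s. s \<in> S X Y \<Longrightarrow> X \<in> Ob C \<Longrightarrow> Y \<in> Ob C \<Longrightarrow> s \<in> Arr C X Y"
    and S_idn [simp]: "\<And>X. X \<in> Ob C \<Longrightarrow> Idn C X \<in> S X X"
    and S_cmp [simp]: "\<And>X Y Z s t. \<lbrakk>s \<in> S X Y; t \<in> S Y Z; X \<in> Ob C; Y \<in> Ob C; Z \<in> Ob C\<rbrakk> \<Longrightarrow> Cmp C X Y Z t s \<in> S X Z"
    and R_ob [simp]: "\<And>X. X \<in> Ob C \<Longrightarrow> R X \<in> Ob C"
    and q_S [simp]: "\<And>X. X \<in> Ob C \<Longrightarrow> q X \<in> S (R X) X"
    and lift_ex: "\<And>X Y Z s f. \<lbrakk>s \<in> S Z Y; f \<in> Arr C (R X) Y; X \<in> Ob C; Y \<in> Ob C; Z \<in> Ob C\<rbrakk> \<Longrightarrow>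
       \<exists>g\<in>Arr C (R X) Z. Cmp C (R X) Z Y s g = f"
    and lift_uniq: "\<And>X Y Z s g h. \<lbrakk>s \<in> S Z Y; g \<in> Arr C (R X) Z; h \<in> Arr C (R X) Z; X \<in> Ob C; Y \<in> Ob C; Z \<in> Ob C;
       Cmp C (R X) Z Y s g = Cmp C (R X) Z Y s h\<rbrakk> \<Longrightarrow> g = h"
begin

lemma q_in [simp]: "X \<in> Ob C \<Longrightarrow> q X \<in> Arr C (R X) X"
  by (rule S_arr) simp_all

definition lift :: "'o \<Rightarrow> 'o \<Rightarrow> 'o \<Rightarrow> 'm \<Rightarrow> 'm \<Rightarrow> 'm" where
  "lift X Z Y s f = (SOME g. g \<in> Arr C (R X) Z \<and> Cmp C (R X) Z Y s g = f)"

lemma lift: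
  assumes "s \<in> S Z Y" "f \<in> Arr C (R X) Y" "X \<in> Ob C" "Y \<in> Ob C" "Z \<in> Ob C"
  shows lift_in [simp]: "lift X Z Y s f \<in> Arr C (R X) Z" and cmp_lift [simp]: "Cmp C (R X) Z Y s (lift X Z Y s f) = f"
proof -
  have "lift X Z Y s f \<in> Arr C (R X) Z \<and> Cmp C (R X) Z Y s (lift X Z Y s f) = f"
    unfolding lift_def by (rule someI_ex) (use lift_ex[OF assms] in blast)
  then show "lift X Z Y s f \<in> Arr C (R X) Z" "Cmp C (R X) Z Y s (lift X Z Y s f) = f" by simp_all
qed

lemma lift_eqI:
  "\<lbrakk>s \<in> S Z Y; g \<in> Arr C (R X) Z; Cmp C (R X) Z Y s g = f; f \<in> Arr C (R X) Y; X \<in> Ob C; Y \<in> Ob C; Z \<in> Ob C\<rbrakk> \<Longrightarrow>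
   lift X Z Y s f = g"
  by (rule lift_uniq[of s Z Y _ X]) simp_all

definition val :: "'o \<Rightarrow> 'o \<Rightarrow> 'o \<times> 'm \<times> 'm \<Rightarrow> 'm" where
  "val X Y r = (case r of (Z, s, f) \<Rightarrow> Cmp C (R X) Z Y f (lift X Z X s (q X)))"

lemma roofsI: "\<lbrakk>Z \<in> Ob C; s \<in> S Z X; f \<in> Arr C Z Y\<rbrakk> \<Longrightarrow> (Z, s, f) \<in> roofs C S X Y"
  and roofsD: "(Z, s, f) \<in> roofs C S X Y \<Longrightarrow> Z \<in> Ob C \<and> s \<in> S Z X \<and> f \<in> Arr C Z Y"
  by (simp_all add: roofs_def)

lemma val_in [simp]:
  assumes "r \<in> roofs C S X Y" "X \<in> Ob C" "Y \<in> Ob C"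
  shows "val X Y r \<in> Arr C (R X) Y"
proof -
  obtain Z s f where r: "r = (Z, s, f)" by (cases r)
  note z = roofsD[OF assms(1)[unfolded r]]
  have "lift X Z X s (q X) \<in> Arr C (R X) Z" using z assms by (intro lift_in) simp_all
  then show ?thesis using z assms unfolding r val_def by (auto intro!: cmp_in)
qed

text \<open>By uniqueness of lifts the value can be computed over any refinement W of the roof on
  which \<open>q X\<close> factors through the refined denominator.\<close>

lemma val_cmp:
  assumes "(Z, s, f) \<in> roofs C S X Y" "W \<in> Ob C" "u \<in> Arr C W Z" "w \<in> Arr C (R X) W"
    and "Cmp C (R X) W X (Cmp C W Z X s u) w = q X" "X \<in> Ob C" "Y \<in> Ob C"
  shows "val X Y (Z, s, f) = Cmp C (R X) W Y (Cmp C W Z Y f u) w"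
proof -
  note z = roofsD[OF assms(1)]
  have s: "s \<in> Arr C Z X" using z assms by (intro S_arr) simp_all
  have "lift X Z X s (q X) = Cmp C (R X) W Z u w"
    using z assms s by (intro lift_eqI) (simp_all add: cmp_assoc)
  then show ?thesis using z assms by (simp add: val_def cmp_assoc)
qed

text \<open>Equivalent roofs have a common refinement, over which both values are computed.
  Conversely, for equal values the object \<open>R X\<close>, mapped by the two lifts of
  \<open>q X\<close>, is itself a common refinement.\<close>

lemma roof_eq_iff:
  assumes "r \<in> roofs C S X Y" "r' \<in> roofs C S X Y" and [simp]: "X \<in> Ob C" "Y \<in> Ob C"
  shows "roof_eq C S X Y r r' \<longleftrightarrow> val X Y r = val X Y r'"
proof -
  obtain Z s f where r: "r = (Z, s, f)" by (cases r)
  obtain Z' s' f' where r': "r' = (Z', s', f')" by (cases r')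
  have z: "Z \<in> Ob C" "s \<in> S Z X" "f \<in> Arr C Z Y" and z': "Z' \<in> Ob C" "s' \<in> S Z' X" "f' \<in> Arr C Z' Y"
    using roofsD assms(1,2) unfolding r r' by blast+
  show ?thesis
  proof
    assume "roof_eq C S X Y r r'"
    then obtain W u u' where w: "W \<in> Ob C" "u \<in> Arr C W Z" "u' \<in> Arr C W Z'" "Cmp C W Z X s u \<in> S W X"
      "Cmp C W Z X s u = Cmp C W Z' X s' u'" "Cmp C W Z Y f u = Cmp C W Z' Y f' u'"
      unfolding roof_eq_def r r' by auto
    let ?w = "lift X W X (Cmp C W Z X s u) (q X)"
    have l: "?w \<in> Arr C (R X) W" "Cmp C (R X) W X (Cmp C W Z X s u) ?w = q X"
      using w by (intro lift_in cmp_lift; simp)+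
    have "val X Y r = Cmp C (R X) W Y (Cmp C W Z Y f u) ?w"
      unfolding r by (rule val_cmp) (use assms(1) r w l in simp_all)
    moreover have "val X Y r' = Cmp C (R X) W Y (Cmp C W Z' Y f' u') ?w"
      unfolding r' by (rule val_cmp) (use assms(2) r' w l in simp_all)
    ultimately show "val X Y r = val X Y r'" using w by simp
  next
    assume eq: "val X Y r = val X Y r'"
    let ?u = "lift X Z X s (q X)" and ?u' = "lift X Z' X s' (q X)"
    have "?u \<in> Arr C (R X) Z" "?u' \<in> Arr C (R X) Z'" "Cmp C (R X) Z X s ?u = q X" "Cmp C (R X) Z' X s' ?u' = q X"
      using z z' by simp_all
    with eq show "roof_eq C S X Y r r'"
      unfolding roof_eq_def r r' prod.case
      by (intro bexI[of _ "R X"], rule_tac bexI[of _ ?u], rule_tac bexI[of _ ?u']) (simp_all add: val_def)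
  qed
qed

text \<open>Indexing the classes by values instead of representatives makes the arrows from X to Y
  in the localization correspond to the arrows from \<open>R X\<close> to Y in C.\<close>

definition cls :: "'o \<Rightarrow> 'o \<Rightarrow> 'm \<Rightarrow> ('o \<times> 'm \<times> 'm) set" where
  "cls X Y g = {r \<in> roofs C S X Y. val X Y r = g}"

lemma roof_class_eq:
  assumes "r \<in> roofs C S X Y" "X \<in> Ob C" "Y \<in> Ob C"
  shows "roof_class C S X Y r = cls X Y (val X Y r)"
  unfolding roof_class_def cls_def using roof_eq_iff[OF assms(1) _ assms(2,3)] by auto

lemma std_roof: "\<lbrakk>g \<in> Arr C (R X) Y; X \<in> Ob C; Y \<in> Ob C\<rbrakk> \<Longrightarrow> (R X, q X, g) \<in> cls X Y g"
  using lift_eqI[of "q X" "R X" X "Idn C (R X)" X "q X"] by (simp add: cls_def roofs_def val_def)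

lemma cls_inject: "\<lbrakk>cls X Y g = cls X Y h; g \<in> Arr C (R X) Y; X \<in> Ob C; Y \<in> Ob C\<rbrakk> \<Longrightarrow> g = h"
proof -
  assume "cls X Y g = cls X Y h" "g \<in> Arr C (R X) Y" "X \<in> Ob C" "Y \<in> Ob C"
  then have "(R X, q X, g) \<in> cls X Y g" "(R X, q X, g) \<in> cls X Y h" using std_roof[of g X Y] by auto
  then show ?thesis by (auto simp: cls_def)
qed

abbreviation Loc :: "('o, ('o \<times> 'm \<times> 'm) set) precat" where "Loc \<equiv> localization C S"

lemma Loc_Ob [simp]: "Ob Loc = Ob C"
  by (simp add: localization_def)

lemma Loc_arr: 
  assumes "X \<in> Ob C" "Y \<in> Ob C"
  shows "Arr Loc X Y = cls X Y ` Arr C (R X) Y"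
proof -
  have "Arr Loc X Y = roof_class C S X Y ` roofs C S X Y" by (simp add: localization_def)
  also have "\<dots> = cls X Y ` (val X Y ` roofs C S X Y)"
    using roof_class_eq assms by (auto simp: image_image intro!: image_cong)
  also have "val X Y ` roofs C S X Y = Arr C (R X) Y"
  proof (intro equalityI subsetI)
    fix g assume "g \<in> Arr C (R X) Y"
    from std_roof[OF this assms] show "g \<in> val X Y ` roofs C S X Y"
      by (auto simp: cls_def intro: rev_image_eqI)
  qed (use assms in auto)
  finally show ?thesis .
qed

text \<open>All choices in the union have one value: the two candidates for an arrow from
  \<open>R X\<close> to B both become \<open>f\<close> after the denominator \<open>t\<close>, so
  they agree. A choice exists, since lifting \<open>f\<close> through \<open>q Y\<close> completes a
  square over \<open>R X\<close>.\<close>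

lemma Loc_cmp:
  assumes f: "f \<in> Arr C (R X) Y" and g: "g \<in> Arr C (R Y) Z" and [simp]: "X \<in> Ob C" "Y \<in> Ob C" "Z \<in> Ob C"
  shows "Cmp Loc X Y Z (cls Y Z g) (cls X Y f) = cls X Z (Cmp C (R X) (R Y) Z g (lift X (R Y) Y (q Y) f))"
proof -
  let ?k = "lift X (R Y) Y (q Y) f"
  let ?B = "cls X Z (Cmp C (R X) (R Y) Z g ?k)"
  let ?F = "{roof_class C S X Z (W, Cmp C W A X s u, Cmp C W B Z g' h) |
         A s f' B t g' W u h. (A, s, f') \<in> cls X Y f \<and> (B, t, g') \<in> cls Y Z g \<and> W \<in> Ob C \<and> u \<in> S W A \<and> h \<in> Arr C W B \<and>
         Cmp C W A Y f' u = Cmp C W B Y t h}"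
  have k: "?k \<in> Arr C (R X) (R Y)" "Cmp C (R X) (R Y) Y (q Y) ?k = f" using f by simp_all
  have all: "T = ?B" if T: "T \<in> ?F" for T
  proof -
    obtain A s f' B t g' W u h where T: "T = roof_class C S X Z (W, Cmp C W A X s u, Cmp C W B Z g' h)"
      and a: "(A, s, f') \<in> cls X Y f" and b: "(B, t, g') \<in> cls Y Z g"
      and w [simp]: "W \<in> Ob C" "u \<in> S W A" "h \<in> Arr C W B" and sq: "Cmp C W A Y f' u = Cmp C W B Y t h"
      using T by blast
    have A [simp]: "A \<in> Ob C" "s \<in> S A X" "f' \<in> Arr C A Y" and ar: "(A, s, f') \<in> roofs C S X Y" "val X Y (A, s, f') = f"
      using a roofsD unfolding cls_def by blast+
    have B [simp]: "B \<in> Ob C" "t \<in> S B Y" "g' \<in> Arr C B Z" and bv: "val Y Z (B, t, g') = g"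
      using b roofsD unfolding cls_def by blast+
    have [simp]: "u \<in> Arr C W A" "s \<in> Arr C A X" "t \<in> Arr C B Y" by (rule S_arr; simp)+
    have r: "(W, Cmp C W A X s u, Cmp C W B Z g' h) \<in> roofs C S X Z" by (rule roofsI) auto
    let ?w = "lift X W X (Cmp C W A X s u) (q X)" and ?l = "lift Y B Y t (q Y)"
    have w1: "?w \<in> Arr C (R X) W" "Cmp C (R X) W X (Cmp C W A X s u) ?w = q X"
      by (intro lift_in cmp_lift; simp)+
    have l: "?l \<in> Arr C (R Y) B" "Cmp C (R Y) B Y t ?l = q Y" by simp_all
    have f_eq: "f = Cmp C (R X) W Y (Cmp C W A Y f' u) ?w"
      using val_cmp[OF ar(1) w(1) _ w1] ar(2) by simp
    have "Cmp C (R X) W B h ?w = Cmp C (R X) (R Y) B ?l ?k"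
    proof (rule lift_uniq[of t B Y _ X])
      have "Cmp C (R X) B Y t (Cmp C (R X) W B h ?w) = f"
        unfolding f_eq sq using w1 by (simp add: cmp_assoc)
      moreover have "Cmp C (R X) B Y t (Cmp C (R X) (R Y) B ?l ?k) = Cmp C (R X) (R Y) Y (Cmp C (R Y) B Y t ?l) ?k"
        using l(1) k(1) by (simp add: cmp_assoc del: cmp_lift)
      ultimately show "Cmp C (R X) B Y t (Cmp C (R X) W B h ?w) = Cmp C (R X) B Y t (Cmp C (R X) (R Y) B ?l ?k)"
        using l(2) k(2) by simp
    qed (use w1 l k in auto)
    moreover have "val X Z (W, Cmp C W A X s u, Cmp C W B Z g' h) = Cmp C (R X) B Z g' (Cmp C (R X) W B h ?w)"
      using w1 by (simp add: val_def cmp_assoc)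
    moreover have "g = Cmp C (R Y) B Z g' ?l" using bv by (simp add: val_def)
    ultimately have "val X Z (W, Cmp C W A X s u, Cmp C W B Z g' h) = Cmp C (R X) (R Y) Z g ?k"
      using l k by (simp add: cmp_assoc)
    then show ?thesis unfolding T using roof_class_eq[OF r] by simp
  qed
  have "(R X, q X, f) \<in> cls X Y f" "(R Y, q Y, g) \<in> cls Y Z g" "R X \<in> Ob C" "Idn C (R X) \<in> S (R X) (R X)"
    "?k \<in> Arr C (R X) (R Y)" "Cmp C (R X) (R X) Y f (Idn C (R X)) = Cmp C (R X) (R Y) Y (q Y) ?k"
    using std_roof[OF f] std_roof[OF g] k f by simp_all
  then have inF: "roof_class C S X Z (R X, Cmp C (R X) (R X) X (q X) (Idn C (R X)), Cmp C (R X) (R Y) Z g ?k) \<in> ?F"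
    by (intro CollectI exI conjI) (rule refl | assumption)+
  then have "?B \<in> ?F" unfolding all[OF inF] .
  with all have "\<Union>?F = ?B" by (rule Union_const)
  then show ?thesis by (simp add: localization_def)
qed

text \<open>The union runs over pairs of roofs with a common denominator; the standard roofs of
  \<open>f\<close> and \<open>g\<close> share the denominator \<open>q X\<close>, so it is not
  empty.\<close>

lemma Loc_add:
  assumes f: "f \<in> Arr C (R X) Y" and g: "g \<in> Arr C (R X) Y" and [simp]: "X \<in> Ob C" "Y \<in> Ob C"
  shows "Add Loc X Y (cls X Y f) (cls X Y g) = cls X Y (Add C (R X) Y f g)"
proof -
  let ?F = "{roof_class C S X Y (Z, s, Add C Z Y f' g') | Z s f' g'. (Z, s, f') \<in> cls X Y f \<and> (Z, s, g') \<in> cls X Y g}"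
  let ?B = "cls X Y (Add C (R X) Y f g)"
  have all: "T = ?B" if T: "T \<in> ?F" for T
  proof -
    obtain Z s f' g' where T: "T = roof_class C S X Y (Z, s, Add C Z Y f' g')"
      and a: "(Z, s, f') \<in> cls X Y f" and b: "(Z, s, g') \<in> cls X Y g" using T by blast
    have z [simp]: "Z \<in> Ob C" "s \<in> S Z X" "f' \<in> Arr C Z Y" "g' \<in> Arr C Z Y"
      and v: "val X Y (Z, s, f') = f" "val X Y (Z, s, g') = g"
      using a b roofsD unfolding cls_def by blast+
    have r: "(Z, s, Add C Z Y f' g') \<in> roofs C S X Y" by (rule roofsI) auto
    have "val X Y (Z, s, Add C Z Y f' g') = Add C (R X) Y f g"
      using v by (simp add: val_def cmp_addl)
    then show ?thesis unfolding T using roof_class_eq[OF r] by simp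
  qed
  have "(R X, q X, f) \<in> cls X Y f" "(R X, q X, g) \<in> cls X Y g" using std_roof[OF f] std_roof[OF g] by simp_all
  then have inF: "roof_class C S X Y (R X, q X, Add C (R X) Y f g) \<in> ?F"
    by (intro CollectI exI conjI) (rule refl | assumption)+
  then have "?B \<in> ?F" unfolding all[OF inF] .
  with all have "\<Union>?F = ?B" by (rule Union_const)
  then show ?thesis by (simp add: localization_def)
qed

lemma localize_arr_cls:
  assumes "f \<in> Arr C X Y" "X \<in> Ob C" "Y \<in> Ob C"
  shows "localize_arr C S X Y f = cls X Y (Cmp C (R X) X Y f (q X))"
proof -
  have "(X, Idn C X, f) \<in> roofs C S X Y" using assms by (intro roofsI) auto
  moreover have "lift X X X (Idn C X) (q X) = q X" using assms by (intro lift_eqI) auto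
  ultimately show ?thesis using assms by (simp add: localize_arr_def roof_class_eq val_def)
qed

lemma Loc_idn: "X \<in> Ob C \<Longrightarrow> Idn Loc X = cls X X (q X)"
  using localize_arr_cls[of "Idn C X" X X] by (simp add: localization_def localize_arr_def)

lemma Loc_zer: "X \<in> Ob C \<Longrightarrow> Y \<in> Ob C \<Longrightarrow> Zer Loc X Y = cls X Y (Zer C (R X) Y)"
  using localize_arr_cls[of "Zer C X Y" X Y] by (simp add: localization_def localize_arr_def)

lemma lift_q_cmp: "\<lbrakk>k \<in> Arr C (R X) (R Y); X \<in> Ob C; Y \<in> Ob C\<rbrakk> \<Longrightarrow> lift X (R Y) Y (q Y) (Cmp C (R X) (R Y) Y (q Y) k) = k"
  by (rule lift_eqI) auto

text \<open>The second description of arrows in the localization, by arrows between resolutions. In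
  this form composition is that of C, without lifts, so \<open>preadditive_transfer\<close>
  applies.\<close>

definition rmap :: "'o \<Rightarrow> 'o \<Rightarrow> 'm \<Rightarrow> ('o \<times> 'm \<times> 'm) set" where
  "rmap X Y k = cls X Y (Cmp C (R X) (R Y) Y (q Y) k)"

lemma Loc_arr_rmap:
  assumes [simp]: "X \<in> Ob C" "Y \<in> Ob C"
  shows "Arr Loc X Y = rmap X Y ` Arr C (R X) (R Y)"
proof -
  have "Arr C (R X) Y = Cmp C (R X) (R Y) Y (q Y) ` Arr C (R X) (R Y)"
  proof (intro equalityI subsetI)
    fix f assume "f \<in> Arr C (R X) Y"
    then show "f \<in> Cmp C (R X) (R Y) Y (q Y) ` Arr C (R X) (R Y)"
      using lift_ex[of "q Y" "R Y" Y f X] by auto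
  qed auto
  then show ?thesis by (simp add: Loc_arr image_image rmap_def)
qed

lemma rmap_cmp:
  "\<lbrakk>f \<in> Arr C (R X) (R Y); g \<in> Arr C (R Y) (R Z); X \<in> Ob C; Y \<in> Ob C; Z \<in> Ob C\<rbrakk> \<Longrightarrow>
   Cmp Loc X Y Z (rmap Y Z g) (rmap X Y f) = rmap X Z (Cmp C (R X) (R Y) (R Z) g f)"
  unfolding rmap_def by (simp add: Loc_cmp lift_q_cmp cmp_assoc cmp_in)

lemma rmap_inject:
  assumes "rmap X Y f = rmap X Y g" "f \<in> Arr C (R X) (R Y)" "g \<in> Arr C (R X) (R Y)" "X \<in> Ob C" "Y \<in> Ob C"
  shows "f = g"
  using cls_inject[OF assms(1)[unfolded rmap_def]] assms lift_uniq[of "q Y" "R Y" Y f X g] by auto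

lemma preadditive_Loc: "preadditive_category Loc"
proof (rule preadditive_transfer[OF preadditive, where \<omega> = R and \<phi> = rmap])
  fix X Y f g assume "X \<in> Ob Loc" "Y \<in> Ob Loc" "f \<in> Arr C (R X) (R Y)" "g \<in> Arr C (R X) (R Y)"
  then show "Add Loc X Y (rmap X Y f) (rmap X Y g) = rmap X Y (Add C (R X) (R Y) f g)"
    unfolding rmap_def by (simp add: Loc_add cmp_addr)
qed (simp_all add: Loc_arr_rmap rmap_cmp, simp_all add: rmap_def Loc_idn Loc_zer)

sublocale L: preadditive Loc
  by unfold_locales (rule preadditive_Loc)

lemma addfun_Loc: "addfun C Loc (\<lambda>X. X) (localize_arr C S)"
proof unfold_locales
  have in': "localize_arr C S X Y f \<in> Arr Loc X Y" if "f \<in> Arr C X Y" "X \<in> Ob C" "Y \<in> Ob C" for X Y f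
    using that by (simp add: localize_arr_cls Loc_arr)
  have cmp: "localize_arr C S X Z (Cmp C X Y Z g f) = Cmp Loc X Y Z (localize_arr C S Y Z g) (localize_arr C S X Y f)"
    if [simp]: "f \<in> Arr C X Y" "g \<in> Arr C Y Z" "X \<in> Ob C" "Y \<in> Ob C" "Z \<in> Ob C" for X Y Z f g
  proof -
    let ?k = "lift X (R Y) Y (q Y) (Cmp C (R X) X Y f (q X))"
    have k: "?k \<in> Arr C (R X) (R Y)" "Cmp C (R X) (R Y) Y (q Y) ?k = Cmp C (R X) X Y f (q X)"
      by (intro lift_in cmp_lift; simp)+
    have "Cmp Loc X Y Z (localize_arr C S Y Z g) (localize_arr C S X Y f) = cls X Z (Cmp C (R X) (R Y) Z (Cmp C (R Y) Y Z g (q Y)) ?k)"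
      by (simp add: localize_arr_cls Loc_cmp)
    also have "Cmp C (R X) (R Y) Z (Cmp C (R Y) Y Z g (q Y)) ?k = Cmp C (R X) Y Z g (Cmp C (R X) (R Y) Y (q Y) ?k)"
      using k(1) by (simp add: cmp_assoc del: cmp_lift)
    also have "\<dots> = Cmp C (R X) X Z (Cmp C X Y Z g f) (q X)" unfolding k(2) by (simp add: cmp_assoc)
    finally show ?thesis by (simp add: localize_arr_cls)
  qed
  show "additive_functor C Loc (\<lambda>X. X) (localize_arr C S)"
    unfolding additive_functor_def
    by (auto simp: in' cmp) (simp_all add: localize_arr_cls Loc_idn Loc_add cmp_addl)
qed

text \<open>The inverse is the class whose value is the lift of \<open>q Y\<close> through
  \<open>s\<close>.\<close>

lemma S_isomorphic:
  assumes s: "s \<in> S X Y" and [simp]: "X \<in> Ob C" "Y \<in> Ob C"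
  shows "isomorphic Loc X Y"
proof -
  let ?l = "lift Y X Y s (q Y)"
  have sA [simp]: "s \<in> Arr C X Y" using s by (rule S_arr) simp_all
  have l: "?l \<in> Arr C (R Y) X" "Cmp C (R Y) X Y s ?l = q Y" using s by simp_all
  let ?k = "lift Y (R X) X (q X) ?l" and ?m = "lift X (R Y) Y (q Y) (Cmp C (R X) X Y s (q X))"
  have k: "?k \<in> Arr C (R Y) (R X)" "Cmp C (R Y) (R X) X (q X) ?k = ?l" using l(1) by simp_all
  have m: "?m \<in> Arr C (R X) (R Y)" "Cmp C (R X) (R Y) Y (q Y) ?m = Cmp C (R X) X Y s (q X)" by (simp_all add: cmp_in)
  show ?thesis
  proof (rule L.isoI[of "cls X Y (Cmp C (R X) X Y s (q X))" _ _ "cls Y X ?l"])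
    show "cls X Y (Cmp C (R X) X Y s (q X)) \<in> Arr Loc X Y" "cls Y X ?l \<in> Arr Loc Y X"
      using l(1) by (simp_all add: Loc_arr)
    have "Cmp C (R X) (R Y) X ?l ?m = q X"
    proof (rule lift_uniq[OF s, of _ X])
      have "Cmp C (R X) X Y s (Cmp C (R X) (R Y) X ?l ?m) = Cmp C (R X) (R Y) Y (Cmp C (R Y) X Y s ?l) ?m"
        using l(1) m(1) by (simp add: cmp_assoc del: cmp_lift)
      then show "Cmp C (R X) X Y s (Cmp C (R X) (R Y) X ?l ?m) = Cmp C (R X) X Y s (q X)" using l(2) m(2) by simp
    qed (use l m in \<open>auto intro!: cmp_in\<close>)
    then show "Cmp Loc X Y X (cls Y X ?l) (cls X Y (Cmp C (R X) X Y s (q X))) = Idn Loc X"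
      using l(1) by (simp add: Loc_cmp Loc_idn)
    have "Cmp C (R Y) (R X) Y (Cmp C (R X) X Y s (q X)) ?k = Cmp C (R Y) X Y s (Cmp C (R Y) (R X) X (q X) ?k)"
      using k(1) by (simp add: cmp_assoc del: cmp_lift)
    then show "Cmp Loc Y X Y (cls X Y (Cmp C (R X) X Y s (q X))) (cls Y X ?l) = Idn Loc Y"
      using l k by (simp add: Loc_cmp Loc_idn)
  qed
qed

text \<open>Since \<open>rmap\<close> is bijective and respects composition, an inverse pair in the
  localization comes from one between the resolutions. This returns from roofs to homotopy classes
  of chain maps.\<close>

lemma isomorphic_LocD:
  assumes "isomorphic Loc X Y" and [simp]: "X \<in> Ob C" "Y \<in> Ob C"
  shows "isomorphic C (R X) (R Y)"
  using assms(1)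
proof (rule L.isoE)
  fix f g assume f: "f \<in> Arr Loc X Y" and g: "g \<in> Arr Loc Y X"
    and eq: "Cmp Loc X Y X g f = Idn Loc X" "Cmp Loc Y X Y f g = Idn Loc Y"
  obtain f' where f': "f' \<in> Arr C (R X) (R Y)" "f = rmap X Y f'" using f by (auto simp: Loc_arr_rmap)
  obtain g' where g': "g' \<in> Arr C (R Y) (R X)" "g = rmap Y X g'" using g by (auto simp: Loc_arr_rmap)
  have idn: "Idn Loc Z = rmap Z Z (Idn C (R Z))" if "Z \<in> Ob C" for Z using that by (simp add: rmap_def Loc_idn)
  have "rmap X X (Cmp C (R X) (R Y) (R X) g' f') = rmap X X (Idn C (R X))"
    using eq(1) f' g' by (simp add: rmap_cmp idn)
  then have "Cmp C (R X) (R Y) (R X) g' f' = Idn C (R X)" by (rule rmap_inject) (use f' g' in \<open>auto intro!: cmp_in\<close>)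
  moreover have "rmap Y Y (Cmp C (R Y) (R X) (R Y) f' g') = rmap Y Y (Idn C (R Y))"
    using eq(2) f' g' by (simp add: rmap_cmp idn)
  then have "Cmp C (R Y) (R X) (R Y) f' g' = Idn C (R Y)" by (rule rmap_inject) (use f' g' in \<open>auto intro!: cmp_in\<close>)
  ultimately show ?thesis using f' g' by (intro isoI) auto
qed

end

section \<open>Finite-dimensional subspaces of the sequence space\<close>

text \<open>Used as rewrite rules, these eta-expand \<open>0\<close>, \<open>+\<close> and \<open>-\<close> on vectors.\<close>

declare zero_fun_apply [simp del] plus_fun_apply [simp del] minus_apply [simp del] uminus_apply [simp del]

definition smul :: "'k::field \<Rightarrow> 'k vec \<Rightarrow> 'k vec" where
  "smul c v = (\<lambda>n. c * v n)"

interpretation vec: vector_space "smul :: 'k::field \<Rightarrow> 'k vec \<Rightarrow> 'k vec"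
  by unfold_locales (simp_all add: smul_def fun_eq_iff algebra_simps plus_fun_apply)

text \<open>The ambient sequence space is infinite-dimensional, hence the explicit finite spanning
  set. It may lie outside \<open>V\<close>, which makes the passage to subspaces immediate.\<close>

definition fdim :: "'k::field vec set \<Rightarrow> bool" where
  "fdim V \<longleftrightarrow> vec.subspace V \<and> (\<exists>B. finite B \<and> V \<subseteq> vec.span B)"

lemma fdim_basis:
  assumes "fdim V"
  obtains B where "B \<subseteq> V" "finite B" "vec.independent B" "V \<subseteq> vec.span B" "card B = vec.dim V"
proof -
  obtain B where B: "B \<subseteq> V" "vec.independent B" "V \<subseteq> vec.span B" "card B = vec.dim V"
    by (rule vec.basis_exists)
  obtain F where "finite F" "V \<subseteq> vec.span F" using assms by (auto simp: fdim_def)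
  then have "finite B" using vec.independent_span_bound[of F B] B by blast
  with B show thesis by (intro that)
qed

lemma fdim_subset: "\<lbrakk>fdim V; vec.subspace W; W \<subseteq> V\<rbrakk> \<Longrightarrow> fdim W"
  by (auto simp: fdim_def)

lemma fdim_dim_mono:
  assumes "fdim V" "fdim W" "W \<subseteq> V"
  shows "vec.dim W \<le> vec.dim V"
proof -
  obtain B where B: "finite B" "V \<subseteq> vec.span B" "card B = vec.dim V" using assms(1) by (rule fdim_basis)
  obtain C where C: "C \<subseteq> W" "vec.independent C" "card C = vec.dim W" using assms(2) by (rule fdim_basis)
  then show ?thesis using vec.independent_span_bound[of B C] B assms(3) by auto
qed

lemma fdim_dim_eq:
  assumes "fdim V" "fdim W" "W \<subseteq> V" "vec.dim V \<le> vec.dim W"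
  shows "W = V"
proof (rule ccontr)
  assume "W \<noteq> V"
  then obtain v where v: "v \<in> V" "v \<notin> W" using assms(3) by blast
  obtain B where B: "finite B" "V \<subseteq> vec.span B" "card B = vec.dim V" using assms(1) by (rule fdim_basis)
  obtain C where C: "C \<subseteq> W" "finite C" "vec.independent C" "W \<subseteq> vec.span C" "card C = vec.dim W" using assms(2) by (rule fdim_basis)
  have "vec.span C \<subseteq> W" using C(1) assms(2) by (intro vec.span_minimal) (auto simp: fdim_def)
  then have "v \<notin> vec.span C" using v by blast
  then have "vec.independent (insert v C)" "v \<notin> C" using C vec.independent_insertI vec.span_base by blast+
  then have "card (insert v C) \<le> card B"
    using vec.independent_span_bound[of B "insert v C"] B C v assms(3) by blast
  then show False using \<open>v \<notin> C\<close> B C assms(4) by simp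
qed

lemma decreasing_stable:
  assumes "\<And>n. fdim (V n)" "\<And>n. V (Suc n) \<subseteq> V n"
  shows "\<exists>n. \<forall>m\<ge>n. V m = V n"
proof -
  have dec: "V m \<subseteq> V n" if "n \<le> m" for m n using that assms(2) by (rule lift_Suc_antimono_le[rotated])
  obtain n where n: "\<And>m. vec.dim (V n) \<le> vec.dim (V m)"
    using ex_has_least_nat[of "\<lambda>_. True" 0 "\<lambda>n. vec.dim (V n)"] by auto
  have "V m = V n" if "n \<le> m" for m
    by (rule fdim_dim_eq[OF assms(1) assms(1) dec[OF that] n])
  then show ?thesis by blast
qed

lemma increasing_stable:
  assumes "fdim W" "\<And>n. fdim (V n)" "\<And>n. V n \<subseteq> V (Suc n)" "\<And>n. V n \<subseteq> W"
  shows "\<exists>n. \<forall>m\<ge>n. V m = V n"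
proof -
  have inc: "V n \<subseteq> V m" if "n \<le> m" for m n using that assms(3) by (rule lift_Suc_mono_le[rotated])
  have "\<And>n. vec.dim (V n) < Suc (vec.dim W)" using fdim_dim_mono[OF assms(1,2,4)] by (simp add: less_Suc_eq_le)
  then obtain n where n: "\<And>m. vec.dim (V m) \<le> vec.dim (V n)"
    using ex_has_greatest_nat[of "\<lambda>_. True" 0 "\<lambda>n. vec.dim (V n)" "Suc (vec.dim W)"] by auto
  have "V m = V n" if "n \<le> m" for m
    using fdim_dim_eq[OF assms(2) assms(2) inc[OF that] n] by simp
  then show ?thesis by blast
qed

text \<open>Quotient modules must again live on subspaces of the sequence space, so B is divided out
  by a linear endomorphism of the whole space. It kills a basis of B and fixes the other vectors of
  an extended basis; as v and its image always differ by an element of B, the kernel is no larger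
  than B.\<close>

lemma projection_along:
  assumes "vec.subspace (B :: 'k::field vec set)"
  obtains p where "\<And>v w. p (v + w) = p v + p w" "\<And>c v. p (smul c v) = smul c (p v)" "\<And>v. p v = 0 \<longleftrightarrow> v \<in> B"
proof -
  interpret vp: vector_space_pair "smul :: 'k \<Rightarrow> 'k vec \<Rightarrow> 'k vec" "smul :: 'k \<Rightarrow> 'k vec \<Rightarrow> 'k vec" by unfold_locales
  obtain b where b: "b \<subseteq> B" "vec.independent b" "B \<subseteq> vec.span b" by (rule vec.maximal_independent_subset)
  have sb: "vec.span b = B" using b vec.span_minimal[OF b(1) assms] by blast
  obtain C where C: "b \<subseteq> C" "vec.independent C" "UNIV \<subseteq> vec.span C"
    using vec.maximal_independent_subset_extend[of b UNIV] b(2) by auto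
  obtain p where p: "Vector_Spaces.linear smul smul p" "\<And>x. x \<in> C \<Longrightarrow> p x = (if x \<in> b then 0 else x)"
    using vp.linear_independent_extend[OF C(2), of "\<lambda>x. if x \<in> b then 0 else x"] by auto
  interpret p: Vector_Spaces.linear smul smul p by (rule p(1))
  have diff: "v - p v \<in> B" for v
  proof -
    have "v \<in> vec.span C" using C(3) by blast
    then show ?thesis
    proof (induction rule: vec.span_induct)
      case base
      show ?case
      proof (rule vec.subspaceI)
        show "0 \<in> {v. v - p v \<in> B}" using vec.subspace_0[OF assms] by (simp add: p.zero)
        fix x y c assume "x \<in> {v. v - p v \<in> B}" "y \<in> {v. v - p v \<in> B}"
        then have xy: "x - p x \<in> B" "y - p y \<in> B" by simp_all
        have "x + y - p (x + y) = (x - p x) + (y - p y)" by (simp add: p.add)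
        then show "x + y \<in> {v. v - p v \<in> B}" using vec.subspace_add[OF assms xy] by (simp only: mem_Collect_eq)
        have "smul c x - p (smul c x) = smul c (x - p x)" by (simp add: p.scale vec.scale_right_diff_distrib)
        then show "smul c x \<in> {v. v - p v \<in> B}" using vec.subspace_scale[OF assms xy(1)] by simp
      qed
    next
      case (step x)
      then show ?case using p(2)[of x] b(1) vec.subspace_0[OF assms] by auto
    qed
  qed
  have zero: "p v = 0" if "v \<in> B" for v
  proof -
    have "v \<in> vec.span b" using that sb by simp
    then show ?thesis
      by (induction rule: vec.span_induct) (use C(1) p(2) in \<open>auto intro!: vec.subspaceI simp: p.zero p.add p.scale\<close>)
  qed
  show thesis
  proof (rule that)
    show "p v = 0 \<longleftrightarrow> v \<in> B" for v using diff[of v] zero[of v] by auto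
  qed (simp_all add: p.add p.scale)
qed

section \<open>Finitely generated modules\<close>

locale fd_alg =
  fixes scale :: "'k::field \<Rightarrow> 'h::ring_1 \<Rightarrow> 'h"
  assumes fd_algebra: "fd_algebra scale"
begin

abbreviation "fg \<equiv> fg_module scale"

sublocale hs: vector_space scale
  using fd_algebra unfolding fd_algebra_def finite_dimensional_vector_space_def by blast

lemma scale_mult: "scale c x * y = scale c (x * y)" "x * scale c y = scale c (x * y)"
  using fd_algebra unfolding fd_algebra_def by metis+

lemma h_basis:
  obtains B where "finite B" "hs.independent B" "hs.span B = UNIV"
  using fd_algebra unfolding fd_algebra_def finite_dimensional_vector_space_def finite_dimensional_vector_space_axioms_def
  by blast

text \<open>\<open>fg_module\<close> without its clause on generators; the latter becomes finite
  dimension in \<open>fg_iff\<close>.\<close>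

definition lmod :: "('h, 'k) hmod \<Rightarrow> bool" where
  "lmod M \<longleftrightarrow> 0 \<in> mcar M \<and> (\<forall>v\<in>mcar M. \<forall>w\<in>mcar M. v + w \<in> mcar M) \<and>
     (\<forall>a. \<forall>v\<in>mcar M. mact M a v \<in> mcar M) \<and>
     (\<forall>a. \<forall>v\<in>mcar M. \<forall>w\<in>mcar M. mact M a (v + w) = mact M a v + mact M a w) \<and>
     (\<forall>a b. \<forall>v\<in>mcar M. mact M (a + b) v = mact M a v + mact M b v) \<and>
     (\<forall>a b. \<forall>v\<in>mcar M. mact M (a * b) v = mact M a (mact M b v)) \<and>
     (\<forall>c. \<forall>v\<in>mcar M. mact M (scale c 1) v = smul c v)"

context
  fixes M assumes M: "lmod M"
begin

lemma m_zero [simp]: "0 \<in> mcar M"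
  and m_add: "v \<in> mcar M \<Longrightarrow> w \<in> mcar M \<Longrightarrow> v + w \<in> mcar M"
  and m_act: "v \<in> mcar M \<Longrightarrow> mact M a v \<in> mcar M"
  and act_add: "v \<in> mcar M \<Longrightarrow> w \<in> mcar M \<Longrightarrow> mact M a (v + w) = mact M a v + mact M a w"
  and add_act: "v \<in> mcar M \<Longrightarrow> mact M (a + b) v = mact M a v + mact M b v"
  and mult_act: "v \<in> mcar M \<Longrightarrow> mact M (a * b) v = mact M a (mact M b v)"
  and scale_act: "v \<in> mcar M \<Longrightarrow> mact M (scale c 1) v = smul c v"
  using M by (simp_all add: lmod_def)

lemma m_smul: "v \<in> mcar M \<Longrightarrow> smul c v \<in> mcar M"
  using m_act[of v "scale c 1"] by (simp add: scale_act)

lemma act_scale: "v \<in> mcar M \<Longrightarrow> mact M (scale c a) v = smul c (mact M a v)"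
  using mult_act[of v "scale c 1" a] scale_act[OF m_act[of v a], of c] by (simp add: scale_mult)

lemma one_act: "v \<in> mcar M \<Longrightarrow> mact M 1 v = v"
  using scale_act[of v 1] by simp

lemma m_subspace: "vec.subspace (mcar M)"
  by (rule vec.subspaceI) (simp_all add: m_add m_smul)

lemma m_neg: "v \<in> mcar M \<Longrightarrow> - v \<in> mcar M"
  and m_diff: "v \<in> mcar M \<Longrightarrow> w \<in> mcar M \<Longrightarrow> v - w \<in> mcar M"
  using vec.subspace_neg[OF m_subspace] vec.subspace_diff[OF m_subspace] by simp_all

lemma act_zero [simp]: "mact M a 0 = 0"
  using act_add[of 0 0 a] by simp

lemma act_neg: "v \<in> mcar M \<Longrightarrow> mact M a (- v) = - mact M a v"
  using act_add[of v "- v" a] m_neg[of v] by (simp add: eq_neg_iff_add_eq_0 add.commute)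

end

text \<open>Generators multiplied by a basis of the algebra span the module over the field.
  Conversely, a vector space basis generates, as scalars act through
  \<open>scale c 1\<close>.\<close>

lemma fg_iff: "fg M \<longleftrightarrow> lmod M \<and> fdim (mcar M)"
proof
  assume M: "fg M"
  then have l: "lmod M" unfolding fg_module_def lmod_def smul_def by blast
  have "\<exists>S. finite S \<and> S \<subseteq> mcar M \<and> (\<forall>v\<in>mcar M. \<exists>a. v = (\<Sum>s\<in>S. mact M (a s) s))"
    using M by (simp add: fg_module_def)
  then obtain S where S: "finite S" "S \<subseteq> mcar M" "\<And>v. v \<in> mcar M \<Longrightarrow> \<exists>a. v = (\<Sum>s\<in>S. mact M (a s) s)"
    by blast
  obtain B where B: "finite B" "hs.span B = UNIV" by (rule h_basis)
  let ?G = "(\<lambda>(b, s). mact M b s) ` (B \<times> S)"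
  have "mact M a s \<in> vec.span ?G" if s: "s \<in> S" for a s
  proof -
    have sM: "s \<in> mcar M" using s S by blast
    have "a \<in> hs.span B" using B by simp
    then show ?thesis
    proof (induction rule: hs.span_induct)
      case base
      have "mact M 0 s = 0" using act_scale[OF l sM, of 0 0] by simp
      then show ?case
        by (intro hs.subspaceI) (simp_all add: vec.span_zero vec.span_add vec.span_scale add_act[OF l sM] act_scale[OF l sM])
    next
      case (step b)
      then show ?case using s by (intro vec.span_base) auto
    qed
  qed
  then have "v \<in> vec.span ?G" if "v \<in> mcar M" for v
    using S(3)[OF that] by (auto intro!: vec.span_sum)
  then have "fdim (mcar M)" using m_subspace[OF l] B S unfolding fdim_def by (intro conjI exI[of _ ?G]) auto
  with l show "lmod M \<and> fdim (mcar M)" ..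
next
  assume M: "lmod M \<and> fdim (mcar M)"
  then obtain B where B: "B \<subseteq> mcar M" "finite B" "mcar M \<subseteq> vec.span B" using fdim_basis by metis
  have "\<exists>a. v = (\<Sum>s\<in>B. mact M (a s) s)" if v: "v \<in> mcar M" for v
  proof -
    have "v \<in> vec.span B" using v B by blast
    then obtain u where u: "v = (\<Sum>s\<in>B. smul (u s) s)" using vec.span_finite[OF B(2)] by auto
    also have "\<dots> = (\<Sum>s\<in>B. mact M (scale (u s) 1) s)"
      using B(1) M by (intro sum.cong) (auto simp: scale_act)
    finally show ?thesis by (rule exI[of _ "\<lambda>s. scale (u s) 1"])
  qed
  then show "fg M" using M B unfolding fg_module_def lmod_def smul_def by blast
qed

lemma fg_lmod [simp]: "fg M \<Longrightarrow> lmod M" by (simp add: fg_iff)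

lemma hom_in: "f \<in> module_hom M N \<Longrightarrow> v \<in> mcar M \<Longrightarrow> f v \<in> mcar N"
  and hom_add: "f \<in> module_hom M N \<Longrightarrow> v \<in> mcar M \<Longrightarrow> w \<in> mcar M \<Longrightarrow> f (v + w) = f v + f w"
  and hom_act: "f \<in> module_hom M N \<Longrightarrow> v \<in> mcar M \<Longrightarrow> f (mact M a v) = mact N a (f v)"
  and hom_out: "f \<in> module_hom M N \<Longrightarrow> v \<notin> mcar M \<Longrightarrow> f v = 0"
  by (auto simp: module_hom_def)

lemma homI:
  "\<lbrakk>\<And>v. v \<in> mcar M \<Longrightarrow> f v \<in> mcar N; \<And>v w. v \<in> mcar M \<Longrightarrow> w \<in> mcar M \<Longrightarrow> f (v + w) = f v + f w;
    \<And>a v. v \<in> mcar M \<Longrightarrow> f (mact M a v) = mact N a (f v); \<And>v. v \<notin> mcar M \<Longrightarrow> f v = 0\<rbrakk> \<Longrightarrow> f \<in> module_hom M N"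
  by (simp add: module_hom_def)

lemma restrI:
  "\<lbrakk>lmod M; \<And>v. v \<in> mcar M \<Longrightarrow> f v \<in> mcar N; \<And>v w. v \<in> mcar M \<Longrightarrow> w \<in> mcar M \<Longrightarrow> f (v + w) = f v + f w;
    \<And>a v. v \<in> mcar M \<Longrightarrow> f (mact M a v) = mact N a (f v)\<rbrakk> \<Longrightarrow> restr M f \<in> module_hom M N"
  by (rule homI) (simp_all add: restr_def m_add m_act)

lemma hom_zero [simp]: "f \<in> module_hom M N \<Longrightarrow> lmod M \<Longrightarrow> f 0 = 0"
  using hom_add[of f M N 0 0] by simp

lemma hom_neg: "f \<in> module_hom M N \<Longrightarrow> lmod M \<Longrightarrow> v \<in> mcar M \<Longrightarrow> f (- v) = - f v"
  using hom_add[of f M N v "- v"] m_neg[of M v] by (simp add: eq_neg_iff_add_eq_0 add.commute)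

lemma hom_diff: "f \<in> module_hom M N \<Longrightarrow> lmod M \<Longrightarrow> v \<in> mcar M \<Longrightarrow> w \<in> mcar M \<Longrightarrow> f (v - w) = f v - f w"
  using hom_add[of f M N v "- w"] hom_neg[of f M N w] m_neg[of M w] by simp

lemma idn_hom: "lmod M \<Longrightarrow> restr M (\<lambda>v. v) \<in> module_hom M M"
  by (rule restrI) simp_all

lemma cmp_hom: "\<lbrakk>f \<in> module_hom L M; g \<in> module_hom M N; lmod M\<rbrakk> \<Longrightarrow> (\<lambda>v. g (f v)) \<in> module_hom L N"
  by (rule homI) (simp_all add: hom_in hom_add hom_act hom_out)

lemma add_hom: "\<lbrakk>f \<in> module_hom M N; g \<in> module_hom M N; lmod N\<rbrakk> \<Longrightarrow> (\<lambda>v. f v + g v) \<in> module_hom M N"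
  by (rule homI) (simp_all add: hom_in hom_add hom_act hom_out m_add act_add ac_simps)

lemma neg_hom: "\<lbrakk>f \<in> module_hom M N; lmod N\<rbrakk> \<Longrightarrow> (\<lambda>v. - f v) \<in> module_hom M N"
  by (rule homI) (simp_all add: hom_in hom_add hom_act hom_out m_neg act_neg)

lemma diff_hom: "\<lbrakk>f \<in> module_hom M N; g \<in> module_hom M N; lmod N\<rbrakk> \<Longrightarrow> (\<lambda>v. f v - g v) \<in> module_hom M N"
  using add_hom[OF _ neg_hom, of f M N g] by simp

lemma zero_hom: "lmod N \<Longrightarrow> (\<lambda>v. 0) \<in> module_hom M N"
  by (rule homI) simp_all

lemma FgMod_simps [simp]:
  "Ob (FgMod scale) = {M. fg M}" "Arr (FgMod scale) = module_hom" "Idn (FgMod scale) M = restr M (\<lambda>v. v)"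
  "Cmp (FgMod scale) L M N g f = (\<lambda>v. g (f v))" "Add (FgMod scale) M N f g = (\<lambda>v. f v + g v)"
  "Zer (FgMod scale) M N = (\<lambda>v. 0)"
  by (simp_all add: FgMod_def)

lemma preadditive_FgMod: "preadditive_category (FgMod scale)"
  unfolding preadditive_category_def
proof (intro conjI ballI)
  show "category (FgMod scale)"
    unfolding category_def
  proof (intro conjI ballI)
    fix M N f assume "M \<in> Ob (FgMod scale)" "N \<in> Ob (FgMod scale)" "f \<in> Arr (FgMod scale) M N"
    then have f: "lmod M" "lmod N" "f \<in> module_hom M N" by simp_all
    have "f (restr M (\<lambda>v. v) v) = f v" "restr N (\<lambda>v. v) (f v) = f v" for v
      using f hom_in[OF f(3), of v] hom_out[OF f(3), of v] by (cases "v \<in> mcar M"; simp add: restr_def)+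
    then show "Cmp (FgMod scale) M M N f (Idn (FgMod scale) M) = f" "Cmp (FgMod scale) M N N (Idn (FgMod scale) N) f = f"
      by simp_all
  qed (auto simp: idn_hom intro: cmp_hom)
  fix M N assume "M \<in> Ob (FgMod scale)" "N \<in> Ob (FgMod scale)"
  then have MN: "lmod M" "lmod N" by simp_all
  show "comm_group (hom_group (FgMod scale) M N)"
  proof (rule comm_groupI)
    fix f assume "f \<in> carrier (hom_group (FgMod scale) M N)"
    then show "\<exists>g\<in>carrier (hom_group (FgMod scale) M N). g \<otimes>\<^bsub>hom_group (FgMod scale) M N\<^esub> f = \<one>\<^bsub>hom_group (FgMod scale) M N\<^esub>"
      using MN neg_hom[of f M N] by (intro bexI[of _ "\<lambda>v. - f v"]) auto
  qed (use MN in \<open>auto simp: zero_hom add_hom ac_simps\<close>)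
next
  fix L M N f f' g g'
  assume "L \<in> Ob (FgMod scale)" "M \<in> Ob (FgMod scale)" "N \<in> Ob (FgMod scale)"
    and f: "f \<in> Arr (FgMod scale) L M" "f' \<in> Arr (FgMod scale) L M" and g: "g \<in> Arr (FgMod scale) M N"
  then have "g (f v + f' v) = g (f v) + g (f' v)" for v
    by (cases "v \<in> mcar L") (simp_all add: hom_add hom_in hom_out)
  then show "Cmp (FgMod scale) L M N g (Add (FgMod scale) L M f f') =
      Add (FgMod scale) L N (Cmp (FgMod scale) L M N g f) (Cmp (FgMod scale) L M N g f')" by simp
qed auto

lemma preadditive_FgMod': "preadditive (FgMod scale)"
  by unfold_locales (rule preadditive_FgMod)

lemma FgMod_zero_object: "zero_object (FgMod scale) M \<longleftrightarrow> fg M \<and> mcar M = {0}"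
proof -
  interpret F: preadditive "FgMod scale" by (rule preadditive_FgMod')
  have "restr M (\<lambda>v. v) = (\<lambda>v. 0) \<longleftrightarrow> mcar M = {0}" if "fg M"
    using m_zero[of M] that by (auto simp: restr_def fun_eq_iff[where f = "\<lambda>v. (if _ v then v else 0)"] split: if_splits)
  then show ?thesis by (auto simp: F.zero_object_iff)
qed

subsection \<open>Submodules and quotients\<close>

definition subm :: "'k vec set \<Rightarrow> ('h, 'k) hmod \<Rightarrow> bool" where
  "subm A M \<longleftrightarrow> A \<subseteq> mcar M \<and> 0 \<in> A \<and> (\<forall>v\<in>A. \<forall>w\<in>A. v + w \<in> A) \<and> (\<forall>a. \<forall>v\<in>A. mact M a v \<in> A)"

definition sub :: "('h, 'k) hmod \<Rightarrow> 'k vec set \<Rightarrow> ('h, 'k) hmod" where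
  "sub M A = \<lparr>mcar = A, mact = mact M\<rparr>"

lemma sub_simps [simp]: "mcar (sub M A) = A" "mact (sub M A) = mact M"
  by (simp_all add: sub_def)

lemma subm_lmod: "lmod M \<Longrightarrow> subm A M \<Longrightarrow> lmod (sub M A)"
  unfolding lmod_def subm_def by (auto simp: subset_iff)

lemma subm_fg: "fg M \<Longrightarrow> subm A M \<Longrightarrow> fg (sub M A)"
  unfolding fg_iff using subm_lmod[of M A] m_subspace[of "sub M A"] fdim_subset[of "mcar M" A] by (auto simp: subm_def)

lemma subm_submodule: "subm A M \<Longrightarrow> submodule (sub M A) M"
  by (simp add: subm_def submodule_def)

lemma subm_ker: "f \<in> module_hom M N \<Longrightarrow> lmod M \<Longrightarrow> lmod N \<Longrightarrow> subm {v \<in> mcar M. f v = 0} M"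
  by (simp add: subm_def m_add m_act hom_add hom_act)

lemma subm_image:
  assumes f: "f \<in> module_hom M N" and [simp]: "lmod M" "lmod N" and A: "subm A M"
  shows "subm (f ` A) N"
  unfolding subm_def
proof (intro conjI ballI allI)
  have AM: "v \<in> mcar M" if "v \<in> A" for v using A that by (auto simp: subm_def)
  show "f ` A \<subseteq> mcar N" using AM hom_in[OF f] by blast
  have "0 \<in> A" using A by (simp add: subm_def)
  then show "0 \<in> f ` A" using hom_zero[OF f] by force
  fix v assume "v \<in> f ` A"
  then obtain v' where v: "v' \<in> A" "v = f v'" by blast
  show "mact N a v \<in> f ` A" for a
    using A v hom_act[OF f AM[OF v(1)], of a, symmetric] by (simp add: subm_def)
  fix w assume "w \<in> f ` A"
  then obtain w' where w: "w' \<in> A" "w = f w'" by blast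
  have "v' + w' \<in> A" using A v w by (simp add: subm_def)
  then show "v + w \<in> f ` A" using hom_add[OF f AM[OF v(1)] AM[OF w(1)]] v(2) w(2) by force
qed

lemma subm_self: "lmod M \<Longrightarrow> subm (mcar M) M"
  by (simp add: subm_def m_add m_act)

lemma subm_vimage:
  assumes f: "f \<in> module_hom M N" and "lmod M" "lmod N" and A: "subm A N"
  shows "subm {v \<in> mcar M. f v \<in> A} M"
  using assms by (auto simp: subm_def m_add m_act hom_add hom_act)

lemma incl_hom: "lmod M \<Longrightarrow> subm A M \<Longrightarrow> restr (sub M A) (\<lambda>v. v) \<in> module_hom (sub M A) M"
  by (rule restrI) (auto simp: subm_lmod subm_def)

lemma hom_corestrict: "f \<in> module_hom M N \<Longrightarrow> f ` mcar M \<subseteq> A \<Longrightarrow> f \<in> module_hom M (sub N A)"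
  by (auto simp: module_hom_def)

text \<open>The quotient is realised on the image of a linear map with kernel B. The action is
  defined through a chosen preimage, and two preimages differ by an element of the submodule B, so
  the choice does not matter (\<open>act\<close>).\<close>

lemma quotient_module:
  assumes V: "fg V" and B: "subm B V"
  obtains W p where "fg W" "p \<in> module_hom V W" "p ` mcar V = mcar W" "\<And>v. v \<in> mcar V \<Longrightarrow> p v = 0 \<longleftrightarrow> v \<in> B"
proof -
  note [simp] = fg_lmod[OF V]
  have "vec.subspace B" using m_subspace[OF subm_lmod[OF _ B]] by simp
  then obtain p where p: "\<And>v w. p (v + w) = p v + p w" "\<And>c v. p (smul c v) = smul c (p v)" "\<And>v. p v = 0 \<longleftrightarrow> v \<in> B"
    by (rule projection_along) blast
  have p0: "p 0 = 0" using p(1)[of 0 0] by simp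
  have pd: "p (v - w) = p v - p w" for v w using p(1)[of "v - w" w] by simp
  define r where "r x = (SOME v. v \<in> mcar V \<and> p v = x)" for x
  have r: "r x \<in> mcar V" "p (r x) = x" if "x \<in> p ` mcar V" for x
    using someI_ex[of "\<lambda>v. v \<in> mcar V \<and> p v = x"] that by (auto simp: r_def)
  have act: "p (mact V a (r (p v))) = p (mact V a v)" if v: "v \<in> mcar V" for a v
  proof -
    have "p (r (p v) - v) = 0" using r[of "p v"] v by (simp add: pd)
    then have "r (p v) - v \<in> B" using p(3) by blast
    then have "mact V a (r (p v) - v) \<in> B" using B by (simp add: subm_def)
    then have "p (mact V a (r (p v) - v)) = 0" using p(3) by blast
    moreover have "mact V a (r (p v)) = mact V a (r (p v) - v) + mact V a v"
      using act_add[of V "r (p v) - v" v a] r[of "p v"] v m_diff[of V] by simp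
    ultimately show ?thesis by (simp add: p(1))
  qed
  define W where "W = \<lparr>mcar = p ` mcar V, mact = (\<lambda>a x. p (mact V a (r x)))\<rparr>"
  have W [simp]: "mcar W = p ` mcar V" "\<And>a x. mact W a x = p (mact V a (r x))" by (simp_all add: W_def)
  have "lmod W"
    unfolding lmod_def
  proof (intro conjI ballI allI)
    show "0 \<in> mcar W" using p0 m_zero[of V] by (auto simp: image_iff intro: bexI[of _ 0])
    fix x assume "x \<in> mcar W"
    then obtain v where v: "v \<in> mcar V" "x = p v" by auto
    show "mact W a x \<in> mcar W" for a using v m_act[of V] by (simp add: act)
    show "mact W (a + b) x = mact W a x + mact W b x" for a b using v by (simp add: act add_act p(1))
    show "mact W (a * b) x = mact W a (mact W b x)" for a b using v by (simp add: act mult_act m_act)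
    show "mact W (scale c 1) x = smul c x" for c using v by (simp add: act scale_act p(2))
    fix y assume "y \<in> mcar W"
    then obtain w where w: "w \<in> mcar V" "y = p w" by auto
    show "x + y \<in> mcar W" using v w by (auto simp: m_add image_iff p(1)[symmetric] intro!: bexI[of _ "v + w"])
    show "mact W a (x + y) = mact W a x + mact W a y" for a
      using v w m_add[of V v w] by (simp add: act act_add p(1)[symmetric])
  qed
  moreover have "fdim (mcar W)"
  proof -
    obtain F where F: "finite F" "mcar V \<subseteq> vec.span F" using V by (auto simp: fg_iff fdim_def)
    have "p v \<in> vec.span (p ` F)" if "v \<in> vec.span F" for v
      using that
    proof (induction rule: vec.span_induct)
      case base
      show ?case by (intro vec.subspaceI) (simp_all add: p0 p(1,2) vec.span_zero vec.span_add vec.span_scale)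
    next
      case (step x)
      then show ?case by (intro vec.span_base) auto
    qed
    then show ?thesis using F m_subspace[OF \<open>lmod W\<close>] unfolding fdim_def by (intro conjI exI[of _ "p ` F"]) auto
  qed
  ultimately have "fg W" by (simp add: fg_iff)
  then show thesis
  proof (rule that)
    show "restr V p \<in> module_hom V W" by (rule restrI) (auto simp: p(1) act)
    show "restr V p ` mcar V = mcar W" by (auto simp: restr_def)
    show "restr V p v = 0 \<longleftrightarrow> v \<in> B" if "v \<in> mcar V" for v using that p(3) by (simp add: restr_def)
  qed
qed

subsection \<open>Decomposition into indecomposable modules\<close>

lemma internal_sum:
  assumes M: "fg M" and A: "subm A M" and B: "subm B M" and disj: "A \<inter> B \<subseteq> {0}"
    and cover: "\<And>v. v \<in> mcar M \<Longrightarrow> \<exists>a\<in>A. \<exists>b\<in>B. v = a + b"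
  shows "direct_sum (FgMod scale) [sub M A, sub M B] M"
proof -
  interpret F: preadditive "FgMod scale" by (rule preadditive_FgMod')
  note [simp] = fg_lmod[OF M]
  have lA: "lmod (sub M A)" and lB: "lmod (sub M B)" using A B by (simp_all add: subm_lmod)
  have AM: "v \<in> mcar M" if "v \<in> A" for v using A that by (auto simp: subm_def)
  have BM: "v \<in> mcar M" if "v \<in> B" for v using B that by (auto simp: subm_def)
  obtain p where p: "\<And>v. v \<in> mcar M \<Longrightarrow> p v \<in> A \<and> v - p v \<in> B"
  proof -
    have "\<forall>v\<in>mcar M. \<exists>a. a \<in> A \<and> v - a \<in> B" using cover by force
    then show thesis using that by metis
  qed
  \<comment> \<open>The component in A is characterised by two memberships, so additivity and
    linearity of \<open>p\<close> follow by naming a candidate and checking them.\<close>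
  have uniq: "p v = a" if "v \<in> mcar M" "a \<in> A" "v - a \<in> B" for v a
  proof -
    have "p v - a \<in> A" using m_diff[OF lA, of "p v" a] p that by simp
    moreover have "(v - a) - (v - p v) \<in> B" using m_diff[OF lB, of "v - a" "v - p v"] p that by simp
    then have "p v - a \<in> B" by simp
    ultimately have "p v - a = 0" using disj by blast
    then show ?thesis by simp
  qed
  have p_add: "p (v + w) = p v + p w" if "v \<in> mcar M" "w \<in> mcar M" for v w
  proof (rule uniq)
    show "p v + p w \<in> A" using p that m_add[OF lA, of "p v" "p w"] by simp
    have "(v - p v) + (w - p w) \<in> B" using p that m_add[OF lB, of "v - p v" "w - p w"] by simp
    then show "v + w - (p v + p w) \<in> B" by (simp add: algebra_simps)
  qed (use that in \<open>simp add: m_add\<close>)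
  have p_act: "p (mact M a v) = mact M a (p v)" if "v \<in> mcar M" for a v
  proof (rule uniq)
    show "mact M a (p v) \<in> A" using p that m_act[OF lA, of "p v"] by simp
    have "mact M a (v - p v) \<in> B" using p that m_act[OF lB, of "v - p v"] by simp
    moreover have "mact M a v = mact M a (v - p v) + mact M a (p v)"
      using act_add[of M "v - p v" "p v" a] p that BM AM by simp
    ultimately show "mact M a v - mact M a (p v) \<in> B" by simp
  qed (use that in \<open>simp add: m_act\<close>)
  have pA: "p v = v" if "v \<in> A" for v using that AM[OF that] m_zero[OF lB] by (intro uniq) simp_all
  have pB: "p v = 0" if "v \<in> B" for v using that BM[OF that] m_zero[OF lA] by (intro uniq) simp_all
  have p1: "restr M p \<in> module_hom M (sub M A)"
    by (rule restrI) (simp_all add: p p_add p_act)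
  have p2: "restr M (\<lambda>v. v - p v) \<in> module_hom M (sub M B)"
  proof (rule restrI)
    fix a v assume v: "v \<in> mcar M"
    have "mact M a v = mact M a (v - p v) + mact M a (p v)"
      using act_add[of M "v - p v" "p v" a] p v BM AM by simp
    then have "mact M a v - mact M a (p v) = mact M a (v - p v)" by simp
    then show "mact M a v - p (mact M a v) = mact (sub M B) a (v - p v)" by (simp add: p_act[OF v])
  qed (simp_all add: p p_add)
  show ?thesis
  proof (rule F.direct_sum_pairI)
    show "restr (sub M A) (\<lambda>v. v) \<in> Arr (FgMod scale) (sub M A) M" "restr (sub M B) (\<lambda>v. v) \<in> Arr (FgMod scale) (sub M B) M"
      using A B by (simp_all add: incl_hom)
    show "restr M p \<in> Arr (FgMod scale) M (sub M A)" "restr M (\<lambda>v. v - p v) \<in> Arr (FgMod scale) M (sub M B)"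
      using p1 p2 by simp_all
    show "Cmp (FgMod scale) (sub M A) M (sub M A) (restr M p) (restr (sub M A) (\<lambda>v. v)) = Idn (FgMod scale) (sub M A)"
      using AM pA pB[of 0] m_zero[OF lB] by (auto simp: restr_def)
    show "Cmp (FgMod scale) (sub M B) M (sub M B) (restr M (\<lambda>v. v - p v)) (restr (sub M B) (\<lambda>v. v)) = Idn (FgMod scale) (sub M B)"
      using BM pB m_zero[OF lB] by (auto simp: restr_def)
    show "Cmp (FgMod scale) (sub M A) M (sub M B) (restr M (\<lambda>v. v - p v)) (restr (sub M A) (\<lambda>v. v)) = Zer (FgMod scale) (sub M A) (sub M B)"
      using AM pA pB[of 0] m_zero[OF lB] by (auto simp: restr_def)
    show "Cmp (FgMod scale) (sub M B) M (sub M A) (restr M p) (restr (sub M B) (\<lambda>v. v)) = Zer (FgMod scale) (sub M B) (sub M A)"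
      using BM pB m_zero[OF lB] by (auto simp: restr_def)
    show "Add (FgMod scale) M M (Cmp (FgMod scale) M (sub M A) M (restr (sub M A) (\<lambda>v. v)) (restr M p))
        (Cmp (FgMod scale) M (sub M B) M (restr (sub M B) (\<lambda>v. v)) (restr M (\<lambda>v. v - p v))) = Idn (FgMod scale) M"
      using p by (auto simp: restr_def)
  qed (use M A B in \<open>simp_all add: subm_fg\<close>)
qed

text \<open>The summands of an abstract decomposition are replaced by their images in M: these are
  proper subspaces, so the dimension drops and the induction can proceed.\<close>

lemma fg_indecomposable_sum:
  assumes "fg M"
  shows "\<exists>Us. direct_sum (FgMod scale) Us M \<and> (\<forall>U\<in>set Us. indecomposable (FgMod scale) U)"
  using assms
proof (induction "vec.dim (mcar M)" arbitrary: M rule: less_induct)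
  case less
  interpret F: preadditive "FgMod scale" by (rule preadditive_FgMod')
  note M = less.prems
  note [simp] = fg_lmod[OF M]
  show ?case
  proof (cases "zero_object (FgMod scale) M \<or> indecomposable (FgMod scale) M")
    case True
    then show ?thesis
    proof
      assume "zero_object (FgMod scale) M"
      then show ?thesis by (intro exI[of _ "[]"]) simp
    next
      assume "indecomposable (FgMod scale) M"
      then show ?thesis using M by (intro exI[of _ "[M]"]) (simp add: F.direct_sum_single)
    qed
  next
    case False
    then obtain A B where AB: "direct_sum (FgMod scale) [A, B] M" "\<not> zero_object (FgMod scale) A" "\<not> zero_object (FgMod scale) B"
      using M by (auto simp: indecomposable_def)
    obtain i1 i2 p1 p2 where ip: "i1 \<in> module_hom A M" "i2 \<in> module_hom B M" "p1 \<in> module_hom M A" "p2 \<in> module_hom M B"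
      and e: "(\<lambda>v. p1 (i1 v)) = restr A (\<lambda>v. v)" "(\<lambda>v. p2 (i2 v)) = restr B (\<lambda>v. v)"
      "(\<lambda>v. p2 (i1 v)) = (\<lambda>v. 0)" "(\<lambda>v. p1 (i2 v)) = (\<lambda>v. 0)"
      "(\<lambda>v. i1 (p1 v) + i2 (p2 v)) = restr M (\<lambda>v. v)" and fgAB: "fg A" "fg B" "fg M"
      using AB(1) by (rule F.direct_sum_pairE[unfolded FgMod_simps mem_Collect_eq])
    let ?A = "i1 ` mcar A" and ?B = "i2 ` mcar B"
    have nz: "mcar A \<noteq> {0}" "mcar B \<noteq> {0}" using AB(2,3) fgAB by (simp_all add: FgMod_zero_object)
    have sA: "subm ?A M" and sB: "subm ?B M" using ip fgAB by (simp_all add: subm_image subm_self)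
    have p2A: "p2 v = 0" if "v \<in> ?A" for v using that e(3) by (auto dest: fun_cong)
    have p1B: "p1 v = 0" if "v \<in> ?B" for v using that e(4) by (auto dest: fun_cong)
    have id: "v = i1 (p1 v) + i2 (p2 v)" if "v \<in> mcar M" for v
      using fun_cong[OF e(5), of v] that by (simp add: restr_def)
    have inM: "v \<in> mcar M" if "v \<in> ?A \<or> v \<in> ?B" for v using that hom_in ip(1,2) by blast
    have "?A \<inter> ?B \<subseteq> {0}"
    proof
      fix v assume "v \<in> ?A \<inter> ?B"
      then have "p1 v = 0" "p2 v = 0" "v \<in> mcar M" using p1B p2A inM by blast+
      then show "v \<in> {0}" using id[of v] ip(1,2) fgAB by simp
    qed
    moreover have "\<exists>a\<in>?A. \<exists>b\<in>?B. v = a + b" if "v \<in> mcar M" for v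
      using id[OF that] hom_in[OF ip(3) that] hom_in[OF ip(4) that] by blast
    ultimately have sum: "direct_sum (FgMod scale) [sub M ?A, sub M ?B] M"
      by (rule internal_sum[OF M sA sB])
    have "?A \<noteq> mcar M"
    proof
      assume eq: "?A = mcar M"
      have "w = 0" if w: "w \<in> mcar B" for w
      proof -
        have "p2 (i2 w) = 0" using p2A hom_in[OF ip(2) w] eq by blast
        then show ?thesis using fun_cong[OF e(2), of w] w by (simp add: restr_def)
      qed
      then show False using nz(2) m_zero[OF fg_lmod[OF fgAB(2)]] by blast
    qed
    moreover have "?B \<noteq> mcar M"
    proof
      assume eq: "?B = mcar M"
      have "w = 0" if w: "w \<in> mcar A" for w
      proof -
        have "p1 (i1 w) = 0" using p1B hom_in[OF ip(1) w] eq by blast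
        then show ?thesis using fun_cong[OF e(1), of w] w by (simp add: restr_def)
      qed
      then show False using nz(1) m_zero[OF fg_lmod[OF fgAB(1)]] by blast
    qed
    moreover have "fg (sub M ?A)" "fg (sub M ?B)" using M sA sB by (simp_all add: subm_fg)
    ultimately have dims: "vec.dim (mcar (sub M ?A)) < vec.dim (mcar M)" "vec.dim (mcar (sub M ?B)) < vec.dim (mcar M)"
      using fdim_dim_eq[of "mcar M" ?A] fdim_dim_eq[of "mcar M" ?B] M sA sB by (auto simp: fg_iff subm_def not_le[symmetric])
    obtain As where As: "direct_sum (FgMod scale) As (sub M ?A)" "\<forall>U\<in>set As. indecomposable (FgMod scale) U"
      using less.hyps[OF dims(1)] M sA by (auto simp: subm_fg)
    obtain Bs where Bs: "direct_sum (FgMod scale) Bs (sub M ?B)" "\<forall>U\<in>set Bs. indecomposable (FgMod scale) U"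
      using less.hyps[OF dims(2)] M sB by (auto simp: subm_fg)
    show ?thesis
      using F.direct_sum_append[OF sum As(1) Bs(1)] As(2) Bs(2) by (intro exI[of _ "As @ Bs"]) auto
  qed
qed

text \<open>For large n the kernels and images of the powers of f are stable, and then U is the
  direct sum of the kernel and the image of \<open>f ^^ n\<close>. As U is indecomposable, one of
  the two vanishes.\<close>

lemma fitting:
  assumes U: "indecomposable (FgMod scale) U" and f: "f \<in> module_hom U U"
  shows "bij_betw f (mcar U) (mcar U) \<or> (\<exists>n. \<forall>v\<in>mcar U. (f ^^ n) v = 0)"
proof -
  have fgU: "fg U" using U by (simp add: indecomposable_def)
  note [simp] = fg_lmod[OF fgU]
  have fU: "fdim (mcar U)" using fgU by (simp add: fg_iff)
  have pow_in: "(f ^^ n) v \<in> mcar U" if "v \<in> mcar U" for n v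
    using that by (induction n) (simp_all add: hom_in[OF f])
  have pow_zero [simp]: "(f ^^ n) 0 = 0" for n by (induction n) (simp_all add: hom_zero[OF f])
  \<comment> \<open>The restriction is needed because \<open>f ^^ 0\<close> does not vanish outside
    the carrier.\<close>
  have pow_hom: "restr U (f ^^ n) \<in> module_hom U U" for n
  proof (rule restrI)
    show "(f ^^ n) (v + w) = (f ^^ n) v + (f ^^ n) w" if "v \<in> mcar U" "w \<in> mcar U" for v w
      using that by (induction n) (simp_all add: hom_add[OF f] pow_in)
    show "(f ^^ n) (mact U a v) = mact U a ((f ^^ n) v)" if "v \<in> mcar U" for a v
      using that by (induction n) (simp_all add: hom_act[OF f] pow_in)
  qed (simp_all add: pow_in)
  define I where "I n = (f ^^ n) ` mcar U" for n
  define K where "K n = {v \<in> mcar U. (f ^^ n) v = 0}" for n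
  have "I n = restr U (f ^^ n) ` mcar U" for n by (auto simp: I_def restr_def)
  then have I: "subm (I n) U" for n using subm_image[OF pow_hom _ _ subm_self] by simp
  have "K n = {v \<in> mcar U. restr U (f ^^ n) v = 0}" for n by (auto simp: K_def restr_def)
  then have K: "subm (K n) U" for n using subm_ker[OF pow_hom] by simp
  have fsub: "fdim A" if "subm A U" for A
    using subm_fg[OF fgU that] by (simp add: fg_iff)
  have "I (Suc n) \<subseteq> I n" for n
    using hom_in[OF f] by (auto simp: I_def funpow_swap1 simp del: funpow.simps(2) simp add: funpow_Suc_right)
  then obtain a where a: "\<And>m. a \<le> m \<Longrightarrow> I m = I a" using decreasing_stable[of I] fsub[OF I] by blast
  have "K n \<subseteq> K (Suc n)" for n by (auto simp: K_def hom_zero[OF f])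
  moreover have "K n \<subseteq> mcar U" for n by (auto simp: K_def)
  ultimately obtain b where b: "\<And>m. b \<le> m \<Longrightarrow> K m = K b"
    using increasing_stable[of "mcar U" K] fsub[OF K] fU by blast
  \<comment> \<open>Both chains are stable from here on. Comparing n with n + n gives the trivial
    intersection from the kernels and the covering of U from the images.\<close>
  define n where "n = max a b"
  have II: "I (n + n) = I n" using a[of "n + n"] a[of n] by (simp add: n_def)
  have KK: "K (n + n) = K n" using b[of "n + n"] b[of n] by (simp add: n_def)
  have "direct_sum (FgMod scale) [sub U (K n), sub U (I n)] U"
  proof (rule internal_sum[OF fgU K I])
    show "K n \<inter> I n \<subseteq> {0}"
    proof
      fix x assume "x \<in> K n \<inter> I n"
      then obtain y where y: "y \<in> mcar U" "x = (f ^^ n) y" "(f ^^ n) x = 0" by (auto simp: K_def I_def)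
      then have "y \<in> K (n + n)" by (simp add: K_def funpow_add)
      then have "y \<in> K n" using KK by simp
      then show "x \<in> {0}" using y by (simp add: K_def)
    qed
    fix v assume v: "v \<in> mcar U"
    then have "(f ^^ n) v \<in> I (n + n)" unfolding II by (simp add: I_def)
    then obtain y where y: "y \<in> mcar U" "(f ^^ n) v = (f ^^ (n + n)) y" by (auto simp: I_def)
    have "restr U (f ^^ n) (v - (f ^^ n) y) = 0"
      using y v hom_diff[OF pow_hom, of v "(f ^^ n) y" n] pow_in[OF y(1)] by (simp add: restr_def funpow_add)
    then have "v - (f ^^ n) y \<in> K n" using v y pow_in[OF y(1)] by (simp add: K_def restr_def m_diff)
    then show "\<exists>k\<in>K n. \<exists>i\<in>I n. v = k + i" using y(1) by (intro bexI[of _ "v - (f ^^ n) y"] bexI[of _ "(f ^^ n) y"]) (auto simp: I_def)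
  qed
  then have "zero_object (FgMod scale) (sub U (K n)) \<or> zero_object (FgMod scale) (sub U (I n))"
    using U by (simp add: indecomposable_def)
  then show ?thesis
  proof
    assume "zero_object (FgMod scale) (sub U (K n))"
    then have K0: "K n = {0}" by (simp add: FgMod_zero_object)
    have "inj_on f (mcar U)"
    proof (rule inj_onI)
      fix x y assume xy: "x \<in> mcar U" "y \<in> mcar U" "f x = f y"
      then have f0: "f (x - y) = 0" using hom_diff[OF f] by simp
      have "K (Suc n) = K n" using b[of "Suc n"] b[of n] by (simp add: n_def)
      moreover have "x - y \<in> K (Suc n)"
        using f0 xy by (simp add: K_def m_diff funpow_Suc_right del: funpow.simps(2))
      ultimately have "x - y \<in> {0}" using K0 by blast
      then show "x = y" by simp
    qed
    moreover have "f ` mcar U = mcar U"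
    proof
      show "f ` mcar U \<subseteq> mcar U" using hom_in[OF f] by blast
      have "I n = mcar U"
      proof
        show "mcar U \<subseteq> I n"
        proof
          fix v assume v: "v \<in> mcar U"
          then have "(f ^^ n) v \<in> I (n + n)" unfolding II by (simp add: I_def)
          then obtain y where y: "y \<in> mcar U" "(f ^^ n) v = (f ^^ (n + n)) y" by (auto simp: I_def)
          have "restr U (f ^^ n) (v - (f ^^ n) y) = 0"
            using y v hom_diff[OF pow_hom, of v "(f ^^ n) y" n] pow_in[OF y(1)] by (simp add: restr_def funpow_add)
          then have "v - (f ^^ n) y \<in> K n" using v y pow_in[OF y(1)] by (simp add: K_def restr_def m_diff)
          then have "v = (f ^^ n) y" using K0 by simp
          then show "v \<in> I n" using y by (simp add: I_def)
        qed
      qed (use I[of n] in \<open>simp add: subm_def\<close>)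
      moreover have "I (Suc n) = I n" using a[of "Suc n"] a[of n] by (simp add: n_def)
      moreover have "I (Suc n) \<subseteq> f ` mcar U" using pow_in by (auto simp: I_def)
      ultimately show "mcar U \<subseteq> f ` mcar U" by blast
    qed
    ultimately show ?thesis by (simp add: bij_betw_def)
  next
    assume "zero_object (FgMod scale) (sub U (I n))"
    then have "I n = {0}" by (simp add: FgMod_zero_object)
    then show ?thesis by (auto simp: I_def)
  qed
qed

lemma bij_hom_unit:
  assumes U: "fg U" and f: "f \<in> module_hom U U" and b: "bij_betw f (mcar U) (mcar U)"
  shows "f \<in> Units (End_ring (FgMod scale) U)"
proof -
  interpret F: preadditive "FgMod scale" by (rule preadditive_FgMod')
  note [simp] = fg_lmod[OF U]
  let ?g = "inv_into (mcar U) f"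
  have g: "?g v \<in> mcar U" "f (?g v) = v" if "v \<in> mcar U" for v
    using b that bij_betw_imp_surj_on[OF b] inv_into_into[of v f "mcar U"] f_inv_into_f[of v f "mcar U"] by auto
  have gf: "?g (f v) = v" if "v \<in> mcar U" for v using b that by (simp add: bij_betw_inv_into_left)
  have uniq: "?g x = v" if "v \<in> mcar U" "f v = x" for x v using gf[OF that(1)] that(2) by simp
  have "restr U ?g \<in> module_hom U U"
  proof (rule restrI)
    show "?g (v + w) = ?g v + ?g w" if "v \<in> mcar U" "w \<in> mcar U" for v w
      using that g by (intro uniq) (simp_all add: m_add hom_add[OF f])
    show "?g (mact U a v) = mact U a (?g v)" if "v \<in> mcar U" for a v
      using that g by (intro uniq) (simp_all add: m_act hom_act[OF f])
  qed (simp_all add: g)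
  moreover have "(\<lambda>v. restr U ?g (f v)) = restr U (\<lambda>v. v)"
    using gf hom_in[OF f] hom_out[OF f] uniq[of 0 0] hom_zero[OF f] by (auto simp: restr_def)
  moreover have "(\<lambda>v. f (restr U ?g v)) = restr U (\<lambda>v. v)"
    using g hom_zero[OF f] by (auto simp: restr_def)
  ultimately show ?thesis using f by (auto simp: Units_def intro!: bexI[of _ "restr U ?g"])
qed

text \<open>If neither a nor b = 1 - a were invertible, both would be nilpotent by
  \<open>fitting\<close>. But b v = 0 means a v = v, whence v = 0 by nilpotency of a; so b is
  injective and nilpotent, which forces U = 0.\<close>

lemma local_End_indecomposable:
  assumes U: "indecomposable (FgMod scale) U"
  shows "local_ring (End_ring (FgMod scale) U)"
proof (rule local_ringI)
  interpret F: preadditive "FgMod scale" by (rule preadditive_FgMod')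
  have fgU: "fg U" and nz: "mcar U \<noteq> {0}" using U by (auto simp: indecomposable_def FgMod_zero_object)
  note [simp] = fg_lmod[OF fgU]
  let ?R = "End_ring (FgMod scale) U"
  show "ring ?R" using fgU by (intro F.ring_End) simp
  then interpret R: ring ?R .
  have "Idn (FgMod scale) U \<noteq> Zer (FgMod scale) U U"
    using U F.zero_object_iff[of U] fgU by (auto simp: indecomposable_def)
  then show "\<one>\<^bsub>?R\<^esub> \<noteq> \<zero>\<^bsub>?R\<^esub>" by simp
  fix a assume a: "a \<in> carrier ?R"
  then have ah: "a \<in> module_hom U U" by simp
  define b where "b = \<one>\<^bsub>?R\<^esub> \<ominus>\<^bsub>?R\<^esub> a"
  have bR: "b \<in> carrier ?R" using a by (simp add: b_def del: F.End_ring_simps)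
  then have bh: "b \<in> module_hom U U" by simp
  have "b \<oplus>\<^bsub>?R\<^esub> a = \<one>\<^bsub>?R\<^esub>"
    using a by (simp add: b_def R.minus_eq R.a_assoc R.l_neg del: F.End_ring_simps)
  then have eq: "(\<lambda>v. b v + a v) = restr U (\<lambda>v. v)" by simp
  have ab: "b v = v - a v" if "v \<in> mcar U" for v
  proof -
    have "b v + a v = v" using fun_cong[OF eq, of v] that by (simp add: restr_def)
    then show ?thesis by (simp add: eq_diff_eq)
  qed
  have "a \<in> Units ?R \<or> b \<in> Units ?R"
  proof (rule ccontr)
    assume neg: "\<not> (a \<in> Units ?R \<or> b \<in> Units ?R)"
    obtain n where n: "\<And>v. v \<in> mcar U \<Longrightarrow> (a ^^ n) v = 0"
      using fitting[OF U ah] bij_hom_unit[OF fgU ah] neg by blast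
    obtain m where m: "\<And>v. v \<in> mcar U \<Longrightarrow> (b ^^ m) v = 0"
      using fitting[OF U bh] bij_hom_unit[OF fgU bh] neg by blast
    have inj: "v = 0" if v: "v \<in> mcar U" "b v = 0" for v
    proof -
      have "a v = v" using ab v by simp
      then have "(a ^^ k) v = v" for k by (induction k) simp_all
      then show ?thesis using n v by metis
    qed
    have nilp: "v = 0" if "v \<in> mcar U" "(b ^^ k) v = 0" for v k
      using that
    proof (induction k arbitrary: v)
      case (Suc k)
      have "b v \<in> mcar U" using hom_in[OF bh] Suc by blast
      then have "b v = 0" using Suc by (simp add: funpow_Suc_right del: funpow.simps(2))
      then show ?case using inj Suc by blast
    qed simp
    have "mcar U = {0}" using nilp[OF _ m] m_zero[OF fg_lmod[OF fgU]] by blast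
    with nz show False ..
  qed
  then show "a \<in> Units ?R \<or> \<one>\<^bsub>?R\<^esub> \<ominus>\<^bsub>?R\<^esub> a \<in> Units ?R" by (simp only: b_def)
qed

end

context fd_alg
begin

subsection \<open>Projective modules\<close>

lemma proj_fg: "projective_module scale P \<Longrightarrow> fg P"
  by (simp add: projective_module_def)

text \<open>Projectivity is defined by lifting along surjections; replacing the target by the image
  of \<open>g\<close> covers the case in which only the values of \<open>f\<close> are
  attained.\<close>

lemma proj_lift:
  assumes P: "projective_module scale P" and M: "fg M" and N: "fg N"
    and g: "g \<in> module_hom M N" and f: "f \<in> module_hom P N"
    and sub: "\<And>v. v \<in> mcar P \<Longrightarrow> \<exists>w\<in>mcar M. g w = f v"
  obtains h where "h \<in> module_hom P M" "\<And>v. v \<in> mcar P \<Longrightarrow> g (h v) = f v"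
proof -
  let ?N = "sub N (g ` mcar M)"
  have s: "subm (g ` mcar M) N" using subm_image[OF g _ _ subm_self] M N by simp
  have "g \<in> module_hom M ?N" using g by (rule hom_corestrict) simp
  moreover have "f \<in> module_hom P ?N"
  proof (rule hom_corestrict[OF f], rule image_subsetI)
    fix v assume "v \<in> mcar P"
    then obtain w where "w \<in> mcar M" "g w = f v" using sub by blast
    then show "f v \<in> g ` mcar M" by (metis imageI)
  qed
  moreover have "fg ?N" using N s by (rule subm_fg)
  ultimately have "\<exists>h\<in>module_hom P M. \<forall>v\<in>mcar P. g (h v) = f v"
    using P M unfolding projective_module_def by (metis sub_simps(1))
  then show thesis using that by blast
qed

lemma vpair_simps [simp]:
  "vfst (vpair v w) = v" "vsnd (vpair v w) = w" "vpair (vfst u) (vsnd u) = u"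
  "vfst (u + u') = vfst u + vfst u'" "vsnd (u + u') = vsnd u + vsnd u'"
  "vfst (- u) = - vfst u" "vsnd (- u) = - vsnd u"
  "vfst (u - u') = vfst u - vfst u'" "vsnd (u - u') = vsnd u - vsnd u'"
  "vfst 0 = 0" "vsnd 0 = 0" "vfst (smul c u) = smul c (vfst u)" "vsnd (smul c u) = smul c (vsnd u)"
  by (auto simp: vfst_def vsnd_def vpair_def smul_def fun_eq_iff zero_fun_apply plus_fun_apply minus_apply uminus_apply
      elim!: evenE oddE)

lemma vpair_eqI: "vfst u = vfst u' \<Longrightarrow> vsnd u = vsnd u' \<Longrightarrow> u = u'" for u u' :: "'k vec"
  using vpair_simps(3)[of u] vpair_simps(3)[of u'] by metis

lemma vpair_arith: "vpair v w + vpair v' w' = vpair (v + v') (w + w')" "vpair v w - vpair v' w' = vpair (v - v') (w - w')"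
  "- vpair v w = vpair (- v) (- w)" "smul c (vpair v w) = vpair (smul c v) (smul c w)" "vpair 0 0 = (0 :: 'k vec)"
  for v w v' w' :: "'k vec"
  by (rule vpair_eqI; simp)+

lemma mod_sum_simps [simp]:
  "u \<in> mcar (mod_sum M N) \<longleftrightarrow> vfst u \<in> mcar M \<and> vsnd u \<in> mcar N"
  "mact (mod_sum M N) a u = vpair (mact M a (vfst u)) (mact N a (vsnd u))"
  by (simp_all add: mod_sum_def)

lemma lmod_mod_sum: "lmod M \<Longrightarrow> lmod N \<Longrightarrow> lmod (mod_sum M N)"
  unfolding lmod_def by (simp add: vpair_arith(1)) (simp flip: vpair_arith(4))

lemma fg_mod_sum [simp]:
  assumes "fg M" "fg N"
  shows "fg (mod_sum M N)"
proof -
  obtain B where B: "finite B" "mcar M \<subseteq> vec.span B" using assms(1) by (auto simp: fg_iff fdim_def)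
  obtain C where C: "finite C" "mcar N \<subseteq> vec.span C" using assms(2) by (auto simp: fg_iff fdim_def)
  let ?F = "(\<lambda>v. vpair v 0) ` B \<union> vpair 0 ` C"
  have 1: "vpair v 0 \<in> vec.span ?F" if "v \<in> vec.span B" for v
    using that
  proof (induction rule: vec.span_induct)
    case base
    show ?case
    proof (rule vec.subspaceI)
      fix c x y assume "x \<in> {v. vpair v 0 \<in> vec.span ?F}" "y \<in> {v. vpair v 0 \<in> vec.span ?F}"
      then show "x + y \<in> {v. vpair v 0 \<in> vec.span ?F}" "smul c x \<in> {v. vpair v 0 \<in> vec.span ?F}"
        using vec.span_add[of "vpair x 0" ?F "vpair y 0"] vec.span_scale[of "vpair x 0" ?F c] by (simp_all add: vpair_arith)
    qed (simp add: vpair_arith vec.span_zero)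
  next
    case (step x)
    then show ?case by (intro vec.span_base) auto
  qed
  have 2: "vpair 0 v \<in> vec.span ?F" if "v \<in> vec.span C" for v
    using that
  proof (induction rule: vec.span_induct)
    case base
    show ?case
    proof (rule vec.subspaceI)
      fix c x y assume "x \<in> {v. vpair 0 v \<in> vec.span ?F}" "y \<in> {v. vpair 0 v \<in> vec.span ?F}"
      then show "x + y \<in> {v. vpair 0 v \<in> vec.span ?F}" "smul c x \<in> {v. vpair 0 v \<in> vec.span ?F}"
        using vec.span_add[of "vpair 0 x" ?F "vpair 0 y"] vec.span_scale[of "vpair 0 x" ?F c] by (simp_all add: vpair_arith)
    qed (simp add: vpair_arith vec.span_zero)
  next
    case (step x)
    then show ?case by (intro vec.span_base) auto
  qed
  have "u \<in> vec.span ?F" if "u \<in> mcar (mod_sum M N)" for u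
  proof -
    have "vpair (vfst u) 0 + vpair 0 (vsnd u) \<in> vec.span ?F"
      using that 1[of "vfst u"] 2[of "vsnd u"] B C by (intro vec.span_add) auto
    then show ?thesis by (simp add: vpair_arith)
  qed
  then have "mcar (mod_sum M N) \<subseteq> vec.span ?F" by blast
  moreover have "finite ?F" using B C by simp
  moreover have "lmod (mod_sum M N)" using assms by (simp add: lmod_mod_sum)
  ultimately show ?thesis using m_subspace unfolding fg_iff fdim_def by blast
qed

definition zmod :: "('h, 'k) hmod" where
  "zmod = \<lparr>mcar = {0}, mact = (\<lambda>a v. 0)\<rparr>"

lemma zmod_simps [simp]: "mcar zmod = {0}" "mact zmod a v = 0"
  by (simp_all add: zmod_def)

lemma fg_zmod [simp]: "fg zmod"
proof -
  have "lmod zmod" by (simp add: lmod_def)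
  then show ?thesis using m_subspace[of zmod] by (auto simp: fg_iff fdim_def intro!: exI[of _ "{}"])
qed

lemma proj_zmod: "projective_module scale zmod"
  unfolding projective_module_def
proof (intro conjI allI ballI impI)
  fix M N g f assume g: "g \<in> module_hom M N" and f: "f \<in> module_hom zmod N" and "fg M \<and> fg N \<and> g ` mcar M = mcar N"
  then have "lmod M" "f 0 = 0" "g 0 = 0" using hom_zero[OF f] hom_zero[OF g] by simp_all
  then show "\<exists>h\<in>module_hom zmod M. \<forall>v\<in>mcar zmod. g (h v) = f v"
    by (intro bexI[of _ "\<lambda>v. 0"]) (simp_all add: zero_hom)
qed simp

lemma proj_mod_sum:
  assumes P: "projective_module scale P" and Q: "projective_module scale Q"
  shows "projective_module scale (mod_sum P Q)"
  unfolding projective_module_def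
proof (intro conjI allI ballI impI)
  show "fg (mod_sum P Q)" using proj_fg[OF P] proj_fg[OF Q] by simp
  fix M N g f assume g: "g \<in> module_hom M N" and f: "f \<in> module_hom (mod_sum P Q) N" and MN: "fg M \<and> fg N \<and> g ` mcar M = mcar N"
  have lP: "lmod P" and lQ: "lmod Q" and lM: "lmod M" using proj_fg[OF P] proj_fg[OF Q] MN by simp_all
  note [simp] = m_zero[OF lP] m_zero[OF lQ] act_zero[OF lP] act_zero[OF lQ]
  have sur: "\<exists>w\<in>mcar M. g w = x" if "x \<in> mcar N" for x using MN that by (metis imageE)
  have f1: "restr P (\<lambda>v. f (vpair v 0)) \<in> module_hom P N"
    by (rule restrI[OF lP])
      (use hom_in[OF f, of "vpair _ 0"] hom_add[OF f, of "vpair _ 0" "vpair _ 0"] hom_act[OF f, of "vpair _ 0"] in \<open>simp_all add: vpair_arith\<close>)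
  have f2: "restr Q (\<lambda>v. f (vpair 0 v)) \<in> module_hom Q N"
    by (rule restrI[OF lQ])
      (use hom_in[OF f, of "vpair 0 _"] hom_add[OF f, of "vpair 0 _" "vpair 0 _"] hom_act[OF f, of "vpair 0 _"] in \<open>simp_all add: vpair_arith\<close>)
  obtain h1 where h1: "h1 \<in> module_hom P M" "\<And>v. v \<in> mcar P \<Longrightarrow> g (h1 v) = restr P (\<lambda>v. f (vpair v 0)) v"
    using proj_lift[OF P _ _ g f1] MN sur hom_in[OF f1] by blast
  obtain h2 where h2: "h2 \<in> module_hom Q M" "\<And>v. v \<in> mcar Q \<Longrightarrow> g (h2 v) = restr Q (\<lambda>v. f (vpair 0 v)) v"
    using proj_lift[OF Q _ _ g f2] MN sur hom_in[OF f2] by blast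
  let ?h = "restr (mod_sum P Q) (\<lambda>u. h1 (vfst u) + h2 (vsnd u))"
  have "?h \<in> module_hom (mod_sum P Q) M"
    using lmod_mod_sum[OF lP lQ] lM h1(1) h2(1)
    by (intro restrI) (simp_all add: hom_in hom_add hom_act m_add act_add ac_simps)
  moreover have "g (?h u) = f u" if u: "u \<in> mcar (mod_sum P Q)" for u
  proof -
    have "g (?h u) = f (vpair (vfst u) 0) + f (vpair 0 (vsnd u))"
      using u h1 h2 by (simp add: restr_def hom_add[OF g] hom_in)
    also have "\<dots> = f u" using u hom_add[OF f, of "vpair (vfst u) 0" "vpair 0 (vsnd u)"] by (simp add: vpair_arith)
    finally show ?thesis .
  qed
  ultimately show "\<exists>h\<in>module_hom (mod_sum P Q) M. \<forall>v\<in>mcar (mod_sum P Q). g (h v) = f v" by blast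
qed

text \<open>\<open>R\<close> is the regular module in coordinates, and \<open>e\<close> its unit element.\<close>

lemma regular_module:
  obtains R e where "projective_module scale R" "e \<in> mcar R"
    "\<And>M t. fg M \<Longrightarrow> t \<in> mcar M \<Longrightarrow> \<exists>f\<in>module_hom R M. f e = t"
proof -
  obtain B where B: "finite B" "hs.independent B" "hs.span B = UNIV" by (rule h_basis)
  obtain b where b: "bij_betw b {0..<card B} B" using ex_bij_betw_nat_finite[OF B(1)] by blast
  \<comment> \<open>Coordinates from \<open>card B\<close> on are zero, which places the algebra in
    a finite-dimensional subspace of the sequence space.\<close>
  define enc where "enc x = (\<lambda>n. if n < card B then hs.representation B x (b n) else 0)" for x
  have enc_add: "enc (x + y) = enc x + enc y" for x y
    by (rule ext) (simp add: enc_def plus_fun_apply hs.representation_add[OF B(2)] B(3))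
  have enc_scale: "enc (scale c x) = smul c (enc x)" for c x
    by (rule ext) (simp add: enc_def smul_def hs.representation_scale[OF B(2)] B(3))
  have enc_inj: "x = y" if "enc x = enc y" for x y
  proof -
    have "hs.representation B x v = hs.representation B y v" if "v \<in> B" for v
    proof -
      have "v \<in> b ` {0..<card B}" using b \<open>v \<in> B\<close> by (simp add: bij_betw_def)
      then obtain n where "n < card B" "v = b n" by auto
      then show ?thesis using fun_cong[OF \<open>enc x = enc y\<close>, of n] by (simp add: enc_def)
    qed
    moreover have "(\<Sum>v\<in>B. scale (hs.representation B z v) v) = z" for z
      using hs.sum_representation_eq[OF B(2) _ B(1)] B(3) by simp
    ultimately show ?thesis by (metis (no_types, lifting) sum.cong)
  qed
  define dec where "dec v = (SOME x. enc x = v)" for v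
  have dec [simp]: "dec (enc x) = x" for x
    unfolding dec_def by (rule some_equality) (auto intro: enc_inj)
  have enc0: "enc 0 = 0" using enc_add[of 0 0] by simp
  define R :: "('h, 'k) hmod" where "R = \<lparr>mcar = range enc, mact = (\<lambda>a v. enc (a * dec v))\<rparr>"
  have R [simp]: "mcar R = range enc" "mact R a v = enc (a * dec v)" for a v by (simp_all add: R_def)
  have lR: "lmod R"
    unfolding lmod_def
    by (auto simp: enc_add[symmetric] enc_scale[symmetric] algebra_simps scale_mult) (metis enc0 rangeI)
  have "mcar R \<subseteq> vec.span (enc ` B)"
  proof
    fix v assume "v \<in> mcar R"
    then obtain x where x: "v = enc x" by auto
    have "x \<in> hs.span B" using B by simp
    then have "enc x \<in> vec.span (enc ` B)"
    proof (induction rule: hs.span_induct)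
      case base
      show ?case by (intro hs.subspaceI) (simp_all add: enc0 enc_add enc_scale vec.span_zero vec.span_add vec.span_scale)
    next
      case (step x)
      then show ?case by (intro vec.span_base) auto
    qed
    then show "v \<in> vec.span (enc ` B)" using x by simp
  qed
  then have fgR: "fg R" using lR m_subspace[OF lR] B(1) unfolding fg_iff fdim_def by blast
  have ex: "\<exists>f\<in>module_hom R M. f (enc 1) = t" if M: "fg M" and t: "t \<in> mcar M" for M t
  proof
    note [simp] = fg_lmod[OF M]
    show "restr R (\<lambda>v. mact M (dec v) t) \<in> module_hom R M"
      using lR t by (intro restrI) (auto simp: m_act add_act mult_act enc_add[symmetric])
    show "restr R (\<lambda>v. mact M (dec v) t) (enc 1) = t" using t by (simp add: restr_def one_act)
  qed
  have "projective_module scale R"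
    unfolding projective_module_def
  proof (intro conjI allI ballI impI fgR)
    fix M N g f assume g: "g \<in> module_hom M N" and f: "f \<in> module_hom R N" and MN: "fg M \<and> fg N \<and> g ` mcar M = mcar N"
    have "f (enc 1) \<in> mcar N" using hom_in[OF f] by simp
    then obtain t where t: "t \<in> mcar M" "g t = f (enc 1)" using MN by (metis imageE)
    obtain h where h: "h \<in> module_hom R M" "h (enc 1) = t" using ex t MN by blast
    have "g (h v) = f v" if "v \<in> mcar R" for v
    proof -
      obtain x where v: "v = enc x" using \<open>v \<in> mcar R\<close> by auto
      have 1: "v = mact R x (enc 1)" "enc 1 \<in> mcar R" by (simp_all add: v)
      have "g (h v) = mact N x (g t)"
        using hom_act[OF h(1) 1(2), of x] hom_act[OF g t(1), of x] h(2) 1(1) by metis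
      also have "\<dots> = f v" using t(2) hom_act[OF f 1(2), of x] 1(1) by metis
      finally show ?thesis .
    qed
    then show "\<exists>h\<in>module_hom R M. \<forall>v\<in>mcar R. g (h v) = f v" using h(1) by blast
  qed
  then show thesis using ex by (intro that[of R "enc 1"]) auto
qed

text \<open>One copy of the regular module is added for each element to be reached.\<close>

lemma proj_onto_finite:
  assumes "finite T" "fg M" "T \<subseteq> mcar M"
  shows "\<exists>P. projective_module scale P \<and> (\<exists>\<pi>\<in>module_hom P M. T \<subseteq> \<pi> ` mcar P)"
  using assms
proof (induction T rule: finite_induct)
  case empty
  then show ?case using proj_zmod zero_hom[of M zmod] by auto
next
  case (insert t T)
  then obtain P \<pi> where P: "projective_module scale P" "\<pi> \<in> module_hom P M" "T \<subseteq> \<pi> ` mcar P" by auto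
  obtain R e where R: "projective_module scale R" "e \<in> mcar R"
    and ex: "\<And>M t. fg M \<Longrightarrow> t \<in> mcar M \<Longrightarrow> \<exists>f\<in>module_hom R M. f e = t" by (rule regular_module) blast
  obtain f where f: "f \<in> module_hom R M" "f e = t" using ex insert by blast
  have l: "lmod R" "lmod P" "lmod M" using proj_fg[OF R(1)] proj_fg[OF P(1)] insert by simp_all
  let ?p = "restr (mod_sum R P) (\<lambda>u. f (vfst u) + \<pi> (vsnd u))"
  have "?p \<in> module_hom (mod_sum R P) M"
    using lmod_mod_sum[OF l(1,2)] l(3) f(1) P(2)
    by (intro restrI) (simp_all add: hom_in hom_add hom_act m_add act_add ac_simps)
  moreover have "insert t T \<subseteq> ?p ` mcar (mod_sum R P)"
  proof
    fix x assume "x \<in> insert t T"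
    then consider "x = t" | v where "v \<in> mcar P" "x = \<pi> v" using P(3) by blast
    then show "x \<in> ?p ` mcar (mod_sum R P)"
    proof cases
      case 1
      then show ?thesis
        using R(2) l f P(2) by (intro image_eqI[of _ _ "vpair e 0"]) (simp_all add: restr_def)
    next
      case 2
      then show ?thesis
        using l f(1) by (intro image_eqI[of _ _ "vpair 0 v"]) (simp_all add: restr_def)
    qed
  qed
  ultimately show ?case using proj_mod_sum[OF R(1) P(1)] by blast
qed

text \<open>The last clause, obtained by treating the zero module separately, keeps the resolution
  of a bounded complex bounded and ties its projectives to the degrees in which the complex
  lives.\<close>

lemma proj_cover:
  assumes M: "fg M"
  obtains P \<pi> where "projective_module scale P" "\<pi> \<in> module_hom P M" "\<pi> ` mcar P = mcar M"
    "mcar M = {0} \<Longrightarrow> mcar P = {0}"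
proof (cases "mcar M = {0}")
  case True
  show thesis
  proof (rule that[OF proj_zmod zero_hom])
    show "lmod M" using M by simp
  qed (simp_all add: True)
next
  case False
  obtain T where T: "finite T" "T \<subseteq> mcar M" "mcar M \<subseteq> vec.span T"
    using fdim_basis[of "mcar M"] M by (metis fg_iff)
  obtain P \<pi> where P: "projective_module scale P" "\<pi> \<in> module_hom P M" "T \<subseteq> \<pi> ` mcar P"
    using proj_onto_finite[OF T(1) M T(2)] by blast
  have lM: "lmod M" and lP: "lmod P" using M proj_fg[OF P(1)] by simp_all
  have s: "subm (\<pi> ` mcar P) M" using subm_image[OF P(2) lP lM subm_self[OF lP]] .
  have "vec.span T \<subseteq> \<pi> ` mcar P"
    using m_subspace[OF subm_lmod[OF lM s]] P(3) by (intro vec.span_minimal) simp_all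
  moreover have "\<pi> ` mcar P \<subseteq> mcar M" using hom_in[OF P(2)] by blast
  ultimately have "\<pi> ` mcar P = mcar M" using T(3) by blast
  with P show thesis using that False by blast
qed

end

context fd_alg
begin

section \<open>Complexes and homotopy\<close>

abbreviation "bc \<equiv> bounded_complex scale"

lemma c_fg [simp]: "bc X \<Longrightarrow> fg (cmod X n)"
  and c_dif: "bc X \<Longrightarrow> cdif X n \<in> module_hom (cmod X n) (cmod X (n + 1))"
  and c_dd [simp]: "bc X \<Longrightarrow> cdif X (n + 1) (cdif X n v) = 0"
  by (simp_all add: bounded_complex_def)

lemma c_lmod [simp]: "bc X \<Longrightarrow> lmod (cmod X n)"
  by simp

lemma c_dif': "bc X \<Longrightarrow> cdif X (n - 1) \<in> module_hom (cmod X (n - 1)) (cmod X n)"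
  using c_dif[of X "n - 1"] by simp

lemma c_dd' [simp]: "bc X \<Longrightarrow> cdif X n (cdif X (n - 1) v) = 0"
  using c_dd[of X "n - 1"] by simp

lemma ch_hom: "f \<in> chain_maps X Y \<Longrightarrow> f n \<in> module_hom (cmod X n) (cmod Y n)"
  and ch_com: "f \<in> chain_maps X Y \<Longrightarrow> f (n + 1) (cdif X n v) = cdif Y n (f n v)"
  by (simp_all add: chain_maps_def)

lemma ch_com': "f \<in> chain_maps X Y \<Longrightarrow> f n (cdif X (n - 1) v) = cdif Y (n - 1) (f (n - 1) v)"
  using ch_com[of f X Y "n - 1"] by simp

text \<open>\<open>chain_maps\<close> asks for commutation on all vectors; outside the carrier both
  sides are zero, so checking carriers suffices. \<open>homotopicI\<close> plays the same role for
  homotopies.\<close>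

lemma chI: "\<lbrakk>\<And>n. f n \<in> module_hom (cmod X n) (cmod Y n); \<And>n v. v \<in> mcar (cmod X n) \<Longrightarrow> f (n + 1) (cdif X n v) = cdif Y n (f n v);
   bc X; bc Y\<rbrakk> \<Longrightarrow> f \<in> chain_maps X Y"
  unfolding chain_maps_def
proof (intro CollectI conjI allI)
  fix n v
  assume f: "\<And>n. f n \<in> module_hom (cmod X n) (cmod Y n)" "\<And>n v. v \<in> mcar (cmod X n) \<Longrightarrow> f (n + 1) (cdif X n v) = cdif Y n (f n v)"
    and [simp]: "bc X" "bc Y"
  show "f (n + 1) (cdif X n v) = cdif Y n (f n v)"
  proof (cases "v \<in> mcar (cmod X n)")
    case False
    then show ?thesis
      using hom_out[OF c_dif[of X n]] hom_out[OF f(1)[of n]] hom_zero[OF f(1)[of "n + 1"]] hom_zero[OF c_dif[of Y n]] by simp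
  qed (rule f(2))
qed

text \<open>Complexes with honest chain maps. Biproducts are built here, where maps are functions,
  and carried to homotopy classes and roofs by additive functors.\<close>

definition Ch :: "(('h, 'k) cplx, 'k cmap) precat" where
  "Ch = \<lparr>Ob = {X. bc X}, Arr = chain_maps, Idn = (\<lambda>X n. restr (cmod X n) (\<lambda>v. v)),
     Cmp = (\<lambda>X Y Z g f n v. g n (f n v)), Add = (\<lambda>X Y f g n v. f n v + g n v), Zer = (\<lambda>X Y n v. 0)\<rparr>"

lemma Ch_simps [simp]:
  "Ob Ch = {X. bc X}" "Arr Ch = chain_maps" "Idn Ch X = (\<lambda>n. restr (cmod X n) (\<lambda>v. v))"
  "Cmp Ch X Y Z g f = (\<lambda>n v. g n (f n v))" "Add Ch X Y f g = (\<lambda>n v. f n v + g n v)" "Zer Ch X Y = (\<lambda>n v. 0)"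
  by (simp_all add: Ch_def)

lemma ch_idn: "bc X \<Longrightarrow> (\<lambda>n. restr (cmod X n) (\<lambda>v. v)) \<in> chain_maps X X"
proof (rule chI)
  fix n v assume "bc X" "v \<in> mcar (cmod X n)"
  then show "restr (cmod X (n + 1)) (\<lambda>v. v) (cdif X n v) = cdif X n (restr (cmod X n) (\<lambda>v. v) v)"
    using hom_in[OF c_dif[of X n]] by (simp add: restr_def)
qed (simp_all add: idn_hom)

lemma ch_cmp: "\<lbrakk>f \<in> chain_maps X Y; g \<in> chain_maps Y Z; bc X; bc Y; bc Z\<rbrakk> \<Longrightarrow> (\<lambda>n v. g n (f n v)) \<in> chain_maps X Z"
  by (rule chI) (auto simp: ch_com intro: cmp_hom[OF ch_hom ch_hom])

lemma ch_add: "\<lbrakk>f \<in> chain_maps X Y; g \<in> chain_maps X Y; bc X; bc Y\<rbrakk> \<Longrightarrow> (\<lambda>n v. f n v + g n v) \<in> chain_maps X Y"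
  by (rule chI) (auto simp: ch_com hom_add[OF c_dif] hom_in[OF ch_hom] intro: add_hom[OF ch_hom ch_hom])

lemma ch_neg: "\<lbrakk>f \<in> chain_maps X Y; bc X; bc Y\<rbrakk> \<Longrightarrow> (\<lambda>n v. - f n v) \<in> chain_maps X Y"
  by (rule chI) (auto simp: ch_com hom_neg[OF c_dif] hom_in[OF ch_hom] intro: neg_hom[OF ch_hom])

lemma ch_zero: "\<lbrakk>bc X; bc Y\<rbrakk> \<Longrightarrow> (\<lambda>n v. 0) \<in> chain_maps X Y"
  by (rule chI) (auto simp: hom_zero[OF c_dif] zero_hom)

lemma preadditive_Ch: "preadditive_category Ch"
  unfolding preadditive_category_def
proof (intro conjI ballI)
  show "category Ch"
    unfolding category_def
  proof (intro conjI ballI)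
    fix X Y f assume "X \<in> Ob Ch" "Y \<in> Ob Ch" "f \<in> Arr Ch X Y"
    then have XY: "bc X" "bc Y" and f: "f \<in> chain_maps X Y" by simp_all
    have "f n (restr (cmod X n) (\<lambda>v. v) v) = f n v" "restr (cmod Y n) (\<lambda>v. v) (f n v) = f n v" for n v
      using XY hom_in[OF ch_hom[OF f], of v n] hom_out[OF ch_hom[OF f], of v n] hom_zero[OF ch_hom[OF f], of n]
      by (cases "v \<in> mcar (cmod X n)"; simp add: restr_def)+
    then show "Cmp Ch X X Y f (Idn Ch X) = f" "Cmp Ch X Y Y (Idn Ch Y) f = f" by simp_all
  qed (auto simp: ch_idn intro: ch_cmp)
  fix X Y assume "X \<in> Ob Ch" "Y \<in> Ob Ch"
  then have XY: "bc X" "bc Y" by simp_all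
  show "comm_group (hom_group Ch X Y)"
  proof (rule comm_groupI)
    fix f assume "f \<in> carrier (hom_group Ch X Y)"
    then show "\<exists>g\<in>carrier (hom_group Ch X Y). g \<otimes>\<^bsub>hom_group Ch X Y\<^esub> f = \<one>\<^bsub>hom_group Ch X Y\<^esub>"
      using XY ch_neg[of f X Y] by (intro bexI[of _ "\<lambda>n v. - f n v"]) auto
  qed (use XY in \<open>auto simp: ch_zero ch_add ac_simps\<close>)
next
  fix X Y Z f f' g g'
  assume "X \<in> Ob Ch" "Y \<in> Ob Ch" "Z \<in> Ob Ch" and "f \<in> Arr Ch X Y" "f' \<in> Arr Ch X Y" and "g \<in> Arr Ch Y Z"
  then have fg: "f \<in> chain_maps X Y" "f' \<in> chain_maps X Y" "g \<in> chain_maps Y Z" and b: "bc Y" by simp_all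
  have "g n (f n v + f' n v) = g n (f n v) + g n (f' n v)" for n v
    using hom_add[OF ch_hom[OF fg(3)]] hom_in[OF ch_hom[OF fg(1)]] hom_in[OF ch_hom[OF fg(2)]]
      hom_out[OF ch_hom[OF fg(1)]] hom_out[OF ch_hom[OF fg(2)]] hom_zero[OF ch_hom[OF fg(3)]] b
    by (cases "v \<in> mcar (cmod X n)") simp_all
  then show "Cmp Ch X Y Z g (Add Ch X Y f f') = Add Ch X Z (Cmp Ch X Y Z g f) (Cmp Ch X Y Z g f')" by simp
qed auto

lemma homotopicE:
  assumes "homotopic X Y f g"
  obtains h where "\<And>n. h n \<in> module_hom (cmod X n) (cmod Y (n - 1))"
    "\<And>n v. f n v - g n v = cdif Y (n - 1) (h n v) + h (n + 1) (cdif X n v)"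
  using assms unfolding homotopic_def by blast

lemma homotopicI:
  assumes h: "\<And>n. h n \<in> module_hom (cmod X n) (cmod Y (n - 1))"
    and f: "f \<in> chain_maps X Y" and g: "g \<in> chain_maps X Y" and b: "bc X" "bc Y"
    and eq: "\<And>n v. v \<in> mcar (cmod X n) \<Longrightarrow> f n v - g n v = cdif Y (n - 1) (h n v) + h (n + 1) (cdif X n v)"
  shows "homotopic X Y f g"
  unfolding homotopic_def
proof (intro exI[of _ h] conjI allI h)
  fix n v
  show "f n v - g n v = cdif Y (n - 1) (h n v) + h (n + 1) (cdif X n v)"
  proof (cases "v \<in> mcar (cmod X n)")
    case False
    then show ?thesis
      using b hom_out[OF ch_hom[OF f]] hom_out[OF ch_hom[OF g]] hom_out[OF h[of n]] hom_out[OF c_dif[OF b(1)]]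
        hom_zero[OF c_dif[OF b(2), of "n - 1"]] hom_zero[OF h[of "n + 1"]] by simp
  qed (rule eq)
qed

lemma homotopic_refl:
  assumes "f \<in> chain_maps X Y" "bc X" "bc Y"
  shows "homotopic X Y f f"
  by (rule homotopicI[where h = "\<lambda>n v. 0"]) (use assms hom_zero[OF c_dif] in \<open>simp_all add: zero_hom\<close>)

lemma homotopic_sym:
  assumes "homotopic X Y f g" "f \<in> chain_maps X Y" "g \<in> chain_maps X Y" "bc X" "bc Y"
  shows "homotopic X Y g f"
  using assms(1)
proof (rule homotopicE)
  fix h assume h: "\<And>n. h n \<in> module_hom (cmod X n) (cmod Y (n - 1))"
    "\<And>n v. f n v - g n v = cdif Y (n - 1) (h n v) + h (n + 1) (cdif X n v)"
  show ?thesis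
  proof (rule homotopicI)
    show "(\<lambda>v. - h n v) \<in> module_hom (cmod X n) (cmod Y (n - 1))" for n using neg_hom[OF h(1)] assms by simp
    fix n v assume v: "v \<in> mcar (cmod X n)"
    have "g n v - f n v = - (f n v - g n v)" by simp
    also have "\<dots> = cdif Y (n - 1) (- h n v) + - h (n + 1) (cdif X n v)"
      unfolding h(2) using v assms hom_in[OF h(1)] hom_neg[OF c_dif'[of Y n]] by simp
    finally show "g n v - f n v = cdif Y (n - 1) (- h n v) + - h (n + 1) (cdif X n v)" .
  qed (use assms in auto)
qed

lemma homotopic_add:
  assumes "homotopic X Y f g" "homotopic X Y f' g'" "f \<in> chain_maps X Y" "g \<in> chain_maps X Y"
    "f' \<in> chain_maps X Y" "g' \<in> chain_maps X Y" "bc X" "bc Y"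
  shows "homotopic X Y (\<lambda>n v. f n v + f' n v) (\<lambda>n v. g n v + g' n v)"
proof -
  obtain h where h: "\<And>n. h n \<in> module_hom (cmod X n) (cmod Y (n - 1))"
    "\<And>n v. f n v - g n v = cdif Y (n - 1) (h n v) + h (n + 1) (cdif X n v)" using assms(1) by (rule homotopicE) blast
  obtain k where k: "\<And>n. k n \<in> module_hom (cmod X n) (cmod Y (n - 1))"
    "\<And>n v. f' n v - g' n v = cdif Y (n - 1) (k n v) + k (n + 1) (cdif X n v)" using assms(2) by (rule homotopicE) blast
  show ?thesis
  proof (rule homotopicI)
    show "(\<lambda>v. h n v + k n v) \<in> module_hom (cmod X n) (cmod Y (n - 1))" for n using add_hom[OF h(1) k(1)] assms by simp
    fix n v assume v: "v \<in> mcar (cmod X n)"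
    have "(f n v + f' n v) - (g n v + g' n v) = (f n v - g n v) + (f' n v - g' n v)" by simp
    also have "\<dots> = cdif Y (n - 1) (h n v + k n v) + (h (n + 1) (cdif X n v) + k (n + 1) (cdif X n v))"
      unfolding h(2) k(2) using hom_add[OF c_dif'[OF assms(8), of n] hom_in[OF h(1) v] hom_in[OF k(1) v]] by (simp add: ac_simps)
    finally show "(f n v + f' n v) - (g n v + g' n v) = cdif Y (n - 1) (h n v + k n v) + (h (n + 1) (cdif X n v) + k (n + 1) (cdif X n v))" .
  qed (use assms ch_add in auto)
qed

text \<open>Adding the two homotopies compares f + g with g + k, and the difference of these is f -
  k.\<close>

lemma homotopic_trans:
  assumes "homotopic X Y f g" "homotopic X Y g k" "f \<in> chain_maps X Y" "g \<in> chain_maps X Y" "k \<in> chain_maps X Y" "bc X" "bc Y"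
  shows "homotopic X Y f k"
proof -
  have "homotopic X Y (\<lambda>n v. f n v + g n v) (\<lambda>n v. g n v + k n v)"
    using assms by (intro homotopic_add)
  then show ?thesis unfolding homotopic_def by (simp add: algebra_simps)
qed

lemma homotopic_cmp_left:
  assumes "homotopic X Y f g" and k: "k \<in> chain_maps Y Z" and fg: "f \<in> chain_maps X Y" "g \<in> chain_maps X Y" and b: "bc X" "bc Y" "bc Z"
  shows "homotopic X Z (\<lambda>n v. k n (f n v)) (\<lambda>n v. k n (g n v))"
proof -
  obtain h where h: "\<And>n. h n \<in> module_hom (cmod X n) (cmod Y (n - 1))"
    "\<And>n v. f n v - g n v = cdif Y (n - 1) (h n v) + h (n + 1) (cdif X n v)" using assms(1) by (rule homotopicE) blast
  show ?thesis
  proof (rule homotopicI)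
    show "(\<lambda>v. k (n - 1) (h n v)) \<in> module_hom (cmod X n) (cmod Z (n - 1))" for n
      using cmp_hom[OF h(1) ch_hom[OF k]] b by simp
    fix n v assume v: "v \<in> mcar (cmod X n)"
    have h': "h (n + 1) (cdif X n v) \<in> mcar (cmod Y n)" using hom_in[OF h(1)[of "n + 1"] hom_in[OF c_dif[OF b(1)] v]] by simp
    have "k n (f n v) - k n (g n v) = k n (f n v - g n v)"
      using hom_diff[OF ch_hom[OF k] _ hom_in[OF ch_hom[OF fg(1)] v] hom_in[OF ch_hom[OF fg(2)] v]] b by simp
    also have "\<dots> = k n (cdif Y (n - 1) (h n v)) + k n (h (n + 1) (cdif X n v))"
      unfolding h(2) by (rule hom_add[OF ch_hom[OF k] hom_in[OF c_dif'[OF b(2)] hom_in[OF h(1) v]] h'])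
    finally show "k n (f n v) - k n (g n v) = cdif Z (n - 1) (k (n - 1) (h n v)) + k (n + 1 - 1) (h (n + 1) (cdif X n v))"
      by (simp add: ch_com'[OF k])
  qed (use assms ch_cmp in auto)
qed

lemma homotopic_cmp_right:
  assumes "homotopic Y Z f g" and k: "k \<in> chain_maps X Y" and fg: "f \<in> chain_maps Y Z" "g \<in> chain_maps Y Z" and b: "bc X" "bc Y" "bc Z"
  shows "homotopic X Z (\<lambda>n v. f n (k n v)) (\<lambda>n v. g n (k n v))"
proof -
  obtain h where h: "\<And>n. h n \<in> module_hom (cmod Y n) (cmod Z (n - 1))"
    "\<And>n v. f n v - g n v = cdif Z (n - 1) (h n v) + h (n + 1) (cdif Y n v)" using assms(1) by (rule homotopicE) blast
  show ?thesis
  proof (rule homotopicI)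
    show "(\<lambda>v. h n (k n v)) \<in> module_hom (cmod X n) (cmod Z (n - 1))" for n
      using cmp_hom[OF ch_hom[OF k] h(1)] b by simp
    show "f n (k n v) - g n (k n v) = cdif Z (n - 1) (h n (k n v)) + h (n + 1) (k (n + 1) (cdif X n v))" for n v
      unfolding h(2) by (simp add: ch_com[OF k])
  qed (use assms ch_cmp in auto)
qed

lemma hclass_eq_iff:
  assumes "f \<in> chain_maps X Y" "g \<in> chain_maps X Y" "bc X" "bc Y"
  shows "hclass X Y f = hclass X Y g \<longleftrightarrow> homotopic X Y f g"
proof
  assume "hclass X Y f = hclass X Y g"
  moreover have "g \<in> hclass X Y g" using assms homotopic_refl by (simp add: hclass_def)
  ultimately have "g \<in> hclass X Y f" by simp
  then show "homotopic X Y f g" by (simp add: hclass_def)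
next
  assume fg: "homotopic X Y f g"
  then have gf: "homotopic X Y g f" by (rule homotopic_sym[OF _ assms])
  show "hclass X Y f = hclass X Y g"
  proof (intro equalityI subsetI)
    fix k assume "k \<in> hclass X Y f"
    then show "k \<in> hclass X Y g" using homotopic_trans[OF gf _ assms(2,1) _ assms(3,4), of k] by (simp add: hclass_def)
  next
    fix k assume "k \<in> hclass X Y g"
    then show "k \<in> hclass X Y f" using homotopic_trans[OF fg _ assms(1,2) _ assms(3,4), of k] by (simp add: hclass_def)
  qed
qed

lemma hclass_self: "\<lbrakk>f \<in> chain_maps X Y; bc X; bc Y\<rbrakk> \<Longrightarrow> f \<in> hclass X Y f"
  by (simp add: hclass_def homotopic_refl)

abbreviation "KB \<equiv> Kb scale"

lemma Kb_simps [simp]: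
  "Ob KB = {X. bc X}" "Arr KB X Y = hclass X Y ` chain_maps X Y" "Idn KB X = hclass X X (\<lambda>n. restr (cmod X n) (\<lambda>v. v))"
  "Zer KB X Y = hclass X Y (\<lambda>n v. 0)"
  by (simp_all add: Kb_def)

lemma Kb_cmp:
  assumes f: "f \<in> chain_maps X Y" and g: "g \<in> chain_maps Y Z" and b: "bc X" "bc Y" "bc Z"
  shows "Cmp KB X Y Z (hclass Y Z g) (hclass X Y f) = hclass X Z (\<lambda>n v. g n (f n v))"
proof -
  let ?F = "{hclass X Z (\<lambda>n v. g' n (f' n v)) | f' g'. f' \<in> hclass X Y f \<and> g' \<in> hclass Y Z g}"
  have "A = hclass X Z (\<lambda>n v. g n (f n v))" if A: "A \<in> ?F" for A
  proof -
    obtain f' g' where A: "A = hclass X Z (\<lambda>n v. g' n (f' n v))" and "f' \<in> hclass X Y f" "g' \<in> hclass Y Z g" using A by blast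
    then have c: "f' \<in> chain_maps X Y" "g' \<in> chain_maps Y Z" and h: "homotopic X Y f f'" "homotopic Y Z g g'" by (simp_all add: hclass_def)
    have 1: "homotopic X Z (\<lambda>n v. g n (f n v)) (\<lambda>n v. g n (f' n v))" by (rule homotopic_cmp_left[OF h(1) g f c(1) b])
    have 2: "homotopic X Z (\<lambda>n v. g n (f' n v)) (\<lambda>n v. g' n (f' n v))" by (rule homotopic_cmp_right[OF h(2) c(1) g c(2) b])
    note m = ch_cmp[OF f g b] ch_cmp[OF c(1) g b] ch_cmp[OF c b]
    have "homotopic X Z (\<lambda>n v. g n (f n v)) (\<lambda>n v. g' n (f' n v))" by (rule homotopic_trans[OF 1 2 m b(1,3)])
    then show ?thesis unfolding A using hclass_eq_iff[OF m(1,3) b(1,3)] by simp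
  qed
  moreover have "hclass X Z (\<lambda>n v. g n (f n v)) \<in> ?F"
    using hclass_self[OF f b(1,2)] hclass_self[OF g b(2,3)] by (intro CollectI exI conjI) (rule refl | assumption)+
  ultimately have "\<Union>?F = hclass X Z (\<lambda>n v. g n (f n v))" by (rule Union_const)
  then show ?thesis by (simp add: Kb_def)
qed

lemma Kb_add:
  assumes f: "f \<in> chain_maps X Y" and g: "g \<in> chain_maps X Y" and b: "bc X" "bc Y"
  shows "Add KB X Y (hclass X Y f) (hclass X Y g) = hclass X Y (\<lambda>n v. f n v + g n v)"
proof -
  let ?F = "{hclass X Y (\<lambda>n v. f' n v + g' n v) | f' g'. f' \<in> hclass X Y f \<and> g' \<in> hclass X Y g}"
  have "A = hclass X Y (\<lambda>n v. f n v + g n v)" if A: "A \<in> ?F" for A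
  proof -
    obtain f' g' where A: "A = hclass X Y (\<lambda>n v. f' n v + g' n v)" and "f' \<in> hclass X Y f" "g' \<in> hclass X Y g" using A by blast
    then have c: "f' \<in> chain_maps X Y" "g' \<in> chain_maps X Y" and h: "homotopic X Y f f'" "homotopic X Y g g'" by (simp_all add: hclass_def)
    have "homotopic X Y (\<lambda>n v. f n v + g n v) (\<lambda>n v. f' n v + g' n v)" by (rule homotopic_add[OF h f c(1) g c(2) b])
    then show ?thesis unfolding A using hclass_eq_iff[OF ch_add[OF f g b] ch_add[OF c b] b] by simp
  qed
  moreover have "hclass X Y (\<lambda>n v. f n v + g n v) \<in> ?F"
    using hclass_self[OF f b] hclass_self[OF g b] by (intro CollectI exI conjI) (rule refl | assumption)+
  ultimately have "\<Union>?F = hclass X Y (\<lambda>n v. f n v + g n v)" by (rule Union_const)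
  then show ?thesis by (simp add: Kb_def)
qed

lemma preadditive_Kb: "preadditive_category KB"
  by (rule preadditive_transfer[OF preadditive_Ch, where \<omega> = "\<lambda>X. X" and \<phi> = hclass]) (auto simp: Kb_cmp Kb_add)

sublocale Ch: preadditive Ch
  by unfold_locales (rule preadditive_Ch)

sublocale Kb: preadditive KB
  by unfold_locales (rule preadditive_Kb)

lemma addfun_Kb: "addfun Ch KB (\<lambda>X. X) hclass"
  by unfold_locales (auto simp: additive_functor_def Kb_cmp Kb_add)

subsection \<open>Quasi-isomorphisms\<close>

definition bnd :: "('h, 'k) cplx \<Rightarrow> int \<Rightarrow> 'k vec set" where
  "bnd X n = cdif X (n - 1) ` mcar (cmod X (n - 1))"

lemma bnd_subm: "bc X \<Longrightarrow> subm (bnd X n) (cmod X n)"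
  unfolding bnd_def using subm_image[OF c_dif'[of X n] _ _ subm_self] by simp

lemma cocycles_subm: "bc X \<Longrightarrow> subm (cocycles X n) (cmod X n)"
  unfolding cocycles_def using subm_ker[OF c_dif[of X n]] by simp

lemma bnd_lmod: "bc X \<Longrightarrow> lmod (sub (cmod X n) (bnd X n))"
  using subm_lmod[OF _ bnd_subm] by simp

lemma bnd_zero: "bc X \<Longrightarrow> 0 \<in> bnd X n"
  and bnd_add: "bc X \<Longrightarrow> v \<in> bnd X n \<Longrightarrow> w \<in> bnd X n \<Longrightarrow> v + w \<in> bnd X n"
  and bnd_diff: "bc X \<Longrightarrow> v \<in> bnd X n \<Longrightarrow> w \<in> bnd X n \<Longrightarrow> v - w \<in> bnd X n"
  and bnd_neg: "bc X \<Longrightarrow> v \<in> bnd X n \<Longrightarrow> - v \<in> bnd X n"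
  using m_zero[OF bnd_lmod[of X n]] m_add[OF bnd_lmod[of X n]] m_diff[OF bnd_lmod[of X n]] m_neg[OF bnd_lmod[of X n]] by simp_all

lemma bndI: "w \<in> mcar (cmod X (n - 1)) \<Longrightarrow> cdif X (n - 1) w \<in> bnd X n"
  by (simp add: bnd_def)

lemma bnd_cocycle: "bc X \<Longrightarrow> v \<in> bnd X n \<Longrightarrow> v \<in> cocycles X n"
  using hom_in[OF c_dif'[of X n]] by (auto simp: bnd_def cocycles_def)

lemma cocycleI: "v \<in> mcar (cmod X n) \<Longrightarrow> cdif X n v = 0 \<Longrightarrow> v \<in> cocycles X n"
  and cocycleD: "v \<in> cocycles X n \<Longrightarrow> v \<in> mcar (cmod X n)" "v \<in> cocycles X n \<Longrightarrow> cdif X n v = 0"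
  by (simp_all add: cocycles_def)

lemma ch_cocycle: "f \<in> chain_maps X Y \<Longrightarrow> bc Y \<Longrightarrow> bc X \<Longrightarrow> v \<in> cocycles X n \<Longrightarrow> f n v \<in> cocycles Y n"
  using hom_in[OF ch_hom[of f X Y n], of v] ch_com[of f X Y n v] hom_zero[OF ch_hom[of f X Y "n + 1"]]
  by (simp add: cocycles_def)

lemma ch_bnd: "f \<in> chain_maps X Y \<Longrightarrow> v \<in> bnd X n \<Longrightarrow> f n v \<in> bnd Y n"
  using hom_in[OF ch_hom[of f X Y]] by (auto simp: bnd_def ch_com')

lemma coh_class_alt: "coh_class X n v = (\<lambda>b. v + b) ` bnd X n"
  by (auto simp: coh_class_def bnd_def)

lemma coh_class_eq_iff:
  assumes "bc X"
  shows "coh_class X n v = coh_class X n w \<longleftrightarrow> v - w \<in> bnd X n"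
proof
  assume "coh_class X n v = coh_class X n w"
  moreover have "v \<in> coh_class X n v" using bnd_zero[OF assms] by (force simp: coh_class_alt)
  ultimately obtain b where "b \<in> bnd X n" "v = w + b" by (auto simp: coh_class_alt)
  then show "v - w \<in> bnd X n" by simp
next
  assume d: "v - w \<in> bnd X n"
  have d': "w - v \<in> bnd X n" using bnd_neg[OF assms d] by simp
  show "coh_class X n v = coh_class X n w"
    unfolding coh_class_alt
  proof (intro equalityI subsetI)
    fix x assume "x \<in> (\<lambda>b. v + b) ` bnd X n"
    then obtain b where "b \<in> bnd X n" "x = w + ((v - w) + b)" by auto
    then show "x \<in> (\<lambda>b. w + b) ` bnd X n" using bnd_add[OF assms d] by blast
  next
    fix x assume "x \<in> (\<lambda>b. w + b) ` bnd X n"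
    then obtain b where "b \<in> bnd X n" "x = v + ((w - v) + b)" by auto
    then show "x \<in> (\<lambda>b. v + b) ` bnd X n" using bnd_add[OF assms d'] by blast
  qed
qed

lemma cohomology_map_class:
  assumes f: "f \<in> chain_maps X Y" and b: "bc X" "bc Y" and v: "v \<in> mcar (cmod X n)"
  shows "cohomology_map Y f n (coh_class X n v) = coh_class Y n (f n v)"
proof -
  have "coh_class Y n (f n (v + b)) = coh_class Y n (f n v)" if "b \<in> bnd X n" for b
  proof -
    have "b \<in> mcar (cmod X n)" using bnd_cocycle[OF b(1) that] by (rule cocycleD)
    then have "f n (v + b) - f n v = f n b" using hom_add[OF ch_hom[OF f] v] by simp
    then show ?thesis using coh_class_eq_iff[OF b(2)] ch_bnd[OF f that] by simp
  qed
  then have "cohomology_map Y f n (coh_class X n v) = (\<Union>b\<in>bnd X n. coh_class Y n (f n v))"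
    by (simp add: cohomology_map_def coh_class_alt[of X])
  then show ?thesis using bnd_zero[OF b(1)] by auto
qed

text \<open>Elementwise form of bijectivity on cohomology: the first condition is injectivity and
  the second surjectivity.\<close>

lemma quasi_iso_iff:
  assumes b: "bc X" "bc Y"
  shows "quasi_iso X Y f \<longleftrightarrow> f \<in> chain_maps X Y \<and>
    (\<forall>n. \<forall>v\<in>cocycles X n. f n v \<in> bnd Y n \<longrightarrow> v \<in> bnd X n) \<and>
    (\<forall>n. \<forall>w\<in>cocycles Y n. \<exists>v\<in>cocycles X n. w - f n v \<in> bnd Y n)"
proof (cases "f \<in> chain_maps X Y")
  case f: True
  have cm: "cohomology_map Y f n (coh_class X n v) = coh_class Y n (f n v)" if "v \<in> cocycles X n" for n v
    by (rule cohomology_map_class[OF f b]) (use that in \<open>rule cocycleD\<close>)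
  have inj_iff: "inj_on (cohomology_map Y f n) (cohomology X n) \<longleftrightarrow> (\<forall>v\<in>cocycles X n. f n v \<in> bnd Y n \<longrightarrow> v \<in> bnd X n)" for n
  proof
    assume inj: "inj_on (cohomology_map Y f n) (cohomology X n)"
    show "\<forall>v\<in>cocycles X n. f n v \<in> bnd Y n \<longrightarrow> v \<in> bnd X n"
    proof (intro ballI impI)
      fix v assume v: "v \<in> cocycles X n" and fv: "f n v \<in> bnd Y n"
      have z: "0 \<in> cocycles X n" using bnd_cocycle[OF b(1) bnd_zero[OF b(1)]] .
      have "f n 0 = 0" using hom_zero[OF ch_hom[OF f]] b by simp
      then have "cohomology_map Y f n (coh_class X n v) = cohomology_map Y f n (coh_class X n 0)"
        using coh_class_eq_iff[OF b(2)] fv by (simp add: cm v z)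
      then have "coh_class X n v = coh_class X n 0" using inj v z by (simp add: inj_on_def cohomology_def)
      then show "v \<in> bnd X n" using coh_class_eq_iff[OF b(1)] by simp
    qed
  next
    assume inj: "\<forall>v\<in>cocycles X n. f n v \<in> bnd Y n \<longrightarrow> v \<in> bnd X n"
    show "inj_on (cohomology_map Y f n) (cohomology X n)"
      unfolding cohomology_def
    proof (rule inj_onI, elim imageE)
      fix x y v w assume eq: "cohomology_map Y f n x = cohomology_map Y f n y"
        and x: "x = coh_class X n v" "v \<in> cocycles X n" and y: "y = coh_class X n w" "w \<in> cocycles X n"
      have "f n v - f n w \<in> bnd Y n" using eq coh_class_eq_iff[OF b(2)] x y by (simp add: cm)
      then have "f n (v - w) \<in> bnd Y n" using hom_diff[OF ch_hom[OF f]] x y b by (simp add: cocycleD)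
      moreover have "v - w \<in> cocycles X n"
        using m_diff[OF subm_lmod[OF _ cocycles_subm[OF b(1)]], of n v w] x y b by simp
      ultimately show "x = y" using inj x y coh_class_eq_iff[OF b(1)] by simp
    qed
  qed
  have img_iff: "cohomology_map Y f n ` cohomology X n = cohomology Y n \<longleftrightarrow> (\<forall>w\<in>cocycles Y n. \<exists>v\<in>cocycles X n. w - f n v \<in> bnd Y n)" for n
  proof -
    have "cohomology_map Y f n ` cohomology X n = (\<lambda>v. coh_class Y n (f n v)) ` cocycles X n"
      by (auto simp: cohomology_def image_image cm intro!: image_cong)
    moreover have "(\<lambda>v. coh_class Y n (f n v)) ` cocycles X n \<subseteq> cohomology Y n"
      using ch_cocycle[OF f b(2,1)] by (auto simp: cohomology_def)
    moreover have "cohomology Y n \<subseteq> (\<lambda>v. coh_class Y n (f n v)) ` cocycles X n \<longleftrightarrow> (\<forall>w\<in>cocycles Y n. \<exists>v\<in>cocycles X n. w - f n v \<in> bnd Y n)"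
      by (auto simp: cohomology_def image_subset_iff image_iff coh_class_eq_iff[OF b(2)])
    ultimately show ?thesis by auto
  qed
  show ?thesis using f unfolding quasi_iso_def bij_betw_def inj_iff img_iff all_conj_distrib by simp
qed (simp add: quasi_iso_def)

end

context fd_alg
begin

section \<open>Projective resolutions\<close>

lemma mod_sum_hom:
  assumes "f \<in> module_hom M N" "g \<in> module_hom M' N" "lmod M" "lmod M'" "lmod N"
  shows "restr (mod_sum M M') (\<lambda>u. f (vfst u) + g (vsnd u)) \<in> module_hom (mod_sum M M') N"
  using lmod_mod_sum[OF assms(3,4)] assms
  by (intro restrI) (simp_all add: hom_in hom_add hom_act m_add act_add ac_simps)

lemma restr_sub_hom: "f \<in> module_hom M N \<Longrightarrow> lmod M \<Longrightarrow> subm A M \<Longrightarrow> restr (sub M A) f \<in> module_hom (sub M A) N"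
  by (rule restrI) (auto simp: subm_lmod hom_in hom_add hom_act subm_def subset_iff)

text \<open>The two-term complexes \<open>K n \<subseteq> Q n\<close> in degrees \<open>n - 1\<close> and \<open>n\<close>, summed over \<open>n\<close>.\<close>

definition Dc :: "(int \<Rightarrow> ('h, 'k) hmod) \<Rightarrow> (int \<Rightarrow> 'k vec set) \<Rightarrow> ('h, 'k) cplx" where
  "Dc Q K = \<lparr>cmod = (\<lambda>n. mod_sum (Q n) (sub (Q (n + 1)) (K (n + 1)))),
     cdif = (\<lambda>n. restr (mod_sum (Q n) (sub (Q (n + 1)) (K (n + 1)))) (\<lambda>u. vpair (vsnd u) 0))\<rparr>"

lemma Dc_simps [simp]:
  "cmod (Dc Q K) n = mod_sum (Q n) (sub (Q (n + 1)) (K (n + 1)))"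
  "cdif (Dc Q K) n u = (if vfst u \<in> mcar (Q n) \<and> vsnd u \<in> K (n + 1) then vpair (vsnd u) 0 else 0)"
  by (simp_all add: Dc_def restr_def)

definition fgdata :: "(int \<Rightarrow> ('h, 'k) hmod) \<Rightarrow> (int \<Rightarrow> 'k vec set) \<Rightarrow> bool" where
  "fgdata Q K \<longleftrightarrow> (\<forall>n. fg (Q n) \<and> subm (K n) (Q n)) \<and> (\<exists>b. \<forall>n. b < \<bar>n\<bar> \<longrightarrow> mcar (Q n) = {0})"

definition resdata :: "(int \<Rightarrow> ('h, 'k) hmod) \<Rightarrow> (int \<Rightarrow> 'k vec set) \<Rightarrow> bool" where
  "resdata Q K \<longleftrightarrow> fgdata Q K \<and> (\<forall>n. projective_module scale (Q n) \<and> projective_module scale (sub (Q n) (K n)))"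

lemma fgdataD:
  assumes "fgdata Q K"
  shows "fg (Q n)" "lmod (Q n)" "subm (K n) (Q n)" "fg (sub (Q n) (K n))" "lmod (sub (Q n) (K n))"
    "K n \<subseteq> mcar (Q n)" "0 \<in> K n" "0 \<in> mcar (Q n)"
  using assms subm_fg[of "Q n" "K n"] subm_lmod[of "Q n" "K n"] m_zero[of "Q n"] by (auto simp: fgdata_def subm_def)

lemma bc_Dc:
  assumes "fgdata Q K"
  shows "bc (Dc Q K)"
  unfolding bounded_complex_def
proof (intro conjI allI)
  note D = fgdataD[OF assms]
  show "fg (cmod (Dc Q K) n)" for n using D by simp
  have "cdif (Dc Q K) n = restr (cmod (Dc Q K) n) (\<lambda>u. vpair (vsnd u) 0)" for n by (auto simp: restr_def)
  moreover have "restr (cmod (Dc Q K) n) (\<lambda>u. vpair (vsnd u) 0) \<in> module_hom (cmod (Dc Q K) n) (cmod (Dc Q K) (n + 1))" for n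
  proof (rule restrI)
    show "lmod (cmod (Dc Q K) n)" using D by (simp add: lmod_mod_sum)
  qed (use D(6)[of "n + 1"] D(7) act_zero[OF D(2), of "n + 1 + 1"] in \<open>auto simp: vpair_arith\<close>)
  ultimately show "cdif (Dc Q K) n \<in> module_hom (cmod (Dc Q K) n) (cmod (Dc Q K) (n + 1))" for n by simp
  show "cdif (Dc Q K) (n + 1) (cdif (Dc Q K) n v) = 0" for n v using D(7,8) by (simp add: vpair_arith)
  obtain b where b: "\<And>n. b < \<bar>n\<bar> \<Longrightarrow> mcar (Q n) = {0}" using assms by (auto simp: fgdata_def)
  have "mcar (cmod (Dc Q K) n) = {0}" if "b + 1 < \<bar>n\<bar>" for n
  proof -
    have "mcar (Q n) = {0}" "mcar (Q (n + 1)) = {0}" using that by (intro b; simp)+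
    then have "vfst u = 0" "vsnd u = 0" if "u \<in> mcar (cmod (Dc Q K) n)" for u
      using that D(6)[of "n + 1"] by auto
    then have "u = 0" if "u \<in> mcar (cmod (Dc Q K) n)" for u
      using that by (metis vpair_simps(10,11) vpair_eqI)
    moreover have "0 \<in> mcar (cmod (Dc Q K) n)" using D(7,8) by simp
    ultimately show ?thesis by blast
  qed
  then show "\<exists>b. \<forall>n. b < \<bar>n\<bar> \<longrightarrow> mcar (cmod (Dc Q K) n) = {0}" by blast
qed

lemma lift_bnd:
  assumes "projective_module scale P" "bc Z" "\<psi> \<in> module_hom P (cmod Z n)" "\<And>p. p \<in> mcar P \<Longrightarrow> \<psi> p \<in> bnd Z n"
  obtains c where "c \<in> module_hom P (cmod Z (n - 1))" "\<And>p. p \<in> mcar P \<Longrightarrow> cdif Z (n - 1) (c p) = \<psi> p"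
proof (rule proj_lift[OF assms(1) _ _ c_dif'[OF assms(2)] assms(3)])
  fix v assume "v \<in> mcar P"
  from assms(4)[OF this] show "\<exists>w\<in>mcar (cmod Z (n - 1)). cdif Z (n - 1) w = \<psi> v" by (force simp: bnd_def)
qed (use assms that in auto)

text \<open>Surjectivity of \<open>s\<close> on cohomology says that (z, w) \<mapsto> s z - d w,
  defined on cocycles of Z plus all of Y in degree n - 1, attains every cocycle of Y. Lifting
  \<open>\<phi>\<close> through this map gives \<open>\<psi>\<close> and \<open>\<epsilon>\<close>
  as the two components.\<close>

lemma lift_cocycle:
  assumes P: "projective_module scale P" and b [simp]: "bc Z" "bc Y" and s: "quasi_iso Z Y s"
    and \<phi>: "\<phi> \<in> module_hom P (cmod Y n)" "\<And>p. p \<in> mcar P \<Longrightarrow> cdif Y n (\<phi> p) = 0"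
  obtains \<psi> \<epsilon> where "\<psi> \<in> module_hom P (cmod Z n)" "\<epsilon> \<in> module_hom P (cmod Y (n - 1))"
    "\<And>p. p \<in> mcar P \<Longrightarrow> cdif Z n (\<psi> p) = 0" "\<And>p. p \<in> mcar P \<Longrightarrow> s n (\<psi> p) - \<phi> p = cdif Y (n - 1) (\<epsilon> p)"
proof -
  let ?Z = "sub (cmod Z n) (cocycles Z n)"
  let ?M = "mod_sum ?Z (cmod Y (n - 1))"
  have sc: "s \<in> chain_maps Z Y" and sur: "\<And>w. w \<in> cocycles Y n \<Longrightarrow> \<exists>v\<in>cocycles Z n. w - s n v \<in> bnd Y n"
    using s quasi_iso_iff[OF b] by blast+
  have lZ: "lmod ?Z" "fg ?Z" using cocycles_subm[of Z n] by (simp_all add: subm_lmod subm_fg)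
  let ?g = "restr ?M (\<lambda>u. restr ?Z (s n) (vfst u) + - cdif Y (n - 1) (vsnd u))"
  have g: "?g \<in> module_hom ?M (cmod Y n)"
    using restr_sub_hom[OF ch_hom[OF sc] _ cocycles_subm] neg_hom[OF c_dif'[of Y n]] lZ
    by (intro mod_sum_hom) simp_all
  obtain h where h: "h \<in> module_hom P ?M" "\<And>p. p \<in> mcar P \<Longrightarrow> ?g (h p) = \<phi> p"
  proof (rule proj_lift[OF P _ _ g \<phi>(1)])
    fix p assume p: "p \<in> mcar P"
    have "\<phi> p \<in> cocycles Y n" using hom_in[OF \<phi>(1) p] \<phi>(2)[OF p] by (rule cocycleI)
    then obtain v where v: "v \<in> cocycles Z n" "\<phi> p - s n v \<in> bnd Y n" using sur by blast
    then obtain w where w: "w \<in> mcar (cmod Y (n - 1))" "\<phi> p - s n v = cdif Y (n - 1) w" by (auto simp: bnd_def)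
    have "- w \<in> mcar (cmod Y (n - 1))" using w by (simp add: m_neg)
    moreover have "s n v + cdif Y (n - 1) w = \<phi> p" by (simp flip: w(2))
    ultimately show "\<exists>w\<in>mcar ?M. ?g w = \<phi> p"
      using v w hom_neg[OF c_dif'[of Y n]] by (intro bexI[of _ "vpair v (- w)"]) (simp_all add: restr_def)
  qed (use lZ in auto)
  have hin: "vfst (h p) \<in> cocycles Z n" "vsnd (h p) \<in> mcar (cmod Y (n - 1))" if "p \<in> mcar P" for p
    using hom_in[OF h(1) that] by simp_all
  show thesis
  proof (rule that)
    show "(\<lambda>p. vfst (h p)) \<in> module_hom P (cmod Z n)" "(\<lambda>p. vsnd (h p)) \<in> module_hom P (cmod Y (n - 1))"
      using hin(2) cocycleD(1)[OF hin(1)] by (auto intro!: homI simp: hom_add[OF h(1)] hom_act[OF h(1)] hom_out[OF h(1)])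
    show "cdif Z n (vfst (h p)) = 0" if "p \<in> mcar P" for p using hin(1)[OF that] by (rule cocycleD(2))
    show "s n (vfst (h p)) - \<phi> p = cdif Y (n - 1) (vsnd (h p))" if "p \<in> mcar P" for p
      using h(2)[OF that] hin[OF that] by (simp add: restr_def algebra_simps)
  qed
qed

text \<open>A chain map out of \<open>Dc Q K\<close> amounts to maps a on each \<open>Q n\<close>
  with values in cocycles, and maps b on each \<open>K n\<close> with d b = a there. Pieces for
  different n do not interact, so lifts and homotopies can be constructed for each n
  separately.\<close>

lemma Dc_chain_split:
  assumes D: "fgdata Q K" and f: "f \<in> chain_maps (Dc Q K) Y" and [simp]: "bc Y"
  shows "(\<lambda>q. if q \<in> mcar (Q n) then f n (vpair q 0) else 0) \<in> module_hom (Q n) (cmod Y n)"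
    "(\<lambda>k. if k \<in> K n then f (n - 1) (vpair 0 k) else 0) \<in> module_hom (sub (Q n) (K n)) (cmod Y (n - 1))"
    "q \<in> mcar (Q n) \<Longrightarrow> cdif Y n (f n (vpair q 0)) = 0"
    "k \<in> K n \<Longrightarrow> cdif Y (n - 1) (f (n - 1) (vpair 0 k)) = f n (vpair k 0)"
    "\<lbrakk>q \<in> mcar (Q n); k \<in> K (n + 1)\<rbrakk> \<Longrightarrow> f n (vpair q k) = f n (vpair q 0) + f n (vpair 0 k)"
proof -
  note d = fgdataD[OF D]
  have fh: "f m \<in> module_hom (mod_sum (Q m) (sub (Q (m + 1)) (K (m + 1)))) (cmod Y m)" for m
    using ch_hom[OF f, of m] by simp
  have z: "f m 0 = 0" for m using hom_zero[OF fh] d by (simp add: lmod_mod_sum)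
  show "(\<lambda>q. if q \<in> mcar (Q n) then f n (vpair q 0) else 0) \<in> module_hom (Q n) (cmod Y n)"
    using restrI[of "Q n" "\<lambda>q. f n (vpair q 0)" "cmod Y n"] d
      hom_in[OF fh[of n], of "vpair _ 0"] hom_add[OF fh[of n], of "vpair _ 0" "vpair _ 0"] hom_act[OF fh[of n], of "vpair _ 0"]
    by (simp add: vpair_arith restr_def act_zero[OF d(2)])
  show "(\<lambda>k. if k \<in> K n then f (n - 1) (vpair 0 k) else 0) \<in> module_hom (sub (Q n) (K n)) (cmod Y (n - 1))"
    using restrI[of "sub (Q n) (K n)" "\<lambda>k. f (n - 1) (vpair 0 k)" "cmod Y (n - 1)"] d
      hom_in[OF fh[of "n - 1"], of "vpair 0 _"] hom_add[OF fh[of "n - 1"], of "vpair 0 _" "vpair 0 _"] hom_act[OF fh[of "n - 1"], of "vpair 0 _"]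
    by (simp add: vpair_arith restr_def act_zero[OF d(2)])
  show "cdif Y n (f n (vpair q 0)) = 0" if "q \<in> mcar (Q n)"
    using ch_com[OF f, of n "vpair q 0"] that d z by (simp add: vpair_arith)
  show "cdif Y (n - 1) (f (n - 1) (vpair 0 k)) = f n (vpair k 0)" if "k \<in> K n"
    using ch_com'[OF f, of n "vpair 0 k"] that d by simp
  show "f n (vpair q k) = f n (vpair q 0) + f n (vpair 0 k)" if "q \<in> mcar (Q n)" "k \<in> K (n + 1)"
    using hom_add[OF fh[of n], of "vpair q 0" "vpair 0 k"] that d by (simp add: vpair_arith)
qed

text \<open>On \<open>Q n\<close> the cocycle-valued part is lifted up to a coboundary
  \<open>h\<close>. On \<open>K n\<close> the lift becomes a coboundary in Y, hence in Z by
  injectivity on cohomology, which gives \<open>c\<close>; a second cocycle lift adjusts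
  \<open>c\<close> to the given map.\<close>

lemma resolution_lift:
  assumes D: "resdata Q K" and b [simp]: "bc Z" "bc Y" and s: "quasi_iso Z Y s" and f: "f \<in> chain_maps (Dc Q K) Y"
  shows "\<exists>g\<in>chain_maps (Dc Q K) Z. homotopic (Dc Q K) Y (\<lambda>n v. s n (g n v)) f"
proof -
  have F: "fgdata Q K" and P: "\<And>n. projective_module scale (Q n)" and PK: "\<And>n. projective_module scale (sub (Q n) (K n))"
    using D by (simp_all add: resdata_def)
  note d = fgdataD[OF F] and bD [simp] = bc_Dc[OF F] and sp = Dc_chain_split[OF F f b(2)]
  have sc: "s \<in> chain_maps Z Y" using s by (simp add: quasi_iso_def)
  have "\<exists>a h c y. a \<in> module_hom (Q n) (cmod Z n) \<and> h \<in> module_hom (Q n) (cmod Y (n - 1)) \<and>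
      c \<in> module_hom (sub (Q n) (K n)) (cmod Z (n - 1)) \<and> y \<in> module_hom (sub (Q n) (K n)) (cmod Y (n - 1 - 1)) \<and>
      (\<forall>q\<in>mcar (Q n). cdif Z n (a q) = 0 \<and> s n (a q) - f n (vpair q 0) = cdif Y (n - 1) (h q)) \<and>
      (\<forall>k\<in>K n. cdif Z (n - 1) (c k) = a k \<and> s (n - 1) (c k) - f (n - 1) (vpair 0 k) = h k - cdif Y (n - 1 - 1) (y k))" for n
  proof -
    let ?K = "sub (Q n) (K n)"
    obtain a h where a: "a \<in> module_hom (Q n) (cmod Z n)" "h \<in> module_hom (Q n) (cmod Y (n - 1))"
      "\<And>q. q \<in> mcar (Q n) \<Longrightarrow> cdif Z n (a q) = 0"
      "\<And>q. q \<in> mcar (Q n) \<Longrightarrow> s n (a q) - f n (vpair q 0) = cdif Y (n - 1) (h q)"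
    proof (rule lift_cocycle[OF P b s sp(1)])
      fix p assume "p \<in> mcar (Q n)"
      then show "cdif Y n (if p \<in> mcar (Q n) then f n (vpair p 0) else 0) = 0" using sp(3) by simp
    next
      fix \<psi> \<epsilon> assume "\<psi> \<in> module_hom (Q n) (cmod Z n)" "\<epsilon> \<in> module_hom (Q n) (cmod Y (n - 1))"
        "\<And>p. p \<in> mcar (Q n) \<Longrightarrow> cdif Z n (\<psi> p) = 0"
        "\<And>p. p \<in> mcar (Q n) \<Longrightarrow> s n (\<psi> p) - (if p \<in> mcar (Q n) then f n (vpair p 0) else 0) = cdif Y (n - 1) (\<epsilon> p)"
      then show thesis by (intro that) simp_all
    qed
    have kq: "k \<in> mcar (Q n)" if "k \<in> K n" for k using that d(6) by blast
    have aK: "restr ?K a \<in> module_hom ?K (cmod Z n)" using a(1) d by (simp add: restr_sub_hom)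
    have hK: "restr ?K h \<in> module_hom ?K (cmod Y (n - 1))" using a(2) d by (simp add: restr_sub_hom)
    obtain c where c: "c \<in> module_hom ?K (cmod Z (n - 1))" "\<And>k. k \<in> K n \<Longrightarrow> cdif Z (n - 1) (c k) = a k"
    proof (rule lift_bnd[OF PK b(1) aK])
      fix k assume "k \<in> mcar ?K"
      then have k: "k \<in> K n" by simp
      have "s n (a k) = cdif Y (n - 1) (f (n - 1) (vpair 0 k)) + cdif Y (n - 1) (h k)"
        using a(4)[OF kq[OF k]] sp(4)[OF k] by (simp add: algebra_simps)
      also have "\<dots> = cdif Y (n - 1) (f (n - 1) (vpair 0 k) + h k)"
        using hom_add[OF c_dif'[OF b(2), of n], of "f (n - 1) (vpair 0 k)" "h k"] hom_in[OF sp(2)[of n], of k] hom_in[OF a(2) kq[OF k]] k by simp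
      finally have "s n (a k) \<in> bnd Y n"
        using m_add[of "cmod Y (n - 1)" "f (n - 1) (vpair 0 k)" "h k"] hom_in[OF sp(2)[of n], of k] hom_in[OF a(2) kq[OF k]] k
        by (auto intro: bndI)
      moreover have "a k \<in> cocycles Z n" using hom_in[OF a(1) kq[OF k]] a(3)[OF kq[OF k]] by (rule cocycleI)
      ultimately have "a k \<in> bnd Z n" using s quasi_iso_iff[OF b] by blast
      then show "restr ?K a k \<in> bnd Z n" using k by (simp add: restr_def)
    next
      fix c assume "c \<in> module_hom ?K (cmod Z (n - 1))" "\<And>p. p \<in> mcar ?K \<Longrightarrow> cdif Z (n - 1) (c p) = restr ?K a p"
      then show thesis by (intro that) (simp_all add: restr_def)
    qed
    let ?B = "\<lambda>k. if k \<in> K n then f (n - 1) (vpair 0 k) else 0"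
    \<comment> \<open>The failure of \<open>c\<close> to match the given map and the homotopy
      \<open>h\<close>. Its values are cocycles of Y, and \<open>c\<close> may be changed by
      cocycles of Z, so lifting it yields the correction \<open>z\<close>.\<close>
    let ?\<phi> = "\<lambda>k. (s (n - 1) (c k) - ?B k) - restr ?K h k"
    have \<phi>: "?\<phi> \<in> module_hom ?K (cmod Y (n - 1))"
      using cmp_hom[OF c(1) ch_hom[OF sc]] sp(2) hK by (intro diff_hom) simp_all
    obtain z y where z: "z \<in> module_hom ?K (cmod Z (n - 1))" "y \<in> module_hom ?K (cmod Y (n - 1 - 1))"
      "\<And>k. k \<in> K n \<Longrightarrow> cdif Z (n - 1) (z k) = 0"
      "\<And>k. k \<in> K n \<Longrightarrow> s (n - 1) (z k) - ?\<phi> k = cdif Y (n - 1 - 1) (y k)"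
    proof (rule lift_cocycle[OF PK b s \<phi>])
      fix k assume "k \<in> mcar ?K"
      then have k: "k \<in> K n" by simp
      have in': "s (n - 1) (c k) \<in> mcar (cmod Y (n - 1))" "f (n - 1) (vpair 0 k) \<in> mcar (cmod Y (n - 1))" "h k \<in> mcar (cmod Y (n - 1))"
        using hom_in[OF ch_hom[OF sc] hom_in[OF c(1)]] hom_in[OF sp(2)[of n], of k] hom_in[OF a(2) kq[OF k]] k by simp_all
      have "cdif Y (n - 1) (?\<phi> k) = cdif Y (n - 1) (s (n - 1) (c k)) - cdif Y (n - 1) (f (n - 1) (vpair 0 k)) - cdif Y (n - 1) (h k)"
        using k in' m_diff[of "cmod Y (n - 1)" "s (n - 1) (c k)" "f (n - 1) (vpair 0 k)"] by (simp add: restr_def hom_diff[OF c_dif'[OF b(2)]])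
      also have "cdif Y (n - 1) (s (n - 1) (c k)) = s n (a k)" using c(2)[OF k] ch_com'[OF sc, of n "c k"] by simp
      also have "s n (a k) - cdif Y (n - 1) (f (n - 1) (vpair 0 k)) - cdif Y (n - 1) (h k) = 0"
        using a(4)[OF kq[OF k]] sp(4)[OF k] by simp
      finally show "cdif Y (n - 1) (?\<phi> k) = 0" .
    qed (use that in auto)
    show ?thesis
    proof (intro exI conjI ballI)
      show "a \<in> module_hom (Q n) (cmod Z n)" "h \<in> module_hom (Q n) (cmod Y (n - 1))" by (rule a)+
      show "(\<lambda>k. c k - z k) \<in> module_hom ?K (cmod Z (n - 1))" using c(1) z(1) by (intro diff_hom) simp_all
      show "y \<in> module_hom ?K (cmod Y (n - 1 - 1))" by (rule z)
      show "cdif Z n (a q) = 0" "s n (a q) - f n (vpair q 0) = cdif Y (n - 1) (h q)" if "q \<in> mcar (Q n)" for q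
        using a that by simp_all
      fix k assume k: "k \<in> K n"
      have ck: "c k \<in> mcar (cmod Z (n - 1))" and zk: "z k \<in> mcar (cmod Z (n - 1))" using hom_in[OF c(1)] hom_in[OF z(1)] k by simp_all
      show "cdif Z (n - 1) (c k - z k) = a k" using hom_diff[OF c_dif'[OF b(1), of n] _ ck zk] c(2)[OF k] z(3)[OF k] by simp
      have "s (n - 1) (c k - z k) = s (n - 1) (c k) - s (n - 1) (z k)" using hom_diff[OF ch_hom[OF sc] _ ck zk] by simp
      then have "s (n - 1) (c k - z k) - f (n - 1) (vpair 0 k) = h k - (s (n - 1) (z k) - ?\<phi> k)"
        using k by (simp add: restr_def)
      then show "s (n - 1) (c k - z k) - f (n - 1) (vpair 0 k) = h k - cdif Y (n - 1 - 1) (y k)"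
        by (simp only: z(4)[OF k])
    qed
  qed
  then obtain a h c y where A: "\<And>n. a n \<in> module_hom (Q n) (cmod Z n)" "\<And>n. h n \<in> module_hom (Q n) (cmod Y (n - 1))"
      "\<And>n. c n \<in> module_hom (sub (Q n) (K n)) (cmod Z (n - 1))" "\<And>n. y n \<in> module_hom (sub (Q n) (K n)) (cmod Y (n - 1 - 1))"
      "\<And>n q. q \<in> mcar (Q n) \<Longrightarrow> cdif Z n (a n q) = 0" "\<And>n q. q \<in> mcar (Q n) \<Longrightarrow> s n (a n q) - f n (vpair q 0) = cdif Y (n - 1) (h n q)"
      "\<And>n k. k \<in> K n \<Longrightarrow> cdif Z (n - 1) (c n k) = a n k"
      "\<And>n k. k \<in> K n \<Longrightarrow> s (n - 1) (c n k) - f (n - 1) (vpair 0 k) = h n k - cdif Y (n - 1 - 1) (y n k)"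
    by metis
  define g where "g n = restr (cmod (Dc Q K) n) (\<lambda>u. a n (vfst u) + c (n + 1) (vsnd u))" for n
  \<comment> \<open>\<open>y\<close> enters with a minus sign, as in the equation for
    \<open>c\<close> above.\<close>
  define H where "H n = restr (cmod (Dc Q K) n) (\<lambda>u. h n (vfst u) + - y (n + 1) (vsnd u))" for n
  have gh: "g n \<in> module_hom (cmod (Dc Q K) n) (cmod Z n)" for n
    unfolding g_def using mod_sum_hom[of "a n" "Q n" "cmod Z n" "c (n + 1)" "sub (Q (n + 1)) (K (n + 1))"] A(1)[of n] A(3)[of "n + 1"] d by simp
  have Hh: "H n \<in> module_hom (cmod (Dc Q K) n) (cmod Y (n - 1))" for n
    unfolding H_def using mod_sum_hom[of "h n" "Q n" "cmod Y (n - 1)" "\<lambda>v. - y (n + 1) v" "sub (Q (n + 1)) (K (n + 1))"]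
      A(2)[of n] neg_hom[OF A(4)[of "n + 1"]] d by simp
  have gv: "g n u = a n (vfst u) + c (n + 1) (vsnd u)" if "vfst u \<in> mcar (Q n)" "vsnd u \<in> K (n + 1)" for n u
    using that by (simp add: g_def restr_def)
  have Hv: "H n u = h n (vfst u) - y (n + 1) (vsnd u)" if "vfst u \<in> mcar (Q n)" "vsnd u \<in> K (n + 1)" for n u
    using that by (simp add: H_def restr_def)
  have kq: "k \<in> mcar (Q n)" if "k \<in> K n" for k n using that d(6) by blast
  have c0: "c n 0 = 0" and y0: "y n 0 = 0" for n using hom_zero[OF A(3)] hom_zero[OF A(4)] d by simp_all
  have gc: "g \<in> chain_maps (Dc Q K) Z"
  proof (rule chI[OF gh])
    fix n u assume "u \<in> mcar (cmod (Dc Q K) n)"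
    then have u: "vfst u \<in> mcar (Q n)" "vsnd u \<in> K (n + 1)" by simp_all
    have "cdif Z n (g n u) = cdif Z n (a n (vfst u)) + cdif Z n (c (n + 1) (vsnd u))"
      using hom_add[OF c_dif[OF b(1), of n] hom_in[OF A(1) u(1)], of "c (n + 1) (vsnd u)"] hom_in[OF A(3)[of "n + 1"], of "vsnd u"] u by (simp add: gv)
    also have "\<dots> = a (n + 1) (vsnd u)" using A(5)[OF u(1)] A(7)[OF u(2)] by simp
    also have "\<dots> = g (n + 1) (cdif (Dc Q K) n u)"
      using u kq[OF u(2)] d(7) c0 by (simp add: gv)
    finally show "g (n + 1) (cdif (Dc Q K) n u) = cdif Z n (g n u)" by simp
  qed simp_all
  moreover have "homotopic (Dc Q K) Y (\<lambda>n v. s n (g n v)) f"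
  proof (rule homotopicI[OF Hh _ f])
    show "(\<lambda>n v. s n (g n v)) \<in> chain_maps (Dc Q K) Y" using ch_cmp[OF gc sc] by simp
    fix n u assume "u \<in> mcar (cmod (Dc Q K) n)"
    then have u: "vfst u \<in> mcar (Q n)" "vsnd u \<in> K (n + 1)" by simp_all
    have f1: "f n u = f n (vpair (vfst u) 0) + f n (vpair 0 (vsnd u))" using sp(5)[OF u] by simp
    have s1: "s n (g n u) = s n (a n (vfst u)) + s n (c (n + 1) (vsnd u))"
      using hom_add[OF ch_hom[OF sc] hom_in[OF A(1) u(1)], of "c (n + 1) (vsnd u)"] hom_in[OF A(3)[of "n + 1"], of "vsnd u"] u by (simp add: gv)
    have s2: "s n (c (n + 1) (vsnd u)) - f n (vpair 0 (vsnd u)) = h (n + 1) (vsnd u) - cdif Y (n - 1) (y (n + 1) (vsnd u))"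
      using A(8)[OF u(2)] by simp
    have "s n (g n u) - f n u = (s n (a n (vfst u)) - f n (vpair (vfst u) 0)) + (s n (c (n + 1) (vsnd u)) - f n (vpair 0 (vsnd u)))"
      by (simp add: f1 s1)
    also have "\<dots> = (cdif Y (n - 1) (h n (vfst u)) - cdif Y (n - 1) (y (n + 1) (vsnd u))) + h (n + 1) (vsnd u)"
      unfolding s2 A(6)[OF u(1)] by simp
    also have "\<dots> = cdif Y (n - 1) (H n u) + h (n + 1) (vsnd u)"
      using hom_diff[OF c_dif'[OF b(2), of n] _ hom_in[OF A(2) u(1)], of "y (n + 1) (vsnd u)"] hom_in[OF A(4)[of "n + 1"], of "vsnd u"] u by (simp add: Hv)
    also have "h (n + 1) (vsnd u) = H (n + 1) (cdif (Dc Q K) n u)" using u kq[OF u(2)] d(7) y0 by (simp add: Hv)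
    finally show "s n (g n u) - f n u = cdif Y (n - 1) (H n u) + H (n + 1) (cdif (Dc Q K) n u)" .
  qed simp_all
  ultimately show ?thesis by blast
qed

text \<open>Injectivity on cohomology bounds \<open>g\<close> on \<open>Q n\<close> by some
  \<open>e\<close>. Surjectivity allows \<open>e\<close> to be changed by cocycles until its image
  agrees with the given homotopy up to a coboundary. Then on \<open>K n\<close> the remaining
  difference is a cocycle with bounding image, hence bounds in Z.\<close>

lemma resolution_null:
  assumes D: "resdata Q K" and b [simp]: "bc Z" "bc Y" and s: "quasi_iso Z Y s" and g: "g \<in> chain_maps (Dc Q K) Z"
    and null: "homotopic (Dc Q K) Y (\<lambda>n v. s n (g n v)) (\<lambda>n v. 0)"
  shows "homotopic (Dc Q K) Z g (\<lambda>n v. 0)"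
proof -
  have F: "fgdata Q K" and P: "\<And>n. projective_module scale (Q n)" and PK: "\<And>n. projective_module scale (sub (Q n) (K n))"
    using D by (simp_all add: resdata_def)
  note d = fgdataD[OF F] and bD [simp] = bc_Dc[OF F] and sp = Dc_chain_split[OF F g b(1)]
  have sc: "s \<in> chain_maps Z Y" using s by (simp add: quasi_iso_def)
  have kq: "k \<in> mcar (Q n)" if "k \<in> K n" for k n using that d(6) by blast
  obtain H where H: "\<And>n. H n \<in> module_hom (cmod (Dc Q K) n) (cmod Y (n - 1))"
    "\<And>n v. s n (g n v) - 0 = cdif Y (n - 1) (H n v) + H (n + 1) (cdif (Dc Q K) n v)"
    using null by (rule homotopicE) blast
  have H0: "H n 0 = 0" for n using hom_zero[OF H(1)[of n]] d by (simp add: lmod_mod_sum)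
  have "\<exists>e w. e \<in> module_hom (Q n) (cmod Z (n - 1)) \<and> w \<in> module_hom (sub (Q n) (K n)) (cmod Z (n - 1 - 1)) \<and>
      (\<forall>q\<in>mcar (Q n). cdif Z (n - 1) (e q) = g n (vpair q 0)) \<and>
      (\<forall>k\<in>K n. cdif Z (n - 1 - 1) (w k) = g (n - 1) (vpair 0 k) - e k)" for n
  proof -
    let ?K = "sub (Q n) (K n)" and ?a = "\<lambda>q. if q \<in> mcar (Q n) then g n (vpair q 0) else 0"
      and ?b = "\<lambda>k. if k \<in> K n then g (n - 1) (vpair 0 k) else 0"
    have Hq: "H n (vpair q 0) \<in> mcar (cmod Y (n - 1))" if "q \<in> mcar (Q n)" for q using hom_in[OF H(1)[of n], of "vpair q 0"] that d by simp
    have Hk: "H (n - 1) (vpair 0 k) \<in> mcar (cmod Y (n - 1 - 1))" if "k \<in> K n" for k using hom_in[OF H(1)[of "n - 1"], of "vpair 0 k"] that d by simp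
    have sa: "s n (g n (vpair q 0)) = cdif Y (n - 1) (H n (vpair q 0))" if "q \<in> mcar (Q n)" for q
      using H(2)[of n "vpair q 0"] that d H0 by (simp add: vpair_arith)
    have sb: "s (n - 1) (g (n - 1) (vpair 0 k)) = cdif Y (n - 1 - 1) (H (n - 1) (vpair 0 k)) + H n (vpair k 0)" if "k \<in> K n" for k
      using H(2)[of "n - 1" "vpair 0 k"] that d by simp
    obtain e where e: "e \<in> module_hom (Q n) (cmod Z (n - 1))" "\<And>q. q \<in> mcar (Q n) \<Longrightarrow> cdif Z (n - 1) (e q) = g n (vpair q 0)"
    proof (rule lift_bnd[OF P b(1) sp(1)])
      fix q assume q: "q \<in> mcar (Q n)"
      have "g n (vpair q 0) \<in> cocycles Z n" using hom_in[OF sp(1)[of n] q] sp(3)[OF q] q by (simp add: cocycleI)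
      moreover have "s n (g n (vpair q 0)) \<in> bnd Y n" using Hq[OF q] sa[OF q] by (simp add: bndI)
      ultimately show "?a q \<in> bnd Z n" using s quasi_iso_iff[OF b] q by auto
    next
      fix c assume "c \<in> module_hom (Q n) (cmod Z (n - 1))" "\<And>p. p \<in> mcar (Q n) \<Longrightarrow> cdif Z (n - 1) (c p) = ?a p"
      then show thesis by (intro that) simp_all
    qed
    let ?h = "restr (Q n) (\<lambda>q. H n (vpair q 0))"
    have hh: "?h \<in> module_hom (Q n) (cmod Y (n - 1))"
      using restrI[of "Q n" "\<lambda>q. H n (vpair q 0)" "cmod Y (n - 1)"] d Hq
        hom_add[OF H(1)[of n], of "vpair _ 0" "vpair _ 0"] hom_act[OF H(1)[of n], of "vpair _ 0"]
      by (simp add: vpair_arith act_zero[OF d(2)])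
    \<comment> \<open>The distance of \<open>e\<close> from the given null-homotopy. Without
      correcting it, the difference on \<open>K n\<close> is a cocycle whose image in Y need not
      bound.\<close>
    let ?\<phi> = "\<lambda>q. s (n - 1) (e q) - ?h q"
    have \<phi>: "?\<phi> \<in> module_hom (Q n) (cmod Y (n - 1))" using cmp_hom[OF e(1) ch_hom[OF sc]] hh by (intro diff_hom) simp_all
    have ein: "e q \<in> mcar (cmod Z (n - 1))" if "q \<in> mcar (Q n)" for q using hom_in[OF e(1) that] .
    have sein: "s (n - 1) (e q) \<in> mcar (cmod Y (n - 1))" if "q \<in> mcar (Q n)" for q using hom_in[OF ch_hom[OF sc] ein[OF that]] .
    obtain z y where z: "z \<in> module_hom (Q n) (cmod Z (n - 1))" "y \<in> module_hom (Q n) (cmod Y (n - 1 - 1))"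
      "\<And>q. q \<in> mcar (Q n) \<Longrightarrow> cdif Z (n - 1) (z q) = 0"
      "\<And>q. q \<in> mcar (Q n) \<Longrightarrow> s (n - 1) (z q) - ?\<phi> q = cdif Y (n - 1 - 1) (y q)"
    proof (rule lift_cocycle[OF P b s \<phi>])
      fix q assume q: "q \<in> mcar (Q n)"
      have "cdif Y (n - 1) (?\<phi> q) = cdif Y (n - 1) (s (n - 1) (e q)) - cdif Y (n - 1) (H n (vpair q 0))"
        using q hom_diff[OF c_dif'[OF b(2), of n] _ sein[OF q] Hq[OF q]] by (simp add: restr_def)
      also have "cdif Y (n - 1) (s (n - 1) (e q)) = s n (g n (vpair q 0))" using ch_com'[OF sc, of n "e q"] e(2)[OF q] by simp
      finally show "cdif Y (n - 1) (?\<phi> q) = 0" using sa[OF q] by simp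
    qed (use that in auto)
    define e' where "e' q = e q - z q" for q
    have e'h: "e' \<in> module_hom (Q n) (cmod Z (n - 1))" unfolding e'_def using e(1) z(1) by (intro diff_hom) simp_all
    have zin: "z q \<in> mcar (cmod Z (n - 1))" if "q \<in> mcar (Q n)" for q using hom_in[OF z(1) that] .
    have e'd: "cdif Z (n - 1) (e' q) = g n (vpair q 0)" if "q \<in> mcar (Q n)" for q
      using hom_diff[OF c_dif'[OF b(1), of n] _ ein[OF that] zin[OF that]] e(2)[OF that] z(3)[OF that] by (simp add: e'_def)
    have e's: "s (n - 1) (e' q) = H n (vpair q 0) - cdif Y (n - 1 - 1) (y q)" if "q \<in> mcar (Q n)" for q
    proof -
      have "s (n - 1) (e' q) = H n (vpair q 0) - (s (n - 1) (z q) - ?\<phi> q)"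
        using hom_diff[OF ch_hom[OF sc] _ ein[OF that] zin[OF that]] that by (simp add: e'_def restr_def)
      then show ?thesis by (simp only: z(4)[OF that])
    qed
    let ?\<psi> = "\<lambda>k. ?b k - restr ?K e' k"
    have \<psi>: "?\<psi> \<in> module_hom ?K (cmod Z (n - 1))"
      using sp(2)[of n] restr_sub_hom[OF e'h] d by (intro diff_hom) simp_all
    obtain w where w: "w \<in> module_hom ?K (cmod Z (n - 1 - 1))" "\<And>k. k \<in> K n \<Longrightarrow> cdif Z (n - 1 - 1) (w k) = g (n - 1) (vpair 0 k) - e' k"
    proof (rule lift_bnd[OF PK b(1) \<psi>])
      fix k assume "k \<in> mcar ?K"
      then have k: "k \<in> K n" by simp
      let ?x = "g (n - 1) (vpair 0 k) - e' k"
      have bin: "g (n - 1) (vpair 0 k) \<in> mcar (cmod Z (n - 1))" and e'in: "e' k \<in> mcar (cmod Z (n - 1))"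
        using hom_in[OF sp(2)[of n], of k] hom_in[OF e'h kq[OF k]] k by simp_all
      have "cdif Z (n - 1) ?x = 0"
        using hom_diff[OF c_dif'[OF b(1), of n] _ bin e'in] sp(4)[OF k] e'd[OF kq[OF k]] by simp
      then have cyc: "?x \<in> cocycles Z (n - 1)" using bin e'in by (simp add: cocycleI m_diff)
      have yk: "y k \<in> mcar (cmod Y (n - 1 - 1))" using hom_in[OF z(2) kq[OF k]] .
      have "s (n - 1) ?x = cdif Y (n - 1 - 1) (H (n - 1) (vpair 0 k)) + cdif Y (n - 1 - 1) (y k)"
        using hom_diff[OF ch_hom[OF sc] _ bin e'in] sb[OF k] e's[OF kq[OF k]] by simp
      also have "\<dots> = cdif Y (n - 1 - 1) (H (n - 1) (vpair 0 k) + y k)"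
        using hom_add[OF c_dif'[OF b(2), of "n - 1"] Hk[OF k] yk] by simp
      finally have "s (n - 1) ?x \<in> bnd Y (n - 1)" using bndI[of "H (n - 1) (vpair 0 k) + y k" Y "n - 1"] Hk[OF k] yk by (simp add: m_add)
      then have "?x \<in> bnd Z (n - 1)" using cyc s quasi_iso_iff[OF b] by blast
      then show "?\<psi> k \<in> bnd Z (n - 1)" using k by (simp add: restr_def)
    next
      fix c assume "c \<in> module_hom ?K (cmod Z (n - 1 - 1))" "\<And>p. p \<in> mcar ?K \<Longrightarrow> cdif Z (n - 1 - 1) (c p) = ?\<psi> p"
      then show thesis by (intro that) (simp_all add: restr_def)
    qed
    show ?thesis using e'h w e'd by blast
  qed
  then obtain e w where A: "\<And>n. e n \<in> module_hom (Q n) (cmod Z (n - 1))" "\<And>n. w n \<in> module_hom (sub (Q n) (K n)) (cmod Z (n - 1 - 1))"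
      "\<And>n q. q \<in> mcar (Q n) \<Longrightarrow> cdif Z (n - 1) (e n q) = g n (vpair q 0)"
      "\<And>n k. k \<in> K n \<Longrightarrow> cdif Z (n - 1 - 1) (w n k) = g (n - 1) (vpair 0 k) - e n k" by metis
  define G where "G n = restr (cmod (Dc Q K) n) (\<lambda>u. e n (vfst u) + w (n + 1) (vsnd u))" for n
  have Gh: "G n \<in> module_hom (cmod (Dc Q K) n) (cmod Z (n - 1))" for n
    unfolding G_def using mod_sum_hom[of "e n" "Q n" "cmod Z (n - 1)" "w (n + 1)" "sub (Q (n + 1)) (K (n + 1))"] A(1)[of n] A(2)[of "n + 1"] d by simp
  have Gv: "G n u = e n (vfst u) + w (n + 1) (vsnd u)" if "vfst u \<in> mcar (Q n)" "vsnd u \<in> K (n + 1)" for n u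
    using that by (simp add: G_def restr_def)
  have w0: "w n 0 = 0" for n using hom_zero[OF A(2)] d by simp
  show ?thesis
  proof (rule homotopicI[OF Gh g ch_zero])
    fix n u assume "u \<in> mcar (cmod (Dc Q K) n)"
    then have u: "vfst u \<in> mcar (Q n)" "vsnd u \<in> K (n + 1)" by simp_all
    have w': "cdif Z (n - 1) (w (n + 1) (vsnd u)) = g n (vpair 0 (vsnd u)) - e (n + 1) (vsnd u)" using A(4)[OF u(2)] by simp
    have "g n u = g n (vpair (vfst u) 0) + g n (vpair 0 (vsnd u))" using sp(5)[OF u] by simp
    also have "\<dots> = (cdif Z (n - 1) (e n (vfst u)) + cdif Z (n - 1) (w (n + 1) (vsnd u))) + e (n + 1) (vsnd u)"
      unfolding w' A(3)[OF u(1)] by simp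
    also have "\<dots> = cdif Z (n - 1) (G n u) + e (n + 1) (vsnd u)"
      using hom_add[OF c_dif'[OF b(1), of n] hom_in[OF A(1) u(1)], of "w (n + 1) (vsnd u)"] hom_in[OF A(2)[of "n + 1"], of "vsnd u"] u by (simp add: Gv)
    also have "e (n + 1) (vsnd u) = G (n + 1) (cdif (Dc Q K) n u)" using u kq[OF u(2)] d(7) w0 by (simp add: Gv)
    finally show "g n u - 0 = cdif Z (n - 1) (G n u) + G (n + 1) (cdif (Dc Q K) n u)" by simp
  qed simp_all
qed

end

section \<open>Transfer of local endomorphism rings\<close>

context preadditive
begin

text \<open>After normalising r so that f r = 1, the idempotent e = r f lies in the local ring of Y,
  so it is 1 or 0. If it is 1, then r and f are inverse; if it is 0, then 1 = f e r = 0 on X, which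
  is excluded.\<close>

lemma section_local_iso:
  assumes f: "f \<in> Arr C Y X" and r: "r \<in> Arr C X Y" and u: "Cmp C X Y X f r \<in> Units (End_ring C X)"
    and locX: "local_ring (End_ring C X)" and locY: "local_ring (End_ring C Y)" and [simp]: "X \<in> Ob C" "Y \<in> Ob C"
  shows "isomorphic C X Y"
proof -
  interpret RY: ring "End_ring C Y" by (rule local_ringD(1)[OF locY])
  obtain w where w: "w \<in> Arr C X X" "Cmp C X X X (Cmp C X Y X f r) w = Idn C X" using u by (auto simp: Units_def)
  define r' where "r' = Cmp C X X Y r w"
  have r' [simp]: "r' \<in> Arr C X Y" using r w by (simp add: r'_def cmp_in)
  note [simp] = f
  have fr: "Cmp C X Y X f r' = Idn C X" using w r by (simp add: r'_def cmp_assoc)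
  define e where "e = Cmp C Y X Y r' f"
  have e [simp]: "e \<in> Arr C Y Y" by (simp add: e_def cmp_in)
  have ee: "Cmp C Y Y Y e e = e"
  proof -
    have "Cmp C Y Y Y e e = Cmp C Y X Y r' (Cmp C Y X X (Cmp C X Y X f r') f)"
      unfolding e_def by (simp add: cmp_assoc cmp_in del: cmp_idl)
    then show ?thesis by (simp add: fr e_def)
  qed
  have eR: "e \<in> carrier (End_ring C Y)" by simp
  define d where "d = \<one>\<^bsub>End_ring C Y\<^esub> \<ominus>\<^bsub>End_ring C Y\<^esub> e"
  have dR: "d \<in> carrier (End_ring C Y)" using eR by (simp add: d_def del: End_ring_simps)
  have sum: "d \<oplus>\<^bsub>End_ring C Y\<^esub> e = \<one>\<^bsub>End_ring C Y\<^esub>"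
    using eR by (simp add: d_def RY.minus_eq RY.a_assoc RY.l_neg del: End_ring_simps)
  have "d \<in> Units (End_ring C Y) \<or> e \<in> Units (End_ring C Y)"
    by (rule local_ringD(4)[OF locY dR eR]) (simp only: sum RY.Units_one_closed)
  then show ?thesis
  proof
    assume "e \<in> Units (End_ring C Y)"
    moreover have "e \<otimes>\<^bsub>End_ring C Y\<^esub> e = e \<otimes>\<^bsub>End_ring C Y\<^esub> \<one>\<^bsub>End_ring C Y\<^esub>" by (simp add: ee)
    ultimately have "e = \<one>\<^bsub>End_ring C Y\<^esub>" using RY.Units_l_cancel[OF _ eR RY.one_closed] by blast
    then have "Cmp C Y X Y r' f = Idn C Y" by (simp add: e_def)
    then show ?thesis using fr by (intro isoI[of r' _ _ f]) simp_all
  next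
    assume du: "d \<in> Units (End_ring C Y)"
    have "Add C Y Y (Cmp C Y Y Y d e) e = Cmp C Y Y Y (Add C Y Y d e) e"
      using dR by (simp add: cmp_addl ee)
    also have "\<dots> = e" using sum by simp
    finally have "Add C Y Y e (Cmp C Y Y Y d e) = Add C Y Y e (Zer C Y Y)"
      using dR by (simp add: add_comm cmp_in)
    then have "Cmp C Y Y Y d e = Zer C Y Y" by (rule add_cancel) (use dR in \<open>simp_all add: cmp_in\<close>)
    then have "d \<otimes>\<^bsub>End_ring C Y\<^esub> e = d \<otimes>\<^bsub>End_ring C Y\<^esub> \<zero>\<^bsub>End_ring C Y\<^esub>" using dR by simp
    then have "e = \<zero>\<^bsub>End_ring C Y\<^esub>" using RY.Units_l_cancel[OF du eR RY.zero_closed] by blast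
    then have e0: "e = Zer C Y Y" by simp
    have "Idn C X = Cmp C X Y X f (Cmp C X X Y r' (Cmp C X Y X f r'))" by (simp add: fr)
    also have "\<dots> = Cmp C X Y X f (Cmp C X Y Y e r')" unfolding e_def by (simp add: cmp_assoc del: cmp_idl cmp_idr)
    also have "\<dots> = Zer C X X" by (simp add: e0)
    finally show ?thesis using local_ringD(2)[OF locX] by simp
  qed
qed

end

context addfun
begin

text \<open>A non-zero quotient of a local ring is local: of f and 1 - f one is a unit, and its
  image is again a unit.\<close>

lemma local_End_full:
  assumes X [simp]: "X \<in> Ob C" and loc: "local_ring (End_ring C X)"
    and full: "Arr D (\<omega> X) (\<omega> X) \<subseteq> \<phi> X X ` Arr C X X" and nz: "Idn D (\<omega> X) \<noteq> Zer D (\<omega> X) (\<omega> X)"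
  shows "local_ring (End_ring D (\<omega> X))"
proof (rule local_ringI)
  interpret RC: ring "End_ring C X" by (rule C.ring_End) simp
  interpret RD: ring "End_ring D (\<omega> X)" by (rule D.ring_End) simp
  show "ring (End_ring D (\<omega> X))" by (rule RD.ring_axioms)
  show "\<one>\<^bsub>End_ring D (\<omega> X)\<^esub> \<noteq> \<zero>\<^bsub>End_ring D (\<omega> X)\<^esub>" using nz by simp
  have unit: "\<phi> X X f \<in> Units (End_ring D (\<omega> X))" if fu: "f \<in> Units (End_ring C X)" for f
  proof -
    obtain g where "f \<in> Arr C X X" "g \<in> Arr C X X" "Cmp C X X X g f = Idn C X" "Cmp C X X X f g = Idn C X"
      using fu by (auto simp: Units_def)
    then show ?thesis by (auto simp: Units_def simp flip: fun_cmp intro!: bexI[of _ "\<phi> X X g"])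
  qed
  fix a assume "a \<in> carrier (End_ring D (\<omega> X))"
  then obtain f where f: "f \<in> Arr C X X" "a = \<phi> X X f" using full by auto
  then have fR: "f \<in> carrier (End_ring C X)" by simp
  define d where "d = \<one>\<^bsub>End_ring C X\<^esub> \<ominus>\<^bsub>End_ring C X\<^esub> f"
  have dR: "d \<in> carrier (End_ring C X)" using fR by (simp add: d_def del: C.End_ring_simps)
  have sum: "d \<oplus>\<^bsub>End_ring C X\<^esub> f = \<one>\<^bsub>End_ring C X\<^esub>"
    using fR by (simp add: d_def RC.minus_eq RC.a_assoc RC.l_neg del: C.End_ring_simps)
  have "\<phi> X X d \<oplus>\<^bsub>End_ring D (\<omega> X)\<^esub> a = \<one>\<^bsub>End_ring D (\<omega> X)\<^esub>"
    using sum dR f fun_add[of d X X f] by simp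
  moreover have "\<phi> X X d \<in> carrier (End_ring D (\<omega> X))" "a \<in> carrier (End_ring D (\<omega> X))" using dR f by simp_all
  ultimately have "\<phi> X X d = \<one>\<^bsub>End_ring D (\<omega> X)\<^esub> \<ominus>\<^bsub>End_ring D (\<omega> X)\<^esub> a"
    by (metis RD.add.inv_solve_right' RD.minus_eq RD.one_closed)
  moreover have "d \<in> Units (End_ring C X) \<or> f \<in> Units (End_ring C X)"
    by (rule local_ringD(4)[OF loc dR fR]) (simp only: sum RC.Units_one_closed)
  ultimately show "a \<in> Units (End_ring D (\<omega> X)) \<or> \<one>\<^bsub>End_ring D (\<omega> X)\<^esub> \<ominus>\<^bsub>End_ring D (\<omega> X)\<^esub> a \<in> Units (End_ring D (\<omega> X))"
    using unit f(2) by metis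
qed

end

lemma addfun_comp:
  assumes "addfun A B \<omega> \<phi>" "addfun B C \<omega>' \<phi>'"
  shows "addfun A C (\<lambda>X. \<omega>' (\<omega> X)) (\<lambda>X Y f. \<phi>' (\<omega> X) (\<omega> Y) (\<phi> X Y f))"
proof -
  interpret F: addfun A B \<omega> \<phi> by (rule assms)
  interpret G: addfun B C \<omega>' \<phi>' by (rule assms)
  show ?thesis
    by unfold_locales (auto simp: additive_functor_def F.fun_cmp G.fun_cmp F.fun_add G.fun_add)
qed

section \<open>The bounded derived category of a hereditary algebra\<close>

locale hered_alg = fd_alg scale for scale :: "'k::field \<Rightarrow> 'h::ring_1 \<Rightarrow> 'h" +
  assumes hereditary: "hereditary scale"
begin

text \<open>The last clause locates the projectives: for a module placed in one degree only one
  \<open>Q n\<close> can be non-zero, from which the computation of maps between shifted modules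
  follows.\<close>

definition is_resolution ::
  "('h, 'k) cplx \<Rightarrow> (int \<Rightarrow> ('h, 'k) hmod) \<times> (int \<Rightarrow> 'k vec set) \<times> 'k cmap \<Rightarrow> bool" where
  "is_resolution X t \<longleftrightarrow> (case t of (Q, K, p) \<Rightarrow> resdata Q K \<and> quasi_iso (Dc Q K) X p \<and>
     (\<forall>n. mcar (cmod X n) = {0} \<longrightarrow> mcar (Q n) = {0}))"

text \<open>\<open>Q n\<close> covers the cocycles of X in degree n and \<open>K n\<close> is the
  preimage of the coboundaries, so their quotient is the cohomology of X. On \<open>K n\<close> the
  cover lifts through the differential to \<open>\<sigma>\<close>, and \<open>\<pi>\<close> and
  \<open>\<sigma>\<close> together form the quasi-isomorphism.\<close>

lemma resolution_exists:
  assumes X [simp]: "bc X"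
  shows "\<exists>t. is_resolution X t"
proof -
  define Pr where "Pr n Q \<pi> \<sigma> \<longleftrightarrow> projective_module scale Q \<and> \<pi> \<in> module_hom Q (cmod X n) \<and> \<pi> ` mcar Q = cocycles X n \<and>
      (mcar (cmod X n) = {0} \<longrightarrow> mcar Q = {0}) \<and> subm {q \<in> mcar Q. \<pi> q \<in> bnd X n} Q \<and>
      projective_module scale (sub Q {q \<in> mcar Q. \<pi> q \<in> bnd X n}) \<and>
      \<sigma> \<in> module_hom (sub Q {q \<in> mcar Q. \<pi> q \<in> bnd X n}) (cmod X (n - 1)) \<and>
      (\<forall>k\<in>mcar Q. \<pi> k \<in> bnd X n \<longrightarrow> cdif X (n - 1) (\<sigma> k) = \<pi> k)" for n Q \<pi> \<sigma>
  have "\<exists>Q \<pi> \<sigma>. Pr n Q \<pi> \<sigma>" for n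
  proof -
    let ?C = "sub (cmod X n) (cocycles X n)"
    have fC: "fg ?C" using subm_fg[OF _ cocycles_subm] by simp
    obtain Q \<pi> where Q: "projective_module scale Q" "\<pi> \<in> module_hom Q ?C" "\<pi> ` mcar Q = mcar ?C" "mcar ?C = {0} \<Longrightarrow> mcar Q = {0}"
      using fC by (rule proj_cover) blast
    have fQ: "fg Q" using Q(1) by (rule proj_fg)
    have \<pi>: "\<pi> \<in> module_hom Q (cmod X n)" using Q(2) cocycles_subm[of X n] by (auto simp: module_hom_def subm_def)
    let ?K = "{q \<in> mcar Q. \<pi> q \<in> bnd X n}"
    have K: "subm ?K Q" using subm_vimage[OF \<pi> _ _ bnd_subm] fQ by simp
    \<comment> \<open>Heredity enters here: \<open>K n\<close> is a submodule of a projective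
      module.\<close>
    have PK: "projective_module scale (sub Q ?K)"
      using hereditary Q(1) subm_fg[OF fQ K] subm_submodule[OF K] unfolding hereditary_def by blast
    have "restr (sub Q ?K) \<pi> \<in> module_hom (sub Q ?K) (cmod X n)" using \<pi> K fQ by (simp add: restr_sub_hom)
    then obtain \<sigma> where \<sigma>: "\<sigma> \<in> module_hom (sub Q ?K) (cmod X (n - 1))"
      "\<And>k. k \<in> mcar (sub Q ?K) \<Longrightarrow> cdif X (n - 1) (\<sigma> k) = restr (sub Q ?K) \<pi> k"
    proof (rule lift_bnd[OF PK X])
      fix p assume "p \<in> mcar (sub Q ?K)"
      then show "restr (sub Q ?K) \<pi> p \<in> bnd X n" by (simp add: restr_def)
    qed blast
    have z: "mcar Q = {0}" if "mcar (cmod X n) = {0}"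
    proof (rule Q(4))
      show "mcar ?C = {0}" using that cocycles_subm[of X n] by (auto simp: subm_def)
    qed
    show ?thesis
      unfolding Pr_def using Q(1,3) \<pi> K PK \<sigma> z
      by (intro exI[of _ Q] exI[of _ \<pi>] exI[of _ \<sigma>]) (simp add: restr_def)
  qed
  then obtain Q \<pi> \<sigma> where Pr: "\<And>n. Pr n (Q n) (\<pi> n) (\<sigma> n)" by metis
  have A: "\<And>n. projective_module scale (Q n)" "\<And>n. \<pi> n \<in> module_hom (Q n) (cmod X n)" "\<And>n. \<pi> n ` mcar (Q n) = cocycles X n"
      "\<And>n. mcar (cmod X n) = {0} \<Longrightarrow> mcar (Q n) = {0}" "\<And>n. subm {q \<in> mcar (Q n). \<pi> n q \<in> bnd X n} (Q n)"
      "\<And>n. projective_module scale (sub (Q n) {q \<in> mcar (Q n). \<pi> n q \<in> bnd X n})"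
      "\<And>n. \<sigma> n \<in> module_hom (sub (Q n) {q \<in> mcar (Q n). \<pi> n q \<in> bnd X n}) (cmod X (n - 1))"
      "\<And>n k. k \<in> mcar (Q n) \<Longrightarrow> \<pi> n k \<in> bnd X n \<Longrightarrow> cdif X (n - 1) (\<sigma> n k) = \<pi> n k"
    using Pr unfolding Pr_def by simp_all
  define K where "K n = {q \<in> mcar (Q n). \<pi> n q \<in> bnd X n}" for n
  have fQ: "fg (Q n)" for n using A(1) by (rule proj_fg)
  obtain b where b: "\<And>n. b < \<bar>n\<bar> \<Longrightarrow> mcar (cmod X n) = {0}" using X unfolding bounded_complex_def by blast
  have F: "fgdata Q K"
    unfolding fgdata_def
  proof (intro conjI allI exI[of _ b] impI)
    show "subm (K n) (Q n)" for n unfolding K_def by (rule A(5))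
    show "mcar (Q n) = {0}" if "b < \<bar>n\<bar>" for n by (rule A(4)[OF b[OF that]])
  qed (rule fQ)
  have D: "resdata Q K" unfolding resdata_def using F A(1,6) by (simp add: K_def)
  note d = fgdataD[OF F] and bD [simp] = bc_Dc[OF F]
  have \<sigma>: "\<sigma> n \<in> module_hom (sub (Q n) (K n)) (cmod X (n - 1))" for n unfolding K_def by (rule A(7))
  have \<sigma>d: "cdif X (n - 1) (\<sigma> n k) = \<pi> n k" if "k \<in> K n" for n k using A(8) that by (simp add: K_def)
  have \<sigma>0: "\<sigma> n 0 = 0" for n using hom_zero[OF \<sigma>] d by simp
  have \<pi>0: "\<pi> n 0 = 0" for n using hom_zero[OF A(2)] d by simp
  have \<pi>c: "\<pi> n q \<in> cocycles X n" if "q \<in> mcar (Q n)" for n q using A(3)[of n] that by blast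
  define p where "p n = restr (cmod (Dc Q K) n) (\<lambda>u. \<pi> n (vfst u) + \<sigma> (n + 1) (vsnd u))" for n
  have ph: "p n \<in> module_hom (cmod (Dc Q K) n) (cmod X n)" for n
    unfolding p_def using mod_sum_hom[of "\<pi> n" "Q n" "cmod X n" "\<sigma> (n + 1)" "sub (Q (n + 1)) (K (n + 1))"] A(2)[of n] \<sigma>[of "n + 1"] d by simp
  have pv: "p n u = \<pi> n (vfst u) + \<sigma> (n + 1) (vsnd u)" if "vfst u \<in> mcar (Q n)" "vsnd u \<in> K (n + 1)" for n u
    using that by (simp add: p_def restr_def)
  have kq: "k \<in> mcar (Q n)" if "k \<in> K n" for k n using that d(6) by blast
  have pc: "p \<in> chain_maps (Dc Q K) X"
  proof (rule chI[OF ph])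
    fix n u assume "u \<in> mcar (cmod (Dc Q K) n)"
    then have u: "vfst u \<in> mcar (Q n)" "vsnd u \<in> K (n + 1)" by simp_all
    have "cdif X n (p n u) = cdif X n (\<pi> n (vfst u)) + cdif X n (\<sigma> (n + 1) (vsnd u))"
      using hom_add[OF c_dif[OF X, of n] hom_in[OF A(2) u(1)], of "\<sigma> (n + 1) (vsnd u)"] hom_in[OF \<sigma>[of "n + 1"], of "vsnd u"] u by (simp add: pv)
    also have "\<dots> = \<pi> (n + 1) (vsnd u)" using cocycleD(2)[OF \<pi>c[OF u(1)]] \<sigma>d[OF u(2)] by simp
    also have "\<dots> = p (n + 1) (cdif (Dc Q K) n u)" using u kq[OF u(2)] d(7) \<sigma>0 by (simp add: pv)
    finally show "p (n + 1) (cdif (Dc Q K) n u) = cdif X n (p n u)" by simp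
  qed simp_all
  have "quasi_iso (Dc Q K) X p"
    unfolding quasi_iso_iff[OF bD X]
  proof (intro conjI allI ballI impI pc)
    fix n v assume v: "v \<in> cocycles (Dc Q K) n" and pb: "p n v \<in> bnd X n"
    have u: "vfst v \<in> mcar (Q n)" "vsnd v \<in> K (n + 1)" and "cdif (Dc Q K) n v = 0" using v by (auto simp: cocycles_def simp del: Dc_simps(2))
    then have "vpair (vsnd v) 0 = 0" by simp
    then have v0: "vsnd v = 0" by (metis vpair_simps(1,10))
    then have "\<pi> n (vfst v) \<in> bnd X n" using pb u \<sigma>0 by (simp add: pv)
    then have k: "vfst v \<in> K n" using u by (simp add: K_def)
    have "cdif (Dc Q K) (n - 1) (vpair 0 (vfst v)) = v" using k d(8) v0 vpair_simps(3)[of v] by simp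
    then show "v \<in> bnd (Dc Q K) n" using bndI[of "vpair 0 (vfst v)" "Dc Q K" n] k d(8) by simp
  next
    fix n w assume "w \<in> cocycles X n"
    then obtain q where q: "q \<in> mcar (Q n)" "w = \<pi> n q" using A(3)[of n] by blast
    have "vpair q 0 \<in> cocycles (Dc Q K) n" using q d(7) by (simp add: cocycles_def vpair_arith)
    moreover have "w - p n (vpair q 0) = 0" using q d(7) \<sigma>0 by (simp add: pv)
    ultimately show "\<exists>v\<in>cocycles (Dc Q K) n. w - p n v \<in> bnd X n" using bnd_zero[OF X] by metis
  qed
  then show ?thesis using D A(4) unfolding is_resolution_def by (intro exI[of _ "(Q, K, p)"]) simp
qed

definition RQ :: "('h, 'k) cplx \<Rightarrow> int \<Rightarrow> ('h, 'k) hmod" where "RQ X = fst (SOME t. is_resolution X t)"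
definition RK :: "('h, 'k) cplx \<Rightarrow> int \<Rightarrow> 'k vec set" where "RK X = fst (snd (SOME t. is_resolution X t))"
definition rp :: "('h, 'k) cplx \<Rightarrow> 'k cmap" where "rp X = snd (snd (SOME t. is_resolution X t))"

abbreviation Rs :: "('h, 'k) cplx \<Rightarrow> ('h, 'k) cplx" where "Rs X \<equiv> Dc (RQ X) (RK X)"

lemma Rs:
  assumes "bc X"
  shows "resdata (RQ X) (RK X)" "fgdata (RQ X) (RK X)" "bc (Rs X)" "quasi_iso (Rs X) X (rp X)" "rp X \<in> chain_maps (Rs X) X"
    "mcar (cmod X n) = {0} \<Longrightarrow> mcar (RQ X n) = {0}"
proof -
  have "is_resolution X (SOME t. is_resolution X t)" using someI_ex[OF resolution_exists[OF assms]] .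
  then have *: "is_resolution X (RQ X, RK X, rp X)" by (simp add: RQ_def RK_def rp_def)
  then show "resdata (RQ X) (RK X)" "quasi_iso (Rs X) X (rp X)" "mcar (cmod X n) = {0} \<Longrightarrow> mcar (RQ X n) = {0}"
    by (simp_all add: is_resolution_def)
  then show "fgdata (RQ X) (RK X)" "bc (Rs X)" "rp X \<in> chain_maps (Rs X) X" using bc_Dc by (simp_all add: resdata_def quasi_iso_def)
qed

lemma quasi_iso_idn: "bc X \<Longrightarrow> quasi_iso X X (\<lambda>n. restr (cmod X n) (\<lambda>v. v))"
  unfolding quasi_iso_iff
  using ch_idn[of X] bnd_zero[of X] by (auto simp: restr_def cocycles_def intro!: bexI)

lemma quasi_iso_cmp:
  assumes f: "quasi_iso X Y f" and g: "quasi_iso Y Z g" and b: "bc X" "bc Y" "bc Z"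
  shows "quasi_iso X Z (\<lambda>n v. g n (f n v))"
  unfolding quasi_iso_iff[OF b(1,3)]
proof (intro conjI allI ballI impI)
  have c: "f \<in> chain_maps X Y" "g \<in> chain_maps Y Z" using f g by (simp_all add: quasi_iso_def)
  note F = quasi_iso_iff[OF b(1,2), THEN iffD1, OF f] and G = quasi_iso_iff[OF b(2,3), THEN iffD1, OF g]
  show "(\<lambda>n v. g n (f n v)) \<in> chain_maps X Z" by (rule ch_cmp[OF c b])
  show "v \<in> bnd X n" if "v \<in> cocycles X n" "g n (f n v) \<in> bnd Z n" for n v
    using that F G ch_cocycle[OF c(1) b(2,1) that(1)] by blast
  fix n w assume "w \<in> cocycles Z n"
  then obtain y where y: "y \<in> cocycles Y n" "w - g n y \<in> bnd Z n" using G by blast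
  then obtain x where x: "x \<in> cocycles X n" "y - f n x \<in> bnd Y n" using F by blast
  have "g n (y - f n x) = g n y - g n (f n x)"
    using hom_diff[OF ch_hom[OF c(2)] _ cocycleD(1)[OF y(1)] cocycleD(1)[OF ch_cocycle[OF c(1) b(2,1) x(1)]]] b by simp
  then have "g n y - g n (f n x) \<in> bnd Z n" using ch_bnd[OF c(2) x(2)] by simp
  then have "(w - g n y) + (g n y - g n (f n x)) \<in> bnd Z n" by (rule bnd_add[OF b(3) y(2)])
  then show "\<exists>v\<in>cocycles X n. w - g n (f n v) \<in> bnd Z n" using x(1) by (intro bexI[of _ x]) simp_all
qed

lemma homotopic_diff_iff:
  "homotopic X Y f g \<longleftrightarrow> homotopic X Y (\<lambda>n v. f n v - g n v) (\<lambda>n v. 0)"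
  by (simp add: homotopic_def)

lemma qisE:
  assumes "s \<in> qis X Y"
  obtains f where "quasi_iso X Y f" "s = hclass X Y f" "f \<in> chain_maps X Y"
  using assms by (auto simp: qis_def quasi_iso_def)

lemma qisI: "quasi_iso X Y f \<Longrightarrow> hclass X Y f \<in> qis X Y"
  by (simp add: qis_def)

text \<open>Existence of lifts is \<open>resolution_lift\<close>; uniqueness is
  \<open>resolution_null\<close> applied to the difference of two lifts.\<close>

lemma resolved_Kb: "resolved KB qis Rs (\<lambda>X. hclass (Rs X) X (rp X))"
proof unfold_locales
  fix X Y :: "('h, 'k) cplx" and s assume "s \<in> qis X Y" "X \<in> Ob KB" "Y \<in> Ob KB"
  then show "s \<in> Arr KB X Y" by (auto elim: qisE)
next
  fix X assume "X \<in> Ob KB"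
  then show "Idn KB X \<in> qis X X" using qisI[OF quasi_iso_idn[of X]] by simp
next
  fix X Y Z s t assume b: "X \<in> Ob KB" "Y \<in> Ob KB" "Z \<in> Ob KB" and "s \<in> qis X Y" "t \<in> qis Y Z"
  then obtain f g where f: "quasi_iso X Y f" "s = hclass X Y f" "f \<in> chain_maps X Y"
    and g: "quasi_iso Y Z g" "t = hclass Y Z g" "g \<in> chain_maps Y Z" by (meson qisE)
  then show "Cmp KB X Y Z t s \<in> qis X Z" using b quasi_iso_cmp[OF f(1) g(1)] by (simp add: Kb_cmp qisI)
next
  show "X \<in> Ob KB \<Longrightarrow> Rs X \<in> Ob KB" for X using Rs(3) by simp
  show "X \<in> Ob KB \<Longrightarrow> hclass (Rs X) X (rp X) \<in> qis (Rs X) X" for X using qisI[OF Rs(4)[of X]] by simp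
next
  fix X Y Z s f assume s: "s \<in> qis Z Y" and f: "f \<in> Arr KB (Rs X) Y" and "X \<in> Ob KB" "Y \<in> Ob KB" "Z \<in> Ob KB"
  then have b [simp]: "bc X" "bc Y" "bc Z" by simp_all
  note [simp] = Rs(3)
  obtain s' where s': "quasi_iso Z Y s'" "s = hclass Z Y s'" "s' \<in> chain_maps Z Y" using s by (rule qisE)
  obtain f' where f': "f' \<in> chain_maps (Rs X) Y" "f = hclass (Rs X) Y f'" using f by auto
  obtain g where g: "g \<in> chain_maps (Rs X) Z" "homotopic (Rs X) Y (\<lambda>n v. s' n (g n v)) f'"
    using resolution_lift[OF Rs(1)[OF b(1)] b(3,2) s'(1) f'(1)] by blast
  have "hclass (Rs X) Y (\<lambda>n v. s' n (g n v)) = f"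
    unfolding f'(2) using hclass_eq_iff[OF ch_cmp[OF g(1) s'(3)] f'(1)] g(2) by simp
  then show "\<exists>g\<in>Arr KB (Rs X) Z. Cmp KB (Rs X) Z Y s g = f"
    using g(1) s' by (intro bexI[of _ "hclass (Rs X) Z g"]) (simp_all add: Kb_cmp)
next
  fix X Y Z s g h assume s: "s \<in> qis Z Y" and gh: "g \<in> Arr KB (Rs X) Z" "h \<in> Arr KB (Rs X) Z" and "X \<in> Ob KB" "Y \<in> Ob KB" "Z \<in> Ob KB"
    and eq: "Cmp KB (Rs X) Z Y s g = Cmp KB (Rs X) Z Y s h"
  then have b [simp]: "bc X" "bc Y" "bc Z" by simp_all
  note [simp] = Rs(3)
  obtain s' where s': "quasi_iso Z Y s'" "s = hclass Z Y s'" "s' \<in> chain_maps Z Y" using s by (rule qisE)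
  obtain g' where g': "g' \<in> chain_maps (Rs X) Z" "g = hclass (Rs X) Z g'" using gh(1) by auto
  obtain h' where h': "h' \<in> chain_maps (Rs X) Z" "h = hclass (Rs X) Z h'" using gh(2) by auto
  have "homotopic (Rs X) Y (\<lambda>n v. s' n (g' n v)) (\<lambda>n v. s' n (h' n v))"
    using eq hclass_eq_iff[OF ch_cmp[OF g'(1) s'(3)] ch_cmp[OF h'(1) s'(3)]] s' g' h' by (simp add: Kb_cmp)
  moreover have "s' n (g' n v) - s' n (h' n v) = s' n (g' n v - h' n v)" for n v
    using hom_diff[OF ch_hom[OF s'(3)]] hom_in[OF ch_hom[OF g'(1)]] hom_in[OF ch_hom[OF h'(1)]]
      hom_out[OF ch_hom[OF g'(1)]] hom_out[OF ch_hom[OF h'(1)]] hom_zero[OF ch_hom[OF s'(3)]]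
    by (cases "v \<in> mcar (cmod (Rs X) n)") (simp_all del: Dc_simps)
  ultimately have "homotopic (Rs X) Y (\<lambda>n v. s' n (g' n v - h' n v)) (\<lambda>n v. 0)"
    unfolding homotopic_diff_iff[of _ _ "\<lambda>n v. s' n (g' n v)"] by simp
  moreover have "(\<lambda>n v. g' n v - h' n v) \<in> chain_maps (Rs X) Z"
    using ch_add[OF g'(1) ch_neg[OF h'(1)]] by simp
  ultimately have "homotopic (Rs X) Z (\<lambda>n v. g' n v - h' n v) (\<lambda>n v. 0)"
    by (intro resolution_null[OF Rs(1)[OF b(1)] b(3,2) s'(1)])
  then show "g = h" using hclass_eq_iff[OF g'(1) h'(1)] g' h' by (simp flip: homotopic_diff_iff)
qed

sublocale D: resolved KB qis Rs "\<lambda>X. hclass (Rs X) X (rp X)"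
  by (rule resolved_Kb)

abbreviation "DB \<equiv> Db scale"

lemma Db_Loc: "DB = D.Loc"
  by (simp add: Db_def)

lemma addfun_Db: "addfun Ch DB (\<lambda>X. X) (\<lambda>X Y f. localize_arr KB qis X Y (hclass X Y f))"
  unfolding Db_Loc by (rule addfun_comp[OF addfun_Kb D.addfun_Loc])

lemma Db_Ob [simp]: "Ob DB = {X. bc X}"
  by (simp add: Db_Loc)

lemma preadditive_Db: "preadditive DB"
  unfolding Db_Loc by (rule D.L.preadditive_axioms)

lemma quasi_iso_isomorphic: "quasi_iso X Y f \<Longrightarrow> bc X \<Longrightarrow> bc Y \<Longrightarrow> isomorphic DB X Y"
  unfolding Db_Loc by (rule D.S_isomorphic[OF qisI]) simp_all

end

section \<open>Shifts of complexes and of isomorphisms\<close>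

context hered_alg
begin

interpretation DB: preadditive DB
  by (rule preadditive_Db)

lemma shift_simps [simp]:
  "cmod (shift m X) n = cmod X (n + m)"
  "cdif (shift m X) n v = (if even m then cdif X (n + m) v else - cdif X (n + m) v)"
  by (simp_all add: shift_def)

lemma shift_shift: "shift m (shift m' X) = shift (m + m') X"
  by (rule cplx.equality) (auto simp: shift_def fun_eq_iff add.assoc)

lemma shift_0: "shift 0 X = X"
  by (rule cplx.equality) (auto simp: shift_def fun_eq_iff)

lemma bc_shift [simp]:
  assumes X: "bc X"
  shows "bc (shift m X)"
  unfolding bounded_complex_def
proof (intro conjI allI)
  fix n v
  show "fg (cmod (shift m X) n)" using X by simp
  have d: "cdif X (n + m) \<in> module_hom (cmod X (n + m)) (cmod X (n + 1 + m))"
    using c_dif[OF X, of "n + m"] by (simp add: ac_simps)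
  have "cdif (shift m X) n = (if even m then cdif X (n + m) else (\<lambda>v. - cdif X (n + m) v))" by (auto simp: fun_eq_iff)
  then show "cdif (shift m X) n \<in> module_hom (cmod (shift m X) n) (cmod (shift m X) (n + 1))"
    using d neg_hom[OF d] X by simp
  have "cdif X (n + 1 + m) (cdif X (n + m) v) = 0" for v using c_dd[OF X, of "n + m" v] by (simp add: ac_simps)
  moreover have "cdif X (n + 1 + m) (- cdif X (n + m) v) = - cdif X (n + 1 + m) (cdif X (n + m) v)"
  proof (cases "v \<in> mcar (cmod X (n + m))")
    case True
    then show ?thesis using hom_neg[OF c_dif[OF X] _ hom_in[OF d]] X by simp
  next
    case False
    then have "cdif X (n + m) v = 0" using hom_out[OF c_dif[OF X]] by blast
    then show ?thesis using hom_zero[OF c_dif[OF X]] X by simp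
  qed
  ultimately show "cdif (shift m X) (n + 1) (cdif (shift m X) n v) = 0" by simp
next
  obtain b where b: "\<And>n. b < \<bar>n\<bar> \<Longrightarrow> mcar (cmod X n) = {0}" using X unfolding bounded_complex_def by blast
  have "mcar (cmod (shift m X) n) = {0}" if "b + \<bar>m\<bar> < \<bar>n\<bar>" for n
    using that by (simp, intro b) linarith
  then show "\<exists>b. \<forall>n. b < \<bar>n\<bar> \<longrightarrow> mcar (cmod (shift m X) n) = {0}" by blast
qed

lemma cocycles_shift: "cocycles (shift m X) n = cocycles X (n + m)"
  by (auto simp: cocycles_def)

text \<open>For odd m the differential changes sign, which leaves its image unchanged.\<close>

lemma bnd_shift:
  assumes X: "bc X"
  shows "bnd (shift m X) n = bnd X (n + m)"
proof -
  have i: "n - 1 + m = n + m - 1" by simp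
  show ?thesis
  proof (cases "even m")
    case True
    then show ?thesis by (simp add: bnd_def i)
  next
    case False
    have "(\<lambda>v. - cdif X (n + m - 1) v) ` mcar (cmod X (n + m - 1)) = cdif X (n + m - 1) ` mcar (cmod X (n + m - 1))"
    proof (intro equalityI subsetI)
      fix x assume "x \<in> (\<lambda>v. - cdif X (n + m - 1) v) ` mcar (cmod X (n + m - 1))"
      then obtain v where "v \<in> mcar (cmod X (n + m - 1))" "x = cdif X (n + m - 1) (- v)"
        using hom_neg[OF c_dif[OF X]] X by auto
      then show "x \<in> cdif X (n + m - 1) ` mcar (cmod X (n + m - 1))" using m_neg[of "cmod X (n + m - 1)" v] X by simp
    next
      fix x assume "x \<in> cdif X (n + m - 1) ` mcar (cmod X (n + m - 1))"
      then obtain v where v: "v \<in> mcar (cmod X (n + m - 1))" "x = cdif X (n + m - 1) v" by auto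
      then have "x = - cdif X (n + m - 1) (- v)" using hom_neg[OF c_dif[OF X]] X by simp
      then show "x \<in> (\<lambda>v. - cdif X (n + m - 1) v) ` mcar (cmod X (n + m - 1))"
        using m_neg[of "cmod X (n + m - 1)" v] X v by (intro image_eqI[of _ _ "- v"]) simp_all
    qed
    then show ?thesis using False by (simp add: bnd_def i)
  qed
qed

lemma quasi_iso_shift:
  assumes f: "quasi_iso X Y f" and b: "bc X" "bc Y"
  shows "quasi_iso (shift m X) (shift m Y) (\<lambda>n. f (n + m))"
proof -
  have c: "f \<in> chain_maps X Y" using f by (simp add: quasi_iso_def)
  have "(\<lambda>n. f (n + m)) \<in> chain_maps (shift m X) (shift m Y)"
  proof (rule chI)
    show "f (n + m) \<in> module_hom (cmod (shift m X) n) (cmod (shift m Y) n)" for n using ch_hom[OF c] by simp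
    fix n v assume "v \<in> mcar (cmod (shift m X) n)"
    then have "cdif X (n + m) v \<in> mcar (cmod X (n + m + 1))" using hom_in[OF c_dif[OF b(1)], of v "n + m"] by simp
    then have "f (n + m + 1) (- cdif X (n + m) v) = - f (n + m + 1) (cdif X (n + m) v)"
      using hom_neg[OF ch_hom[OF c]] b by simp
    moreover have "f (n + m + 1) (cdif X (n + m) v) = cdif Y (n + m) (f (n + m) v)" by (rule ch_com[OF c])
    moreover have i: "n + 1 + m = n + m + 1" by simp
    ultimately show "f (n + 1 + m) (cdif (shift m X) n v) = cdif (shift m Y) n (f (n + m) v)" unfolding i by simp
  qed (use b in simp_all)
  then show ?thesis
    using quasi_iso_iff[OF b, THEN iffD1, OF f] unfolding quasi_iso_iff[OF bc_shift[OF b(1)] bc_shift[OF b(2)]]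
    by (simp add: cocycles_shift bnd_shift b)
qed

text \<open>On cocycles, a map homotopic to the identity differs from it by a coboundary, since the
  other term of the homotopy vanishes there.\<close>

lemma homotopy_equivalence_quasi_iso:
  assumes f: "f \<in> chain_maps X Y" and g: "g \<in> chain_maps Y X" and b [simp]: "bc X" "bc Y"
    and gf: "homotopic X X (\<lambda>n v. g n (f n v)) (\<lambda>n. restr (cmod X n) (\<lambda>v. v))"
    and fg: "homotopic Y Y (\<lambda>n v. f n (g n v)) (\<lambda>n. restr (cmod Y n) (\<lambda>v. v))"
  shows "quasi_iso X Y f"
proof -
  have null: "k n v - v \<in> bnd Z n" if hk: "homotopic Z Z k (\<lambda>n. restr (cmod Z n) (\<lambda>v. v))" and v: "v \<in> cocycles Z n" and Z: "bc Z" for Z k n v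
  proof -
    obtain h where h: "\<And>n. h n \<in> module_hom (cmod Z n) (cmod Z (n - 1))"
      "\<And>n v. k n v - restr (cmod Z n) (\<lambda>v. v) v = cdif Z (n - 1) (h n v) + h (n + 1) (cdif Z n v)"
      using hk by (rule homotopicE) blast
    have "k n v - v = cdif Z (n - 1) (h n v)"
      using h(2)[of n v] cocycleD[OF v] hom_zero[OF h(1)[of "n + 1"]] Z by (simp add: restr_def)
    then show ?thesis using bndI[OF hom_in[OF h(1) cocycleD(1)[OF v]]] by simp
  qed
  show ?thesis
    unfolding quasi_iso_iff[OF b]
  proof (intro conjI allI ballI impI f)
    fix n v assume v: "v \<in> cocycles X n" "f n v \<in> bnd Y n"
    have "g n (f n v) - (g n (f n v) - v) \<in> bnd X n"
      by (rule bnd_diff[OF b(1) ch_bnd[OF g v(2)] null[OF gf v(1) b(1)]])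
    then show "v \<in> bnd X n" by simp
  next
    fix n w assume w: "w \<in> cocycles Y n"
    have "- (f n (g n w) - w) \<in> bnd Y n" using null[OF fg w] by (intro bnd_neg) simp_all
    then show "\<exists>v\<in>cocycles X n. w - f n v \<in> bnd Y n" using ch_cocycle[OF g _ _ w] by (intro bexI[of _ "g n w"]) simp_all
  qed
qed

text \<open>An isomorphism of roofs cannot be shifted by hand, but a chain map can. The isomorphism
  comes from a homotopy equivalence of resolutions, which with \<open>rp Y\<close> gives a
  quasi-isomorphism from \<open>Rs X\<close> to Y; this one and \<open>rp X\<close> are
  shifted.\<close>

lemma isomorphic_shift:
  assumes iso: "isomorphic DB X Y" and b [simp]: "bc X" "bc Y"
  shows "isomorphic DB (shift m X) (shift m Y)"
proof -
  note [simp] = Rs(3)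
  have "isomorphic KB (Rs X) (Rs Y)" using iso unfolding Db_Loc by (rule D.isomorphic_LocD) simp_all
  then obtain f' g' where *: "f' \<in> Arr KB (Rs X) (Rs Y)" "g' \<in> Arr KB (Rs Y) (Rs X)"
    "Cmp KB (Rs X) (Rs Y) (Rs X) g' f' = Idn KB (Rs X)" "Cmp KB (Rs Y) (Rs X) (Rs Y) f' g' = Idn KB (Rs Y)"
    by (rule Kb.isoE) blast
  obtain f where f: "f \<in> chain_maps (Rs X) (Rs Y)" "f' = hclass (Rs X) (Rs Y) f" using *(1) by auto
  obtain g where g: "g \<in> chain_maps (Rs Y) (Rs X)" "g' = hclass (Rs Y) (Rs X) g" using *(2) by auto
  have "quasi_iso (Rs X) (Rs Y) f"
  proof (rule homotopy_equivalence_quasi_iso[OF f(1) g(1)])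
    show "homotopic (Rs X) (Rs X) (\<lambda>n v. g n (f n v)) (\<lambda>n. restr (cmod (Rs X) n) (\<lambda>v. v))"
      using *(3) hclass_eq_iff[OF ch_cmp[OF f(1) g(1)] ch_idn[of "Rs X"]] f g by (simp add: Kb_cmp del: Dc_simps)
    show "homotopic (Rs Y) (Rs Y) (\<lambda>n v. f n (g n v)) (\<lambda>n. restr (cmod (Rs Y) n) (\<lambda>v. v))"
      using *(4) hclass_eq_iff[OF ch_cmp[OF g(1) f(1)] ch_idn[of "Rs Y"]] f g by (simp add: Kb_cmp del: Dc_simps)
  qed simp_all
  then have q: "quasi_iso (Rs X) Y (\<lambda>n v. rp Y n (f n v))" using Rs(4)[OF b(2)] by (rule quasi_iso_cmp) simp_all
  have "isomorphic DB (shift m (Rs X)) (shift m X)" "isomorphic DB (shift m (Rs X)) (shift m Y)"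
    by (rule quasi_iso_isomorphic[OF quasi_iso_shift[OF Rs(4)[OF b(1)]]] quasi_iso_isomorphic[OF quasi_iso_shift[OF q]]; simp)+
  then show ?thesis by (rule DB.iso_trans[OF DB.iso_sym]; simp)
qed

subsection \<open>Stalk complexes\<close>

abbreviation sh :: "int \<Rightarrow> ('h, 'k) hmod \<Rightarrow> ('h, 'k) cplx" where
  "sh m U \<equiv> shift m (stalk U)"

lemma stalk_simps [simp]: "cmod (stalk U) n = (if n = 0 then U else zmod)" "cdif (stalk U) n v = 0"
  by (simp_all add: stalk_def zmod_def)

lemma bc_stalk [simp]:
  assumes "fg U"
  shows "bc (stalk U)"
  unfolding bounded_complex_def
proof (intro conjI allI)
  have "cdif (stalk U) n = (\<lambda>v. 0)" for n by (auto simp: fun_eq_iff)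
  then show "cdif (stalk U) n \<in> module_hom (cmod (stalk U) n) (cmod (stalk U) (n + 1))" for n
    using assms by (simp add: zero_hom)
  show "\<exists>b. \<forall>n. b < \<bar>n\<bar> \<longrightarrow> mcar (cmod (stalk U) n) = {0}" by (intro exI[of _ 0]) simp
qed (use assms in simp_all)

text \<open>\<open>sh m U\<close> is concentrated in degree \<open>- m\<close>, whence the test
  \<open>n + m = 0\<close>.\<close>

definition sm :: "int \<Rightarrow> ('k vec \<Rightarrow> 'k vec) \<Rightarrow> 'k cmap" where
  "sm m u = (\<lambda>n. if n + m = 0 then u else (\<lambda>v. 0))"

lemma sm_chain: "u \<in> module_hom U V \<Longrightarrow> fg U \<Longrightarrow> fg V \<Longrightarrow> sm m u \<in> chain_maps (sh m U) (sh m V)"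
  by (rule chI) (auto simp: sm_def zero_hom hom_zero)

lemma addfun_sh: "addfun (FgMod scale) Ch (sh m) (\<lambda>U V. sm m)"
proof (rule addfun.intro)
  show "preadditive (FgMod scale)" by (rule preadditive_FgMod')
  show "preadditive Ch" by (rule Ch.preadditive_axioms)
  show "addfun_axioms (FgMod scale) Ch (sh m) (\<lambda>U V. sm m)"
    unfolding addfun_axioms_def additive_functor_def
  proof (intro conjI ballI)
    fix U assume "U \<in> Ob (FgMod scale)"
    then have U: "fg U" by simp
    then show "sh m U \<in> Ob Ch" by simp
    show "sm m (Idn (FgMod scale) U) = Idn Ch (sh m U)" by (auto simp: sm_def fun_eq_iff restr_def)
  next
    fix U V W u v assume "u \<in> Arr (FgMod scale) U V" "v \<in> Arr (FgMod scale) V W"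
    show "sm m (Cmp (FgMod scale) U V W v u) = Cmp Ch (sh m U) (sh m V) (sh m W) (sm m v) (sm m u)" by (auto simp: sm_def fun_eq_iff)
  next
    fix U V u v assume "u \<in> Arr (FgMod scale) U V" "v \<in> Arr (FgMod scale) U V"
    show "sm m (Add (FgMod scale) U V u v) = Add Ch (sh m U) (sh m V) (sm m u) (sm m v)" by (auto simp: sm_def fun_eq_iff)
  qed (use sm_chain in simp_all)
qed

definition shmap :: "int \<Rightarrow> ('h, 'k) hmod \<Rightarrow> ('h, 'k) hmod \<Rightarrow> ('k vec \<Rightarrow> 'k vec) \<Rightarrow> (('h, 'k) cplx \<times> 'k cmap set \<times> 'k cmap set) set" where
  "shmap m U V u = localize_arr KB qis (sh m U) (sh m V) (hclass (sh m U) (sh m V) (sm m u))"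

lemma addfun_shmap: "addfun (FgMod scale) DB (sh m) (shmap m)"
  unfolding shmap_def using addfun_comp[OF addfun_sh addfun_Db] .

lemma sh_bnd: "bnd (sh m U) n \<subseteq> {0}"
  by (auto simp: bnd_def)

lemma hom_factor:
  assumes p: "p \<in> module_hom M V" and sur: "p ` mcar M = mcar V" and f: "f \<in> module_hom M U"
    and ker: "\<And>v. v \<in> mcar M \<Longrightarrow> p v = 0 \<Longrightarrow> f v = 0" and l: "lmod M" "lmod V" "lmod U"
  obtains u where "u \<in> module_hom V U" "\<And>v. v \<in> mcar M \<Longrightarrow> u (p v) = f v"
proof -
  define r where "r x = (SOME v. v \<in> mcar M \<and> p v = x)" for x
  have r: "r x \<in> mcar M" "p (r x) = x" if x: "x \<in> mcar V" for x
  proof -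
    from x have "x \<in> p ` mcar M" by (simp only: sur)
    then obtain v where "v \<in> mcar M \<and> p v = x" by (elim imageE) simp
    then have "r x \<in> mcar M \<and> p (r x) = x" unfolding r_def by (rule someI[where P = "\<lambda>v. v \<in> mcar M \<and> p v = x"])
    then show "r x \<in> mcar M" "p (r x) = x" by simp_all
  qed
  have eq: "f v = f w" if vw: "v \<in> mcar M" "w \<in> mcar M" "p v = p w" for v w
  proof -
    have "p (v - w) = 0" using hom_diff[OF p l(1) vw(1,2)] vw(3) by simp
    then have "f (v - w) = 0" by (rule ker[OF m_diff[OF l(1) vw(1,2)]])
    then show ?thesis using hom_diff[OF f l(1) vw(1,2)] by simp
  qed
  have fr: "f (r (p v)) = f v" if v: "v \<in> mcar M" for v
    using r[OF hom_in[OF p v]] v by (intro eq) simp_all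
  show thesis
  proof (rule that)
    show "restr V (\<lambda>x. f (r x)) \<in> module_hom V U"
    proof (rule restrI[OF l(2)])
      show "f (r v) \<in> mcar U" if "v \<in> mcar V" for v using hom_in[OF f r(1)[OF that]] .
      show "f (r (v + w)) = f (r v) + f (r w)" if "v \<in> mcar V" "w \<in> mcar V" for v w
      proof -
        have "f (r (v + w)) = f (r v + r w)"
          using that r m_add[OF l(2) that] l(1) by (intro eq) (simp_all add: m_add hom_add[OF p])
        then show ?thesis using hom_add[OF f] r that by simp
      qed
      show "f (r (mact V a v)) = mact U a (f (r v))" if "v \<in> mcar V" for a v
      proof -
        have "f (r (mact V a v)) = f (mact M a (r v))"
          using that r m_act[OF l(2) that] l(1) by (intro eq) (simp_all add: m_act hom_act[OF p])
        then show ?thesis using hom_act[OF f] r that by simp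
      qed
    qed
    show "restr V (\<lambda>x. f (r x)) (p v) = f v" if "v \<in> mcar M" for v
      using fr[OF that] hom_in[OF p that] by (simp add: restr_def)
  qed
qed

text \<open>The projective in degree \<open>- m + 1\<close> vanishes, so every element of the
  resolution in degree \<open>- m\<close> is a cocycle. As V[m] has no non-zero coboundaries, the
  quasi-isomorphism maps this component onto V with kernel in the coboundaries.\<close>

lemma sh_resolution:
  assumes V [simp]: "fg V"
  shows "rp (sh m V) (- m) ` cocycles (Rs (sh m V)) (- m) = mcar V"
    "v \<in> mcar (cmod (Rs (sh m V)) (- m)) \<Longrightarrow> v \<in> cocycles (Rs (sh m V)) (- m)"
    "\<lbrakk>v \<in> mcar (cmod (Rs (sh m V)) (- m)); rp (sh m V) (- m) v = 0\<rbrakk> \<Longrightarrow> v \<in> bnd (Rs (sh m V)) (- m)"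
proof -
  let ?X = "sh m V"
  have X [simp]: "bc ?X" by simp
  note R = Rs[OF X] and q = quasi_iso_iff[OF Rs(3)[OF X] X, THEN iffD1, OF Rs(4)[OF X]]
  have "mcar (RQ ?X (- m + 1)) = {0}" by (rule R(6)) simp
  then have K: "k = 0" if "k \<in> RK ?X (- m + 1)" for k using that fgdataD(6)[OF R(2), of "- m + 1"] by blast
  show c: "v \<in> cocycles (Rs ?X) (- m)" if "v \<in> mcar (cmod (Rs ?X) (- m))" for v
    using that K[of "vsnd v"] by (auto simp: cocycles_def vpair_arith)
  show "v \<in> bnd (Rs ?X) (- m)" if "v \<in> mcar (cmod (Rs ?X) (- m))" "rp ?X (- m) v = 0"
    using q c[OF that(1)] that(2) bnd_zero[OF X] by metis
  show "rp ?X (- m) ` cocycles (Rs ?X) (- m) = mcar V"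
  proof
    show "rp ?X (- m) ` cocycles (Rs ?X) (- m) \<subseteq> mcar V"
      using hom_in[OF ch_hom[OF R(5), of "- m"]] cocycleD(1) by fastforce
    show "mcar V \<subseteq> rp ?X (- m) ` cocycles (Rs ?X) (- m)"
    proof
      fix w assume "w \<in> mcar V"
      then have "w \<in> cocycles ?X (- m)" by (simp add: cocycles_def)
      then obtain v where v: "v \<in> cocycles (Rs ?X) (- m)" "w - rp ?X (- m) v \<in> bnd ?X (- m)" using q by blast
      then have "w - rp ?X (- m) v = 0" using sh_bnd[of m V "- m"] by blast
      then show "w \<in> rp ?X (- m) ` cocycles (Rs ?X) (- m)" using v(1) by (intro image_eqI[of _ _ v]) simp_all
    qed
  qed
qed

text \<open>A chain map from the resolution of V[m] to U[m] has a component in degree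
  \<open>- m\<close> only. It kills coboundaries, which contain the kernel of the map onto V, and
  therefore factors through V.\<close>

lemma sh_full:
  assumes V [simp]: "fg V" and U [simp]: "fg U"
  shows "Arr DB (sh m V) (sh m U) \<subseteq> shmap m V U ` module_hom V U"
proof
  let ?X = "sh m V" and ?Y = "sh m U"
  have X [simp]: "bc ?X" and Y [simp]: "bc ?Y" by simp_all
  note R = Rs[OF X] and sr = sh_resolution[OF V, where m = m]
  fix a assume "a \<in> Arr DB ?X ?Y"
  then obtain f where f: "f \<in> chain_maps (Rs ?X) ?Y" "a = D.cls ?X ?Y (hclass (Rs ?X) ?Y f)"
    unfolding Db_Loc by (auto simp: D.Loc_arr)
  have pm: "rp ?X (- m) \<in> module_hom (cmod (Rs ?X) (- m)) V" using ch_hom[OF R(5), of "- m"] by simp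
  have fm: "f (- m) \<in> module_hom (cmod (Rs ?X) (- m)) U" using ch_hom[OF f(1), of "- m"] by simp
  obtain u where u: "u \<in> module_hom V U" "\<And>v. v \<in> mcar (cmod (Rs ?X) (- m)) \<Longrightarrow> u (rp ?X (- m) v) = f (- m) v"
  proof (rule hom_factor[OF pm _ fm])
    show "rp ?X (- m) ` mcar (cmod (Rs ?X) (- m)) = mcar V"
      using sr(1,2) cocycleD(1)[of _ "Rs ?X" "- m"] by blast
    fix v assume v: "v \<in> mcar (cmod (Rs ?X) (- m))" "rp ?X (- m) v = 0"
    then show "f (- m) v = 0" using ch_bnd[OF f(1) sr(3)[OF v]] sh_bnd by blast
  qed (use R(3) c_lmod in \<open>auto simp del: Dc_simps\<close>)
  have "f n v = sm m u n (rp ?X n v)" for n v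
  proof (cases "v \<in> mcar (cmod (Rs ?X) n)")
    case True
    show ?thesis
    proof (cases "n = - m")
      case True
      then show ?thesis using u(2) \<open>v \<in> mcar (cmod (Rs ?X) n)\<close> by (simp add: sm_def del: Dc_simps)
    next
      case False
      then have "n + m \<noteq> 0" by simp
      then show ?thesis using hom_in[OF ch_hom[OF f(1)] True] by (simp add: sm_def)
    qed
  next
    case False
    then show ?thesis
      using hom_out[OF ch_hom[OF f(1)] False] hom_out[OF ch_hom[OF R(5)] False] hom_zero[OF u(1)] by (simp add: sm_def)
  qed
  then have "f = (\<lambda>n v. sm m u n (rp ?X n v))" by blast
  then have "hclass (Rs ?X) ?Y f = Cmp KB (Rs ?X) ?X ?Y (hclass ?X ?Y (sm m u)) (hclass (Rs ?X) ?X (rp ?X))"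
    using Kb_cmp[OF R(5) sm_chain[OF u(1)] R(3)] by simp
  then have "a = shmap m V U u"
    unfolding f(2) shmap_def using sm_chain[OF u(1)] by (subst D.localize_arr_cls) simp_all
  then show "a \<in> shmap m V U ` module_hom V U" using u(1) by blast
qed

text \<open>Otherwise the resolution map would be null-homotopic. As V[m] has zero differential, it
  would then vanish on cocycles, although it maps them onto V.\<close>

lemma sh_nonzero:
  assumes V [simp]: "fg V" and nz: "mcar V \<noteq> {0}"
  shows "Idn DB (sh m V) \<noteq> Zer DB (sh m V) (sh m V)"
proof
  let ?X = "sh m V"
  have X [simp]: "bc ?X" by simp
  note R = Rs[OF X]
  assume "Idn DB ?X = Zer DB ?X ?X"
  then have "D.cls ?X ?X (hclass (Rs ?X) ?X (rp ?X)) = D.cls ?X ?X (Zer KB (Rs ?X) ?X)"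
    unfolding Db_Loc by (simp add: D.Loc_idn D.Loc_zer)
  then have "hclass (Rs ?X) ?X (rp ?X) = hclass (Rs ?X) ?X (\<lambda>n v. 0)"
    using R(5) by (auto dest!: D.cls_inject)
  then have "homotopic (Rs ?X) ?X (rp ?X) (\<lambda>n v. 0)"
    using hclass_eq_iff[OF R(5) ch_zero[OF R(3) X] R(3) X] by simp
  then obtain h where h: "\<And>n. h n \<in> module_hom (cmod (Rs ?X) n) (cmod ?X (n - 1))"
    "\<And>n v. rp ?X n v - 0 = cdif ?X (n - 1) (h n v) + h (n + 1) (cdif (Rs ?X) n v)"
    by (rule homotopicE) blast
  have rp0: "rp ?X (- m) v = 0" if "v \<in> cocycles (Rs ?X) (- m)" for v
    using h(2)[of "- m" v] cocycleD(2)[OF that] hom_zero[OF h(1)[of "- m + 1"]] c_lmod[OF R(3)] by (simp del: Dc_simps)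
  have "v = 0" if "v \<in> mcar V" for v
  proof -
    from that have "v \<in> rp ?X (- m) ` cocycles (Rs ?X) (- m)" by (simp only: sh_resolution(1)[OF V])
    then show ?thesis using rp0 by (elim imageE) simp
  qed
  then have "mcar V = {0}" using m_zero[of V] by auto
  then show False using nz by simp
qed

lemma local_sh:
  assumes U: "indecomposable (FgMod scale) U"
  shows "local_ring (End_ring DB (sh m U))"
proof -
  interpret F: addfun "FgMod scale" DB "sh m" "shmap m" by (rule addfun_shmap)
  have fgU: "fg U" "mcar U \<noteq> {0}" using U by (auto simp: indecomposable_def FgMod_zero_object)
  show ?thesis
  proof (rule F.local_End_full)
    show "local_ring (End_ring (FgMod scale) U)" by (rule local_End_indecomposable[OF U])
    show "Arr DB (sh m U) (sh m U) \<subseteq> shmap m U U ` Arr (FgMod scale) U U" using sh_full fgU by simp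
    show "Idn DB (sh m U) \<noteq> Zer DB (sh m U) (sh m U)" using sh_nonzero fgU by simp
  qed (use fgU in simp)
qed

text \<open>Vanishing of negative and of higher extensions over a hereditary algebra.\<close>

lemma sh_vanish:
  assumes V [simp]: "fg V" and U [simp]: "fg U" and m: "m' \<noteq> m" "m' \<noteq> m + 1"
  shows "Arr DB (sh m V) (sh m' U) = {Zer DB (sh m V) (sh m' U)}"
proof -
  let ?X = "sh m V" and ?Y = "sh m' U"
  have X [simp]: "bc ?X" and Y [simp]: "bc ?Y" by simp_all
  note R = Rs[OF X]
  have "f = (\<lambda>n v. 0)" if f: "f \<in> chain_maps (Rs ?X) ?Y" for f
  proof -
    have "f n v = 0" for n v
    proof (cases "v \<in> mcar (cmod (Rs ?X) n)")
      case v: True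
      show ?thesis
      proof (cases "n + m' = 0")
        case True
        \<comment> \<open>The resolution of V[m] lives in degrees - m and - m - 1, one for
          \<open>Q\<close> and one for \<open>K\<close>; the two hypotheses on m' say that - m' is
          neither of them.\<close>
        have Q: "mcar (RQ ?X n) = {0}" "mcar (RQ ?X (n + 1)) = {0}" by (rule R(6), use True m in simp)+
        have "vfst v = 0" "vsnd v = 0" using v Q fgdataD(6)[OF R(2), of "n + 1"] by auto
        then have "v = 0" by (metis vpair_simps(10,11) vpair_eqI)
        then show ?thesis using hom_zero[OF ch_hom[OF f]] c_lmod[OF R(3)] by (simp del: Dc_simps)
      next
        case False
        then show ?thesis using hom_in[OF ch_hom[OF f] v] by simp
      qed
    qed (rule hom_out[OF ch_hom[OF f]])
    then show ?thesis by (simp add: fun_eq_iff)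
  qed
  then have "chain_maps (Rs ?X) ?Y = {\<lambda>n v. 0}" using ch_zero[OF R(3) Y] by blast
  then have "Arr KB (Rs ?X) ?Y = {Zer KB (Rs ?X) ?Y}" by simp
  then show ?thesis unfolding Db_Loc by (simp add: D.Loc_arr D.Loc_zer del: Kb_simps(2,4))
qed

end

context hered_alg
begin

interpretation DB: preadditive DB
  by (rule preadditive_Db)

subsection \<open>Every object is a direct sum of shifted stalk complexes\<close>

text \<open>The explicit support allows induction over the degrees.\<close>

definition zc :: "int set \<Rightarrow> (int \<Rightarrow> ('h, 'k) hmod) \<Rightarrow> ('h, 'k) cplx" where
  "zc A W = \<lparr>cmod = (\<lambda>n. if n \<in> A then W n else zmod), cdif = (\<lambda>n v. 0)\<rparr>"

lemma zc_simps [simp]: "cmod (zc A W) n = (if n \<in> A then W n else zmod)" "cdif (zc A W) n v = 0"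
  by (simp_all add: zc_def)

lemma bc_zc [simp]:
  assumes W: "\<And>n. fg (W n)" and A: "finite A"
  shows "bc (zc A W)"
  unfolding bounded_complex_def
proof (intro conjI allI)
  fix n
  have "cdif (zc A W) n = (\<lambda>v. 0)" by (auto simp: fun_eq_iff)
  then show "cdif (zc A W) n \<in> module_hom (cmod (zc A W) n) (cmod (zc A W) (n + 1))"
    using W by (simp add: zero_hom)
next
  have "mcar (cmod (zc A W) n) = {0}" if "Max (abs ` A) < \<bar>n\<bar>" for n
  proof -
    have "\<bar>n\<bar> \<notin> abs ` A" using that A Max_ge[of "abs ` A" "\<bar>n\<bar>"] by (meson finite_imageI leD)
    then have "n \<notin> A" by blast
    then show ?thesis by simp
  qed
  then show "\<exists>b. \<forall>n. b < \<bar>n\<bar> \<longrightarrow> mcar (cmod (zc A W) n) = {0}" by blast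
qed (use W in simp_all)

lemma zc_single: "zc {n} W = sh (- n) (W n)"
  by (rule cplx.equality) (auto simp: zc_def shift_def stalk_def zmod_def fun_eq_iff)

lemma zc_empty: "zero_object Ch (zc {} W)"
  unfolding Ch.zero_object_iff
proof
  have "zc {} W = zc {} (\<lambda>n. zmod)" by (simp add: zc_def)
  then show "zc {} W \<in> Ob Ch" by simp
  show "Idn Ch (zc {} W) = Zer Ch (zc {} W) (zc {} W)" by (auto simp: restr_def fun_eq_iff)
qed

lemma zc_direct_sum:
  assumes W [simp]: "\<And>n. fg (W n)" and A [simp]: "finite A" "finite B" and AB: "A \<inter> B = {}"
  shows "direct_sum Ch [zc A W, zc B W] (zc (A \<union> B) W)"
proof -
  define e where "e A = (\<lambda>n. if n \<in> A then restr (W n) (\<lambda>v. v) else (\<lambda>v. 0))" for A :: "int set"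
  have e: "e A \<in> chain_maps (zc C W) (zc D W)" if "A \<subseteq> C" "A \<subseteq> D" "finite C" "finite D" for A C D
  proof (rule chI)
    show "e A n \<in> module_hom (cmod (zc C W) n) (cmod (zc D W) n)" for n
      using that restrI[of "W n" "\<lambda>v. v" "W n"] by (auto simp: e_def zero_hom)
    show "e A (n + 1) (cdif (zc C W) n v) = cdif (zc D W) n (e A n v)" for n v
      by (simp add: e_def restr_def)
  qed (use that in simp_all)
  have e0: "e A n 0 = 0" for A n by (simp add: e_def restr_def)
  have ee: "(\<lambda>n v. e A n (e A n v)) = e A" for A by (auto simp: e_def restr_def fun_eq_iff)
  have idn: "(\<lambda>n. restr (if n \<in> A then W n else zmod) (\<lambda>v. v)) = e A" for A by (auto simp: e_def restr_def fun_eq_iff)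
  have ne: "(\<lambda>n v. e A n (e B n v)) = (\<lambda>n v. 0)" "(\<lambda>n v. e B n (e A n v)) = (\<lambda>n v. 0)"
    using AB by (auto simp: e_def restr_def fun_eq_iff)
  have un: "(\<lambda>n v. e A n v + e B n v) = e (A \<union> B)"
    using AB by (auto simp: e_def fun_eq_iff)
  show ?thesis
    by (rule Ch.direct_sum_pairI[of "e A" _ _ "e B" _ "e A" "e B"]) (simp_all add: e ee idn idn[of "A \<union> B", unfolded Un_iff] ne un)
qed

text \<open>Each pair contributes the inclusion of \<open>K n\<close> into \<open>Q n\<close>, which
  is quasi-isomorphic to the quotient placed in degree n. The quotient maps form a chain map to a
  complex with zero differential, because they kill \<open>K n\<close>.\<close>

lemma Dc_cohomology:
  assumes D: "fgdata Q K"
  obtains A W where "finite A" "\<And>n. fg (W n)" "isomorphic DB (Dc Q K) (zc A W)"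
proof -
  note d = fgdataD[OF D] and bD [simp] = bc_Dc[OF D]
  have "\<forall>n. \<exists>W p. fg W \<and> p \<in> module_hom (Q n) W \<and> p ` mcar (Q n) = mcar W \<and> (\<forall>v\<in>mcar (Q n). p v = 0 \<longleftrightarrow> v \<in> K n)"
    using quotient_module[OF d(1) d(3)] by metis
  then obtain W p where W [simp]: "\<And>n. fg (W n)" and p: "\<And>n. p n \<in> module_hom (Q n) (W n)"
    and sur: "\<And>n. p n ` mcar (Q n) = mcar (W n)" and ker: "\<And>n v. v \<in> mcar (Q n) \<Longrightarrow> p n v = 0 \<longleftrightarrow> v \<in> K n"
    by metis
  obtain b where b: "\<And>n. b < \<bar>n\<bar> \<Longrightarrow> mcar (Q n) = {0}" using D by (auto simp: fgdata_def)
  \<comment> \<open>Covers every degree with a non-zero \<open>Q n\<close>, and so with a non-zero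
    quotient.\<close>
  let ?A = "{- b..b}" and ?X = "Dc Q K"
  let ?Y = "zc ?A W"
  have bY [simp]: "bc ?Y" by simp
  define f where "f n = (if n \<in> ?A then restr (cmod ?X n) (\<lambda>u. p n (vfst u)) else (\<lambda>u. 0))" for n
  have fX: "f n u = p n (vfst u)" if "u \<in> mcar (cmod ?X n)" for n u
  proof (cases "n \<in> ?A")
    case True
    then show ?thesis using that by (simp add: f_def restr_def)
  next
    case False
    then have "mcar (Q n) = {0}" by (intro b) auto
    then have "vfst u = 0" using that by simp
    moreover have "f n u = 0" by (simp only: f_def False if_False)
    ultimately show ?thesis using hom_zero[OF p d(2)] by simp
  qed
  have f: "f \<in> chain_maps ?X ?Y"
  proof (rule chI)
    show "f n \<in> module_hom (cmod ?X n) (cmod ?Y n)" for n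
    proof (cases "n \<in> ?A")
      case True
      have "restr (cmod ?X n) (\<lambda>u. p n (vfst u)) \<in> module_hom (cmod ?X n) (W n)"
        by (rule restrI) (use c_lmod[OF bD, of n] in \<open>auto simp: hom_in[OF p] hom_add[OF p] hom_act[OF p]\<close>)
      then show ?thesis using True by (simp add: f_def)
    next
      case False
      then have "f n = (\<lambda>u. 0)" by (simp only: f_def False if_False)
      then show ?thesis using zero_hom[of "cmod ?Y n" "cmod ?X n"] c_fg[OF bY, of n] by simp
    qed
    fix n u assume u: "u \<in> mcar (cmod ?X n)"
    then have "vsnd u \<in> K (n + 1)" by simp
    then have "p (n + 1) (vsnd u) = 0" using ker d(6)[of "n + 1"] by blast
    moreover have "cdif ?X n u \<in> mcar (cmod ?X (n + 1))" using hom_in[OF c_dif[OF bD] u] .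
    then have "f (n + 1) (cdif ?X n u) = p (n + 1) (vfst (cdif ?X n u))" by (rule fX)
    ultimately show "f (n + 1) (cdif ?X n u) = cdif ?Y n (f n u)" using u by simp
  qed simp_all
  have coc: "u \<in> cocycles ?X n \<longleftrightarrow> vfst u \<in> mcar (Q n) \<and> vsnd u = 0" for u n
  proof
    assume u: "u \<in> cocycles ?X n"
    then have u': "vfst u \<in> mcar (Q n)" "vsnd u \<in> K (n + 1)" and "cdif ?X n u = 0"
      using cocycleD[OF u] by simp_all
    then have "vpair (vsnd u) 0 = 0" by simp
    then have "vfst (vpair (vsnd u) 0) = 0" by (simp only: vpair_simps(10))
    then show "vfst u \<in> mcar (Q n) \<and> vsnd u = 0" using u' by simp
  next
    assume "vfst u \<in> mcar (Q n) \<and> vsnd u = 0"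
    then show "u \<in> cocycles ?X n" using d(7) by (simp add: cocycles_def vpair_arith)
  qed
  have "quasi_iso ?X ?Y f"
    unfolding quasi_iso_iff[OF bD bY]
  proof (intro conjI allI ballI impI f)
    fix n u assume u: "u \<in> cocycles ?X n" "f n u \<in> bnd ?Y n"
    then have u': "vfst u \<in> mcar (Q n)" "vsnd u = 0" using coc by simp_all
    have "f n u = 0" using u(2) by (auto simp: bnd_def)
    then have "p n (vfst u) = 0" using fX[OF cocycleD(1)[OF u(1)]] by simp
    then have k: "vfst u \<in> K n" using ker[OF u'(1)] by simp
    have "cdif ?X (n - 1) (vpair 0 (vfst u)) = vpair (vfst u) 0" using k d(8) by simp
    also have "\<dots> = u" by (rule vpair_eqI) (use u' in simp_all)
    finally show "u \<in> bnd ?X n" using bndI[of "vpair 0 (vfst u)" ?X n] k d(8) by simp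
  next
    fix n w assume w: "w \<in> cocycles ?Y n"
    have z: "0 \<in> bnd ?Y n" by (rule bnd_zero) simp
    show "\<exists>v\<in>cocycles ?X n. w - f n v \<in> bnd ?Y n"
    proof (cases "n \<in> ?A")
      case True
      then have "w \<in> p n ` mcar (Q n)" using w by (simp add: cocycles_def sur)
      then obtain q where q: "q \<in> mcar (Q n)" "w = p n q" by blast
      have v: "vpair q 0 \<in> cocycles ?X n" using q coc by simp
      have "w - f n (vpair q 0) = 0" using fX[OF cocycleD(1)[OF v]] q by simp
      then show ?thesis using v z by (intro bexI[of _ "vpair q 0"]) simp_all
    next
      case False
      have "w \<in> mcar (cmod ?Y n)" using w by (rule cocycleD(1))
      then have "w = 0" by (simp only: zc_simps False if_False zmod_simps singleton_iff)
      moreover have "0 \<in> cocycles ?X n" using coc d(8) by simp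
      moreover have "f n 0 = 0" by (simp only: f_def False if_False)
      ultimately show ?thesis using z by (intro bexI[of _ 0]) simp_all
    qed
  qed
  then have "isomorphic DB ?X ?Y" by (rule quasi_iso_isomorphic) simp_all
  then show thesis by (intro that[of ?A W]) simp_all
qed

interpretation LD: addfun Ch DB "\<lambda>X. X" "\<lambda>X Y f. localize_arr KB qis X Y (hclass X Y f)"
  by (rule addfun_Db)

text \<open>Each new degree is split off as a biproduct of complexes; its module is decomposed among
  modules, and the decomposition is transported by the functor \<open>shmap\<close>.\<close>

lemma zc_decomposition:
  assumes W [simp]: "\<And>n. fg (W n)" and A: "finite A"
  shows "\<exists>Ys. direct_sum DB Ys (zc A W) \<and> (\<forall>Y\<in>set Ys. \<exists>m U. indecomposable (FgMod scale) U \<and> Y = sh m U)"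
  using A
proof induction
  case empty
  show ?case using LD.fun_direct_sum[OF zc_empty[of W]] by (intro exI[of _ "[]"]) simp
next
  case (insert n A)
  obtain Ys where Ys: "direct_sum DB Ys (zc A W)" "\<forall>Y\<in>set Ys. \<exists>m U. indecomposable (FgMod scale) U \<and> Y = sh m U"
    using insert.IH by blast
  obtain Us where Us: "direct_sum (FgMod scale) Us (W n)" "\<forall>U\<in>set Us. indecomposable (FgMod scale) U"
    using fg_indecomposable_sum[OF W] by blast
  have U: "direct_sum DB (map (sh (- n)) Us) (sh (- n) (W n))"
    by (rule addfun.fun_direct_sum[OF addfun_shmap Us(1)])
  have "direct_sum Ch [zc {n} W, zc A W] (zc ({n} \<union> A) W)" using insert by (intro zc_direct_sum) simp_all
  from LD.fun_direct_sum[OF this] have "direct_sum DB [sh (- n) (W n), zc A W] (zc (insert n A) W)"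
    by (simp add: zc_single)
  from DB.direct_sum_append[OF this U Ys(1)] have "direct_sum DB (map (sh (- n)) Us @ Ys) (zc (insert n A) W)" .
  moreover have "\<forall>Y\<in>set (map (sh (- n)) Us @ Ys). \<exists>m U. indecomposable (FgMod scale) U \<and> Y = sh m U"
    using Us(2) Ys(2) by auto
  ultimately show ?case by blast
qed

lemma stalk_decomposition:
  assumes X [simp]: "bc X"
  obtains Ys where "direct_sum DB Ys X" "\<And>Y. Y \<in> set Ys \<Longrightarrow> \<exists>m U. indecomposable (FgMod scale) U \<and> Y = sh m U"
proof -
  note R = Rs[OF X]
  obtain A W where AW: "finite A" "\<And>n. fg (W n)" "isomorphic DB (Rs X) (zc A W)" by (rule Dc_cohomology[OF R(2)]) (rule that; simp)
  have b: "bc (zc A W)" using AW by simp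
  obtain Ys where Ys: "direct_sum DB Ys (zc A W)" "\<forall>Y\<in>set Ys. \<exists>m U. indecomposable (FgMod scale) U \<and> Y = sh m U"
    using zc_decomposition[of W A] AW(1,2) by blast
  have "isomorphic DB (Rs X) X" by (rule quasi_iso_isomorphic[OF R(4,3) X])
  then have "isomorphic DB (zc A W) X"
    by (rule DB.iso_trans[OF DB.iso_sym[OF AW(3)]]) (use b R(3) in simp_all)
  then have "direct_sum DB Ys X" by (rule DB.direct_sum_iso[OF Ys(1)]) simp
  then show thesis using Ys(2) that by blast
qed

subsection \<open>Biproducts of complexes\<close>

definition csum :: "('h, 'k) cplx \<Rightarrow> ('h, 'k) cplx \<Rightarrow> ('h, 'k) cplx" where
  "csum X Y = \<lparr>cmod = (\<lambda>n. mod_sum (cmod X n) (cmod Y n)),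
     cdif = (\<lambda>n. restr (mod_sum (cmod X n) (cmod Y n)) (\<lambda>u. vpair (cdif X n (vfst u)) (cdif Y n (vsnd u))))\<rparr>"

lemma csum_simps [simp]:
  "cmod (csum X Y) n = mod_sum (cmod X n) (cmod Y n)"
  "cdif (csum X Y) n u = (if vfst u \<in> mcar (cmod X n) \<and> vsnd u \<in> mcar (cmod Y n)
     then vpair (cdif X n (vfst u)) (cdif Y n (vsnd u)) else 0)"
  by (simp_all add: csum_def restr_def)

lemma bc_csum [simp]:
  assumes b [simp]: "bc X" "bc Y"
  shows "bc (csum X Y)"
  unfolding bounded_complex_def
proof (intro conjI allI)
  note hX = c_dif[OF b(1)] and hY = c_dif[OF b(2)]
  show "fg (cmod (csum X Y) n)" for n by simp
  have "cdif (csum X Y) n = restr (mod_sum (cmod X n) (cmod Y n)) (\<lambda>u. vpair (cdif X n (vfst u)) (cdif Y n (vsnd u)))" for n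
    by (simp add: csum_def)
  moreover have "restr (mod_sum (cmod X n) (cmod Y n)) (\<lambda>u. vpair (cdif X n (vfst u)) (cdif Y n (vsnd u)))
    \<in> module_hom (mod_sum (cmod X n) (cmod Y n)) (mod_sum (cmod X (n + 1)) (cmod Y (n + 1)))" for n
    by (rule restrI) (simp_all add: lmod_mod_sum hom_in[OF hX] hom_in[OF hY] hom_add[OF hX] hom_add[OF hY]
        hom_act[OF hX] hom_act[OF hY] vpair_arith)
  ultimately show "cdif (csum X Y) n \<in> module_hom (cmod (csum X Y) n) (cmod (csum X Y) (n + 1))" for n by simp
  show "cdif (csum X Y) (n + 1) (cdif (csum X Y) n u) = 0" for n u
    using hom_zero[OF hX, of "n + 1"] hom_zero[OF hY, of "n + 1"] c_dd[OF b(1)] c_dd[OF b(2)] by (simp add: vpair_arith)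
  obtain bX bY where "\<And>n. bX < \<bar>n\<bar> \<Longrightarrow> mcar (cmod X n) = {0}" "\<And>n. bY < \<bar>n\<bar> \<Longrightarrow> mcar (cmod Y n) = {0}"
    using b unfolding bounded_complex_def by metis
  then have z: "mcar (cmod X n) = {0}" "mcar (cmod Y n) = {0}" if "max bX bY < \<bar>n\<bar>" for n using that by simp_all
  have "mcar (cmod (csum X Y) n) = {0}" if n: "max bX bY < \<bar>n\<bar>" for n
  proof (intro equalityI subsetI)
    fix u assume "u \<in> mcar (cmod (csum X Y) n)"
    then have "vfst u = vfst 0" "vsnd u = vsnd 0" using z[OF n] by simp_all
    then show "u \<in> {0}" using vpair_eqI[of u 0] by simp
  qed (use z[OF n] in simp)
  then show "\<exists>b. \<forall>n. b < \<bar>n\<bar> \<longrightarrow> mcar (cmod (csum X Y) n) = {0}" by blast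
qed

lemma csum_direct_sum:
  assumes b [simp]: "bc X" "bc Y"
  shows "direct_sum Ch [X, Y] (csum X Y)"
proof -
  note hX = c_dif[OF b(1)] and hY = c_dif[OF b(2)]
  define iX where "iX n = restr (cmod X n) (\<lambda>v. vpair v 0)" for n
  define iY where "iY n = restr (cmod Y n) (\<lambda>v. vpair 0 v)" for n
  define pX where "pX n = restr (mod_sum (cmod X n) (cmod Y n)) vfst" for n
  define pY where "pY n = restr (mod_sum (cmod X n) (cmod Y n)) vsnd" for n
  note defs = iX_def iY_def pX_def pY_def
  have zX: "cdif X n 0 = 0" and zY: "cdif Y n 0 = 0" for n
    using hom_zero[OF hX, of n] hom_zero[OF hY, of n] by simp_all
  have iX: "iX \<in> chain_maps X (csum X Y)"
  proof (rule chI)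
    show "iX n \<in> module_hom (cmod X n) (cmod (csum X Y) n)" for n
      unfolding defs by (rule restrI) (simp_all add: vpair_arith act_zero)
  qed (use zY hom_in[OF hX] in \<open>simp_all add: defs restr_def\<close>)
  have iY: "iY \<in> chain_maps Y (csum X Y)"
  proof (rule chI)
    show "iY n \<in> module_hom (cmod Y n) (cmod (csum X Y) n)" for n
      unfolding defs by (rule restrI) (simp_all add: vpair_arith act_zero)
  qed (use zX hom_in[OF hY] in \<open>simp_all add: defs restr_def\<close>)
  have pX: "pX \<in> chain_maps (csum X Y) X"
  proof (rule chI)
    show "pX n \<in> module_hom (cmod (csum X Y) n) (cmod X n)" for n
      unfolding defs csum_simps by (rule restrI) (simp_all add: lmod_mod_sum)
  qed (use hom_in[OF hX] hom_in[OF hY] in \<open>simp_all add: defs restr_def\<close>)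
  have pY: "pY \<in> chain_maps (csum X Y) Y"
  proof (rule chI)
    show "pY n \<in> module_hom (cmod (csum X Y) n) (cmod Y n)" for n
      unfolding defs csum_simps by (rule restrI) (simp_all add: lmod_mod_sum)
  qed (use hom_in[OF hX] hom_in[OF hY] in \<open>simp_all add: defs restr_def\<close>)
  have m0: "0 \<in> mcar (cmod X n)" "0 \<in> mcar (cmod Y n)" for n by (simp_all add: m_zero)
  have c: "pX n (iX n v) = restr (cmod X n) (\<lambda>v. v) v" "pY n (iY n v) = restr (cmod Y n) (\<lambda>v. v) v"
    "pY n (iX n v) = 0" "pX n (iY n v) = 0"
    "iX n (pX n v) + iY n (pY n v) = restr (cmod (csum X Y) n) (\<lambda>v. v) v" for n v
    using m0 by (simp_all add: defs restr_def vpair_arith)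
  show ?thesis
    by (rule Ch.direct_sum_pairI[of iX _ _ iY _ pX pY]) (simp_all add: iX iY pX pY c del: csum_simps)
qed

lemma additive_Db: "additive_category DB"
  unfolding additive_category_def
proof (intro conjI ballI)
  show "preadditive_category DB" using preadditive_Db by (rule preadditive.preadditive)
  show "\<exists>X. zero_object DB X" using LD.fun_direct_sum[OF zc_empty] by auto
  fix X Y assume "X \<in> Ob DB" "Y \<in> Ob DB"
  then have "bc X" "bc Y" by simp_all
  from LD.fun_direct_sum[OF csum_direct_sum[OF this]] show "\<exists>Z. direct_sum DB [X, Y] Z" by auto
qed

end

section \<open>Autoequivalences of the derived category\<close>

text \<open>What the triangle functor G contributes is its additivity and, for every object, an
  isomorphism between G (X[1]) and (G X)[1].\<close>

locale derived_autoequivalence = hered_alg scale for scale :: "'k::field \<Rightarrow> 'h::ring_1 \<Rightarrow> 'h" +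
  fixes G H :: "(('h, 'k) cplx, (('h, 'k) cplx \<times> 'k cmap set \<times> 'k cmap set) set) endofun"
    and \<eta> \<theta> :: "('h, 'k) cplx \<Rightarrow> (('h, 'k) cplx \<times> 'k cmap set \<times> 'k cmap set) set"
  assumes quasi_inverse: "adjoint_quasi_inverse (Db scale) G H \<eta> \<theta>"
    and additive: "additive_endofunctor (Db scale) G"
    and shift_1: "bounded_complex scale X \<Longrightarrow> isomorphic (Db scale) (fob G (shift 1 X)) (shift 1 (fob G X))"
    and g1: "cond_g1 scale G H"
begin

sublocale E: adj_equiv_add DB G H \<eta> \<theta>
proof (intro adj_equiv_add.intro adj_equiv_add_axioms.intro)
  interpret DB: preadditive DB by (rule preadditive_Db)
  show "adj_equiv DB G H \<eta> \<theta>" by (rule DB.adj_equivI[OF quasi_inverse])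
qed (rule additive)

interpretation S: adj_equiv DB H G \<theta> \<eta>
  by (rule E.swap)

lemma bcG [simp]: "bc X \<Longrightarrow> bc (fob G X)"
  and bcH [simp]: "bc X \<Longrightarrow> bc (fob H X)"
  and bcP [simp]: "bc X \<Longrightarrow> bc (E.P i X)"
  using quasi_inverse E.P_ob[of X i] by (simp_all add: adjoint_quasi_inverse_def endofunctor_def)

lemma iso_trans [trans]:
  "\<lbrakk>isomorphic DB X Y; isomorphic DB Y Z; bc X; bc Y; bc Z\<rbrakk> \<Longrightarrow> isomorphic DB X Z"
  by (erule (1) E.iso_trans) simp_all

lemma GH: "bc X \<Longrightarrow> isomorphic DB X (fob G (fob H X))"
  and HG: "bc X \<Longrightarrow> isomorphic DB X (fob H (fob G X))"
  using E.theta_iso[of X] E.eta_iso[of X] by (auto simp: isomorphic_def)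

text \<open>Induction in both directions from 0. Downwards, the case of \<open>shift 1\<close> is
  applied to \<open>shift (i - 1) X\<close>, and the resulting isomorphism is shifted back by
  one.\<close>

lemma G_shift:
  assumes X [simp]: "bc X"
  shows "isomorphic DB (fob G (shift m X)) (shift m (fob G X))"
proof (induction m rule: int_induct[where k = 0])
  case base
  show ?case by (simp add: shift_0 E.iso_refl)
next
  case (step1 i)
  have "isomorphic DB (fob G (shift 1 (shift i X))) (shift 1 (fob G (shift i X)))" by (rule shift_1) simp
  moreover have "isomorphic DB (shift 1 (fob G (shift i X))) (shift 1 (shift i (fob G X)))"
    by (rule isomorphic_shift[OF step1(2)]) simp_all
  ultimately have "isomorphic DB (fob G (shift 1 (shift i X))) (shift 1 (shift i (fob G X)))"
    by (rule iso_trans) simp_all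
  then show ?case by (simp add: shift_shift add.commute)
next
  case (step2 i)
  let ?Y = "shift (i - 1) X"
  have 1: "shift 1 ?Y = shift i X" by (simp add: shift_shift)
  have "isomorphic DB (shift 1 (fob G ?Y)) (fob G (shift 1 ?Y))" by (rule E.iso_sym[OF shift_1]) simp
  then have "isomorphic DB (shift 1 (fob G ?Y)) (shift i (fob G X))"
    unfolding 1 by (rule iso_trans[OF _ step2(2)]) simp_all
  then have "isomorphic DB (shift (- 1) (shift 1 (fob G ?Y))) (shift (- 1) (shift i (fob G X)))"
    by (rule isomorphic_shift) simp_all
  then show ?case by (simp add: shift_shift shift_0)
qed

text \<open>Replacing X by G (H X) lets the shift pass through G; then H cancels G.\<close>

lemma H_shift:
  assumes X [simp]: "bc X"
  shows "isomorphic DB (fob H (shift m X)) (shift m (fob H X))"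
proof -
  have "isomorphic DB (shift m X) (shift m (fob G (fob H X)))" by (rule isomorphic_shift[OF GH]) simp_all
  moreover have "isomorphic DB (shift m (fob G (fob H X))) (fob G (shift m (fob H X)))" by (rule E.iso_sym[OF G_shift]) simp
  ultimately have "isomorphic DB (shift m X) (fob G (shift m (fob H X)))" by (rule iso_trans) simp_all
  then have "isomorphic DB (fob H (shift m X)) (fob H (fob G (shift m (fob H X))))" by (rule S.G_isomorphic) simp_all
  moreover have "isomorphic DB (fob H (fob G (shift m (fob H X)))) (shift m (fob H X))" by (rule E.iso_sym[OF HG]) simp
  ultimately show ?thesis by (rule iso_trans) simp_all
qed

lemma P_shift:
  assumes X [simp]: "bc X"
  shows "isomorphic DB (E.P i (shift m X)) (shift m (E.P i X))"
proof (induction i rule: int_induct[where k = 0])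
  case base
  show ?case by (simp add: E.iso_refl)
next
  case (step1 i)
  have "isomorphic DB (fob G (E.P i (shift m X))) (fob G (shift m (E.P i X)))" by (rule E.G_isomorphic[OF step1(2)]) simp_all
  moreover have "isomorphic DB (fob G (shift m (E.P i X))) (shift m (fob G (E.P i X)))" by (rule G_shift) simp
  ultimately have "isomorphic DB (fob G (E.P i (shift m X))) (shift m (fob G (E.P i X)))" by (rule iso_trans) simp_all
  then show ?case using step1(1) by (simp add: E.P_up)
next
  case (step2 i)
  have "isomorphic DB (fob H (E.P i (shift m X))) (fob H (shift m (E.P i X)))" by (rule S.G_isomorphic[OF step2(2)]) simp_all
  moreover have "isomorphic DB (fob H (shift m (E.P i X))) (shift m (fob H (E.P i X)))" by (rule H_shift) simp
  ultimately have "isomorphic DB (fob H (E.P i (shift m X))) (shift m (fob H (E.P i X)))" by (rule iso_trans) simp_all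
  then show ?case using step2(1) E.P_dn[of "i - 1"] by simp
qed

text \<open>(g1) concerns modules in degree 0. If some power i0 sends X to V0[m], then any further i
  in the set makes the power i - i0 send V0 to a module, since powers commute with shifts; so the
  set lies in a translate of one that is finite by (g1).\<close>

lemma finite_stalks:
  assumes X [simp]: "bc X"
  shows "finite {i. \<exists>V. indecomposable (FgMod scale) V \<and> isomorphic DB (E.P i X) (sh m V)}" (is "finite ?A")
proof (cases "?A = {}")
  case False
  then obtain i0 V0 where V0: "indecomposable (FgMod scale) V0" and i0: "isomorphic DB (E.P i0 X) (sh m V0)" by blast
  have f0 [simp]: "fg V0" using V0 by (simp add: indecomposable_def)
  let ?B = "{j. \<exists>V. indecomposable (FgMod scale) V \<and> isomorphic DB (E.P j (stalk V0)) (stalk V)}"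
  have "?A \<subseteq> (\<lambda>j. j + i0) ` ?B"
  proof
    fix i assume "i \<in> ?A"
    then obtain V where V: "indecomposable (FgMod scale) V" and i: "isomorphic DB (E.P i X) (sh m V)" by blast
    have fV [simp]: "fg V" using V by (simp add: indecomposable_def)
    let ?j = "i - i0"
    have "isomorphic DB (shift m (E.P ?j (stalk V0))) (E.P ?j (sh m V0))" by (rule E.iso_sym[OF P_shift]) simp
    moreover have "isomorphic DB (E.P ?j (sh m V0)) (E.P ?j (E.P i0 X))"
      by (rule E.P_isomorphic[OF E.iso_sym[OF i0]]) simp_all
    ultimately have "isomorphic DB (shift m (E.P ?j (stalk V0))) (E.P ?j (E.P i0 X))" by (rule iso_trans) simp_all
    moreover have "isomorphic DB (E.P ?j (E.P i0 X)) (E.P i X)" using E.P_P_isomorphic[of X ?j i0] by simp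
    ultimately have "isomorphic DB (shift m (E.P ?j (stalk V0))) (E.P i X)" by (rule iso_trans) simp_all
    then have "isomorphic DB (shift m (E.P ?j (stalk V0))) (sh m V)" by (rule iso_trans[OF _ i]) simp_all
    then have "isomorphic DB (shift (- m) (shift m (E.P ?j (stalk V0)))) (shift (- m) (sh m V))"
      by (rule isomorphic_shift) simp_all
    then have "isomorphic DB (E.P ?j (stalk V0)) (stalk V)" by (simp add: shift_shift shift_0)
    then show "i \<in> (\<lambda>j. j + i0) ` ?B" using V by (intro image_eqI[of _ _ ?j]) auto
  qed
  moreover have "finite ?B" using g1 V0 by (simp add: cond_g1_def)
  ultimately show ?thesis by (meson finite_imageI finite_subset)
next
  case True
  then show ?thesis by (simp only: finite.emptyI)
qed

text \<open>Decompose the i-th power of X = U[m] into shifted modules Y and apply the power - i.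
  This decomposes X, whose endomorphism ring is local, so X is isomorphic to the image of one Y, and
  its i-th power to that Y.\<close>

lemma P_indecomposable:
  assumes U: "indecomposable (FgMod scale) U"
  obtains m' V where "indecomposable (FgMod scale) V" "isomorphic DB (E.P i (sh m U)) (sh m' V)"
proof -
  let ?X = "sh m U"
  have [simp]: "fg U" using U by (simp add: indecomposable_def)
  obtain Ys where Ys: "direct_sum DB Ys (E.P i ?X)" "\<And>Y. Y \<in> set Ys \<Longrightarrow> \<exists>m U. indecomposable (FgMod scale) U \<and> Y = sh m U"
    by (rule stalk_decomposition[of "E.P i ?X"]) (simp, rule that)
  have "direct_sum DB (map (E.P (- i)) Ys) (E.P (- i) (E.P i ?X))"
    by (rule addfun.fun_direct_sum[OF E.addfun_P Ys(1)])
  moreover have "isomorphic DB (E.P (- i) (E.P i ?X)) ?X" using E.P_P_isomorphic[of ?X "- i" i] by simp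
  ultimately have "direct_sum DB (map (E.P (- i)) Ys) ?X" by (rule E.direct_sum_iso) simp
  from E.local_End_direct_sum[OF local_sh[OF U] this]
  obtain Y where Y: "Y \<in> set Ys" "isomorphic DB ?X (E.P (- i) Y)" by auto
  obtain m' V where V: "indecomposable (FgMod scale) V" "Y = sh m' V" using Ys(2)[OF Y(1)] by blast
  then have [simp]: "bc Y" by (simp add: indecomposable_def)
  have "isomorphic DB (E.P i ?X) (E.P i (E.P (- i) Y))" by (rule E.P_isomorphic[OF Y(2)]) simp_all
  moreover have "isomorphic DB (E.P i (E.P (- i) Y)) Y" using E.P_P_isomorphic[of Y i "- i"] by simp
  ultimately have "isomorphic DB (E.P i ?X) Y" by (rule iso_trans) simp_all
  then show thesis using V that by blast
qed

text \<open>Otherwise all multiples of i would be exponents whose power sends U[m] to itself up to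
  isomorphism, against \<open>finite_stalks\<close>.\<close>

lemma not_isomorphic_P:
  assumes U: "indecomposable (FgMod scale) U" and i: "i \<noteq> 0"
  shows "\<not> isomorphic DB (sh m U) (E.P i (sh m U))"
proof
  let ?X = "sh m U"
  have [simp]: "fg U" using U by (simp add: indecomposable_def)
  assume "isomorphic DB ?X (E.P i ?X)"
  then have iso: "isomorphic DB (E.P i ?X) ?X" by (rule E.iso_sym)
  have "isomorphic DB (E.P (int n * i) ?X) ?X" for n
  proof (induction n)
    case 0
    show ?case by (simp add: E.iso_refl)
  next
    case (Suc n)
    have "isomorphic DB (E.P i (E.P (int n * i) ?X)) (E.P i ?X)" by (rule E.P_isomorphic[OF Suc]) simp_all
    then have a: "isomorphic DB (E.P i (E.P (int n * i) ?X)) ?X" by (rule iso_trans[OF _ iso]) simp_all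
    have b: "isomorphic DB (E.P (int (Suc n) * i) ?X) (E.P i (E.P (int n * i) ?X))"
      using E.iso_sym[OF E.P_P_isomorphic[of ?X i "int n * i"]] by (simp add: algebra_simps)
    show ?case by (rule iso_trans[OF b a]) simp_all
  qed
  then have "range (\<lambda>n. int n * i) \<subseteq> {i. \<exists>V. indecomposable (FgMod scale) V \<and> isomorphic DB (E.P i ?X) (sh m V)}"
    using U by blast
  moreover have "finite {i. \<exists>V. indecomposable (FgMod scale) V \<and> isomorphic DB (E.P i ?X) (sh m V)}"
    by (rule finite_stalks) simp
  ultimately have "finite (range (\<lambda>n. int n * i))" by (rule finite_subset)
  moreover have "inj (\<lambda>n. int n * i)" using i by (auto intro: injI)
  ultimately show False using finite_imageD by blast
qed

lemma local_orbit:
  assumes U: "indecomposable (FgMod scale) U"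
  shows "local_ring (End_ring (orbit_category DB G H \<eta> \<theta>) (sh m U))"
proof (rule E.local_orb)
  let ?X = "sh m U"
  have [simp]: "fg U" using U by (simp add: indecomposable_def)
  have X [simp]: "?X \<in> Ob DB" by simp
  show "?X \<in> Ob DB" by (rule X)
  show "local_ring (End_ring DB ?X)" by (rule local_sh[OF U])
  \<comment> \<open>A non-zero map from V[m'] to U[m] forces m' = m (homomorphisms) or m' = m - 1
    (extensions), so \<open>finite_stalks\<close> is used for these two shifts.\<close>
  let ?F = "\<lambda>m'. {i. \<exists>V. indecomposable (FgMod scale) V \<and> isomorphic DB (E.P i ?X) (sh m' V)}"
  have "{i. Arr DB (E.P i ?X) ?X \<noteq> {Zer DB (E.P i ?X) ?X}} \<subseteq> ?F m \<union> ?F (m - 1)"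
  proof
    fix i assume "i \<in> {i. Arr DB (E.P i ?X) ?X \<noteq> {Zer DB (E.P i ?X) ?X}}"
    then have nz: "Arr DB (E.P i ?X) ?X \<noteq> {Zer DB (E.P i ?X) ?X}" by simp
    obtain m' V where V: "indecomposable (FgMod scale) V" "isomorphic DB (E.P i ?X) (sh m' V)" by (rule P_indecomposable[OF U])
    have [simp]: "fg V" using V by (simp add: indecomposable_def)
    have Y: "sh m' V \<in> Ob DB" by simp
    obtain a b where ab: "a \<in> Arr DB (E.P i ?X) (sh m' V)" "b \<in> Arr DB (sh m' V) (E.P i ?X)"
      "Cmp DB (E.P i ?X) (sh m' V) (E.P i ?X) b a = Idn DB (E.P i ?X)"
      using V(2) by (rule E.isoE) blast
    have "m' = m \<or> m' = m - 1"
    proof (rule ccontr)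
      assume "\<not> (m' = m \<or> m' = m - 1)"
      then have vanish: "Arr DB (sh m' V) ?X = {Zer DB (sh m' V) ?X}" by (intro sh_vanish) auto
      have "f = Zer DB (E.P i ?X) ?X" if f: "f \<in> Arr DB (E.P i ?X) ?X" for f
      proof -
        have "f = Cmp DB (E.P i ?X) (E.P i ?X) ?X f (Cmp DB (E.P i ?X) (sh m' V) (E.P i ?X) b a)"
          using E.cmp_idr[OF f E.P_ob[OF X] X] ab(3) by simp
        also have "\<dots> = Cmp DB (E.P i ?X) (sh m' V) ?X (Cmp DB (sh m' V) (E.P i ?X) ?X f b) a"
          by (rule E.cmp_assoc[OF ab(1,2) f E.P_ob[OF X] Y E.P_ob[OF X] X, symmetric])
        also have "Cmp DB (sh m' V) (E.P i ?X) ?X f b = Zer DB (sh m' V) ?X"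
          using E.cmp_in[OF ab(2) f Y E.P_ob[OF X] X] vanish by blast
        also have "Cmp DB (E.P i ?X) (sh m' V) ?X (Zer DB (sh m' V) ?X) a = Zer DB (E.P i ?X) ?X"
          using ab(1) E.P_ob[OF X] by simp
        finally show ?thesis .
      qed
      moreover have "Zer DB (E.P i ?X) ?X \<in> Arr DB (E.P i ?X) ?X" using E.P_ob[OF X] by simp
      ultimately show False using nz by blast
    qed
    then show "i \<in> ?F m \<union> ?F (m - 1)" using V by blast
  qed
  moreover have "finite (?F m \<union> ?F (m - 1))" by (intro finite_UnI finite_stalks) simp_all
  ultimately show "finite {i. Arr DB (E.P i ?X) ?X \<noteq> {Zer DB (E.P i ?X) ?X}}" by (rule finite_subset)
  fix i f r assume i: "i \<noteq> 0" and f: "f \<in> Arr DB (E.P i ?X) ?X" and r: "r \<in> Arr DB ?X (E.P i ?X)"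
  note PX = E.P_ob[OF X, of i]
  obtain m' V where V: "indecomposable (FgMod scale) V" "isomorphic DB (E.P i ?X) (sh m' V)" by (rule P_indecomposable[OF U])
  have [simp]: "fg V" using V by (simp add: indecomposable_def)
  have Y: "sh m' V \<in> Ob DB" by simp
  obtain a b where ab: "a \<in> Arr DB (E.P i ?X) (sh m' V)" "b \<in> Arr DB (sh m' V) (E.P i ?X)"
    "Cmp DB (E.P i ?X) (sh m' V) (E.P i ?X) b a = Idn DB (E.P i ?X)"
    using V(2) by (rule E.isoE) blast
  \<comment> \<open>The composite is rerouted through the shifted module isomorphic to the power of
    X, whose endomorphism ring is known to be local, as \<open>section_local_iso\<close>
    requires.\<close>
  show "Cmp DB ?X (E.P i ?X) ?X f r \<notin> Units (End_ring DB ?X)"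
  proof
    assume u: "Cmp DB ?X (E.P i ?X) ?X f r \<in> Units (End_ring DB ?X)"
    let ?f = "Cmp DB (sh m' V) (E.P i ?X) ?X f b" and ?r = "Cmp DB ?X (E.P i ?X) (sh m' V) a r"
    note fb = E.cmp_in[OF ab(2) f Y PX X] and ar = E.cmp_in[OF r ab(1) X PX Y]
    have "Cmp DB ?X (sh m' V) ?X ?f ?r = Cmp DB ?X (E.P i ?X) ?X f (Cmp DB ?X (sh m' V) (E.P i ?X) b ?r)"
      using E.cmp_assoc[OF ar ab(2) f X Y PX X] by simp
    also have "Cmp DB ?X (sh m' V) (E.P i ?X) b ?r = r"
      using E.cmp_assoc[OF r ab(1,2) X PX Y PX] ab(3) E.cmp_idl[OF r X PX] by simp
    finally have "Cmp DB ?X (sh m' V) ?X ?f ?r \<in> Units (End_ring DB ?X)" using u by simp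
    then have "isomorphic DB ?X (sh m' V)"
      by (rule E.section_local_iso[OF fb ar _ local_sh[OF U] local_sh[OF V(1)] X Y])
    then have "isomorphic DB ?X (E.P i ?X)" by (rule iso_trans[OF _ E.iso_sym[OF V(2)]]) simp_all
    then show False using not_isomorphic_P[OF U i] by blast
  qed
qed

lemma krull_schmidt_orbit: "krull_schmidt (orbit_category DB G H \<eta> \<theta>)"
  unfolding krull_schmidt_def
proof (intro conjI ballI)
  interpret F: addfun DB "orbit_category DB G H \<eta> \<theta>" "\<lambda>X. X" "E.homg 0" by (rule E.addfun_orb)
  show "additive_category (orbit_category DB G H \<eta> \<theta>)"
    unfolding additive_category_def
  proof (intro conjI ballI)
    show "preadditive_category (orbit_category DB G H \<eta> \<theta>)" by (rule E.preadditive_orb)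
    show "\<exists>X. zero_object (orbit_category DB G H \<eta> \<theta>) X"
      using additive_Db F.fun_direct_sum[of "[]"] unfolding additive_category_def by auto
    fix X Y assume "X \<in> Ob (orbit_category DB G H \<eta> \<theta>)" "Y \<in> Ob (orbit_category DB G H \<eta> \<theta>)"
    then have "X \<in> Ob DB" "Y \<in> Ob DB" by (simp_all only: E.orb_simps)
    then obtain Z where "direct_sum DB [X, Y] Z" using additive_Db unfolding additive_category_def by blast
    from F.fun_direct_sum[OF this] show "\<exists>Z. direct_sum (orbit_category DB G H \<eta> \<theta>) [X, Y] Z" by auto
  qed
  fix X assume "X \<in> Ob (orbit_category DB G H \<eta> \<theta>)"
  then have "bc X" by simp
  then obtain Ys where Ys: "direct_sum DB Ys X" "\<And>Y. Y \<in> set Ys \<Longrightarrow> \<exists>m U. indecomposable (FgMod scale) U \<and> Y = sh m U"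
    by (rule stalk_decomposition) (rule that)
  have "direct_sum (orbit_category DB G H \<eta> \<theta>) Ys X" using F.fun_direct_sum[OF Ys(1)] by simp
  moreover have "local_ring (End_ring (orbit_category DB G H \<eta> \<theta>) Y)" if "Y \<in> set Ys" for Y
    using Ys(2)[OF that] local_orbit by blast
  ultimately show "\<exists>Ys. direct_sum (orbit_category DB G H \<eta> \<theta>) Ys X \<and>
      (\<forall>Y\<in>set Ys. local_ring (End_ring (orbit_category DB G H \<eta> \<theta>) Y))" by blast
qed

end

theorem proposition1p2:
  fixes scale :: "'k::field \<Rightarrow> 'h::ring_1 \<Rightarrow> 'h"
    and G H :: "(('h, 'k) cplx, (('h, 'k) cplx \<times> 'k cmap set \<times> 'k cmap set) set) endofun"
    and \<eta> \<theta> :: "('h, 'k) cplx \<Rightarrow> (('h, 'k) cplx \<times> 'k cmap set \<times> 'k cmap set) set"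
  assumes "fd_algebra scale" and "hereditary scale"
    and "triangle_endofunctor (Db scale) (Db_shift scale) (Db_triangles scale) G"
    and "adjoint_quasi_inverse (Db scale) G H \<eta> \<theta>"
    and "cond_g1 scale G H" and "cond_g2 scale G H"
  shows "krull_schmidt (orbit_category (Db scale) G H \<eta> \<theta>)"
proof -
  interpret hered_alg scale
    using assms(1,2) by unfold_locales
  obtain \<xi> where \<xi>: "natural_iso DB (comp_fun G (Db_shift scale)) (comp_fun (Db_shift scale) G) \<xi>"
    and add: "additive_endofunctor DB G"
    using assms(3) unfolding triangle_endofunctor_def by blast
  have S: "fob (Db_shift scale) X = shift 1 X" for X :: "('h, 'k) cplx"
    by (simp add: Db_shift_def localize_fun_def Kb_shift_def)
  have "isomorphic DB (fob G (shift 1 X)) (shift 1 (fob G X))" if "bc X" for X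
    using \<xi> that unfolding natural_iso_def isomorphic_def by (auto simp: comp_fun_def S)
  then interpret derived_autoequivalence scale G H \<eta> \<theta>
    using assms(4,5) add by unfold_locales
  show ?thesis by (rule krull_schmidt_orbit)
qed

end
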